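(* Let $k:\mathbb{T}\to\mathbb{T}$ be a homeomorphism. There exists a solution of the welding equation with homeomorphism $k$, i.e. a pair of Blaschke products $A,B$ of the same degree with $A\circ k=B$ on $\mathbb{T}$, if and only if $k$ is a fingerprint of a Jordan curve rational lemniscate $L$. In this case any solution must be of the form $C\circ A$, $C\circ B$ for some Blaschke product $C$, where $A,B$ is a minimal degree solution.
   Context: $\widehat{\mathbb{C}}=\mathbb{C}\cup\{\infty\}$, $\mathbb{D}=\{z\in\widehat{\mathbb{C}}:|z|<1\}$, $\mathbb{D}^*=\{z\in\widehat{\mathbb{C}}:|z|>1\}$, $\mathbb{T}=\{z:|z|=1\}$. A Blaschke product is a rational map of degree $\geq 1$ whose restriction to $\mathbb{D}$ is a proper map onto $\mathbb{D}$. The degree of a solution $A,B$ is the common degree $\deg A=\deg B$, and a minimal degree solution is one whose degree is minimal among all solutions for the given $k$. A Jordan curve rational lemniscate is a Jordan curve $L\subset\widehat{\mathbb{C}}$ of the form $L=r^{-1}(\mathbb{T})$ for a rational map $r$. A homeomorphism $k:\mathbb{T}\to\mathbb{T}$ is a fingerprint of a Jordan curve $\gamma$ if, for some choice of orientation of $\gamma$, there are a conformal map $\psi$ of $\mathbb{D}$ onto the component of $\widehat{\mathbb{C}}\setminus\gamma$ oriented positively with respect to $\gamma$ (the one lying to the left of $\gamma$) and a conformal map $\phi$ of $\mathbb{D}^*$ onto the component of $\widehat{\mathbb{C}}\setminus\gamma$ oriented negatively with respect to $\gamma$ (the other one) such that $\phi\circ k=\psi$ on $\mathbb{T}$, where $\phi,\psi$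 also denote the homeomorphic extensions to $\mathbb{T}$ given by Carathéodory's theorem. *)

theory Defs
  imports "HOL-Complex_Analysis.Complex_Analysis"
    "HOL-Computational_Algebra.Polynomial_Factorial"
    "HOL-Computational_Algebra.Field_as_Ring"
begin

section \<open>The Riemann sphere\<close>

text \<open>The point at infinity is \<open>None\<close>; a finite point \<open>z\<close> is \<open>Some z\<close>.\<close>

type_synonym csphere = "complex option"

abbreviation riemann_sphere :: "csphere topology" where
  "riemann_sphere \<equiv> Alexandroff_compactification euclidean"

abbreviation sphere_subspace :: "csphere set \<Rightarrow> csphere topology" where
  "sphere_subspace S \<equiv> subtopology riemann_sphere S"

definition unit_disc :: "csphere set" where
  "unit_disc = Some ` {z. norm z < 1}"

definition exterior_disc :: "csphere set" where
  "exterior_disc = insert None (Some ` {z. norm z > 1})"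

definition unit_circle :: "csphere set" where
  "unit_circle = Some ` {z. norm z = 1}"

definition sphere_inversion :: "csphere \<Rightarrow> csphere" where
  "sphere_inversion p =
     (case p of None \<Rightarrow> Some 0 | Some z \<Rightarrow> if z = 0 then None else Some (inverse z))"

text \<open>Holomorphy of sphere-valued maps, expressed in the two standard charts \<open>z\<close> and \<open>1/z\<close>
  of the source (\<open>a\<close>) and of the target (\<open>b\<close>). By continuity the domain of every
  coordinate expression is open.\<close>

definition sphere_holomorphic_on :: "(csphere \<Rightarrow> csphere) \<Rightarrow> csphere set \<Rightarrow> bool" where
  "sphere_holomorphic_on f U \<longleftrightarrow>
     openin riemann_sphere U \<and>
     continuous_map (sphere_subspace U) riemann_sphere f \<and>
     (\<forall>a\<in>{id, sphere_inversion}. \<forall>b\<in>{id, sphere_inversion}.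
        (\<lambda>z. the (b (f (a (Some z)))))
          holomorphic_on {z. a (Some z) \<in> U \<and> b (f (a (Some z))) \<noteq> None})"

definition conformal_map_onto :: "(csphere \<Rightarrow> csphere) \<Rightarrow> csphere set \<Rightarrow> csphere set \<Rightarrow> bool" where
  "conformal_map_onto f U V \<longleftrightarrow> sphere_holomorphic_on f U \<and> inj_on f U \<and> f ` U = V"

section \<open>Rational maps and Blaschke products\<close>

text \<open>The extension of \<open>P/Q\<close> to the sphere, for \<open>P\<close>, \<open>Q\<close> coprime and \<open>Q\<close> nonzero.\<close>

definition rat_fun :: "complex poly \<Rightarrow> complex poly \<Rightarrow> csphere \<Rightarrow> csphere" where
  "rat_fun P Q p =
     (case p of
        Some z \<Rightarrow> if poly Q z = 0 then None else Some (poly P z / poly Q z)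
      | None \<Rightarrow> if degree P > degree Q then None
                else Some (coeff P (degree Q) / lead_coeff Q))"

definition rational_map :: "(csphere \<Rightarrow> csphere) \<Rightarrow> bool" where
  "rational_map r \<longleftrightarrow> (\<exists>P Q. coprime P Q \<and> Q \<noteq> 0 \<and> r = rat_fun P Q)"

definition rat_degree :: "(csphere \<Rightarrow> csphere) \<Rightarrow> nat" where
  "rat_degree r =
     (THE d. \<exists>P Q. coprime P Q \<and> Q \<noteq> 0 \<and> r = rat_fun P Q \<and> d = max (degree P) (degree Q))"

lemma rat_fun_eq_imp_cross_eq:
  assumes "rat_fun P Q = rat_fun P' Q'"
  shows "P * Q' = P' * Q"
proof -
  have "poly (P * Q') z = poly (P' * Q) z" for z
    using fun_cong[OF assms, of "Some z"]
    by (auto simp: rat_fun_def field_simps split: if_splits)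
  then show ?thesis by (simp add: poly_eq_poly_eq_iff[symmetric] fun_eq_iff)
qed

lemma rat_fun_eq_imp_degree_le:
  assumes "rat_fun P Q = rat_fun P' Q'" "coprime P Q" "Q \<noteq> 0" "Q' \<noteq> 0"
  shows "degree P \<le> degree P'" "degree Q \<le> degree Q'"
proof -
  have eq: "P * Q' = P' * Q" by (rule rat_fun_eq_imp_cross_eq[OF assms(1)])
  have "Q dvd P * Q'" using eq by simp
  then have "Q dvd Q'" using assms(2) by (simp add: coprime_dvd_mult_right_iff coprime_commute[of P Q])
  then show "degree Q \<le> degree Q'" using assms(4) by (rule dvd_imp_degree_le)
  have "P dvd P' * Q" using eq[symmetric] by simp
  then have "P dvd P'" using assms(2) by (simp add: coprime_dvd_mult_left_iff)
  moreover have "P = 0" if "P' = 0" using eq that assms(4) by simp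
  ultimately show "degree P \<le> degree P'" by (cases "P' = 0") (auto intro: dvd_imp_degree_le)
qed

lemma rat_degree_rat_fun:
  assumes "coprime P Q" "Q \<noteq> 0"
  shows "rat_degree (rat_fun P Q) = max (degree P) (degree Q)"
  unfolding rat_degree_def
proof (rule the_equality)
  fix d assume "\<exists>P' Q'. coprime P' Q' \<and> Q' \<noteq> 0 \<and> rat_fun P Q = rat_fun P' Q' \<and>
    d = max (degree P') (degree Q')"
  then obtain P' Q' where *: "coprime P' Q'" "Q' \<noteq> 0" "rat_fun P Q = rat_fun P' Q'"
    "d = max (degree P') (degree Q')" by blast
  show "d = max (degree P) (degree Q)"
    using rat_fun_eq_imp_degree_le[OF *(3) assms *(2)]
      rat_fun_eq_imp_degree_le[OF *(3)[symmetric] *(1,2) assms(2)] *(4) by simp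
qed (use assms in blast)

definition blaschke_product :: "(csphere \<Rightarrow> csphere) \<Rightarrow> bool" where
  "blaschke_product B \<longleftrightarrow>
     rational_map B \<and> rat_degree B \<ge> 1 \<and>
     proper_map (sphere_subspace unit_disc) (sphere_subspace unit_disc) B \<and>
     B ` unit_disc = unit_disc"

section \<open>Solutions of the welding equation\<close>

definition welding_solution ::
    "(csphere \<Rightarrow> csphere) \<Rightarrow> (csphere \<Rightarrow> csphere) \<Rightarrow> (csphere \<Rightarrow> csphere) \<Rightarrow> bool" where
  "welding_solution k A B \<longleftrightarrow>
     blaschke_product A \<and> blaschke_product B \<and> rat_degree A = rat_degree B \<and>
     (\<forall>z\<in>unit_circle. A (k z) = B z)"

definition minimal_welding_solution ::
    "(csphere \<Rightarrow> csphere) \<Rightarrow> (csphere \<Rightarrow> csphere) \<Rightarrow> (csphere \<Rightarrow> csphere) \<Rightarrow> bool" where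
  "minimal_welding_solution k A B \<longleftrightarrow>
     welding_solution k A B \<and>
     (\<forall>A' B'. welding_solution k A' B' \<longrightarrow> rat_degree A \<le> rat_degree A')"

section \<open>Jordan curves, lemniscates and fingerprints\<close>

definition jordan_parametrization :: "(csphere \<Rightarrow> csphere) \<Rightarrow> csphere set \<Rightarrow> bool" where
  "jordan_parametrization g \<gamma> \<longleftrightarrow>
     homeomorphic_map (sphere_subspace unit_circle) (sphere_subspace \<gamma>) g"

definition jordan_curve :: "csphere set \<Rightarrow> bool" where
  "jordan_curve \<gamma> \<longleftrightarrow> (\<exists>g. jordan_parametrization g \<gamma>)"

definition jordan_rational_lemniscate :: "csphere set \<Rightarrow> bool" where
  "jordan_rational_lemniscate L \<longleftrightarrow>
     jordan_curve L \<and> (\<exists>r. rational_map r \<and> L = r -` unit_circle)"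

text \<open>The quotient \<open>(z - p) / (z - q)\<close>, with factors involving infinity omitted; it is meant for
  \<open>z\<close> different from \<open>p\<close> and \<open>q\<close>. For \<open>p \<noteq> q\<close> it is a Moebius map sending \<open>p\<close> to \<open>0\<close>
  and \<open>q\<close> to infinity.\<close>

definition sphere_diff :: "csphere \<Rightarrow> csphere \<Rightarrow> complex" where
  "sphere_diff z p = (case (z, p) of (Some a, Some b) \<Rightarrow> a - b | _ \<Rightarrow> 1)"

definition sphere_quot :: "csphere \<Rightarrow> csphere \<Rightarrow> csphere \<Rightarrow> complex" where
  "sphere_quot p q z = sphere_diff z p / sphere_diff z q"

text \<open>A parametrization \<open>g\<close> of \<open>\<gamma>\<close> by the counterclockwise unit circle orients \<open>\<gamma>\<close>.
  Two points \<open>p\<close>, \<open>q\<close> off \<open>\<gamma>\<close> lie to the left and to the right of \<open>\<gamma>\<close> respectively if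
  \<open>\<gamma>\<close> winds once counterclockwise around \<open>0\<close> after \<open>p\<close>, \<open>q\<close> have been moved to
  \<open>0\<close> and infinity by a Moebius map.\<close>

definition left_right_components ::
    "(csphere \<Rightarrow> csphere) \<Rightarrow> csphere set \<Rightarrow> csphere set \<Rightarrow> csphere set \<Rightarrow> bool" where
  "left_right_components g \<gamma> \<Omega>l \<Omega>r \<longleftrightarrow>
     \<Omega>l \<in> connected_components_of (sphere_subspace (- \<gamma>)) \<and>
     \<Omega>r \<in> connected_components_of (sphere_subspace (- \<gamma>)) \<and>
     (\<forall>p\<in>\<Omega>l. \<forall>q\<in>\<Omega>r.
        winding_number (\<lambda>t. sphere_quot p q (g (Some (circlepath 0 1 t)))) 0 = 1)"

text \<open>A conformal map together with its Caratheodory extension to the closures.\<close>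

definition conformal_with_boundary ::
    "(csphere \<Rightarrow> csphere) \<Rightarrow> csphere set \<Rightarrow> csphere set \<Rightarrow> bool" where
  "conformal_with_boundary f U V \<longleftrightarrow>
     conformal_map_onto f U V \<and>
     homeomorphic_map (sphere_subspace (riemann_sphere closure_of U))
                      (sphere_subspace (riemann_sphere closure_of V)) f"

text \<open>The existentially quantified parametrization \<open>g\<close> serves as the choice of orientation of \<open>\<gamma>\<close>.\<close>

definition fingerprint :: "(csphere \<Rightarrow> csphere) \<Rightarrow> csphere set \<Rightarrow> bool" where
  "fingerprint k \<gamma> \<longleftrightarrow>
     (\<exists>g \<Omega>l \<Omega>r \<psi> \<phi>.
        jordan_parametrization g \<gamma> \<and> left_right_components g \<gamma> \<Omega>l \<Omega>r \<and>
        conformal_with_boundary \<psi> unit_disc \<Omega>l \<and>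
        conformal_with_boundary \<phi> exterior_disc \<Omega>r \<and>
        (\<forall>z\<in>unit_circle. \<phi> (k z) = \<psi> z))"

end

theory Submission
  imports Defs "HOL-Computational_Algebra.Fundamental_Theorem_Algebra"
begin

text \<open>
  A solution \<open>A \<circ> k = B\<close> makes \<open>k\<close> analytic on the circle, so two closed discs glued along \<open>k\<close> form
  a Riemann surface with charts across the seam. That surface is the sphere: partial weldings (a disc
  with a collar attached) are plane domains, they can be extended step by step with the Riemann mapping
  theorem, and a normal family argument fills in the second disc. In the resulting pair of conformal
  maps \<open>f\<close>, \<open>g\<close> the functions \<open>B \<circ> f\<^sup>-\<^sup>1\<close> and \<open>A \<circ> g\<^sup>-\<^sup>1\<close> agree along the welding curve and define a
  holomorphic map of the sphere, that is, a rational map, whose lemniscate is that curve.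
  Conversely, if \<open>L = r\<^sup>-\<^sup>1(T)\<close> has fingerprint \<open>k\<close>, then \<open>r\<close> takes the two sides of \<open>L\<close> to the two
  sides of the circle, and \<open>r \<circ> \<psi>\<close>, \<open>r \<circ> \<phi>\<close> have unimodular boundary values, hence are Blaschke products
  with \<open>(r \<circ> \<phi>) \<circ> k = r \<circ> \<psi>\<close>.

  For the uniqueness the circle is moved to the real line. The real rational functions \<open>u\<close> for which
  \<open>u \<circ> k\<close> is again rational form a field, which by Lueroth's theorem is generated by one function \<open>D\<close>.
  Topology forces \<open>D\<close> and \<open>E = D \<circ> k\<close> to be Blaschke products up to inversion, so \<open>(D, E)\<close> is itself
  a solution through which all others factor; a minimal solution differs from it by a disc automorphism.
\<close>

subsection \<open>The Riemann sphere through two charts\<close>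

text \<open>The glued surface never appears as an object: a function on it is a pair of functions on
  the disc and on the collar. A thin collar is easy, because the analytic continuation of
  \<open>k\<close> lets the disc itself serve as the first welding; widening it is the obstacle.
  Once the surface with collar radius \<open>R\<close> is mapped onto the unit disc, the collar
  coordinate tends to modulus 1 at the outer rim, without any knowledge of boundary continuity. A
  multiplicative Laurent splitting still yields a reflection. It reaches the radius
  \<open>R^2 / r\<close> for an inner radius \<open>r > 1\<close>, so the gain is a fixed power of
  the radius and can be repeated without limit. For infinite radius, the normalization at the centre
  of the disc makes all later weldings, read on one fixed piece, univalent with a common derivative,
  hence locally bounded. In the uniqueness part, rational self-maps of the circle are not closed
  under addition while real rational functions are, and this makes field theory available. Degrees
  enter through fibres over the circle, which are simple.\<close>

declare topspace_Alexandroff_compactification [simp del]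

text \<open>Both elements are involutions, so each serves as a chart and as its own inverse
  parametrization.\<close>

definition sphere_charts :: "(csphere \<Rightarrow> csphere) set" where
  "sphere_charts = {id, sphere_inversion}"

lemma sphere_charts_intros [simp]: "id \<in> sphere_charts" "sphere_inversion \<in> sphere_charts"
  by (auto simp: sphere_charts_def)

lemma sphere_inversion_simps [simp]:
  "sphere_inversion None = Some 0"
  "sphere_inversion (Some 0) = None"
  "z \<noteq> 0 \<Longrightarrow> sphere_inversion (Some z) = Some (inverse z)"
  by (auto simp: sphere_inversion_def)

lemma sphere_inversion_invol [simp]: "sphere_inversion (sphere_inversion p) = p"
  by (cases p) (auto simp: sphere_inversion_def)

lemma sphere_inversion_eq_iff: "sphere_inversion p = q \<longleftrightarrow> p = sphere_inversion q"
  by (metis sphere_inversion_invol)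

lemma sphere_inversion_eq_None_iff [simp]: "sphere_inversion p = None \<longleftrightarrow> p = Some 0"
  by (simp add: sphere_inversion_eq_iff)

lemma chart_invol: "a \<in> sphere_charts \<Longrightarrow> a (a p) = p"
  by (auto simp: sphere_charts_def)

lemma sphere_inversion_unit_disc_iff: "sphere_inversion p \<in> unit_disc \<longleftrightarrow> p \<in> exterior_disc"
  by (cases p) (auto simp: sphere_inversion_def unit_disc_def exterior_disc_def image_iff norm_inverse inverse_less_1_iff)

lemma sphere_inversion_exterior_disc_iff: "sphere_inversion p \<in> exterior_disc \<longleftrightarrow> p \<in> unit_disc"
  by (metis sphere_inversion_unit_disc_iff sphere_inversion_invol)

lemma sphere_trichotomy:
  "p \<in> unit_disc \<or> p \<in> unit_circle \<or> p \<in> exterior_disc"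
  by (cases p) (auto simp: unit_disc_def unit_circle_def exterior_disc_def image_iff)

lemma sphere_disjoint:
  "p \<in> unit_disc \<Longrightarrow> p \<notin> unit_circle" "p \<in> unit_disc \<Longrightarrow> p \<notin> exterior_disc"
  "p \<in> exterior_disc \<Longrightarrow> p \<notin> unit_circle"
  by (auto simp: unit_disc_def unit_circle_def exterior_disc_def)

lemma sphere_inversion_unit_circle_iff: "sphere_inversion p \<in> unit_circle \<longleftrightarrow> p \<in> unit_circle"
  using sphere_trichotomy[of p] sphere_disjoint[of p] sphere_trichotomy[of "sphere_inversion p"]
    sphere_disjoint[of "sphere_inversion p"]
    sphere_inversion_unit_disc_iff[of p] sphere_inversion_exterior_disc_iff[of p]
  by blast

lemma Some_mem_simps [simp]:
  "Some z \<in> unit_disc \<longleftrightarrow> norm z < 1"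
  "Some z \<in> unit_circle \<longleftrightarrow> norm z = 1"
  "Some z \<in> exterior_disc \<longleftrightarrow> norm z > 1"
  "None \<notin> unit_disc" "None \<notin> unit_circle" "None \<in> exterior_disc"
  by (auto simp: unit_disc_def unit_circle_def exterior_disc_def)

text \<open>A neighbourhood of infinity has a compact complement. If the norms in that complement
  are at most \<open>M\<close>, the inverted set contains the ball of radius \<open>1/M\<close>
  around 0; conversely a ball of radius \<open>e\<close> there bounds the complement by
  \<open>1/e\<close>.\<close>

lemma openin_sphere_iff:
  "openin riemann_sphere U \<longleftrightarrow>
     open {z. Some z \<in> U} \<and> open {z. sphere_inversion (Some z) \<in> U}"
proof -
  let ?V = "{z. Some z \<in> U}" and ?W = "{z. sphere_inversion (Some z) \<in> U}"
  have opn: "open {z::complex. z \<noteq> 0 \<and> inverse z \<in> S}" if "open S" for S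
  proof -
    have "open ((- {0}) \<inter> inverse -` S)"
      by (rule continuous_open_preimage[OF _ _ that]) (auto intro!: continuous_intros)
    moreover have "(- {0}) \<inter> inverse -` S = {z. z \<noteq> 0 \<and> inverse z \<in> S}" by auto
    ultimately show ?thesis by simp
  qed
  show ?thesis
  proof (cases "None \<in> U")
    case False
    have W: "?W = {z. z \<noteq> 0 \<and> inverse z \<in> ?V}"
      using False by (auto simp: sphere_inversion_def)
    have "U = Some ` ?V" using False by (auto simp: image_iff) (metis not_None_eq)
    then have "openin riemann_sphere U \<longleftrightarrow> open ?V"
      by (metis openin_Alexandroff_compactification_image_Some open_openin)
    then show ?thesis unfolding W using opn by blast
  next
    case True
    show ?thesis
    proof
      assume "openin riemann_sphere U"
      then obtain C where C: "compact C" "U = insert None (Some ` (- C))"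
        using True by (auto simp: openin_Alexandroff_compactification Compl_eq_Diff_UNIV)
      have V: "?V = - C" using C by auto
      obtain M where M: "M > 0" "\<And>z. z \<in> C \<Longrightarrow> norm z \<le> M"
        using compact_imp_bounded[OF C(1)] bounded_pos by blast
      have W: "?W = {z. z \<noteq> 0 \<and> inverse z \<in> - C} \<union> ball 0 (1/M)"
      proof (intro equalityI subsetI)
        fix z assume z: "z \<in> {z. z \<noteq> 0 \<and> inverse z \<in> - C} \<union> ball 0 (1/M)"
        show "z \<in> ?W"
        proof (cases "z = 0")
          case False
          have "inverse z \<notin> C"
          proof
            assume "inverse z \<in> C"
            then have "inverse (norm z) \<le> M" using M(2) by (metis norm_inverse)
            then have "1 \<le> M * norm z" using False by (simp add: field_simps)
            then show False using z M False \<open>inverse z \<in> C\<close> by (simp add: field_simps)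
          qed
          with False show ?thesis by (simp add: C)
        qed (simp add: True)
      qed (use M C in \<open>auto simp: sphere_inversion_def split: if_splits\<close>)
      have oC: "open (- C)" using C(1) by (simp add: compact_imp_closed open_Compl)
      show "open ?V \<and> open ?W" unfolding W V using opn[OF oC] oC by blast
    next
      assume o: "open ?V \<and> open ?W"
      let ?C = "- ?V"
      have "0 \<in> ?W" using True by simp
      then obtain e where e: "e > 0" "ball 0 e \<subseteq> ?W" using o openE by blast
      have "norm z \<le> 1/e" if "z \<in> ?C" for z
      proof (rule ccontr)
        assume "\<not> norm z \<le> 1/e"
        then have nz: "1/e < norm z" by simp
        then have "z \<noteq> 0" using e(1) by auto
        have "inverse z \<in> ball 0 e" using nz e(1) \<open>z \<noteq> 0\<close>
          by (simp add: norm_inverse norm_divide field_simps)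
        then show False using e(2) that \<open>z \<noteq> 0\<close> by auto
      qed
      then have "compact ?C"
        using o by (auto simp: compact_eq_bounded_closed bounded_iff closed_Compl)
      moreover have "U = insert None (Some ` (- ?C))"
        using True by (auto simp: image_iff) (metis not_None_eq)
      ultimately show "openin riemann_sphere U"
        by (auto simp: openin_Alexandroff_compactification Compl_eq_Diff_UNIV compact_imp_closed)
    qed
  qed
qed

lemma topspace_sphere [simp]: "topspace riemann_sphere = UNIV"
  by (simp add: topspace_Alexandroff_compactification UNIV_option_conv)

lemma Hausdorff_sphere: "Hausdorff_space riemann_sphere"
  by (simp add: Hausdorff_space_Alexandroff_compactification locally_compact_space_euclidean)

lemma compact_riemann_sphere: "compact_space riemann_sphere"
  by simp

lemma homeomorphic_map_sphere_inversion: "homeomorphic_map riemann_sphere riemann_sphere sphere_inversion"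
proof -
  have "continuous_map riemann_sphere riemann_sphere sphere_inversion"
    unfolding continuous_map_def by (simp add: openin_sphere_iff conj_commute)
  then show ?thesis
    by (intro homeomorphic_maps_imp_map[of _ _ _ sphere_inversion]) (auto simp: homeomorphic_maps_def)
qed

lemma homeomorphic_map_chart: "a \<in> sphere_charts \<Longrightarrow> homeomorphic_map riemann_sphere riemann_sphere a"
  using homeomorphic_map_sphere_inversion by (auto simp: sphere_charts_def)

lemma openin_chart_image:
  assumes "a \<in> sphere_charts" "open S"
  shows "openin riemann_sphere ((\<lambda>z. a (Some z)) ` S)"
proof -
  have "openin riemann_sphere (Some ` S)" using assms(2) by simp
  then have "openin riemann_sphere (a ` Some ` S)"
    using homeomorphic_map_openness[OF homeomorphic_map_chart[OF assms(1)]] by auto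
  then show ?thesis by (simp add: image_image)
qed

lemma open_chart_vimage:
  "openin riemann_sphere U \<Longrightarrow> a \<in> sphere_charts \<Longrightarrow> open {z. a (Some z) \<in> U}"
  by (auto simp: openin_sphere_iff sphere_charts_def)

lemma chart_at:
  obtains a z where "a \<in> sphere_charts" "p = a (Some z)"
proof (cases p)
  case None
  then show ?thesis using that[of sphere_inversion 0] by simp
next
  case (Some z)
  then show ?thesis using that[of id z] by simp
qed

lemma chart_at_iff: "b \<in> sphere_charts \<Longrightarrow> b q \<noteq> None \<longleftrightarrow> q = b (Some (the (b q)))"
  by (metis chart_invol option.collapse option.distinct(1))

subsection \<open>Local holomorphy of sphere-valued maps\<close>

text \<open>Existential in the charts: one local expression suffices to establish it, while
  \<open>sphere_holomorphic_on\<close> asks for all four pairs of charts.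
  \<open>sphere_holomorphic_on_iff\<close> identifies the two notions on open sets.\<close>

definition sphere_holomorphic_at :: "(csphere \<Rightarrow> csphere) \<Rightarrow> csphere \<Rightarrow> bool" where
  "sphere_holomorphic_at f p \<longleftrightarrow>
     (\<exists>a\<in>sphere_charts. \<exists>b\<in>sphere_charts. \<exists>z0 e y. p = a (Some z0) \<and> e > 0 \<and>
        y holomorphic_on ball z0 e \<and> (\<forall>z\<in>ball z0 e. f (a (Some z)) = b (Some (y z))))"

lemma sphere_holomorphic_atI:
  assumes "a \<in> sphere_charts" "b \<in> sphere_charts" "p = a (Some z0)" "open S" "z0 \<in> S"
    "y holomorphic_on S" "\<And>z. z \<in> S \<Longrightarrow> f (a (Some z)) = b (Some (y z))"
  shows "sphere_holomorphic_at f p"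
proof -
  obtain e where "e > 0" "ball z0 e \<subseteq> S" using assms openE by blast
  then show ?thesis unfolding sphere_holomorphic_at_def
    using assms(1-3,6,7) by (intro bexI[OF _ assms(1)] bexI[OF _ assms(2)] exI[of _ z0] exI[of _ e] exI[of _ y])
      (auto intro: holomorphic_on_subset)
qed

text \<open>The transition is the identity or \<open>inverse\<close>; in the second case a point
  seen in both charts is neither 0 nor infinity.\<close>

lemma change_chart:
  assumes "a \<in> sphere_charts" "b \<in> sphere_charts" "a (Some z0) = b (Some w0)"
  obtains S h where "open S" "z0 \<in> S" "h holomorphic_on S" "h z0 = w0" "\<And>z. z \<in> S \<Longrightarrow> a (Some z) = b (Some (h z))"
proof (cases "a = b")
  case True
  then have "z0 = w0" using assms by (metis chart_invol option.inject)
  then show ?thesis using True that[of UNIV "\<lambda>z. z"] by (auto intro: holomorphic_intros)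
next
  case False
  then have ab: "(a = id \<and> b = sphere_inversion) \<or> (a = sphere_inversion \<and> b = id)"
    using assms by (auto simp: sphere_charts_def)
  then have z0: "z0 \<noteq> 0" "w0 = inverse z0" using assms(3)
    by (auto simp: sphere_inversion_def split: if_splits)
  show ?thesis
    by (rule that[of "- {0}" inverse]) (use z0 ab in \<open>auto intro!: holomorphic_intros\<close>)
qed

text \<open>Chart independence: the given local expression is conjugated by the transition maps of
  source and target, on a ball small enough for all three maps to compose.\<close>

lemma sphere_holomorphic_at_charts:
  assumes f: "sphere_holomorphic_at f p" and a: "a \<in> sphere_charts" "p = a (Some z0)"
    and b: "b \<in> sphere_charts" "b (f p) \<noteq> None"
  obtains e y where "e > 0" "y holomorphic_on ball z0 e" "f p = b (Some (y z0))"
    "\<And>z. z \<in> ball z0 e \<Longrightarrow> f (a (Some z)) = b (Some (y z))"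
proof -
  obtain a' b' w0 e y where h: "a' \<in> sphere_charts" "b' \<in> sphere_charts" "p = a' (Some w0)" "e > 0"
    "y holomorphic_on ball w0 e" "\<And>z. z \<in> ball w0 e \<Longrightarrow> f (a' (Some z)) = b' (Some (y z))"
    using f unfolding sphere_holomorphic_at_def by blast
  obtain S h1 where S: "open S" "z0 \<in> S" "h1 holomorphic_on S" "h1 z0 = w0" "\<And>z. z \<in> S \<Longrightarrow> a (Some z) = a' (Some (h1 z))"
    using change_chart[OF a(1) h(1), of z0 w0] a h by metis
  have "f p = b' (Some (y w0))" using h by auto
  then have "b' (Some (y w0)) = b (Some (the (b (f p))))" using b chart_at_iff by metis
  then obtain T h2 where T: "open T" "y w0 \<in> T" "h2 holomorphic_on T" "\<And>z. z \<in> T \<Longrightarrow> b' (Some z) = b (Some (h2 z))"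
    using change_chart[OF h(2) b(1)] by metis
  define V where "V = S \<inter> h1 -` (ball w0 e \<inter> y -` T)"
  have o1: "open (ball w0 e \<inter> y -` T)"
    by (rule continuous_open_preimage[OF holomorphic_on_imp_continuous_on[OF h(5)] open_ball T(1)])
  have "open V" unfolding V_def
    by (rule continuous_open_preimage[OF holomorphic_on_imp_continuous_on[OF S(3)] S(1) o1])
  moreover have "z0 \<in> V" using S T h by (auto simp: V_def)
  ultimately obtain d where d: "d > 0" "ball z0 d \<subseteq> V" using openE by blast
  have "(h2 \<circ> (y \<circ> h1)) holomorphic_on ball z0 d"
    by (intro holomorphic_on_compose_gen[of _ _ _ T] holomorphic_on_compose_gen[of _ _ _ "ball w0 e"]
        holomorphic_on_subset[OF S(3)] h T) (use d in \<open>auto simp: V_def\<close>)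
  moreover have "f (a (Some z)) = b (Some ((h2 \<circ> (y \<circ> h1)) z))" if "z \<in> ball z0 d" for z
  proof -
    have "z \<in> S" "h1 z \<in> ball w0 e" "y (h1 z) \<in> T" using that d by (auto simp: V_def)
    then show ?thesis using h(6) S(5) T(4) by simp
  qed
  ultimately show ?thesis using that[of d "h2 \<circ> (y \<circ> h1)"] d a by auto
qed

lemma sphere_holomorphic_at_cong:
  assumes "sphere_holomorphic_at f p" "openin riemann_sphere U" "p \<in> U" "\<And>q. q \<in> U \<Longrightarrow> f q = g q"
  shows "sphere_holomorphic_at g p"
proof -
  obtain a b z0 e y where h: "a \<in> sphere_charts" "b \<in> sphere_charts" "p = a (Some z0)" "e > 0"
    "y holomorphic_on ball z0 e" "\<And>z. z \<in> ball z0 e \<Longrightarrow> f (a (Some z)) = b (Some (y z))"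
    using assms(1) unfolding sphere_holomorphic_at_def by blast
  show ?thesis
    by (rule sphere_holomorphic_atI[OF h(1-3), of "ball z0 e \<inter> {z. a (Some z) \<in> U}" y])
       (use h assms(2,3) assms(4)[symmetric] open_chart_vimage[OF assms(2) h(1)] in \<open>auto intro: holomorphic_on_subset\<close>)
qed

lemma sphere_holomorphic_at_compose:
  assumes "sphere_holomorphic_at f p" "sphere_holomorphic_at g (f p)"
  shows "sphere_holomorphic_at (g \<circ> f) p"
proof -
  obtain a' b' w0 e' y' where h': "a' \<in> sphere_charts" "b' \<in> sphere_charts" "f p = a' (Some w0)" "e' > 0"
    "y' holomorphic_on ball w0 e'" "\<And>z. z \<in> ball w0 e' \<Longrightarrow> g (a' (Some z)) = b' (Some (y' z))"
    using assms(2) unfolding sphere_holomorphic_at_def by blast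
  obtain a z0 where a: "a \<in> sphere_charts" "p = a (Some z0)" by (rule chart_at)
  have "a' (f p) \<noteq> None" using h' by (metis chart_invol option.distinct(1))
  then obtain e y where h: "e > 0" "y holomorphic_on ball z0 e" "f p = a' (Some (y z0))"
    "\<And>z. z \<in> ball z0 e \<Longrightarrow> f (a (Some z)) = a' (Some (y z))"
    using sphere_holomorphic_at_charts[OF assms(1) a h'(1)] by metis
  have y0: "y z0 = w0" using h h' by (metis chart_invol option.inject)
  define V where "V = ball z0 e \<inter> y -` ball w0 e'"
  have "open V" unfolding V_def
    using h by (intro continuous_open_preimage holomorphic_on_imp_continuous_on) auto
  moreover have "(y' \<circ> y) holomorphic_on V"
    by (rule holomorphic_on_compose_gen[of _ _ _ "ball w0 e'"])
       (use h h' in \<open>auto simp: V_def intro: holomorphic_on_subset\<close>)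
  ultimately show ?thesis
    by (intro sphere_holomorphic_atI[OF a(1) h'(2) a(2), of V "y' \<circ> y"])
       (use h h' y0 in \<open>auto simp: V_def\<close>)
qed

lemma sphere_holomorphic_at_chart: "a \<in> sphere_charts \<Longrightarrow> sphere_holomorphic_at a p"
proof -
  assume a: "a \<in> sphere_charts"
  obtain b z where b: "b \<in> sphere_charts" "p = b (Some z)" by (rule chart_at)
  show ?thesis
  proof (cases "a = b")
    case True
    then show ?thesis using a b
      by (intro sphere_holomorphic_atI[of b id p z UNIV "\<lambda>z. z"]) (auto intro: holomorphic_intros simp: chart_invol)
  next
    case False
    then have "a (b q) = sphere_inversion q" for q using a b by (auto simp: sphere_charts_def)
    then show ?thesis using b
      by (intro sphere_holomorphic_atI[of b sphere_inversion p z UNIV "\<lambda>z. z"]) (auto intro: holomorphic_intros)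
  qed
qed

lemma continuous_map_sphere_subspaceI:
  assumes "\<And>p. p \<in> U \<Longrightarrow> sphere_holomorphic_at f p" "openin riemann_sphere U"
  shows "continuous_map (sphere_subspace U) riemann_sphere f"
proof -
  have "\<exists>T. openin riemann_sphere T \<and> p \<in> T \<and> T \<subseteq> U \<inter> f -` W"
    if W: "openin riemann_sphere W" and p: "p \<in> U" "f p \<in> W" for W p
  proof -
    obtain a b z0 e y where h: "a \<in> sphere_charts" "b \<in> sphere_charts" "p = a (Some z0)" "e > 0"
      "y holomorphic_on ball z0 e" "\<And>z. z \<in> ball z0 e \<Longrightarrow> f (a (Some z)) = b (Some (y z))"
      using assms(1)[OF p(1)] unfolding sphere_holomorphic_at_def by blast
    define V where "V = (ball z0 e \<inter> y -` {w. b (Some w) \<in> W}) \<inter> {z. a (Some z) \<in> U}"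
    have "open V" unfolding V_def
      using h W by (intro open_Int continuous_open_preimage holomorphic_on_imp_continuous_on
          open_chart_vimage[OF assms(2)] open_chart_vimage[OF W]) auto
    then have "openin riemann_sphere ((\<lambda>z. a (Some z)) ` V)" by (rule openin_chart_image[OF h(1)])
    moreover have "p \<in> (\<lambda>z. a (Some z)) ` V" using h p by (auto simp: V_def image_iff)
    ultimately show ?thesis using h(6)
      by (intro exI[of _ "(\<lambda>z. a (Some z)) ` V"]) (auto simp: V_def)
  qed
  then have "openin riemann_sphere (U \<inter> f -` W)" if "openin riemann_sphere W" for W
    using that by (subst openin_subopen) blast
  then show ?thesis unfolding continuous_map_def
    using assms(2) by (auto simp: openin_open_subtopology Int_def vimage_def)
qed

text \<open>From left to right continuity is essential: it makes the domain of a coordinate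
  expression open, so that the expression is holomorphic in a full neighbourhood of the
  point.\<close>

lemma sphere_holomorphic_on_iff:
  "sphere_holomorphic_on f U \<longleftrightarrow> openin riemann_sphere U \<and> (\<forall>p\<in>U. sphere_holomorphic_at f p)"
proof (intro iffI conjI ballI)
  assume f: "sphere_holomorphic_on f U"
  then show U: "openin riemann_sphere U" by (simp add: sphere_holomorphic_on_def)
  fix p assume p: "p \<in> U"
  obtain a z where a: "a \<in> sphere_charts" "p = a (Some z)" by (rule chart_at)
  obtain b w where b: "b \<in> sphere_charts" "f p = b (Some w)" by (rule chart_at)
  have hol: "(\<lambda>z. the (b (f (a (Some z))))) holomorphic_on {z. a (Some z) \<in> U \<and> b (f (a (Some z))) \<noteq> None}"
    using f a b unfolding sphere_holomorphic_on_def sphere_charts_def by blast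
  have cont: "continuous_map (sphere_subspace U) riemann_sphere f"
    using f by (simp add: sphere_holomorphic_on_def)
  have "openin riemann_sphere {q. b q \<noteq> None}"
  proof -
    have "{q. b q \<noteq> None} = (\<lambda>z. b (Some z)) ` UNIV"
    proof (intro equalityI subsetI)
      fix q assume "q \<in> {q. b q \<noteq> None}"
      then show "q \<in> range (\<lambda>z. b (Some z))" using chart_at_iff[OF b(1)] by blast
    qed (use b in \<open>auto simp: chart_invol\<close>)
    then show ?thesis using openin_chart_image[OF b(1), of UNIV] by simp
  qed
  then have "openin (sphere_subspace U) {q \<in> U. b (f q) \<noteq> None}"
    using openin_continuous_map_preimage[OF cont, of "{q. b q \<noteq> None}"] by simp
  then have o: "openin riemann_sphere {q \<in> U. b (f q) \<noteq> None}"
    using U by (simp add: openin_open_subtopology)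
  show "sphere_holomorphic_at f p"
  proof (rule sphere_holomorphic_atI[OF a(1) b(1) a(2) _ _ hol])
    show "open {z. a (Some z) \<in> U \<and> b (f (a (Some z))) \<noteq> None}"
      using open_chart_vimage[OF o a(1)] by simp
    show "z \<in> {z. a (Some z) \<in> U \<and> b (f (a (Some z))) \<noteq> None}"
      using p a b by (auto simp: chart_invol)
  next
    fix z assume "z \<in> {z. a (Some z) \<in> U \<and> b (f (a (Some z))) \<noteq> None}"
    then show "f (a (Some z)) = b (Some (the (b (f (a (Some z))))))"
      using chart_at_iff[OF b(1)] by blast
  qed
next
  assume f: "openin riemann_sphere U \<and> (\<forall>p\<in>U. sphere_holomorphic_at f p)"
  have "(\<lambda>z. the (b (f (a (Some z))))) holomorphic_on {z. a (Some z) \<in> U \<and> b (f (a (Some z))) \<noteq> None}"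
    if ab: "a \<in> sphere_charts" "b \<in> sphere_charts" for a b
    unfolding holomorphic_on_def
  proof
    fix z assume z: "z \<in> {z. a (Some z) \<in> U \<and> b (f (a (Some z))) \<noteq> None}"
    then obtain e y where h: "e > 0" "y holomorphic_on ball z e"
      "\<And>z'. z' \<in> ball z e \<Longrightarrow> f (a (Some z')) = b (Some (y z'))"
      using sphere_holomorphic_at_charts[OF _ ab(1) refl ab(2), of f z] f by auto
    have yd: "y field_differentiable at z"
      using h holomorphic_on_imp_differentiable_at by fastforce
    have yeq: "y z' = the (b (f (a (Some z'))))" if "dist z' z < e" for z'
      using h(3)[of z'] that ab by (simp add: chart_invol dist_commute)
    have "(\<lambda>z. the (b (f (a (Some z))))) field_differentiable at z"
      by (rule field_differentiable_transform_within[OF h(1) UNIV_I yeq yd])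
    then show "(\<lambda>z. the (b (f (a (Some z))))) field_differentiable
         at z within {z. a (Some z) \<in> U \<and> b (f (a (Some z))) \<noteq> None}"
      by (rule field_differentiable_at_within)
  qed
  then show "sphere_holomorphic_on f U"
    unfolding sphere_holomorphic_on_def sphere_charts_def[symmetric] using f continuous_map_sphere_subspaceI by blast
qed

subsection \<open>Rational maps are the holomorphic self-maps of the sphere\<close>

lemma sphere_holomorphic_imp_continuous_map:
  assumes "\<And>p. sphere_holomorphic_at f p"
  shows "continuous_map riemann_sphere riemann_sphere f"
  using continuous_map_sphere_subspaceI[of UNIV f] assms
  by (metis openin_topspace subtopology_topspace topspace_sphere)

text \<open>A nonempty open set is infinite in a chart, so it meets the complement of every finite
  set. This allows identities of continuous maps to be checked off finitely many points, and gives
  connectedness of the sphere from that of the plane.\<close>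

lemma closure_of_Some_minus_finite:
  assumes "finite F"
  shows "riemann_sphere closure_of (Some ` (- F)) = UNIV"
proof -
  have "\<exists>y. y \<in> Some ` (- F) \<and> y \<in> T" if "p \<in> T" and T: "openin riemann_sphere T" for p T
  proof -
    obtain a z where a: "a \<in> sphere_charts" "p = a (Some z)" by (rule chart_at)
    have "open {z. a (Some z) \<in> T}" using open_chart_vimage[OF T a(1)] .
    moreover have "z \<in> {z. a (Some z) \<in> T}" using that a by simp
    ultimately have inf: "infinite {z. a (Some z) \<in> T}"
      using finite_imp_not_open by blast
    have "{z. a (Some z) \<in> T} \<subseteq> (\<lambda>p. the (a p)) ` (insert None (Some ` F) \<union> {p. p \<in> T \<and> p \<in> Some ` (- F)})"
    proof
      fix z assume z: "z \<in> {z. a (Some z) \<in> T}"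
      have "a (Some z) \<in> insert None (Some ` F) \<union> {p. p \<in> T \<and> p \<in> Some ` (- F)}"
        using z by (cases "a (Some z)") auto
      moreover have "z = the (a (a (Some z)))" using a by (simp add: chart_invol)
      ultimately show "z \<in> (\<lambda>p. the (a p)) ` (insert None (Some ` F) \<union> {p. p \<in> T \<and> p \<in> Some ` (- F)})"
        by blast
    qed
    then have "\<not> finite (insert None (Some ` F) \<union> {p. p \<in> T \<and> p \<in> Some ` (- F)})"
      using inf finite_surj by blast
    then have "{p. p \<in> T \<and> p \<in> Some ` (- F)} \<noteq> {}" using assms by (metis finite.emptyI finite_UnI finite_imageI finite_insert)
    then show ?thesis by blast
  qed
  then show ?thesis by (auto simp: in_closure_of)
qed

lemma sphere_holomorphic_eqI:
  assumes "\<And>p. sphere_holomorphic_at f p" "\<And>p. sphere_holomorphic_at g p"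
    and "finite F" "\<And>z. z \<notin> F \<Longrightarrow> f (Some z) = g (Some z)"
  shows "f = g"
proof
  fix p
  have "p \<in> riemann_sphere closure_of (Some ` (- F))" using closure_of_Some_minus_finite assms by auto
  then show "f p = g p"
    by (rule forall_in_closure_of_eq[OF _ Hausdorff_sphere, where f = f and g = g])
       (use assms in \<open>auto intro: sphere_holomorphic_imp_continuous_map\<close>)
qed

lemma connected_riemann_sphere: "connected_space riemann_sphere"
proof -
  have "connectedin riemann_sphere (Some ` UNIV)"
    by (rule connectedin_continuous_map_image[OF continuous_map_Some]) (simp add: connected_UNIV)
  then have "connectedin riemann_sphere (riemann_sphere closure_of (Some ` (- {})))"
    by (intro connectedin_closure_of) simp
  then show ?thesis
    unfolding closure_of_Some_minus_finite[OF finite.emptyI] by (metis connectedin_topspace topspace_sphere)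
qed

text \<open>Coprimality excludes a common zero, so at a pole the reciprocal quotient is regular. At
  infinity the expression in \<open>v = 1/z\<close> is the quotient of the reflected polynomials
  times a power of \<open>v\<close> given by the difference of the degrees.\<close>

lemma rat_fun_holomorphic_at:
  assumes "coprime P Q" "Q \<noteq> 0"
  shows "sphere_holomorphic_at (rat_fun P Q) p"
proof (cases p)
  case (Some z0)
  show ?thesis
  proof (cases "poly Q z0 = 0")
    case False
    show ?thesis
      by (rule sphere_holomorphic_atI[of id id p z0 "- {z. poly Q z = 0}" "\<lambda>z. poly P z / poly Q z"])
         (use Some False assms in \<open>auto simp: rat_fun_def poly_roots_finite finite_imp_closed open_Compl intro!: holomorphic_intros\<close>)
  next
    case True
    then have P0: "poly P z0 \<noteq> 0" using assms(1) by (metis coprime_poly_0)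
    then have P00: "P \<noteq> 0" by auto
    show ?thesis
      by (rule sphere_holomorphic_atI[of id sphere_inversion p z0 "- {z. poly P z = 0}" "\<lambda>z. poly Q z / poly P z"])
         (use Some P0 assms P00 in \<open>auto simp: rat_fun_def poly_roots_finite finite_imp_closed open_Compl intro!: holomorphic_intros\<close>)
  qed
next
  case None
  define P' Q' where "P' = reflect_poly P" and "Q' = reflect_poly Q"
  have Q'0: "poly Q' 0 = lead_coeff Q" "poly P' 0 = lead_coeff P" by (simp_all add: Q'_def P'_def)
  have r: "poly (reflect_poly R) v = v ^ degree R * poly R (inverse v)" if "v \<noteq> 0" for R :: "complex poly" and v
    using that by (simp add: poly_reflect_poly_nz)
  have quo: "poly P (inverse v) * (v ^ degree P * poly Q' v) = poly Q (inverse v) * (v ^ degree Q * poly P' v)" if "v \<noteq> 0" for v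
    using r[OF that, of P] r[OF that, of Q] by (simp add: P'_def Q'_def mult_ac)
  show ?thesis
  proof (cases "degree P > degree Q")
    case True
    then have P: "P \<noteq> 0" by auto
    show ?thesis
    proof (rule sphere_holomorphic_atI[of sphere_inversion sphere_inversion p 0 "- {v. poly P' v = 0}"
          "\<lambda>v. v ^ (degree P - degree Q) * poly Q' v / poly P' v"])
      fix v assume v: "v \<in> - {v. poly P' v = 0}"
      show "rat_fun P Q (sphere_inversion (Some v)) = sphere_inversion (Some (v ^ (degree P - degree Q) * poly Q' v / poly P' v))"
      proof (cases "v = 0")
        case True
        then show ?thesis using \<open>degree P > degree Q\<close> by (simp add: rat_fun_def power_0_left)
      next
        case False
        have pP: "poly P (inverse v) \<noteq> 0" using v r[OF False, of P] by (auto simp: P'_def)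
        have "poly Q' v = 0 \<longleftrightarrow> poly Q (inverse v) = 0" using r[OF False, of Q] False by (simp add: Q'_def)
        moreover have "poly Q (inverse v) / poly P (inverse v) = v ^ (degree P - degree Q) * poly Q' v / poly P' v"
          using quo[OF False] pP v False True
          by (simp add: frac_eq_eq power_diff) (simp add: field_simps)
        ultimately show ?thesis using False pP v
          by (auto simp: rat_fun_def) (metis inverse_divide)
      qed
    qed (use None P Q'0 in \<open>auto simp: P'_def poly_roots_finite finite_imp_closed open_Compl intro!: holomorphic_intros\<close>)
  next
    case False
    then have le: "degree P \<le> degree Q" by simp
    show ?thesis
    proof (rule sphere_holomorphic_atI[of sphere_inversion id p 0 "- {v. poly Q' v = 0}"
          "\<lambda>v. v ^ (degree Q - degree P) * poly P' v / poly Q' v"])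
      fix v assume v: "v \<in> - {v. poly Q' v = 0}"
      show "rat_fun P Q (sphere_inversion (Some v)) = id (Some (v ^ (degree Q - degree P) * poly P' v / poly Q' v))"
      proof (cases "v = 0")
        case True
        have "coeff P (degree Q) = 0" if "degree P < degree Q" using that by (rule coeff_eq_0)
        then show ?thesis using le True Q'0 by (auto simp: rat_fun_def power_0_left)
      next
        case False
        have pQ: "poly Q (inverse v) \<noteq> 0" using v r[OF False, of Q] by (auto simp: Q'_def)
        have "poly P (inverse v) / poly Q (inverse v) = v ^ (degree Q - degree P) * poly P' v / poly Q' v"
          using quo[OF False] pQ v False le
          by (simp add: frac_eq_eq power_diff)
        then show ?thesis using False pQ by (auto simp: rat_fun_def)
      qed
    qed (use None assms Q'0 in \<open>auto simp: Q'_def poly_roots_finite finite_imp_closed open_Compl intro!: holomorphic_intros\<close>)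
  qed
qed

lemma rational_map_holomorphic_at: "rational_map f \<Longrightarrow> sphere_holomorphic_at f p"
  using rat_fun_holomorphic_at unfolding rational_map_def by blast

lemma rational_map_not_None: "rational_map f \<Longrightarrow> \<exists>p. f p \<noteq> None"
proof -
  assume "rational_map f"
  then obtain P Q where f: "Q \<noteq> 0" "f = rat_fun P Q" unfolding rational_map_def by blast
  obtain z where "poly Q z \<noteq> 0" using f(1) by (metis poly_all_0_iff_0)
  then show ?thesis using f by (intro exI[of _ "Some z"]) (simp add: rat_fun_def)
qed

text \<open>\<open>E\<close> collects the points near which \<open>f\<close> is identically
  infinite. A point off \<open>E\<close> has a neighbourhood with no pole other than possibly
  itself, because zeros of \<open>1/f\<close> are isolated; hence \<open>E\<close> is clopen, and
  empty since it misses \<open>p0\<close>. Compactness then leaves finitely many poles. The second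
  claim states that the local expression of \<open>1/f\<close> at a pole is not constant, as needed
  to split off the order of its zero.\<close>

lemma poles_finite:
  assumes f: "\<And>p. sphere_holomorphic_at f p" and "f p0 \<noteq> None"
  shows "finite {p. f p = None}"
    and "\<And>a b z0 y e. a \<in> sphere_charts \<Longrightarrow> b \<in> sphere_charts \<Longrightarrow> f (a (Some z0)) = None \<Longrightarrow> e > 0 \<Longrightarrow>
      (\<And>z. z \<in> ball z0 e \<Longrightarrow> f (a (Some z)) = sphere_inversion (Some (y z))) \<Longrightarrow> \<not> y constant_on ball z0 e"
proof -
  let ?N = "{p. f p = None}"
  define E where "E = {p. \<exists>U. openin riemann_sphere U \<and> p \<in> U \<and> U \<subseteq> ?N}"
  have cont: "continuous_map riemann_sphere riemann_sphere f"
    by (rule sphere_holomorphic_imp_continuous_map) (rule f)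
  have isol: "\<exists>U. openin riemann_sphere U \<and> p \<in> U \<and> U \<inter> ?N \<subseteq> {p}" if p: "p \<notin> E" for p
  proof (cases "f p = None")
    case False
    have "openin riemann_sphere {q \<in> topspace riemann_sphere. f q \<in> Some ` UNIV}"
      by (rule openin_continuous_map_preimage[OF cont]) simp
    moreover have "f p \<in> Some ` UNIV" using False by (metis UNIV_I image_eqI option.exhaust)
    ultimately show ?thesis by (intro exI[of _ "{q. f q \<in> Some ` UNIV}"]) auto
  next
    case True
    obtain a z0 where a: "a \<in> sphere_charts" "p = a (Some z0)" by (rule chart_at)
    obtain e y where y: "e > 0" "y holomorphic_on ball z0 e" "f p = sphere_inversion (Some (y z0))"
      "\<And>z. z \<in> ball z0 e \<Longrightarrow> f (a (Some z)) = sphere_inversion (Some (y z))"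
      using sphere_holomorphic_at_charts[OF f a, of sphere_inversion] True by auto
    have y0: "y z0 = 0" using y(3) True by (simp add: sphere_inversion_def split: if_splits)
    have "\<exists>w\<in>ball z0 e. y w \<noteq> 0"
    proof (rule ccontr)
      assume "\<not> (\<exists>w\<in>ball z0 e. y w \<noteq> 0)"
      then have "(\<lambda>z. a (Some z)) ` ball z0 e \<subseteq> ?N" using y by auto
      then have "p \<in> E" unfolding E_def using openin_chart_image[OF a(1), of "ball z0 e"] a y(1) by auto
      then show False using p by simp
    qed
    then obtain w where w: "w \<in> ball z0 e" "y w \<noteq> 0" by blast
    obtain r where r: "r > 0" "ball z0 r \<subseteq> ball z0 e" "\<And>z. z \<in> ball z0 r - {z0} \<Longrightarrow> y z \<noteq> 0"
      using isolated_zeros[OF y(2) _ _ _ y0 w] y(1) by auto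
    have "(\<lambda>z. a (Some z)) ` ball z0 r \<inter> ?N \<subseteq> {p}"
    proof
      fix q assume q: "q \<in> (\<lambda>z. a (Some z)) ` ball z0 r \<inter> ?N"
      then obtain z where z: "z \<in> ball z0 r" "q = a (Some z)" by blast
      have "z \<in> ball z0 e" using z r(2) by blast
      then have "y z = 0" using y(4)[of z] q z by (auto simp: sphere_inversion_def split: if_splits)
      then show "q \<in> {p}" using r(3)[of z] z a by auto
    qed
    then show ?thesis using openin_chart_image[OF a(1), of "ball z0 r"] a r(1)
      by (intro exI[of _ "(\<lambda>z. a (Some z)) ` ball z0 r"]) auto
  qed
  have oE: "openin riemann_sphere E"
    by (subst openin_subopen) (auto simp: E_def)
  have inf: "infinite U" if "openin riemann_sphere U" "q \<in> U" for U q
  proof -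
    have "U \<inter> Some ` (- F) \<noteq> {}" if "finite F" for F
    proof -
      have "q \<in> riemann_sphere closure_of (Some ` (- F))" using closure_of_Some_minus_finite[OF that] by simp
      then show ?thesis using \<open>openin riemann_sphere U\<close> \<open>q \<in> U\<close> unfolding in_closure_of by blast
    qed
    moreover have "U \<inter> Some ` (- (Some -` U)) = {}" by auto
    ultimately have "infinite (Some -` U)" by blast
    then show ?thesis using finite_vimageI[OF _ inj_Some] by blast
  qed
  have "openin riemann_sphere (- E)"
  proof (subst openin_subopen, intro ballI)
    fix p assume "p \<in> - E"
    then obtain U where U: "openin riemann_sphere U" "p \<in> U" "U \<inter> ?N \<subseteq> {p}" using isol by blast
    have "U \<subseteq> - E"
    proof
      fix q assume q: "q \<in> U"
      show "q \<in> - E"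
      proof
        assume "q \<in> E"
        then obtain V where V: "openin riemann_sphere V" "q \<in> V" "V \<subseteq> ?N" unfolding E_def by blast
        have "infinite (U \<inter> V)" using inf[of "U \<inter> V" q] U V q by blast
        moreover have "U \<inter> V \<subseteq> {p}" using U V by blast
        ultimately show False using finite_subset by blast
      qed
    qed
    then show "\<exists>T. openin riemann_sphere T \<and> p \<in> T \<and> T \<subseteq> - E" using U by blast
  qed
  then have "closedin riemann_sphere E"
    by (simp add: closedin_def Compl_eq_Diff_UNIV)
  then have "E = {} \<or> E = UNIV"
    using connected_riemann_sphere oE unfolding connected_space_clopen_in by auto
  moreover have "p0 \<notin> E" using assms(2) by (auto simp: E_def)
  ultimately have E: "E = {}" by auto
  then obtain U where U: "\<And>p. openin riemann_sphere (U p)" "\<And>p. p \<in> U p" "\<And>p. U p \<inter> ?N \<subseteq> {p}"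
    using isol by (metis empty_iff)
  obtain \<F> where F: "finite \<F>" "\<F> \<subseteq> range U" "\<Union>\<F> = UNIV"
  proof -
    have "\<Union>(range U) = topspace riemann_sphere" using U(2) by auto
    moreover have "\<forall>V\<in>range U. openin riemann_sphere V" using U(1) by auto
    ultimately show ?thesis
      using compact_riemann_sphere that unfolding compact_space_alt topspace_sphere
      by (metis subset_UNIV subset_antisym)
  qed
  then obtain G where G: "finite G" "\<F> = U ` G" by (meson finite_subset_image)
  have "?N \<subseteq> G"
  proof
    fix p assume p: "p \<in> ?N"
    obtain q where "q \<in> G" "p \<in> U q" using F G by blast
    then show "p \<in> G" using U(3)[of q] p by auto
  qed
  then show "finite ?N" using G(1) finite_subset by blast
  fix a b :: "csphere \<Rightarrow> csphere" and z0 y and e :: real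
  assume h: "a \<in> sphere_charts" "f (a (Some z0)) = None" "e > 0"
    "\<And>z. z \<in> ball z0 e \<Longrightarrow> f (a (Some z)) = sphere_inversion (Some (y z))"
  show "\<not> y constant_on ball z0 e"
  proof
    assume "y constant_on ball z0 e"
    moreover have "y z0 = 0" using h(2,3) h(4)[of z0] by (simp add: sphere_inversion_def split: if_splits)
    ultimately have "y z = 0" if "z \<in> ball z0 e" for z using that h(3) unfolding constant_on_def
      by (metis centre_in_ball)
    then have "(\<lambda>z. a (Some z)) ` ball z0 e \<subseteq> ?N" using h(4) by auto
    then have "a (Some z0) \<in> E" unfolding E_def using openin_chart_image[OF h(1), of "ball z0 e"] h(3) by auto
    then show False using E by simp
  qed
qed

text \<open>Induction on the set of poles: a power of \<open>z - c\<close> removes the pole at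
  \<open>c\<close>, and being holomorphic it leaves the orders of the other poles bounded as before.
  \<open>Q\<close> is the product of these powers.\<close>

lemma meromorphic_clear_poles:
  fixes g :: "complex \<Rightarrow> complex"
  assumes "finite C" "g holomorphic_on - C"
    and "\<And>c. c \<in> C \<Longrightarrow> \<exists>k r h. r > 0 \<and> h holomorphic_on ball c r \<and> (\<forall>z\<in>ball c r - {c}. (z - c) ^ k * g z = h z)"
  obtains Q G where "Q \<noteq> 0" "G holomorphic_on UNIV" "\<And>z. z \<notin> C \<Longrightarrow> G z = poly Q z * g z"
  using assms
proof (induction C arbitrary: g thesis rule: finite_induct)
  case empty
  show ?case by (rule empty(1)[of 1 g]) (use empty in auto)
next
  case (insert c C)
  obtain k r h where h: "r > 0" "h holomorphic_on ball c r" "\<forall>z\<in>ball c r - {c}. (z - c) ^ k * g z = h z"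
    using insert.prems(3)[of c] by blast
  define g' where "g' z = (if z = c then h c else (z - c) ^ k * g z)" for z
  define r' where "r' = r"
  have op: "open (- insert c C)" using insert.hyps by (simp add: finite_imp_closed open_Compl)
  have "g' holomorphic_on (- insert c C) \<union> (ball c r - C)"
  proof (rule holomorphic_on_Un)
    show "g' holomorphic_on - insert c C"
      by (rule holomorphic_transform[of "\<lambda>z. (z - c) ^ k * g z"])
         (use insert.prems(2) in \<open>auto simp: g'_def intro!: holomorphic_intros\<close>)
    show "g' holomorphic_on ball c r - C"
      by (rule holomorphic_transform[of h]) (use h in \<open>auto simp: g'_def intro: holomorphic_on_subset\<close>)
    show "open (ball c r - C)" using insert.hyps by (simp add: finite_imp_closed open_Diff)
  qed (use op in auto)
  moreover have "- C \<subseteq> (- insert c C) \<union> (ball c r - C)" using h(1) by auto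
  ultimately have g': "g' holomorphic_on - C" by (rule holomorphic_on_subset)
  have "\<exists>k r h. r > 0 \<and> h holomorphic_on ball d r \<and> (\<forall>z\<in>ball d r - {d}. (z - d) ^ k * g' z = h z)" if d: "d \<in> C" for d
  proof -
    obtain l s u where u: "s > 0" "u holomorphic_on ball d s" "\<forall>z\<in>ball d s - {d}. (z - d) ^ l * g z = u z"
      using insert.prems(3)[of d] d by blast
    have dc: "dist d c > 0" using d insert.hyps by auto
    show ?thesis
      by (intro exI[of _ l] exI[of _ "min s (dist d c)"] exI[of _ "\<lambda>z. (z - c) ^ k * u z"])
         (use u dc in \<open>auto simp: g'_def intro!: holomorphic_intros intro: holomorphic_on_subset\<close>)
  qed
  then obtain Q G where Q: "Q \<noteq> 0" "G holomorphic_on UNIV" "\<And>z. z \<notin> C \<Longrightarrow> G z = poly Q z * g' z"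
    using insert.IH[OF _ g'] by blast
  show ?case
    by (rule insert.prems(1)[of "Q * [:-c, 1:] ^ k" G]) (use Q in \<open>auto simp: g'_def\<close>)
qed

lemma poly_growth:
  fixes Q :: "complex poly"
  assumes "norm z \<ge> 1"
  shows "norm (poly Q z) \<le> (\<Sum>i\<le>degree Q. norm (coeff Q i)) * norm z ^ degree Q"
proof -
  have "norm (poly Q z) \<le> (\<Sum>i\<le>degree Q. norm (coeff Q i * z ^ i))"
    unfolding poly_altdef by (rule norm_sum)
  also have "\<dots> \<le> (\<Sum>i\<le>degree Q. norm (coeff Q i) * norm z ^ degree Q)"
    using assms by (intro sum_mono) (auto simp: norm_mult norm_power intro!: mult_left_mono power_increasing)
  finally show ?thesis by (simp add: sum_distrib_right)
qed

text \<open>Clearing the finitely many poles leaves an entire function. The chart at infinity bounds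
  it by a power of the modulus, so it is a polynomial by Liouville's theorem.\<close>

theorem sphere_holomorphic_imp_rational:
  assumes f: "\<And>p. sphere_holomorphic_at f p" and q: "f q \<noteq> None"
  shows "rational_map f"
proof -
  define C where "C = {z. f (Some z) = None}"
  define g where "g z = the (f (Some z))" for z
  have "finite C" using finite_vimageI[OF poles_finite(1)[OF f q] inj_Some] by (simp add: C_def vimage_def)
  have opC: "open (- C)" using \<open>finite C\<close> by (simp add: finite_imp_closed open_Compl)
  have "sphere_holomorphic_on f UNIV"
    using f by (metis sphere_holomorphic_on_iff openin_topspace topspace_sphere)
  then have "(\<lambda>z. the (id (f (id (Some z))))) holomorphic_on {z. id (Some z) \<in> UNIV \<and> id (f (id (Some z))) \<noteq> None}"
    unfolding sphere_holomorphic_on_def by blast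
  then have "g holomorphic_on {z. f (Some z) \<noteq> None}" by (simp add: g_def[abs_def] del: not_None_eq)
  then have gh: "g holomorphic_on - C" by (simp add: C_def Collect_neg_eq del: not_None_eq)
  have "\<exists>k r h. r > 0 \<and> h holomorphic_on ball c r \<and> (\<forall>z\<in>ball c r - {c}. (z - c) ^ k * g z = h z)" if c: "c \<in> C" for c
  proof -
    have fc: "f (Some c) = None" using c by (simp add: C_def)
    obtain e y where y: "e > 0" "y holomorphic_on ball c e" "f (Some c) = sphere_inversion (Some (y c))"
      "\<And>z. z \<in> ball c e \<Longrightarrow> f (id (Some z)) = sphere_inversion (Some (y z))"
      using sphere_holomorphic_at_charts[OF f, of id "Some c" c sphere_inversion] fc by auto
    have y0: "y c = 0" using y(3) fc by (simp add: sphere_inversion_def split: if_splits)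
    have nc: "\<not> y constant_on ball c e"
      by (rule poles_finite(2)[OF f q, of id id]) (use fc y in auto)
    obtain h r n where h: "0 < r" "ball c r \<subseteq> ball c e" "h holomorphic_on ball c r"
      "\<And>w. w \<in> ball c r \<Longrightarrow> y w = (w - c) ^ n * h w" "\<And>w. w \<in> ball c r \<Longrightarrow> h w \<noteq> 0"
      by (rule holomorphic_factor_zero_nonconstant[OF y(2) open_ball connected_ball _ y0 nc])
         (simp add: y(1), rule that, auto)
    have "(z - c) ^ n * g z = inverse (h z)" if z: "z \<in> ball c r - {c}" for z
    proof -
      have "y z \<noteq> 0" using h z by auto
      then have "g z = inverse (y z)" using y(4)[of z] z h(2) by (auto simp: g_def)
      then show ?thesis using h(4)[of z] z by (simp add: field_simps)
    qed
    then show ?thesis using h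
      by (intro exI[of _ n] exI[of _ r] exI[of _ "\<lambda>z. inverse (h z)"]) (auto intro!: holomorphic_intros)
  qed
  then obtain Q G where Q: "Q \<noteq> 0" "G holomorphic_on UNIV" "\<And>z. z \<notin> C \<Longrightarrow> G z = poly Q z * g z"
    using meromorphic_clear_poles[OF \<open>finite C\<close> gh] by blast
  \<comment> \<open>If infinity is a pole, the exponent is the order of the zero of
    \<open>1/f\<close> there; otherwise \<open>g\<close> is bounded near infinity and the exponent
    is 0.\<close>
  have "\<exists>A B n. A \<ge> 1 \<and> (\<forall>z. norm z \<ge> A \<longrightarrow> z \<notin> C \<longrightarrow> norm (g z) \<le> B * norm z ^ n)"
  proof (cases "f None = None")
    case True
    obtain e y where y: "e > 0" "y holomorphic_on ball 0 e" "f None = sphere_inversion (Some (y 0))"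
      "\<And>z. z \<in> ball 0 e \<Longrightarrow> f (sphere_inversion (Some z)) = sphere_inversion (Some (y z))"
      using sphere_holomorphic_at_charts[OF f, of sphere_inversion None 0 sphere_inversion] True by auto
    have y0: "y 0 = 0" using y(3) True by (simp add: sphere_inversion_def split: if_splits)
    have nc: "\<not> y constant_on ball 0 e"
      by (rule poles_finite(2)[OF f q, of sphere_inversion id]) (use True y in auto)
    obtain h r n where h: "0 < r" "ball (0::complex) r \<subseteq> ball 0 e" "h holomorphic_on ball 0 r"
      "\<And>w. w \<in> ball 0 r \<Longrightarrow> y w = (w - 0) ^ n * h w" "\<And>w. w \<in> ball 0 r \<Longrightarrow> h w \<noteq> 0"
      by (rule holomorphic_factor_zero_nonconstant[OF y(2) open_ball connected_ball _ y0 nc])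
         (simp add: y(1), rule that, auto)
    have "continuous_on (cball 0 (r/2)) (\<lambda>v. inverse (h v))"
      using h by (intro continuous_intros continuous_on_subset[OF holomorphic_on_imp_continuous_on[OF h(3)]]) auto
    then have "bounded ((\<lambda>v. inverse (h v)) ` cball 0 (r/2))"
      by (intro compact_imp_bounded compact_continuous_image) auto
    then obtain B where B: "\<And>v. v \<in> cball 0 (r/2) \<Longrightarrow> norm (inverse (h v)) \<le> B"
      unfolding bounded_iff by blast
    have "norm (g z) \<le> B * norm z ^ n" if z: "norm z \<ge> max 1 (2/r)" for z
    proof -
      have z0: "z \<noteq> 0" using z by auto
      have "2 \<le> r * norm z" using z h(1) by (simp add: field_simps)
      then have v: "inverse z \<in> cball 0 (r/2)" using z0 h(1) by (simp add: norm_inverse norm_divide field_simps)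
      then have v': "inverse z \<in> ball 0 r" using h(1) by auto
      have yz: "y (inverse z) = inverse z ^ n * h (inverse z)" using h(4)[OF v'] by simp
      then have "y (inverse z) \<noteq> 0" using h(5)[OF v'] z0 by simp
      then have "g z = inverse (y (inverse z))" using y(4)[of "inverse z"] v' h(2) z0 by (auto simp: g_def)
      then have "g z = inverse (h (inverse z)) * z ^ n" using yz by (simp add: field_simps)
      then show ?thesis using B[OF v] by (simp add: norm_mult norm_power mult_right_mono)
    qed
    then show ?thesis by (intro exI[of _ "max 1 (2/r)"] exI[of _ B] exI[of _ n]) auto
  next
    case False
    have "\<exists>e (y::complex \<Rightarrow> complex). e > 0 \<and> y holomorphic_on ball (0::complex) e \<and>
        (\<forall>z\<in>ball (0::complex) e. f (sphere_inversion (Some z)) = id (Some (y z)))"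
    proof (rule sphere_holomorphic_at_charts[OF f, of sphere_inversion None 0 id])
      fix e :: real and y :: "complex \<Rightarrow> complex"
      assume "e > 0" "y holomorphic_on ball (0::complex) e"
        "\<And>z. z \<in> ball (0::complex) e \<Longrightarrow> f (sphere_inversion (Some z)) = id (Some (y z))"
      then show ?thesis by blast
    qed (use False in auto)
    then obtain e y where y: "e > 0" "y holomorphic_on ball (0::complex) e"
      "\<And>z. z \<in> ball (0::complex) e \<Longrightarrow> f (sphere_inversion (Some z)) = id (Some (y z))"
      by blast
    have "continuous_on (cball 0 (e/2)) y"
      using y by (intro continuous_on_subset[OF holomorphic_on_imp_continuous_on[OF y(2)]]) auto
    then have "bounded (y ` cball 0 (e/2))"
      by (intro compact_imp_bounded compact_continuous_image) auto
    then obtain B where B: "\<And>v. v \<in> cball 0 (e/2) \<Longrightarrow> norm (y v) \<le> B"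
      unfolding bounded_iff by blast
    have "norm (g z) \<le> B * norm z ^ 0" if z: "norm z \<ge> max 1 (2/e)" for z
    proof -
      have z0: "z \<noteq> 0" using z by auto
      have "2 \<le> e * norm z" using z y(1) by (simp add: field_simps)
      then have v: "inverse z \<in> cball 0 (e/2)" using z0 y(1) by (simp add: norm_inverse norm_divide field_simps)
      then have v': "inverse z \<in> ball 0 e" using y(1) by auto
      have "g z = y (inverse z)" using y(3)[OF v'] z0 by (simp add: g_def)
      then show ?thesis using B[OF v] by simp
    qed
    then show ?thesis by (intro exI[of _ "max 1 (2/e)"] exI[of _ B] exI[of _ 0]) auto
  qed
  then obtain A B n where AB: "A \<ge> 1" "\<And>z::complex. norm z \<ge> A \<Longrightarrow> z \<notin> C \<Longrightarrow> norm (g z) \<le> B * norm z ^ n" by blast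
  obtain M where M: "\<And>z. z \<in> C \<Longrightarrow> norm z \<le> M"
    using finite_imp_bounded[OF \<open>finite C\<close>] unfolding bounded_iff by blast
  define S where "S = (\<Sum>i\<le>degree Q. norm (coeff Q i))"
  have nof: "norm (G z) \<le> (S * B) * norm z ^ (degree Q + n)" if z: "max A (M + 1) \<le> norm z" for z :: complex
  proof -
    have zC: "z \<notin> C" using M z by fastforce
    have "norm (G z) = norm (poly Q z) * norm (g z)" using Q(3)[OF zC] by (simp add: norm_mult)
    also have "\<dots> \<le> (S * norm z ^ degree Q) * (B * norm z ^ n)"
      using poly_growth[of z Q] AB(2)[of z] zC z AB(1) unfolding S_def
      by (intro mult_mono) (auto intro!: mult_nonneg_nonneg sum_nonneg)
    finally show ?thesis by (simp add: power_add mult_ac)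
  qed
  define P where "P = (\<Sum>k\<le>degree Q + n. monom ((deriv ^^ k) G 0 / fact k) k)"
  have "G z = (\<Sum>k\<le>degree Q + n. (deriv ^^ k) G 0 / fact k * z ^ k)" for z
    by (rule Liouville_polynomial[OF Q(2)]) (rule nof)
  then have GP: "G z = poly P z" for z :: complex
    by (simp add: P_def poly_sum poly_monom)
  \<comment> \<open>\<open>rat_fun\<close> represents a rational map only for a coprime
    pair.\<close>
  define d where "d = gcd P Q"
  have "d \<noteq> 0" using Q(1) by (simp add: d_def)
  define P' Q' where "P' = P div d" and "Q' = Q div d"
  have PQ: "P = d * P'" "Q = d * Q'" by (simp_all add: P'_def Q'_def d_def)
  have cop: "coprime P' Q'" unfolding P'_def Q'_def d_def using Q(1) by (simp add: div_gcd_coprime)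
  have Q'0: "Q' \<noteq> 0" using PQ Q(1) by auto
  have "f = rat_fun P' Q'"
  proof (rule sphere_holomorphic_eqI[OF f rat_fun_holomorphic_at[OF cop Q'0]])
    show "finite (C \<union> {z. poly Q z = 0})" using \<open>finite C\<close> Q(1) by (simp add: poly_roots_finite)
    fix z assume z: "z \<notin> C \<union> {z. poly Q z = 0}"
    then have "poly P z = poly Q z * g z" using Q(3) GP by simp
    then have "g z = poly P' z / poly Q' z" using z PQ by (auto simp: field_simps)
    moreover have "f (Some z) = Some (g z)" using z by (auto simp: C_def g_def)
    ultimately show "f (Some z) = rat_fun P' Q' (Some z)" using z PQ by (auto simp: rat_fun_def)
  qed
  then show ?thesis using cop Q'0 unfolding rational_map_def by blast
qed

lemma rational_map_compose:
  assumes "rational_map g" "rational_map f" "g (f p) \<noteq> None"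
  shows "rational_map (g \<circ> f)"
proof (rule sphere_holomorphic_imp_rational)
  show "sphere_holomorphic_at (g \<circ> f) p" for p
    by (rule sphere_holomorphic_at_compose) (rule rational_map_holomorphic_at, rule assms)+
  show "(g \<circ> f) p \<noteq> None" using assms by simp
qed

lemma rational_map_eqI:
  assumes "rational_map f" "rational_map g" "infinite S" "\<And>z. z \<in> S \<Longrightarrow> f (Some z) = g (Some z)"
  shows "f = g"
proof -
  obtain P Q P' Q' where h: "coprime P Q" "Q \<noteq> 0" "f = rat_fun P Q" "coprime P' Q'" "Q' \<noteq> 0" "g = rat_fun P' Q'"
    using assms unfolding rational_map_def by blast
  have "S \<subseteq> {z. poly (P * Q' - P' * Q) z = 0}"
  proof
    fix z assume "z \<in> S"
    then have "rat_fun P Q (Some z) = rat_fun P' Q' (Some z)" using assms(4) h by simp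
    then have "poly P z * poly Q' z = poly P' z * poly Q z"
      by (auto simp: rat_fun_def frac_eq_eq split: if_splits)
    then show "z \<in> {z. poly (P * Q' - P' * Q) z = 0}" by simp
  qed
  then have "P * Q' - P' * Q = 0" using assms(3) poly_roots_finite infinite_super by blast
  then have eq: "poly P z * poly Q' z = poly P' z * poly Q z" for z
    by (metis eq_iff_diff_eq_0 poly_mult)
  show ?thesis unfolding h
  proof (rule sphere_holomorphic_eqI[OF rat_fun_holomorphic_at[OF h(1,2)] rat_fun_holomorphic_at[OF h(4,5)]])
    show "finite ({z. poly Q z = 0} \<union> {z. poly Q' z = 0})" using h by (simp add: poly_roots_finite)
    fix z assume "z \<notin> {z. poly Q z = 0} \<union> {z. poly Q' z = 0}"
    then show "rat_fun P Q (Some z) = rat_fun P' Q' (Some z)"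
      using eq[of z] by (simp add: rat_fun_def frac_eq_eq)
  qed
qed

subsection \<open>Finite Blaschke products\<close>

text \<open>The maximum principle on slightly smaller balls bounds both \<open>h\<close> and
  \<open>1/h\<close> by 1, so the modulus is constantly 1 and attains its maximum inside. The
  boundary condition concerns only the modulus near the rim, since in the application no continuous
  extension is at hand.\<close>

lemma unimodular_boundary_imp_constant:
  assumes h: "h holomorphic_on ball (0::complex) b" "\<And>z. z \<in> ball 0 b \<Longrightarrow> h z \<noteq> 0" "b > 0"
    and lim: "\<And>\<epsilon>. \<epsilon> > 0 \<Longrightarrow> \<exists>s<b. \<forall>z\<in>ball 0 b. norm z > s \<longrightarrow> \<bar>norm (h z) - 1\<bar> < \<epsilon>"
  shows "\<exists>c. norm c = 1 \<and> (\<forall>z\<in>ball 0 b. h z = c)"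
proof -
  have bound: "norm (u w) \<le> 1 + \<epsilon>"
    if u: "u holomorphic_on ball 0 b" and w: "w \<in> ball 0 b" and s: "s < b" "\<And>z. z \<in> ball 0 b \<Longrightarrow> norm z > s \<Longrightarrow> norm (u z) \<le> 1 + \<epsilon>"
    for u :: "complex \<Rightarrow> complex" and w \<epsilon> s
  proof -
    \<comment> \<open>A radius beyond both \<open>norm w\<close> and the threshold \<open>s\<close>,
      but still inside the ball.\<close>
    define t where "t = (max (norm w) (max s 0) + b) / 2"
    have t: "norm w < t" "s < t" "t < b" "t > 0" using w s(1) h(3) by (auto simp: t_def)
    have sub: "cball 0 t \<subseteq> ball (0::complex) b" using t by auto
    show ?thesis
    proof (rule maximum_modulus_frontier[of u "ball 0 t"])
      show "u holomorphic_on interior (ball 0 t)" using sub ball_subset_cball u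
        by (metis holomorphic_on_subset interior_ball order_trans)
      show "continuous_on (closure (ball 0 t)) u"
        using holomorphic_on_imp_continuous_on[OF holomorphic_on_subset[OF u sub]] t by simp
      fix z assume "z \<in> frontier (ball (0::complex) t)"
      then have "norm z = t" using t by simp
      then show "norm (u z) \<le> 1 + \<epsilon>" using s(2)[of z] t by auto
    qed (use t in auto)
  qed
  have n1: "norm (h w) = 1" if w: "w \<in> ball 0 b" for w
  proof (rule antisym)
    show "norm (h w) \<le> 1"
    proof (rule field_le_epsilon)
      fix \<epsilon> :: real assume "\<epsilon> > 0"
      then obtain s where s: "s < b" "\<forall>z\<in>ball 0 b. norm z > s \<longrightarrow> \<bar>norm (h z) - 1\<bar> < \<epsilon>" using lim by blast
      show "norm (h w) \<le> 1 + \<epsilon>"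
        by (rule bound[OF h(1) w s(1)]) (use s(2) in fastforce)
    qed
    have "norm (inverse (h w)) \<le> 1"
    proof (rule field_le_epsilon)
      fix \<epsilon> :: real assume \<epsilon>: "\<epsilon> > 0"
      \<comment> \<open>Chosen so that a modulus of at least \<open>1 - d\<close> has an inverse of
        at most \<open>1 + \<epsilon>\<close>.\<close>
      define d where "d = \<epsilon> / (1 + \<epsilon>)"
      have d: "d > 0" "d < 1" "inverse (1 - d) = 1 + \<epsilon>" using \<epsilon> by (auto simp: d_def field_simps)
      obtain s where s: "s < b" "\<forall>z\<in>ball 0 b. norm z > s \<longrightarrow> \<bar>norm (h z) - 1\<bar> < d" using lim[OF d(1)] by blast
      show "norm (inverse (h w)) \<le> 1 + \<epsilon>"
      proof (rule bound[of "\<lambda>z. inverse (h z)", OF _ w s(1)])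
        show "(\<lambda>z. inverse (h z)) holomorphic_on ball 0 b" using h by (intro holomorphic_intros) auto
        fix z :: complex assume z: "z \<in> ball 0 b" "norm z > s"
        then have "norm (h z) \<ge> 1 - d" using s(2) by fastforce
        then have "inverse (norm (h z)) \<le> inverse (1 - d)" using d by (intro le_imp_inverse_le) auto
        then show "norm (inverse (h z)) \<le> 1 + \<epsilon>" using d by (simp add: norm_inverse)
      qed
    qed
    then show "1 \<le> norm (h w)" using h(2)[OF w] by (simp add: norm_inverse field_simps norm_divide)
  qed
  have "h constant_on ball 0 b"
    by (rule maximum_modulus_principle[OF h(1), of "ball 0 b" 0]) (use h(3) n1 in auto)
  then obtain c where c: "\<And>z. z \<in> ball 0 b \<Longrightarrow> h z = c" unfolding constant_on_def by blast
  moreover have "norm c = 1" using n1[of 0] c[of 0] h(3) by simp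
  ultimately show ?thesis by blast
qed

section \<open>Explicit finite Blaschke products\<close>

definition bnum :: "complex list \<Rightarrow> complex poly" where
  "bnum as = (\<Prod>a\<leftarrow>as. [:- a, 1:])"

text \<open>\<open>bnum as / bden as\<close> is the product of the factors
  \<open>(z - a) / (1 - cnj a * z)\<close>. The zeros form a list, so repetition encodes
  multiplicity.\<close>

definition bden :: "complex list \<Rightarrow> complex poly" where
  "bden as = (\<Prod>a\<leftarrow>as. [:1, - cnj a:])"

lemma bnum_simps [simp]: "bnum [] = 1" "bnum (a # as) = [:- a, 1:] * bnum as"
  and bden_simps [simp]: "bden [] = 1" "bden (a # as) = [:1, - cnj a:] * bden as"
  by (simp_all add: bnum_def bden_def)

lemma bnum_append: "bnum (as @ bs) = bnum as * bnum bs"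
  and bden_append: "bden (as @ bs) = bden as * bden bs"
  by (simp_all add: bnum_def bden_def)

lemma bnum_replicate: "bnum (replicate n a) = [:- a, 1:] ^ n"
  and bden_replicate: "bden (replicate n a) = [:1, - cnj a:] ^ n"
  by (induction n) auto

lemma one_minus_cnj_mult_nonzero:
  assumes "norm a < 1" "norm z \<le> 1"
  shows "1 - z * cnj a \<noteq> 0"
proof
  assume "1 - z * cnj a = 0"
  then have "norm (z * cnj a) = 1" by (metis eq_iff_diff_eq_0 norm_one)
  moreover have "norm z * norm a \<le> 1 * norm a" using assms by (intro mult_right_mono) auto
  ultimately show False using assms by (simp add: norm_mult)
qed

lemma poly_bden_nonzero:
  assumes "set as \<subseteq> ball 0 1" "norm z \<le> 1"
  shows "poly (bden as) z \<noteq> 0"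
  using assms(1) by (induction as) (use assms(2) one_minus_cnj_mult_nonzero[OF _ assms(2)] in auto)

lemma degree_bnum: "degree (bnum as) = length as" "lead_coeff (bnum as) = 1" "bnum as \<noteq> 0"
proof -
  have *: "lead_coeff (bnum as) = 1 \<and> degree (bnum as) = length as \<and> bnum as \<noteq> 0"
  proof (induction as)
    case (Cons a as)
    have "lead_coeff (bnum (a # as)) = 1"
    proof -
      have "lead_coeff [:- a, 1:] = 1" by simp
      moreover have "lead_coeff (bnum as) = 1" by (rule conjunct1[OF Cons.IH])
      ultimately show ?thesis unfolding bnum_simps lead_coeff_mult by (metis mult_1)
    qed
    moreover have "degree (bnum (a # as)) = length (a # as)"
      unfolding bnum_simps using Cons by (subst degree_mult_eq) auto
    ultimately show ?case by fastforce
  qed simp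
  show "degree (bnum as) = length as" "lead_coeff (bnum as) = 1" "bnum as \<noteq> 0" using * by auto
qed

text \<open>The degree drops below the length for every zero placed at the origin, hence an
  inequality together with the coefficient at the formal degree.\<close>

lemma bden_degree: "degree (bden as) \<le> length as"
  "coeff (bden as) (length as) = (\<Prod>a\<leftarrow>as. - cnj a)"
proof -
  have *: "degree (bden as) \<le> length as \<and> coeff (bden as) (length as) = (\<Prod>a\<leftarrow>as. - cnj a)"
  proof (induction as)
    case (Cons a as)
    have "degree (bden (a # as)) \<le> degree [:1, - cnj a:] + degree (bden as)"
      unfolding bden_simps by (rule degree_mult_le)
    also have "\<dots> \<le> Suc (length as)" using Cons by auto
    finally have "degree (bden (a # as)) \<le> length (a # as)" by simp
    moreover have "coeff (bden as) (Suc (length as)) = 0" using Cons by (intro coeff_eq_0) auto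
    ultimately show ?case using Cons by simp
  qed simp
  show "degree (bden as) \<le> length as" "coeff (bden as) (length as) = (\<Prod>a\<leftarrow>as. - cnj a)" using * by auto
qed

lemma norm_prod_list_less_one:
  assumes "set as \<subseteq> ball 0 1" "as \<noteq> []"
  shows "norm (\<Prod>a\<leftarrow>as. - cnj a) < 1"
  using assms
proof (induction as)
  case (Cons a as)
  show ?case
  proof (cases "as = []")
    case False
    then have "norm (\<Prod>a\<leftarrow>as. - cnj a) < 1" "norm a < 1" using Cons by auto
    then have "norm a * norm (\<Prod>a\<leftarrow>as. - cnj a) < 1 * 1" by (intro mult_strict_mono') auto
    then show ?thesis by (simp add: norm_mult)
  qed (use Cons in auto)
qed simp

text \<open>The sign of the right-hand side tells on which side of the circle a Blaschke factor
  takes its values.\<close>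

lemma blaschke_factor_norm_identity:
  "(norm (1 - z * cnj a))\<^sup>2 - (norm (z - a))\<^sup>2 = (1 - (norm a)\<^sup>2) * (1 - (norm z)\<^sup>2)"
  unfolding cmod_power2 by (simp add: power2_eq_square algebra_simps)

lemma norm_bnum_bden:
  assumes "set as \<subseteq> ball 0 1"
  shows "norm z = 1 \<Longrightarrow> norm (poly (bnum as) z) = norm (poly (bden as) z)"
    and "norm z < 1 \<Longrightarrow> as \<noteq> [] \<Longrightarrow> norm (poly (bnum as) z) < norm (poly (bden as) z)"
    and "norm z > 1 \<Longrightarrow> as \<noteq> [] \<Longrightarrow> norm (poly (bnum as) z) > norm (poly (bden as) z)"
proof -
  have fac: "(norm z = 1 \<longrightarrow> norm (z - a) = norm (1 - z * cnj a)) \<and>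
      (norm z < 1 \<longrightarrow> norm (z - a) < norm (1 - z * cnj a)) \<and>
      (norm z > 1 \<longrightarrow> norm (z - a) > norm (1 - z * cnj a))" if "norm a < 1" for a
  proof -
    have a: "1 - (norm a)\<^sup>2 > 0" using that by (simp add: abs_square_less_1)
    note id = blaschke_factor_norm_identity[of z a]
    have "norm z = 1 \<Longrightarrow> (norm (z - a))\<^sup>2 = (norm (1 - z * cnj a))\<^sup>2" using id by simp
    moreover have "norm z < 1 \<Longrightarrow> (norm (z - a))\<^sup>2 < (norm (1 - z * cnj a))\<^sup>2"
    proof -
      assume "norm z < 1"
      then have "1 - (norm z)\<^sup>2 > 0" by (simp add: abs_square_less_1)
      then show ?thesis using id a by (smt (verit) mult_pos_pos)
    qed
    moreover have "norm z > 1 \<Longrightarrow> (norm (z - a))\<^sup>2 > (norm (1 - z * cnj a))\<^sup>2"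
    proof -
      assume "norm z > 1"
      then have "1 - (norm z)\<^sup>2 < 0" by (simp add: power2_eq_square less_1_mult)
      then show ?thesis using id a by (smt (verit) mult_pos_neg)
    qed
    ultimately show ?thesis by (auto intro: power2_eq_imp_eq power2_less_imp_less)
  qed
  show "norm z = 1 \<Longrightarrow> norm (poly (bnum as) z) = norm (poly (bden as) z)"
    using assms
  proof (induction as)
    case (Cons a as)
    have "norm (z - a) * norm (poly (bnum as) z) = norm (1 - z * cnj a) * norm (poly (bden as) z)"
      using Cons fac[of a] by auto
    then show ?case by (simp add: norm_mult[symmetric] algebra_simps)
  qed simp
  show "norm (poly (bnum as) z) < norm (poly (bden as) z)" if "norm z < 1" "as \<noteq> []"
    using that(2) assms
  proof (induction as)
    case (Cons a as)
    have f: "norm (z - a) < norm (1 - z * cnj a)" using fac[of a] Cons.prems that by auto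
    have "norm (poly (bnum as) z) \<le> norm (poly (bden as) z)"
      using Cons by (cases "as = []") auto
    moreover have "norm (poly (bden as) z) > 0" using poly_bden_nonzero[of as z] Cons.prems that by auto
    ultimately have "norm (z - a) * norm (poly (bnum as) z) < norm (1 - z * cnj a) * norm (poly (bden as) z)"
      using f by (metis mult_left_mono mult_strict_right_mono norm_ge_zero order_le_less_trans)
    then show ?case by (simp add: norm_mult[symmetric] algebra_simps)
  qed simp
  show "norm (poly (bnum as) z) > norm (poly (bden as) z)" if "norm z > 1" "as \<noteq> []"
    using that(2) assms
  proof (induction as)
    case (Cons a as)
    have f: "norm (z - a) > norm (1 - z * cnj a)" using fac[of a] Cons.prems that by auto
    have "norm (poly (bnum as) z) \<ge> norm (poly (bden as) z)"
      using Cons by (cases "as = []") auto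
    moreover have "norm (poly (bnum as) z) > 0"
    proof -
      have "poly (bnum as) z \<noteq> 0" using Cons.prems(2) by (induction as) (use that in auto)
      then show ?thesis by simp
    qed
    ultimately have "norm (1 - z * cnj a) * norm (poly (bden as) z) < norm (z - a) * norm (poly (bnum as) z)"
      using f by (metis mult_left_mono mult_strict_right_mono norm_ge_zero order_le_less_trans)
    then show ?case by (simp add: norm_mult[symmetric] algebra_simps)
  qed simp
qed

text \<open>On the circle the logarithmic derivative of a Blaschke product is positive
  (in the direction of \<open>z\<close>), which makes all fibres over the circle simple.\<close>

lemma bnum_bden_wronskian:
  assumes "set as \<subseteq> ball 0 1" "norm z = 1"
  shows "\<exists>s\<ge>0. (as \<noteq> [] \<longrightarrow> s > 0) \<and>
     z * (poly (pderiv (bnum as)) z * poly (bden as) z - poly (bnum as) z * poly (pderiv (bden as)) z)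
       = poly (bnum as) z * poly (bden as) z * of_real s"
  using assms(1)
proof (induction as)
  case (Cons a as)
  then obtain s where s: "s \<ge> 0"
    "z * (poly (pderiv (bnum as)) z * poly (bden as) z - poly (bnum as) z * poly (pderiv (bden as)) z)
       = poly (bnum as) z * poly (bden as) z * of_real s" by auto
  define N D N' D' where "N = poly (bnum as) z" and "D = poly (bden as) z"
    and "N' = poly (pderiv (bnum as)) z" and "D' = poly (pderiv (bden as)) z"
  have eq: "z * (N' * D - N * D') = N * D * of_real s" using s by (simp add: N_def D_def N'_def D'_def)
  have na: "norm a < 1" using Cons by auto
  then have za: "z \<noteq> a" using assms(2) by auto
  define q where "q = (norm (z - a))\<^sup>2"
  have q: "q > 0" using za by (simp add: q_def)
  have zz: "z * cnj z = 1" using assms(2) by (metis complex_norm_square of_real_1 power_one)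
  have qq: "of_real q = (z - a) * cnj (z - a)" unfolding q_def by (rule complex_norm_square)
  have f: "1 - z * cnj a = z * cnj (z - a)" using zz by (simp add: algebra_simps)
  have k: "(z - a) * (1 - z * cnj a) = z * of_real q" unfolding f qq by (simp add: algebra_simps)
  \<comment> \<open>The Poisson kernel of \<open>a\<close> at \<open>z\<close>: the contribution of
    the factor with zero \<open>a\<close> to the logarithmic derivative in the direction of
    \<open>z\<close>.\<close>
  define t where "t = (1 - (norm a)\<^sup>2) / q"
  have t: "t > 0" using na q by (simp add: t_def abs_square_less_1)
  have tq: "of_real t * of_real q = (1 - a * cnj a :: complex)"
  proof -
    have "t * q = 1 - (norm a)\<^sup>2" using q by (simp add: t_def)
    then have "of_real t * of_real q = (of_real (1 - (norm a)\<^sup>2) :: complex)" by (metis of_real_mult)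
    then show ?thesis by (simp only: of_real_diff of_real_1 complex_norm_square)
  qed
  have "z * ((N + (z - a) * N') * ((1 - z * cnj a) * D) - (z - a) * N * (- cnj a * D + (1 - z * cnj a) * D'))
     = N * D * (z * (1 - a * cnj a)) + (z - a) * (1 - z * cnj a) * (z * (N' * D - N * D'))"
    by (simp add: algebra_simps)
  also have "\<dots> = N * D * (z * (of_real t * of_real q)) + (z - a) * (1 - z * cnj a) * (N * D * of_real s)"
    unfolding eq tq ..
  also have "\<dots> = (z - a) * N * ((1 - z * cnj a) * D) * of_real (s + t)"
  proof -
    have "(z - a) * N * ((1 - z * cnj a) * D) * of_real (s + t) =
        N * D * ((z - a) * (1 - z * cnj a)) * (of_real s + of_real t)" by (simp add: mult_ac)
    then show ?thesis unfolding k by (simp add: algebra_simps)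
  qed
  finally have fin: "z * ((N + (z - a) * N') * ((1 - z * cnj a) * D) - (z - a) * N * (- cnj a * D + (1 - z * cnj a) * D'))
     = (z - a) * N * ((1 - z * cnj a) * D) * of_real (s + t)" .
  have e: "poly (bnum (a # as)) z = (z - a) * N" "poly (bden (a # as)) z = (1 - z * cnj a) * D"
    by (simp_all add: N_def D_def algebra_simps)
  have e': "poly (pderiv (bnum (a # as))) z = N + (z - a) * N'"
    "poly (pderiv (bden (a # as))) z = - cnj a * D + (1 - z * cnj a) * D'"
    unfolding bnum_simps bden_simps pderiv_mult
    by (simp_all add: pderiv_pCons N_def D_def N'_def D'_def algebra_simps del: mult_pCons_left mult_pCons_right)
  show ?case unfolding e e' using s(1) t fin by (intro exI[of _ "s + t"]) simp
qed auto

lemma coprime_complex_polyI: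
  fixes p q :: "complex poly"
  assumes "\<And>z. poly p z = 0 \<Longrightarrow> poly q z \<noteq> 0" "q \<noteq> 0"
  shows "coprime p q"
proof (rule coprimeI)
  fix d assume d: "d dvd p" "d dvd q"
  then have "d \<noteq> 0" using assms(2) by auto
  have "degree d = 0"
  proof (rule ccontr)
    assume "degree d \<noteq> 0"
    then obtain z where "poly d z = 0" using alg_closed_imp_poly_has_root[of d] by auto
    then show False using d assms(1)[of z] by (metis dvd_trans poly_eq_0_iff_dvd)
  qed
  then show "is_unit d" using \<open>d \<noteq> 0\<close> by (simp add: is_unit_iff_degree)
qed

abbreviation (input) blaschke_fun :: "complex \<Rightarrow> complex list \<Rightarrow> csphere \<Rightarrow> csphere" where
  "blaschke_fun c as \<equiv> rat_fun (smult c (bnum as)) (bden as)"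

lemma bnum_bden_coprime:
  assumes "norm c = 1" "set as \<subseteq> ball 0 1"
  shows "coprime (smult c (bnum as)) (bden as)" "bden as \<noteq> 0"
proof -
  show "bden as \<noteq> 0" using poly_bden_nonzero[OF assms(2), of 0] by auto
  then show "coprime (smult c (bnum as)) (bden as)"
  proof (intro coprime_complex_polyI)
    fix z assume z: "poly (smult c (bnum as)) z = 0"
    then have "poly (bnum as) z = 0" using assms(1) by auto
    then have "z \<in> set as" by (induction as) auto
    then show "poly (bden as) z \<noteq> 0" using assms(2) by (intro poly_bden_nonzero) auto
  qed
qed

lemma blaschke_fun_rational:
  assumes "norm c = 1" "set as \<subseteq> ball 0 1"
  shows "rational_map (blaschke_fun c as)" "rat_degree (blaschke_fun c as) = length as"
proof -
  show "rational_map (blaschke_fun c as)" unfolding rational_map_def using bnum_bden_coprime[OF assms] by blast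
  have "c \<noteq> 0" using assms(1) by auto
  then show "rat_degree (blaschke_fun c as) = length as"
    unfolding rat_degree_rat_fun[OF bnum_bden_coprime[OF assms]] using degree_bnum bden_degree[of as] by (simp add: max_def)
qed

lemma blaschke_fun_unit_circle:
  assumes "norm c = 1" "set as \<subseteq> ball 0 1" "as \<noteq> []"
  shows "p \<in> unit_disc \<Longrightarrow> blaschke_fun c as p \<in> unit_disc"
    and "p \<in> unit_circle \<Longrightarrow> blaschke_fun c as p \<in> unit_circle"
    and "p \<in> exterior_disc \<Longrightarrow> blaschke_fun c as p \<in> exterior_disc"
proof -
  note nb = norm_bnum_bden[OF assms(2)]
  show "blaschke_fun c as p \<in> unit_disc" if "p \<in> unit_disc"
  proof (cases p)
    case (Some z)
    then have z: "p = Some z" "norm z < 1" using that by auto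
    then show ?thesis using nb(2)[of z] assms poly_bden_nonzero[OF assms(2), of z]
      by (auto simp: rat_fun_def norm_divide norm_mult)
  qed (use that in auto)
  show "blaschke_fun c as p \<in> unit_circle" if "p \<in> unit_circle"
  proof (cases p)
    case (Some z)
    then have z: "p = Some z" "norm z = 1" using that by auto
    then show ?thesis using nb(1)[of z] assms poly_bden_nonzero[OF assms(2), of z]
      by (auto simp: rat_fun_def norm_divide norm_mult)
  qed (use that in auto)
  show "blaschke_fun c as p \<in> exterior_disc" if p: "p \<in> exterior_disc"
  proof (cases p)
    case (Some z)
    then show ?thesis using nb(3)[of z] assms p
      by (auto simp: rat_fun_def norm_divide norm_mult)
  next
    case None
    have c0: "c \<noteq> 0" using assms(1) by auto
    show ?thesis
    proof (cases "degree (bden as) < length as")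
      case True
      then show ?thesis using None c0 by (simp add: rat_fun_def degree_bnum)
    next
      case False
      then have d: "degree (bden as) = length as" using bden_degree[of as] by simp
      have l: "lead_coeff (bden as) = (\<Prod>a\<leftarrow>as. - cnj a)" using bden_degree(2)[of as] d by simp
      have "lead_coeff (bden as) \<noteq> 0" using bnum_bden_coprime(2)[OF assms(1,2)] by simp
      then have "norm (lead_coeff (bden as)) > 0" "norm (lead_coeff (bden as)) < 1"
        using norm_prod_list_less_one[OF assms(2,3)] unfolding l by auto
      moreover have "coeff (bnum as) (degree (bden as)) = 1" using degree_bnum(1,2)[of as] d by simp
      ultimately show ?thesis using None c0 d assms(1)
        by (simp add: rat_fun_def degree_bnum norm_divide)
    qed
  qed
qed

text \<open>The coefficient at the formal degree is \<open>c\<close> minus \<open>w\<close> times a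
  product of modulus below 1. It cannot vanish for \<open>norm w \<le> 1\<close>, so the fibre
  polynomial has full degree.\<close>

lemma blaschke_fun_fibre:
  assumes "norm c = 1" "set as \<subseteq> ball 0 1" "as \<noteq> []" "norm w \<le> 1"
  defines "R \<equiv> smult c (bnum as) - smult w (bden as)"
  shows "degree R = length as" "R \<noteq> 0"
    and "{z. blaschke_fun c as (Some z) = Some w} = {z. poly R z = 0}"
proof -
  have "norm w * norm (\<Prod>a\<leftarrow>as. - cnj a) \<le> 1 * norm (\<Prod>a\<leftarrow>as. - cnj a)"
    using assms(4) by (intro mult_right_mono) auto
  then have lt: "norm (w * (\<Prod>a\<leftarrow>as. - cnj a)) < 1"
    using norm_prod_list_less_one[OF assms(2,3)] by (simp add: norm_mult)
  have "coeff R (length as) = c - w * (\<Prod>a\<leftarrow>as. - cnj a)"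
    using degree_bnum[of as] by (simp add: R_def bden_degree)
  then have nz: "coeff R (length as) \<noteq> 0" using lt assms(1) by auto
  moreover have "degree R \<le> length as" unfolding R_def
    using degree_bnum[of as] bden_degree[of as]
    by (intro degree_diff_le) (auto intro: order_trans[OF degree_smult_le])
  ultimately show "degree R = length as" using le_degree by (metis antisym)
  show "R \<noteq> 0" using nz by auto
  have "poly (bden as) z \<noteq> 0" if "poly R z = 0" for z
  proof
    assume "poly (bden as) z = 0"
    moreover from this have "poly (smult c (bnum as)) z = 0" using that by (simp add: R_def)
    ultimately show False using bnum_bden_coprime[OF assms(1,2)] coprime_poly_0 by blast
  qed
  then show "{z. blaschke_fun c as (Some z) = Some w} = {z. poly R z = 0}"
    by (auto simp: rat_fun_def R_def field_simps)
qed

text \<open>Properness is inherited from the sphere, where continuous maps are proper, because the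
  disc is its own full preimage. Surjectivity comes from a root of the fibre polynomial, which must
  lie in the disc since circle and exterior are preserved.\<close>

lemma blaschke_fun_is_blaschke:
  assumes "norm c = 1" "set as \<subseteq> ball 0 1" "as \<noteq> []"
  shows "blaschke_product (blaschke_fun c as)"
  unfolding blaschke_product_def
proof (intro conjI)
  let ?B = "blaschke_fun c as"
  show "rational_map ?B" "1 \<le> rat_degree ?B"
    using blaschke_fun_rational[OF assms(1,2)] assms(3) by (auto simp: Suc_le_eq)
  have pre: "{x \<in> topspace riemann_sphere. ?B x \<in> unit_disc} = unit_disc"
    using blaschke_fun_unit_circle[OF assms] sphere_trichotomy sphere_disjoint by fastforce
  have "continuous_map riemann_sphere riemann_sphere ?B"
    by (intro sphere_holomorphic_imp_continuous_map rational_map_holomorphic_at) fact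
  then have "proper_map riemann_sphere riemann_sphere ?B"
    by (intro continuous_imp_proper_map compact_riemann_sphere Hausdorff_imp_kc_space Hausdorff_sphere)
  then show "proper_map (sphere_subspace unit_disc) (sphere_subspace unit_disc) ?B"
    using pre by (rule proper_map_restriction)
  show "?B ` unit_disc = unit_disc"
  proof (intro equalityI subsetI)
    fix q assume "q \<in> unit_disc"
    then obtain w where w: "q = Some w" "norm w < 1" by (auto simp: unit_disc_def)
    note R = blaschke_fun_fibre[OF assms, of w]
    have "\<exists>z. poly (smult c (bnum as) - smult w (bden as)) z = 0"
      using R(1) w(2) assms(3) by (intro alg_closed_imp_poly_has_root) auto
    then obtain z where z: "?B (Some z) = Some w" using R(3) w(2) by auto
    have "Some z \<in> unit_disc"
      using blaschke_fun_unit_circle[OF assms, of "Some z"] sphere_trichotomy[of "Some z"]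
        sphere_disjoint[of q] z w by auto
    then show "q \<in> ?B ` unit_disc" using z w by (metis image_eqI)
  qed (use blaschke_fun_unit_circle[OF assms] in auto)
qed

text \<open>At a double root of the fibre polynomial the Wronskian of numerator and denominator
  would vanish, against \<open>bnum_bden_wronskian\<close>. So the roots are simple, and their
  number is the degree.\<close>

lemma blaschke_fun_card_fibre:
  assumes "norm c = 1" "set as \<subseteq> ball 0 1" "as \<noteq> []" "norm w = 1"
  shows "finite {z. norm z = 1 \<and> blaschke_fun c as (Some z) = Some w}"
    and "card {z. norm z = 1 \<and> blaschke_fun c as (Some z) = Some w} = length as"
proof -
  define R where "R = smult c (bnum as) - smult w (bden as)"
  note R = blaschke_fun_fibre[OF assms(1-3), of w, folded R_def]
  have eq: "{z. norm z = 1 \<and> blaschke_fun c as (Some z) = Some w} = {z. poly R z = 0}"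
  proof -
    have "norm z = 1" if "blaschke_fun c as (Some z) = Some w" for z
      using blaschke_fun_unit_circle[OF assms(1-3), of "Some z"] sphere_trichotomy[of "Some z"]
        sphere_disjoint[of "Some w"] that assms(4) by auto
    then show ?thesis using R(3) assms(4) by auto
  qed
  have "rsquarefree R" unfolding rsquarefree_roots
  proof (intro allI notI)
    fix z assume z: "poly R z = 0 \<and> poly (pderiv R) z = 0"
    then have nz: "norm z = 1" using eq by auto
    define N D N' D' where "N = poly (bnum as) z" and "D = poly (bden as) z"
      and "N' = poly (pderiv (bnum as)) z" and "D' = poly (pderiv (bden as)) z"
    obtain s where s: "s > 0" "z * (N' * D - N * D') = N * D * of_real s"
      using bnum_bden_wronskian[OF assms(2) nz] assms(3) unfolding N_def D_def N'_def D'_def by auto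
    have e: "c * N = w * D" "c * N' = w * D'"
      using z by (simp_all add: R_def N_def D_def N'_def D'_def pderiv_diff pderiv_smult)
    have D: "D \<noteq> 0" unfolding D_def using poly_bden_nonzero[OF assms(2)] nz by simp
    have "norm N = norm D" unfolding N_def D_def using norm_bnum_bden(1)[OF assms(2) nz] .
    then have N: "N \<noteq> 0" using D by auto
    have "c * (N' * D - N * D') = 0" using e by (simp add: algebra_simps)
    then have "N' * D - N * D' = 0" using assms(1) by auto
    then show False using s N D by auto
  qed
  then have "smult (lead_coeff R) (\<Prod>z|poly R z = 0. [:-z, 1:]) = R"
    by (rule complex_poly_decompose_rsquarefree)
  moreover have "degree (\<Prod>z|poly R z = 0. [:-z, 1:]) = card {z. poly R z = 0}"
    by (subst degree_prod_sum_eq) auto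
  ultimately have "degree R = card {z. poly R z = 0}"
    using R(2) assms(4) by (metis degree_smult_eq leading_coeff_0_iff order_refl)
  then show "card {z. norm z = 1 \<and> blaschke_fun c as (Some z) = Some w} = length as"
    using R(1) assms(4) eq by simp
  show "finite {z. norm z = 1 \<and> blaschke_fun c as (Some z) = Some w}"
    unfolding eq using R(2) assms(4) by (simp add: poly_roots_finite)
qed

text \<open>The zeros form a compact subset of the open disc, hence a finite set. Dividing by the
  Blaschke factor of one zero, to the full order, removes that zero and keeps the boundary values
  unimodular; without zeros the function is constant. Constant functions are treated apart, as
  splitting off a zero requires nonconstancy.\<close>

lemma unimodular_boundary_imp_blaschke:
  assumes "continuous_on (cball 0 1) f" "f holomorphic_on ball 0 1" "\<And>z. norm z = 1 \<Longrightarrow> norm (f z) = 1"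
  shows "\<exists>c as. norm c = 1 \<and> set as \<subseteq> ball 0 1 \<and> (\<forall>z\<in>cball 0 1. f z = c * poly (bnum as) z / poly (bden as) z)"
proof (cases "f constant_on ball 0 1")
  case True
  then obtain c where c: "\<And>z. z \<in> ball 0 1 \<Longrightarrow> f z = c" unfolding constant_on_def by blast
  have "f z = c" if "z \<in> cball 0 1" for z
  proof -
    have "z \<in> closure (ball 0 1)" using that by simp
    then show ?thesis
      by (rule continuous_constant_on_closure[of "ball 0 1" f c z, rotated 2]) (use assms(1) c in auto)
  qed
  moreover have "norm c = 1" using assms(3)[of 1] calculation[of 1] by simp
  ultimately show ?thesis by (intro exI[of _ c] exI[of _ "[]"]) auto
next
  case False
  define Z where "Z = {z \<in> ball 0 1. f z = 0}"
  have "{z \<in> cball 0 1. f z = 0} = Z"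
    using assms(3) by (auto simp: Z_def) (metis less_eq_real_def norm_zero zero_neq_one)
  have "closed {z \<in> cball 0 1. f z = 0}"
    using continuous_closed_preimage_constant[OF assms(1), of 0] by simp
  then have "compact {z \<in> cball 0 1. f z = 0}"
    by (metis (no_types, lifting) bounded_cball bounded_subset compact_eq_bounded_closed mem_Collect_eq subsetI)
  then have "compact Z" using \<open>_ = Z\<close> by simp
  then have "finite {z \<in> Z. f z = 0}"
    by (intro holomorphic_compact_finite_zeros[OF assms(2) _ _ _ _ False]) (auto simp: Z_def)
  then have finZ: "finite Z" by (simp add: Z_def)
  show ?thesis
    using finZ Z_def assms False
  proof (induction Z arbitrary: f rule: finite_induct)
    case empty
    have "\<exists>c. norm c = 1 \<and> (\<forall>z\<in>ball 0 1. f z = c)"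
    proof (rule unimodular_boundary_imp_constant)
      fix \<epsilon> :: real assume \<epsilon>: "\<epsilon> > 0"
      have "uniformly_continuous_on (cball 0 1) f" using empty by (intro compact_uniformly_continuous) auto
      then obtain d where d: "d > 0" "\<And>x y. x \<in> cball 0 1 \<Longrightarrow> y \<in> cball 0 1 \<Longrightarrow> dist y x < d \<Longrightarrow> dist (f y) (f x) < \<epsilon>"
        using \<epsilon> unfolding uniformly_continuous_on_def by metis
      show "\<exists>s<1. \<forall>z\<in>ball 0 1. s < norm z \<longrightarrow> \<bar>norm (f z) - 1\<bar> < \<epsilon>"
      proof (intro exI[of _ "max 0 (1 - d)"] conjI ballI impI)
        fix z :: complex assume z: "z \<in> ball 0 1" "max 0 (1 - d) < norm z"
        define x where "x = sgn z"
        have z0: "z \<noteq> 0" using z by auto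
        have nx: "norm x = 1" using z0 by (simp add: x_def norm_sgn)
        have "z - x = of_real (norm z - 1) * x" using z0 by (simp add: x_def sgn_eq field_simps)
        then have "norm (z - x) = \<bar>norm z - 1\<bar> * norm x" by (metis norm_mult norm_of_real)
        then have "dist z x < d" using z nx by (auto simp: dist_norm)
        then have "dist (f z) (f x) < \<epsilon>" using d(2)[of x z] z nx by auto
        then show "\<bar>norm (f z) - 1\<bar> < \<epsilon>" using empty(4)[OF nx]
          by (smt (verit) dist_norm norm_triangle_ineq3)
      qed (use d in auto)
    qed (use empty in auto)
    then have "f constant_on ball 0 1" unfolding constant_on_def by auto
    then show ?case using empty by blast
  next
    case (insert a Z)
    have a: "norm a < 1" "f a = 0" using insert.prems(1) by auto
    have ai: "a \<in> ball 0 1" using a by simp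
    obtain g r n where g: "0 < n" "0 < r" "ball a r \<subseteq> ball 0 1" "g holomorphic_on ball a r"
      "\<And>w. w \<in> ball a r \<Longrightarrow> f w = (w - a) ^ n * g w" "\<And>w. w \<in> ball a r \<Longrightarrow> g w \<noteq> 0"
      by (rule holomorphic_factor_zero_nonconstant[OF insert.prems(3) open_ball connected_ball ai a(2) insert.prems(5)])
         (rule that, assumption+)
    \<comment> \<open>The value at \<open>a\<close> is the limit of the quotient, by the
      factorization \<open>f w = (w - a) ^ n * g w\<close>.\<close>
    define f1 where "f1 z = (if z = a then g a * (1 - a * cnj a) ^ n else f z * ((1 - z * cnj a) / (z - a)) ^ n)" for z
    have f1g: "f1 z = g z * (1 - z * cnj a) ^ n" if "z \<in> ball a r" for z
      using g(5)[OF that] by (auto simp: f1_def power_divide)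
    have ff1: "f z = f1 z * ((z - a) / (1 - z * cnj a)) ^ n" if "z \<in> cball 0 1" for z
      using one_minus_cnj_mult_nonzero[OF a(1), of z] that a(2) g(1)
      by (auto simp: f1_def power_divide power_0_left)
    have h1: "f1 holomorphic_on ball a r"
      by (rule holomorphic_transform[of "\<lambda>z. g z * (1 - z * cnj a) ^ n"]) (use g f1g in \<open>auto intro!: holomorphic_intros\<close>)
    have h2: "f1 holomorphic_on ball 0 1 - {a}"
      by (rule holomorphic_transform[of "\<lambda>z. f z * ((1 - z * cnj a) / (z - a)) ^ n"])
         (use insert.prems(3) in \<open>auto simp: f1_def intro!: holomorphic_intros intro: holomorphic_on_subset\<close>)
    have "f1 holomorphic_on (ball 0 1 - {a}) \<union> ball a r"
      by (rule holomorphic_on_Un[OF h2 h1]) auto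
    moreover have "ball 0 1 \<subseteq> (ball 0 1 - {a}) \<union> ball a r" using g by auto
    ultimately have h: "f1 holomorphic_on ball 0 1" by (rule holomorphic_on_subset)
    have c1: "continuous_on (cball 0 1 - {a}) f1"
    proof (rule continuous_on_eq[of _ "\<lambda>z. f z * ((1 - z * cnj a) / (z - a)) ^ n"])
      show "continuous_on (cball 0 1 - {a}) (\<lambda>z. f z * ((1 - z * cnj a) / (z - a)) ^ n)"
        by (intro continuous_intros continuous_on_subset[OF insert.prems(2)]) auto
    qed (auto simp: f1_def)
    have cont: "continuous_on (cball 0 1) f1"
    proof (rule continuous_on_eq_continuous_within[THEN iffD2], rule ballI)
      fix z :: complex assume z: "z \<in> cball 0 1"
      show "continuous (at z within cball 0 1) f1"
      proof (cases "z = a")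
        case True
        have "isCont f1 a" using holomorphic_on_imp_continuous_on[OF h] ai
          by (simp add: continuous_on_eq_continuous_at)
        then show ?thesis using True continuous_at_imp_continuous_within by blast
      next
        case False
        then have "continuous (at z within (cball 0 1 - {a})) f1"
          using c1 z continuous_on_eq_continuous_within by blast
        moreover have "at z within (cball 0 1 - {a}) = at z within cball 0 1"
          by (rule at_within_nhd[of z "- {a}"]) (use False in auto)
        ultimately show ?thesis by simp
      qed
    qed
    have n1: "norm (f1 z) = 1" if z: "norm z = 1" for z
    proof -
      have za: "z \<noteq> a" using z a by auto
      have "norm (1 - z * cnj a) = norm (z - a)"
        using norm_bnum_bden(1)[of "[a]" z] z a by (simp add: algebra_simps)
      then show ?thesis using insert.prems(4)[OF z] za by (simp add: f1_def norm_mult norm_power norm_divide)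
    qed
    have f1a: "f1 a \<noteq> 0" using g one_minus_cnj_mult_nonzero[OF a(1), of a] a by (simp add: f1_def)
    have Z: "Z = {z \<in> ball 0 1. f1 z = 0}"
    proof -
      have "f1 z = 0 \<longleftrightarrow> f z = 0 \<and> z \<noteq> a" if "z \<in> ball 0 1" for z
        using f1a one_minus_cnj_mult_nonzero[OF a(1), of z] that by (auto simp: f1_def)
      then show ?thesis using insert.prems(1) insert.hyps(2) by auto
    qed
    have "\<exists>c as. norm c = 1 \<and> set as \<subseteq> ball 0 1 \<and> (\<forall>z\<in>cball 0 1. f1 z = c * poly (bnum as) z / poly (bden as) z)"
    proof (cases "f1 constant_on ball 0 1")
      case True
      then obtain c where c: "\<And>z. z \<in> ball 0 1 \<Longrightarrow> f1 z = c" unfolding constant_on_def by blast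
      have "f1 z = c" if "z \<in> cball 0 1" for z
      proof -
        have "z \<in> closure (ball 0 1)" using that by simp
        then show ?thesis
          by (rule continuous_constant_on_closure[of "ball 0 1" f1 c z, rotated 2]) (use cont c in auto)
      qed
      moreover have "norm c = 1" using n1[of 1] calculation[of 1] by simp
      ultimately show ?thesis by (intro exI[of _ c] exI[of _ "[]"]) auto
    next
      case False
      show ?thesis by (rule insert.IH[OF Z cont h n1 False])
    qed
    then obtain c as where cas: "norm c = 1" "set as \<subseteq> ball 0 1"
      "\<And>z. z \<in> cball 0 1 \<Longrightarrow> f1 z = c * poly (bnum as) z / poly (bden as) z" by blast
    show ?case
      by (rule exI[of _ c], rule exI[of _ "replicate n a @ as"])
         (use cas a ff1 in \<open>auto simp: bnum_append bden_append bnum_replicate bden_replicate poly_power power_divide mult_ac\<close>)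
  qed
qed

section \<open>Blaschke products among rational maps\<close>

lemma open_finite_values:
  assumes "rational_map f"
  shows "open {z. f (Some z) \<noteq> None}" "(\<lambda>z. the (f (Some z))) holomorphic_on {z. f (Some z) \<noteq> None}"
proof -
  have f: "sphere_holomorphic_on f UNIV"
    using rational_map_holomorphic_at[OF assms] by (metis sphere_holomorphic_on_iff openin_topspace topspace_sphere)
  then have "(\<lambda>z. the (id (f (id (Some z))))) holomorphic_on {z. id (Some z) \<in> UNIV \<and> id (f (id (Some z))) \<noteq> None}"
    unfolding sphere_holomorphic_on_def by blast
  then show "(\<lambda>z. the (f (Some z))) holomorphic_on {z. f (Some z) \<noteq> None}" by (simp del: not_None_eq)
  have cont: "continuous_map riemann_sphere riemann_sphere f"
    by (intro sphere_holomorphic_imp_continuous_map rational_map_holomorphic_at) fact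
  have "openin riemann_sphere {x \<in> topspace riemann_sphere. f x \<in> Some ` UNIV}"
    by (rule openin_continuous_map_preimage[OF cont]) simp
  then have "open {z. Some z \<in> {x \<in> topspace riemann_sphere. f x \<in> Some ` UNIV}}"
    by (simp only: openin_sphere_iff)
  moreover have "{z. Some z \<in> {x \<in> topspace riemann_sphere. f x \<in> Some ` UNIV}} = {z. f (Some z) \<noteq> None}"
    by (auto simp: image_iff)
  ultimately show "open {z. f (Some z) \<noteq> None}" by simp
qed

lemma infinite_cball: "infinite (cball (0::complex) 1)"
  using finite_imp_not_open[of "ball (0::complex) 1"] by (metis ball_eq_empty ball_subset_cball finite_subset not_one_le_zero open_ball)

text \<open>On the closed disc the map is an explicit product by its boundary values; two rational
  maps that agree on this infinite set agree everywhere.\<close>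

lemma rational_imp_blaschke_fun:
  assumes f: "rational_map f" and D: "\<And>p. p \<in> unit_disc \<Longrightarrow> f p \<in> unit_disc"
    and T: "\<And>p. p \<in> unit_circle \<Longrightarrow> f p \<in> unit_circle"
  obtains c as where "norm c = 1" "set as \<subseteq> ball 0 1" "as \<noteq> []" "f = blaschke_fun c as"
proof -
  let ?g = "\<lambda>z. the (f (Some z))"
  have val: "f (Some z) = Some (?g z) \<and> (norm z < 1 \<longrightarrow> norm (?g z) < 1) \<and> (norm z = 1 \<longrightarrow> norm (?g z) = 1)"
    if "z \<in> cball 0 1" for z
    using D[of "Some z"] T[of "Some z"] that by (cases "norm z = 1"; cases "f (Some z)") auto
  have sub: "cball 0 1 \<subseteq> {z. f (Some z) \<noteq> None}" using val by (metis (mono_tags, lifting) mem_Collect_eq option.distinct(1) subsetI)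
  have hol: "?g holomorphic_on cball 0 1" using open_finite_values(2)[OF f] sub by (rule holomorphic_on_subset)
  have "\<exists>c as. norm c = 1 \<and> set as \<subseteq> ball 0 1 \<and> (\<forall>z\<in>cball 0 1. ?g z = c * poly (bnum as) z / poly (bden as) z)"
  proof (rule unimodular_boundary_imp_blaschke)
    show "continuous_on (cball 0 1) ?g" using hol by (rule holomorphic_on_imp_continuous_on)
    show "?g holomorphic_on ball 0 1" using hol by (rule holomorphic_on_subset) auto
  qed (use val in auto)
  then obtain c as where c: "norm c = 1" "set as \<subseteq> ball 0 1"
    "\<And>z. z \<in> cball 0 1 \<Longrightarrow> ?g z = c * poly (bnum as) z / poly (bden as) z" by blast
  have ne: "as \<noteq> []"
  proof
    assume "as = []"
    then show False using c(1) c(3)[of 0] val[of 0] by auto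
  qed
  have "f = blaschke_fun c as"
  proof (rule rational_map_eqI[OF f blaschke_fun_rational(1)[OF c(1,2)] infinite_cball])
    fix z assume z: "z \<in> cball (0::complex) 1"
    then have "poly (bden as) z \<noteq> 0" using poly_bden_nonzero[OF c(2)] by auto
    then show "f (Some z) = blaschke_fun c as (Some z)" using c(3)[OF z] val[OF z] by (auto simp: rat_fun_def)
  qed
  then show ?thesis using that c ne by blast
qed

lemma rational_imp_blaschke_product:
  assumes "rational_map f" "\<And>p. p \<in> unit_disc \<Longrightarrow> f p \<in> unit_disc" "\<And>p. p \<in> unit_circle \<Longrightarrow> f p \<in> unit_circle"
  shows "blaschke_product f"
  using rational_imp_blaschke_fun[OF assms] blaschke_fun_is_blaschke by metis

text \<open>Disc points near \<open>p\<close> keep \<open>B p\<close> out of the open exterior. If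
  \<open>B p\<close> were in the disc, properness would make the preimage of a compact disc around
  it compact inside the open disc, hence closed and away from \<open>p\<close>, although disc points
  close to \<open>p\<close> are mapped into it.\<close>

lemma blaschke_product_boundary:
  assumes B: "blaschke_product B" and p: "p \<in> unit_circle"
  shows "B p \<in> unit_circle"
proof -
  have rat: "rational_map B" and pm: "proper_map (sphere_subspace unit_disc) (sphere_subspace unit_disc) B"
    and im: "B ` unit_disc = unit_disc" using B by (auto simp: blaschke_product_def)
  have cont: "continuous_map riemann_sphere riemann_sphere B"
    by (intro sphere_holomorphic_imp_continuous_map rational_map_holomorphic_at rat)
  have near: "\<exists>q\<in>U. q \<in> unit_disc" if U: "openin riemann_sphere U" "p \<in> U" for U
  proof -
    obtain z where z: "p = Some z" "norm z = 1" using p by (auto simp: unit_circle_def)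
    have "open {w. Some w \<in> U}" using U(1) by (simp add: openin_sphere_iff)
    moreover have "z \<in> closure (ball 0 1)" using z by simp
    ultimately have "{w. Some w \<in> U} \<inter> ball 0 1 \<noteq> {}"
      using U(2) z(1) open_Int_closure_eq_empty by blast
    then show ?thesis by fastforce
  qed
  have pre: "openin riemann_sphere {q. B q \<in> V}" if "openin riemann_sphere V" for V
    using openin_continuous_map_preimage[OF cont that] by simp
  have "B p \<notin> exterior_disc"
  proof
    assume "B p \<in> exterior_disc"
    moreover have "openin riemann_sphere exterior_disc"
    proof -
      have "open {z. sphere_inversion (Some z) \<in> exterior_disc}"
        unfolding sphere_inversion_exterior_disc_iff by (simp add: open_Collect_less continuous_intros)
      moreover have "open {z. Some z \<in> exterior_disc}" by (simp add: open_Collect_less continuous_intros)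
      ultimately show ?thesis by (simp add: openin_sphere_iff)
    qed
    ultimately obtain q where "B q \<in> exterior_disc" "q \<in> unit_disc" using near[OF pre] by auto
    then show False using im sphere_disjoint by blast
  qed
  moreover have "B p \<notin> unit_disc"
  proof
    assume "B p \<in> unit_disc"
    then obtain w where w: "B p = Some w" "norm w < 1" by (auto simp: unit_disc_def)
    obtain \<rho> where \<rho>: "norm w < \<rho>" "\<rho> < 1" using dense w(2) by blast
    define K where "K = Some ` cball (0::complex) \<rho>"
    have "compactin riemann_sphere K" unfolding K_def
      by (rule image_compactin[OF _ continuous_map_Some]) simp
    moreover have KD: "K \<subseteq> unit_disc" using \<rho> by (auto simp: K_def)
    ultimately have "compactin (sphere_subspace unit_disc) K" by (simp add: compactin_subtopology)
    from compactin_proper_map_preimage[OF pm this]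
    have "compactin (sphere_subspace unit_disc) {x \<in> unit_disc. B x \<in> K}" by simp
    then have "compactin riemann_sphere {x \<in> unit_disc. B x \<in> K}" by (simp add: compactin_subtopology)
    then have cl: "closedin riemann_sphere {x \<in> unit_disc. B x \<in> K}"
      using compactin_imp_closedin[OF Hausdorff_sphere] by blast
    define U where "U = {q. B q \<in> Some ` ball 0 \<rho>} \<inter> (- {x \<in> unit_disc. B x \<in> K})"
    have "openin riemann_sphere U" unfolding U_def
      using cl by (intro openin_Int pre) (auto simp: closedin_def Compl_eq_Diff_UNIV)
    moreover have "p \<in> U" unfolding U_def using w \<rho> p by (auto dest: sphere_disjoint)
    ultimately obtain q where "q \<in> U" "q \<in> unit_disc" using near by blast
    then show False by (auto simp: U_def K_def)
  qed
  ultimately show ?thesis using sphere_trichotomy by blast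
qed

lemma blaschke_productE:
  assumes B: "blaschke_product B"
  obtains c as where "norm c = 1" "set as \<subseteq> ball 0 1" "as \<noteq> []" "B = blaschke_fun c as" "rat_degree B = length as"
proof -
  have "rational_map B" "\<And>p. p \<in> unit_disc \<Longrightarrow> B p \<in> unit_disc"
    using B by (auto simp: blaschke_product_def)
  then show ?thesis
    using rational_imp_blaschke_fun[of B] blaschke_product_boundary[OF B] blaschke_fun_rational(2) that by metis
qed

lemma blaschke_product_iff:
  assumes "blaschke_product B"
  shows "B p \<in> unit_disc \<longleftrightarrow> p \<in> unit_disc" "B p \<in> unit_circle \<longleftrightarrow> p \<in> unit_circle"
    "B p \<in> exterior_disc \<longleftrightarrow> p \<in> exterior_disc"
proof -
  obtain c as where h: "norm c = 1" "set as \<subseteq> ball 0 1" "as \<noteq> []" "B = blaschke_fun c as"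
    by (rule blaschke_productE[OF assms])
  note * = blaschke_fun_unit_circle[OF h(1-3), folded h(4), of p]
  consider "p \<in> unit_disc" | "p \<in> unit_circle" | "p \<in> exterior_disc" using sphere_trichotomy by blast
  then have "(B p \<in> unit_disc \<longleftrightarrow> p \<in> unit_disc) \<and> (B p \<in> unit_circle \<longleftrightarrow> p \<in> unit_circle) \<and>
    (B p \<in> exterior_disc \<longleftrightarrow> p \<in> exterior_disc)"
    by cases (use * sphere_disjoint[of p] sphere_disjoint[of "B p"] in auto)
  then show "B p \<in> unit_disc \<longleftrightarrow> p \<in> unit_disc" "B p \<in> unit_circle \<longleftrightarrow> p \<in> unit_circle"
    "B p \<in> exterior_disc \<longleftrightarrow> p \<in> exterior_disc" by auto
qed

lemma blaschke_product_card_fibre: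
  assumes B: "blaschke_product B" and "q \<in> unit_circle"
  shows "card {p \<in> unit_circle. B p = q} = rat_degree B" "finite {p \<in> unit_circle. B p = q}"
proof -
  obtain c as where h: "norm c = 1" "set as \<subseteq> ball 0 1" "as \<noteq> []" "B = blaschke_fun c as" "rat_degree B = length as"
    by (rule blaschke_productE[OF B])
  obtain w where w: "q = Some w" "norm w = 1" using assms(2) by (auto simp: unit_circle_def)
  have "{p \<in> unit_circle. B p = q} = Some ` {z. norm z = 1 \<and> B (Some z) = Some w}"
    using w by (auto simp: unit_circle_def)
  then show "card {p \<in> unit_circle. B p = q} = rat_degree B" "finite {p \<in> unit_circle. B p = q}"
    using blaschke_fun_card_fibre[OF h(1-3) w(2)] h(4,5) by (simp_all add: card_image)
qed

text \<open>\<open>k\<close> carries the fibre of \<open>B\<close> over 1 bijectively onto that of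
  \<open>A\<close>, and the number of points in such a fibre is the degree.\<close>

lemma blaschke_welding_degree_eq:
  assumes A: "blaschke_product A" and B: "blaschke_product B"
    and k: "bij_betw k unit_circle unit_circle" and AkB: "\<And>p. p \<in> unit_circle \<Longrightarrow> A (k p) = B p"
  shows "rat_degree A = rat_degree B"
proof -
  have q: "Some 1 \<in> unit_circle" by simp
  have bij: "bij_betw k {p \<in> unit_circle. B p = Some 1} {p \<in> unit_circle. A p = Some 1}"
    unfolding bij_betw_def
  proof (intro conjI equalityI subsetI)
    show "inj_on k {p \<in> unit_circle. B p = Some 1}"
      using k by (auto simp: bij_betw_def inj_on_def)
    fix p assume p: "p \<in> {p \<in> unit_circle. A p = Some 1}"
    then obtain p' where "p' \<in> unit_circle" "p = k p'" using k by (auto simp: bij_betw_def)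
    then show "p \<in> k ` {p \<in> unit_circle. B p = Some 1}" using AkB p by auto
  qed (use AkB k in \<open>auto simp: bij_betw_def\<close>)
  then show ?thesis
    using blaschke_product_card_fibre(1)[OF A q] blaschke_product_card_fibre(1)[OF B q] bij_betw_same_card[OF bij] by simp
qed

lemma unimodular_boundary_blaschke_product:
  assumes "continuous_on (cball 0 1) f" "f holomorphic_on ball 0 1" "\<And>z. norm z = 1 \<Longrightarrow> norm (f z) = 1"
    and "\<And>z. norm z < 1 \<Longrightarrow> norm (f z) < 1"
  obtains B where "blaschke_product B" "\<And>z. norm z \<le> 1 \<Longrightarrow> B (Some z) = Some (f z)"
proof -
  obtain c as where c: "norm c = 1" "set as \<subseteq> ball 0 1"
    "\<And>z. z \<in> cball 0 1 \<Longrightarrow> f z = c * poly (bnum as) z / poly (bden as) z"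
    using unimodular_boundary_imp_blaschke[OF assms(1-3)] by blast
  have "as \<noteq> []" using c(1) c(3)[of 0] assms(4)[of 0] by auto
  moreover have "blaschke_fun c as (Some z) = Some (f z)" if "norm z \<le> 1" for z
    using c(3)[of z] poly_bden_nonzero[OF c(2) that] that by (auto simp: rat_fun_def)
  ultimately show ?thesis using that blaschke_fun_is_blaschke[OF c(1,2)] by blast
qed

subsection \<open>Reflection across a circle under unimodular boundary values\<close>

text \<open>One statement for both Cauchy kernels of a Laurent expansion: \<open>u - x\<close> for
  the regular part, and \<open>1 - x * u\<close> with \<open>x = 1/z\<close> for the principal
  part.\<close>

lemma holomorphic_integral_quotient:
  fixes \<phi> \<alpha> \<beta> :: "real \<Rightarrow> complex"
  assumes "continuous_on {0..1} \<phi>" "continuous_on {0..1} \<alpha>" "continuous_on {0..1} \<beta>" "convex U"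
    and nz: "\<And>x t. x \<in> U \<Longrightarrow> t \<in> {0..1} \<Longrightarrow> \<alpha> t - x * \<beta> t \<noteq> 0"
  shows "(\<lambda>x. integral {0..1} (\<lambda>t. \<phi> t / (\<alpha> t - x * \<beta> t))) holomorphic_on U"
proof -
  have "(\<lambda>x. integral (cbox 0 1) (\<lambda>t. \<phi> t / (\<alpha> t - x * \<beta> t))) holomorphic_on U"
  proof (rule leibniz_rule_holomorphic[OF _ _ _ \<open>convex U\<close>, where fx = "\<lambda>x t. \<phi> t * \<beta> t / (\<alpha> t - x * \<beta> t) ^ 2"])
    fix x t assume "x \<in> U" "t \<in> cbox 0 (1::real)"
    then show "((\<lambda>x. \<phi> t / (\<alpha> t - x * \<beta> t)) has_field_derivative \<phi> t * \<beta> t / (\<alpha> t - x * \<beta> t) ^ 2) (at x within U)"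
      using nz[of x t] by (auto intro!: derivative_eq_intros simp: power2_eq_square)
  next
    fix x assume "x \<in> U"
    then show "(\<lambda>t. \<phi> t / (\<alpha> t - x * \<beta> t)) integrable_on cbox 0 1"
      using assms nz by (intro integrable_continuous) (auto intro!: continuous_intros)
  next
    have "continuous_on (U \<times> cbox 0 1) (\<lambda>p. \<phi> (snd p) * \<beta> (snd p) / (\<alpha> (snd p) - fst p * \<beta> (snd p)) ^ 2)"
      using nz by (intro continuous_intros continuous_on_compose2[OF assms(1)] continuous_on_compose2[OF assms(2)]
          continuous_on_compose2[OF assms(3)]) auto
    then show "continuous_on (U \<times> cbox 0 1) (\<lambda>(x, t). \<phi> t * \<beta> t / (\<alpha> t - x * \<beta> t) ^ 2)"
      by (simp add: case_prod_unfold)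
  qed
  then show ?thesis by (simp add: cbox_interval)
qed

lemma contour_integral_circlepath0:
  "contour_integral (circlepath 0 r) f =
     integral {0..1} (\<lambda>t. f (circlepath 0 r t) * (2 * of_real pi * \<i> * circlepath 0 r t))"
  unfolding contour_integral_integral vector_derivative_circlepath by (simp add: circlepath mult_ac)

lemma norm_circlepath0: "r > 0 \<Longrightarrow> norm (circlepath 0 r t) = r"
  by (simp add: circlepath norm_mult)

lemma inverse_in_ball: "0 < r \<Longrightarrow> r < norm z \<Longrightarrow> 1 / z \<in> ball (0::complex) (1/r)"
  using frac_less2[of 1 1 r "norm z"] by (simp add: norm_divide)

abbreviation (input) annulus :: "real \<Rightarrow> real \<Rightarrow> complex set" where
  "annulus a b \<equiv> {z. a < norm z \<and> norm z < b}"

lemma open_annulus: "open (annulus a b)"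
  by (intro open_Collect_conj open_Collect_less continuous_intros)

text \<open>The difference quotient of \<open>q\<close> at \<open>z\<close> extends over
  \<open>z\<close>, so its integrals over the two homotopic circles agree. The integral of
  \<open>1 / (u - z)\<close> is \<open>2 * pi * i\<close> over the outer circle and 0 over the inner
  one.\<close>

lemma Cauchy_formula_annulus:
  assumes q: "q holomorphic_on annulus a b" and r: "0 < a" "a < r" "r < norm z" "norm z < t" "t < b"
  shows "2 * of_real pi * \<i> * q z = contour_integral (circlepath 0 t) (\<lambda>u. q u / (u - z))
       - contour_integral (circlepath 0 r) (\<lambda>u. q u / (u - z))"
proof -
  define D where "D = (\<lambda>u. if u = z then deriv q z else (q u - q z) / (u - z))"
  have D: "D holomorphic_on annulus a b" unfolding D_def
    by (rule pole_lemma_open[OF q open_annulus])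
  have qc: "continuous_on (annulus a b) q" using q by (rule holomorphic_on_imp_continuous_on)
  have rt: "r > 0" "t > 0" using r by auto
  have "homotopic_loops (annulus a b) (circlepath 0 t) (circlepath 0 r)"
  proof (rule homotopic_loops_linear)
    fix s x :: real assume "s \<in> {0..1}"
    show "closed_segment (circlepath 0 t s) (circlepath 0 r s) \<subseteq> annulus a b"
    proof
      fix w assume "w \<in> closed_segment (circlepath 0 t s) (circlepath 0 r s)"
      then obtain v where v: "0 \<le> v" "v \<le> 1" "w = (1 - v) *\<^sub>R circlepath 0 t s + v *\<^sub>R circlepath 0 r s"
        unfolding closed_segment_def by blast
      then have "w = of_real ((1 - v) * t + v * r) * exp (2 * of_real pi * \<i> * of_real s)"
        by (simp add: circlepath scaleR_conv_of_real algebra_simps)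
      then have nw: "norm w = \<bar>(1 - v) * t + v * r\<bar>" by (simp add: norm_mult del: of_real_add)
      have "r \<le> (1 - v) * t + v * r" "(1 - v) * t + v * r \<le> t"
      proof -
        have "(1 - v) * r \<le> (1 - v) * t" "v * r \<le> v * t" using r v by (auto intro: mult_left_mono)
        then show "r \<le> (1 - v) * t + v * r" "(1 - v) * t + v * r \<le> t" by (simp_all add: algebra_simps)
      qed
      then show "w \<in> annulus a b" using nw r rt by auto
    qed
  qed auto
  then have eq: "contour_integral (circlepath 0 t) D = contour_integral (circlepath 0 r) D"
    by (rule Cauchy_theorem_homotopic_loops[OF _ open_annulus D]) auto
  have one: "contour_integral (circlepath 0 \<rho>) D =
      contour_integral (circlepath 0 \<rho>) (\<lambda>u. q u / (u - z)) - q z * contour_integral (circlepath 0 \<rho>) (\<lambda>u. 1 / (u - z))"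
    if \<rho>: "\<rho> > 0" "a < \<rho>" "\<rho> < b" "norm z \<noteq> \<rho>" for \<rho>
  proof -
    have im: "path_image (circlepath 0 \<rho>) = sphere 0 \<rho>" using \<rho> by simp
    have nz: "u \<noteq> z" "u \<in> annulus a b" if "u \<in> sphere 0 \<rho>" for u using that \<rho> by auto
    have i1: "(\<lambda>u. q u / (u - z)) contour_integrable_on circlepath 0 \<rho>"
      using nz im \<rho> by (intro contour_integrable_continuous_circlepath continuous_intros continuous_on_subset[OF qc]) auto
    have i2: "(\<lambda>u. q z * (1 / (u - z))) contour_integrable_on circlepath 0 \<rho>"
      using nz im \<rho> by (intro contour_integrable_continuous_circlepath continuous_intros) auto
    have "contour_integral (circlepath 0 \<rho>) D = contour_integral (circlepath 0 \<rho>) (\<lambda>u. q u / (u - z) - q z * (1 / (u - z)))"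
      by (rule contour_integral_cong) (use nz im \<rho> in \<open>auto simp: D_def diff_divide_distrib\<close>)
    also have "\<dots> = contour_integral (circlepath 0 \<rho>) (\<lambda>u. q u / (u - z)) - contour_integral (circlepath 0 \<rho>) (\<lambda>u. q z * (1 / (u - z)))"
      by (rule contour_integral_diff[OF i1 i2])
    also have "contour_integral (circlepath 0 \<rho>) (\<lambda>u. q z * (1 / (u - z))) = q z * contour_integral (circlepath 0 \<rho>) (\<lambda>u. 1 / (u - z))"
      using nz im \<rho> by (intro contour_integral_lmul contour_integrable_continuous_circlepath continuous_intros) auto
    finally show ?thesis .
  qed
  have I1: "contour_integral (circlepath 0 t) (\<lambda>u. 1 / (u - z)) = 2 * of_real pi * \<i>"
    using Cauchy_integral_circlepath_simple[of "\<lambda>_. 1" 0 t z] r contour_integral_unique by fastforce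
  have "((\<lambda>u. 1 / (u - z)) has_contour_integral 0) (circlepath 0 r)"
    by (rule Cauchy_theorem_disc_simple[of _ 0 "norm z"]) (use r rt in \<open>auto intro!: holomorphic_intros\<close>)
  then have I2: "contour_integral (circlepath 0 r) (\<lambda>u. 1 / (u - z)) = 0" by (rule contour_integral_unique)
  show ?thesis using eq one[of t] one[of r] I1 I2 r rt by (simp add: algebra_simps)
qed

text \<open>The two terms of the Cauchy formula for the annulus. The principal part is written
  \<open>s (1/z) / z\<close>, so that \<open>s 0\<close> is the coefficient of
  \<open>1/z\<close>.\<close>

lemma laurent_split:
  assumes q: "q holomorphic_on annulus a b" and r: "0 < a" "a < r" "r < b"
  obtains p s where "p holomorphic_on ball 0 b" "s holomorphic_on ball 0 (1/r)"
    "\<And>z. r < norm z \<Longrightarrow> norm z < b \<Longrightarrow> q z = p z + s (1/z) / z"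
proof -
  have qc: "continuous_on (annulus a b) q" using q by (rule holomorphic_on_imp_continuous_on)
  have r0: "r > 0" using r by simp
  have cc: "continuous_on {0..1} (\<lambda>t. circlepath 0 \<rho> t)" for \<rho>
    using valid_path_circlepath valid_path_imp_path unfolding path_def by blast
  have qcc: "continuous_on {0..1} (\<lambda>t. q (circlepath 0 \<rho> t))" if "a < \<rho>" "\<rho> < b" for \<rho>
    by (rule continuous_on_compose2[OF qc cc]) (use that r norm_circlepath0[of \<rho>] in auto)
  define s where "s v = (1 / (2 * of_real pi * \<i>)) *
    integral {0..1} (\<lambda>t. (q (circlepath 0 r t) * (2 * of_real pi * \<i> * circlepath 0 r t)) / (1 - v * circlepath 0 r t))" for v
  have sh: "s holomorphic_on ball 0 (1/r)" unfolding s_def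
  proof (intro holomorphic_intros holomorphic_integral_quotient)
    fix v :: complex and t :: real assume v: "v \<in> ball 0 (1/r)"
    show "1 - v * circlepath 0 r t \<noteq> 0"
    proof
      assume "1 - v * circlepath 0 r t = 0"
      then have "norm (v * circlepath 0 r t) = 1" by (metis eq_iff_diff_eq_0 norm_one)
      then show False using v r0 norm_circlepath0[OF r0, of t] by (simp add: norm_mult field_simps)
    qed
  qed (use qcc[of r] cc r in \<open>auto intro!: continuous_intros\<close>)
  \<comment> \<open>Any radius between \<open>r\<close> and \<open>b\<close> serves; the formula for
    \<open>p\<close> is continued to the whole ball afterwards.\<close>
  define t0 where "t0 = (r + b) / 2"
  have t0: "r < t0" "t0 < b" "t0 > 0" using r by (auto simp: t0_def)
  define p0 where "p0 z = (1 / (2 * of_real pi * \<i>)) *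
    integral {0..1} (\<lambda>t. (q (circlepath 0 t0 t) * (2 * of_real pi * \<i> * circlepath 0 t0 t)) / (circlepath 0 t0 t - z * 1))" for z
  have p0h: "p0 holomorphic_on ball 0 t0" unfolding p0_def
  proof (intro holomorphic_intros holomorphic_integral_quotient)
    fix z :: complex and t :: real assume v: "z \<in> ball 0 t0"
    show "circlepath 0 t0 t - z * 1 \<noteq> 0" using v norm_circlepath0[OF t0(3), of t] by auto
  qed (use qcc[of t0] cc r t0 in \<open>auto intro!: continuous_intros\<close>)
  have split: "q z = p0 z + s (1/z) / z" if z: "r < norm z" "norm z < t0" for z
  proof -
    have z0: "z \<noteq> 0" using z r by auto
    have I1: "contour_integral (circlepath 0 t0) (\<lambda>u. q u / (u - z)) = 2 * of_real pi * \<i> * p0 z"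
      unfolding contour_integral_circlepath0 p0_def by (simp add: mult_ac)
    have "(\<lambda>t. q (circlepath 0 r t) / (circlepath 0 r t - z) * (2 * of_real pi * \<i> * circlepath 0 r t))
        = (\<lambda>t. (- 1 / z) * ((q (circlepath 0 r t) * (2 * of_real pi * \<i> * circlepath 0 r t)) / (1 - (1/z) * circlepath 0 r t)))"
    proof
      fix t
      have "circlepath 0 r t - z \<noteq> 0" using z norm_circlepath0[OF r0, of t] by auto
      moreover have "1 - (1/z) * circlepath 0 r t = - (circlepath 0 r t - z) / z" using z0 by (simp add: field_simps)
      ultimately show "q (circlepath 0 r t) / (circlepath 0 r t - z) * (2 * of_real pi * \<i> * circlepath 0 r t) =
        (- 1 / z) * ((q (circlepath 0 r t) * (2 * of_real pi * \<i> * circlepath 0 r t)) / (1 - (1/z) * circlepath 0 r t))"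
        using z0 by (simp add: divide_simps) (simp add: algebra_simps)
    qed
    then have I2: "contour_integral (circlepath 0 r) (\<lambda>u. q u / (u - z)) = (- 1 / z) * (2 * of_real pi * \<i> * s (1/z))"
      unfolding contour_integral_circlepath0 s_def by (simp only: integral_mult_right) simp
    have "2 * of_real pi * \<i> * q z = 2 * of_real pi * \<i> * (p0 z + s (1/z) / z)"
      unfolding Cauchy_formula_annulus[OF q r(1,2) z t0(2)] I1 I2 by (simp add: algebra_simps)
    then show ?thesis by simp
  qed
  \<comment> \<open>The Cauchy integral over radius \<open>t0\<close> is holomorphic only inside
    \<open>t0\<close>. Beyond \<open>r\<close> the difference \<open>q z - s (1/z) / z\<close>
    continues it up to \<open>b\<close>.\<close>
  define p where "p z = (if norm z > r then q z - s (1/z) / z else p0 z)" for z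
  have "p holomorphic_on ball 0 t0 \<union> annulus r b"
  proof (rule holomorphic_on_Un)
    show "p holomorphic_on ball 0 t0"
      by (rule holomorphic_transform[OF p0h]) (use split in \<open>auto simp: p_def\<close>)
    show "p holomorphic_on annulus r b"
    proof (rule holomorphic_transform[of "\<lambda>z. q z - s (1/z) / z"])
      have "(\<lambda>z. s (1/z)) holomorphic_on annulus r b"
        using r0 inverse_in_ball[OF r0]
        by (intro holomorphic_on_compose_gen[OF _ sh, of "\<lambda>z. 1/z", unfolded o_def] holomorphic_intros) auto
      then show "(\<lambda>z. q z - s (1/z) / z) holomorphic_on annulus r b"
        using r0 r by (intro holomorphic_intros holomorphic_on_subset[OF q]) auto
    qed (auto simp: p_def)
  qed (auto intro: open_annulus)
  moreover have "ball 0 b \<subseteq> ball 0 t0 \<union> annulus r b" using t0 by auto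
  ultimately have "p holomorphic_on ball 0 b" by (rule holomorphic_on_subset)
  then show ?thesis by (rule that[OF _ sh]) (auto simp: p_def)
qed

lemma ball_primitive:
  assumes "f holomorphic_on ball (0::complex) b"
  obtains F where "F holomorphic_on ball 0 b" "\<And>z. z \<in> ball 0 b \<Longrightarrow> (F has_field_derivative f z) (at z)"
proof -
  have "\<exists>F. \<forall>z\<in>ball 0 b. (F has_field_derivative f z) (at z within ball 0 b)"
  proof (rule holomorphic_convex_primitive[of "ball 0 b" "{}" f])
    show "continuous_on (ball 0 b) f" using assms by (rule holomorphic_on_imp_continuous_on)
    show "f field_differentiable at x" if "x \<in> interior (ball 0 b) - {}" for x
      using assms that by (auto intro: holomorphic_on_imp_differentiable_at)
    fix g assume "\<And>x. x \<in> ball 0 b \<Longrightarrow> (g has_field_derivative f x) (at x within ball 0 b)"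
    then show ?thesis by blast
  qed auto
  then obtain F where F: "\<And>z. z \<in> ball 0 b \<Longrightarrow> (F has_field_derivative f z) (at z within ball 0 b)"
    by blast
  then have "F holomorphic_on ball 0 b" unfolding holomorphic_on_def field_differentiable_def by blast
  moreover have "(F has_field_derivative f z) (at z)" if "z \<in> ball 0 b" for z
    using F[OF that] unfolding at_within_open[OF that open_ball] .
  ultimately show ?thesis using that by blast
qed

text \<open>A multiplicative Laurent splitting: integrate the additive splitting of the logarithmic
  derivative; the residue is an integer because the remaining factor is single valued.\<close>

lemma multiplicative_laurent_split:
  assumes g: "g holomorphic_on annulus a b" and nz: "\<And>z. z \<in> annulus a b \<Longrightarrow> g z \<noteq> 0"
    and r: "0 < a" "a < r" "r < b"
  obtains n :: int and gp gm where "gp holomorphic_on ball 0 b" "gm holomorphic_on ball 0 (1/r)"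
    "\<And>z. z \<in> ball 0 b \<Longrightarrow> gp z \<noteq> 0" "\<And>z. z \<in> ball 0 (1/r) \<Longrightarrow> gm z \<noteq> 0"
    "\<And>z. r < norm z \<Longrightarrow> norm z < b \<Longrightarrow> g z = z powi n * gp z * gm (1/z)"
proof -
  have r0: "r > 0" using r by simp
  have "(\<lambda>z. deriv g z / g z) holomorphic_on annulus a b"
    using g nz open_annulus by (intro holomorphic_intros) auto
  then obtain p s where p: "p holomorphic_on ball 0 b" and s: "s holomorphic_on ball 0 (1/r)"
    and ps: "\<And>z. r < norm z \<Longrightarrow> norm z < b \<Longrightarrow> deriv g z / g z = p z + s (1/z) / z"
    using laurent_split[of "\<lambda>z. deriv g z / g z", OF _ r] by blast
  \<comment> \<open>Without the residue \<open>s 0\<close> the principal part has a primitive in the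
    variable \<open>1/z\<close>.\<close>
  define s' where "s' = (\<lambda>z. if z = 0 then deriv s 0 else (s z - s 0) / (z - 0))"
  have s': "s' holomorphic_on ball 0 (1/r)" unfolding s'_def
    by (rule pole_lemma_open[OF s open_ball])
  obtain P where P: "P holomorphic_on ball 0 b" "\<And>z. z \<in> ball 0 b \<Longrightarrow> (P has_field_derivative p z) (at z)"
    by (rule ball_primitive[OF p]) blast
  obtain S where S: "S holomorphic_on ball 0 (1/r)" "\<And>z. z \<in> ball 0 (1/r) \<Longrightarrow> (S has_field_derivative s' z) (at z)"
    by (rule ball_primitive[OF s']) blast
  \<comment> \<open>What remains of \<open>g\<close> once the parts of the logarithmic derivative
    with a primitive are integrated away; it satisfies \<open>y' = s 0 / z * y\<close>.\<close>
  define y where "y z = g z * exp (- P z) * exp (S (1/z))" for z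
  have inv: "1/z \<in> ball 0 (1/r)" "z \<noteq> 0" if "r < norm z" for z :: complex
    using that r0 inverse_in_ball[of r z] by auto
  have dy: "(y has_field_derivative s 0 / z * y z) (at z)" if z: "r < norm z" "norm z < b" for z
  proof -
    have zA: "z \<in> annulus a b" using z r by auto
    have dg: "(g has_field_derivative deriv g z) (at z)"
      using g zA open_annulus holomorphic_derivI by blast
    have dP: "(P has_field_derivative p z) (at z)" using P(2) z by simp
    have dS: "((\<lambda>z. S (1/z)) has_field_derivative s' (1/z) * (- 1 / z\<^sup>2)) (at z)"
      by (rule DERIV_chain2[where f = S and g = "\<lambda>z. 1/z", OF S(2)[OF inv(1)[OF z(1)]]])
         (use inv(2)[OF z(1)] in \<open>auto intro!: derivative_eq_intros simp: power2_eq_square\<close>)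
    have "(y has_field_derivative
        (deriv g z * exp (- P z) + g z * (exp (- P z) * (- p z))) * exp (S (1/z)) +
        g z * exp (- P z) * (exp (S (1/z)) * (s' (1/z) * (- 1 / z\<^sup>2)))) (at z)"
      unfolding y_def
      by (rule derivative_eq_intros dg dP dS refl | simp)+ (simp add: algebra_simps)
    moreover have "(deriv g z * exp (- P z) + g z * (exp (- P z) * (- p z))) * exp (S (1/z)) +
        g z * exp (- P z) * (exp (S (1/z)) * (s' (1/z) * (- 1 / z\<^sup>2))) = s 0 / z * y z"
    proof -
      have "deriv g z = g z * (p z + s (1/z) / z)" using ps[OF z] nz[OF zA] by (simp add: field_simps)
      then have dg': "deriv g z = g z * (p z + (s 0 + s' (1/z) / z) / z)"
        using inv(2)[OF z(1)] by (simp add: s'_def)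
      have br: "p z + (s 0 + s' (1/z) / z) / z - p z - s' (1/z) / z\<^sup>2 = s 0 / z"
        using inv(2)[OF z(1)] by (simp add: add_divide_distrib power2_eq_square)
      have "(deriv g z * exp (- P z) + g z * (exp (- P z) * (- p z))) * exp (S (1/z)) +
        g z * exp (- P z) * (exp (S (1/z)) * (s' (1/z) * (- 1 / z\<^sup>2)))
        = y z * (p z + (s 0 + s' (1/z) / z) / z - p z - s' (1/z) / z\<^sup>2)"
        unfolding dg' y_def by (simp add: algebra_simps)
      then show ?thesis unfolding br by simp
    qed
    ultimately show ?thesis by simp
  qed
  \<comment> \<open>In the logarithmic coordinate the equation for \<open>y\<close> says that this
    function is constant on the strip.\<close>
  define m where "m w = y (exp w) * exp (- s 0 * w)" for w
  define strip where "strip = {w. ln r < Re w \<and> Re w < ln b}"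
  have b0: "b > 0" using r by simp
  have str: "r < norm (exp w)" "norm (exp w) < b" if "w \<in> strip" for w
    using that r0 b0 exp_less_cancel_iff[of "ln r" "Re w"] exp_less_cancel_iff[of "Re w" "ln b"]
    by (simp_all add: strip_def)
  have "convex strip" 
    by (simp add: strip_def Collect_conj_eq convex_Int convex_halfspace_Re_gt convex_halfspace_Re_lt)
  have dm: "(m has_field_derivative 0) (at w within strip)" if w: "w \<in> strip" for w
  proof -
    have dY: "((\<lambda>w. y (exp w)) has_field_derivative (s 0 / exp w * y (exp w)) * exp w) (at w)"
      by (rule DERIV_chain2[where f = y and g = exp, OF dy[OF str[OF w]]]) (rule DERIV_exp)
    have dE: "((\<lambda>w. exp (- s 0 * w)) has_field_derivative exp (- s 0 * w) * (- s 0)) (at w)"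
      by (auto intro!: derivative_eq_intros)
    have "(m has_field_derivative (s 0 / exp w * y (exp w)) * exp w * exp (- s 0 * w) + exp (- s 0 * w) * (- s 0) * y (exp w)) (at w)"
      using DERIV_mult[OF dY dE] by (simp only: m_def[abs_def])
    then have "(m has_field_derivative 0) (at w)" by simp
    then show ?thesis by (rule has_field_derivative_at_within)
  qed
  obtain K where K: "\<And>w. w \<in> strip \<Longrightarrow> m w = K"
    using has_field_derivative_zero_constant[OF \<open>convex strip\<close> dm] by blast
  define w0 where "w0 = complex_of_real (ln ((r + b) / 2))"
  have lnm: "ln r < ln ((r + b) / 2)" "ln ((r + b) / 2) < ln b"
    using r r0 b0 by (subst ln_less_cancel_iff; simp)+
  have w0: "w0 \<in> strip" "w0 + 2 * of_real pi * \<i> \<in> strip" using lnm by (auto simp: strip_def w0_def)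
  have y0: "y z \<noteq> 0" if "r < norm z" "norm z < b" for z
    using nz[of z] that r by (auto simp: y_def)
  have "K \<noteq> 0" using K[OF w0(1)] y0 str[OF w0(1)] by (auto simp: m_def)
  \<comment> \<open>Two points of the strip over the same point of the annulus: comparing
    \<open>m\<close> there forces \<open>exp (- s 0 * 2 * pi * i) = 1\<close>, so \<open>s 0\<close>
    is an integer.\<close>
  have "exp (w0 + 2 * of_real pi * \<i>) = exp w0" by (simp add: exp_add)
  then have "y (exp w0) * exp (- s 0 * w0) = y (exp w0) * exp (- s 0 * (w0 + 2 * of_real pi * \<i>))"
    using K[OF w0(1)] K[OF w0(2)] unfolding m_def by simp
  then have "exp (- s 0 * w0) = exp (- s 0 * (w0 + 2 * of_real pi * \<i>))"
    using y0[OF str[OF w0(1)]] by simp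
  then have "exp (- s 0 * w0) * 1 = exp (- s 0 * w0) * exp (- s 0 * (2 * of_real pi * \<i>))"
    by (simp only: distrib_left exp_add mult_1_right)
  then have "exp (- s 0 * (2 * of_real pi * \<i>)) = 1" by (metis exp_not_eq_zero mult_left_cancel)
  then obtain n' :: int where n': "Re (- s 0 * (2 * of_real pi * \<i>)) = 0" "Im (- s 0 * (2 * of_real pi * \<i>)) = of_int (2 * n') * pi"
    unfolding exp_eq_1 by blast
  define n where "n = - n'"
  have "pi * (- Re (s 0)) = pi * of_int n'" "Im (s 0) = 0" using n' by auto
  then have "- Re (s 0) = of_int n'" "Im (s 0) = 0" by (metis mult_left_cancel pi_neq_zero)+
  then have s0: "s 0 = of_int n" by (simp add: complex_eq_iff n_def)
  have yz: "y z = K * z powi n" if z: "r < norm z" "norm z < b" for z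
  proof -
    have z0: "z \<noteq> 0" using z r by auto
    have "Ln z \<in> strip" using z z0 r0 b0 by (auto simp: strip_def)
    from K[OF this] have "y z * exp (- s 0 * Ln z) = K" using z0 by (simp add: m_def)
    then have "y z = K * exp (of_int n * Ln z)" by (simp add: s0 exp_minus field_simps)
    then show ?thesis using z0 exp_power_int[of "Ln z" n] by simp
  qed
  show ?thesis
  proof (rule that[of "\<lambda>z. K * exp (P z)" "\<lambda>v. exp (- S v)" n])
    show "(\<lambda>z. K * exp (P z)) holomorphic_on ball 0 b" "(\<lambda>v. exp (- S v)) holomorphic_on ball 0 (1/r)"
      using P(1) S(1) by (auto intro!: holomorphic_intros)
    fix z :: complex assume z: "r < norm z" "norm z < b"
    show "g z = z powi n * (K * exp (P z)) * exp (- S (1 / z))"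
      using yz[OF z] by (simp add: y_def exp_minus field_simps)
  qed (use \<open>K \<noteq> 0\<close> in auto)
qed

text \<open>Write \<open>g z = z powi n * gp z * gm (1/z)\<close> and let \<open>gs\<close> be the
  reflection of \<open>gm\<close> in the circle of radius \<open>b\<close>. There \<open>gs\<close>
  has the modulus of \<open>gm (1/z)\<close>, so the zero-free function
  \<open>gp * gs * b powi n\<close> on the ball has a modulus tending to 1 and is a constant
  \<open>c\<close>. Eliminating \<open>gp\<close> expresses \<open>g\<close> through
  \<open>gm\<close> and \<open>gs\<close>, a formula that makes sense beyond the circle.\<close>

lemma annulus_reflection:
  assumes g: "g holomorphic_on annulus a b" and nz: "\<And>z. z \<in> annulus a b \<Longrightarrow> g z \<noteq> 0"
    and r: "0 < a" "a < r" "r < b"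
    and lim: "\<And>\<epsilon>. \<epsilon> > 0 \<Longrightarrow> \<exists>s<b. \<forall>z. s < norm z \<longrightarrow> norm z < b \<longrightarrow> \<bar>norm (g z) - 1\<bar> < \<epsilon>"
  obtains G where "G holomorphic_on annulus r (b\<^sup>2 / r)"
    "\<And>z. r < norm z \<Longrightarrow> norm z < b \<Longrightarrow> G z = g z"
    "\<And>z. z \<in> annulus r (b\<^sup>2 / r) \<Longrightarrow> G (of_real (b\<^sup>2) / cnj z) * cnj (G z) = 1"
proof -
  obtain n :: int and gp gm where h: "gp holomorphic_on ball 0 b" "gm holomorphic_on ball 0 (1/r)"
    "\<And>z. z \<in> ball 0 b \<Longrightarrow> gp z \<noteq> 0" "\<And>z. z \<in> ball 0 (1/r) \<Longrightarrow> gm z \<noteq> 0"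
    "\<And>z. r < norm z \<Longrightarrow> norm z < b \<Longrightarrow> g z = z powi n * gp z * gm (1/z)"
    by (rule multiplicative_laurent_split[OF g nz r]) auto
  have r0: "r > 0" "b > 0" using r by auto
  \<comment> \<open>The domain of \<open>gm\<close>, moved by the reflection, becomes the ball of
    radius \<open>b^2 / r\<close>, which contains the ball of radius \<open>b\<close>.\<close>
  define gs where "gs w = cnj (gm (cnj w / of_real (b\<^sup>2)))" for w
  have sc: "cnj w / of_real (b\<^sup>2) \<in> ball 0 (1/r)" if "w \<in> ball 0 (b\<^sup>2 / r)" for w
    using that r0 by (simp add: norm_divide norm_power field_simps)
  have gs0: "gs w \<noteq> 0" if "w \<in> ball 0 (b\<^sup>2 / r)" for w
    using h(4)[OF sc[OF that]] by (simp add: gs_def)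
  have gsh: "gs holomorphic_on ball 0 (b\<^sup>2 / r)"
  proof -
    have "(\<lambda>w. gm (w / of_real (b\<^sup>2))) holomorphic_on cnj ` ball 0 (b\<^sup>2 / r)"
      by (rule holomorphic_on_compose_gen[OF _ h(2), of "\<lambda>w. w / of_real (b\<^sup>2)", unfolded o_def])
         (use r0 in \<open>auto intro!: holomorphic_intros simp: norm_divide norm_power field_simps\<close>)
    then have "cnj \<circ> (\<lambda>w. gm (w / of_real (b\<^sup>2))) \<circ> cnj holomorphic_on ball 0 (b\<^sup>2 / r)"
      by (rule holomorphic_on_compose_cnj_cnj) simp
    then show ?thesis by (simp add: o_def gs_def[abs_def])
  qed
  have br: "b \<le> b\<^sup>2 / r" using r r0 by (simp add: field_simps power2_eq_square)
  have bb: "b < b\<^sup>2 / r" using r r0 by (simp add: field_simps power2_eq_square)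
  define H where "H w = gp w * gs w * of_real (b powi n)" for w
  have Hh: "H holomorphic_on ball 0 b" unfolding H_def
    using br by (intro holomorphic_intros h(1) holomorphic_on_subset[OF gsh]) auto
  have H0: "H w \<noteq> 0" if "w \<in> ball 0 b" for w
    using h(3)[OF that] gs0[of w] that br r0 by (auto simp: H_def power_int_eq_0_iff)
  \<comment> \<open>The quotient of \<open>H\<close> by \<open>g\<close>. Unlike \<open>g\<close> it
    is continuous up to the circle, where it is unimodular, so uniform continuity controls its
    modulus near the rim.\<close>
  define m where "m w = gs w * of_real (b powi n) / (gm (1/w) * w powi n)" for w
  define r1 where "r1 = (r + b) / 2"
  have r1: "r < r1" "r1 < b" using r by (auto simp: r1_def)
  define C where "C = {w::complex. r1 \<le> norm w \<and> norm w \<le> b}"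
  have "compact C"
  proof -
    have "closed C" unfolding C_def by (intro closed_Collect_conj closed_Collect_le continuous_intros)
    moreover have "bounded C" unfolding C_def bounded_iff by blast
    ultimately show ?thesis by (simp add: compact_eq_bounded_closed)
  qed
  have Cin: "1/w \<in> ball 0 (1/r)" "w \<noteq> 0" "w \<in> ball 0 (b\<^sup>2 / r)" if "w \<in> C" for w
  proof -
    show w0: "w \<noteq> 0" using that r1 r0 by (auto simp: C_def)
    show "1/w \<in> ball 0 (1/r)" using that r1 by (intro inverse_in_ball r0(1)) (auto simp: C_def)
    show "w \<in> ball 0 (b\<^sup>2 / r)" using that bb by (auto simp: C_def)
  qed
  have mc: "continuous_on C m" unfolding m_def
  proof (intro continuous_intros)
    show "continuous_on C gs"
      by (rule continuous_on_subset[OF holomorphic_on_imp_continuous_on[OF gsh]]) (use Cin in auto)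
    show "continuous_on C (\<lambda>x. gm (1 / x))"
      by (rule continuous_on_compose2[OF holomorphic_on_imp_continuous_on[OF h(2)]])
         (use Cin in \<open>auto intro!: continuous_intros\<close>)
  qed (use Cin h(4) in \<open>auto simp: power_int_eq_0_iff\<close>)
  have nm: "norm (m w) = 1" if w: "norm w = b" for w
  proof -
    have wC: "w \<in> C" using w r1 by (auto simp: C_def)
    have "w * cnj w = of_real (b\<^sup>2)" using w complex_norm_square[of w] by simp
    then have "cnj w / of_real (b\<^sup>2) = 1 / w" using Cin(2)[OF wC] r0 by (simp add: field_simps)
    then have "norm (gs w) = norm (gm (1/w))" by (simp add: gs_def)
    moreover have "norm (w powi n) = b powi n" using w by (simp add: norm_power_int)
    moreover have "gm (1/w) \<noteq> 0" using Cin(1)[OF wC] h(4) by blast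
    moreover have "b powi n > 0" using r0 by simp
    ultimately show ?thesis using r0 by (simp add: m_def norm_mult norm_divide norm_power_int)
  qed
  have "\<exists>c. norm c = 1 \<and> (\<forall>z\<in>ball 0 b. H z = c)"
  proof (rule unimodular_boundary_imp_constant[OF Hh H0 r0(2)])
    fix \<epsilon> :: real assume \<epsilon>: "\<epsilon> > 0"
    \<comment> \<open>Two factors within \<open>\<delta>\<close> of 1 have a product within
      \<open>3 * \<delta>\<close> of 1, because \<open>\<delta>\<close> is at most 1.\<close>
    define \<delta> where "\<delta> = min 1 (\<epsilon> / 3)"
    have \<delta>: "\<delta> > 0" "\<delta> \<le> 1" "\<delta> \<le> \<epsilon> / 3" using \<epsilon> by (auto simp: \<delta>_def)
    have "uniformly_continuous_on C m" by (rule compact_uniformly_continuous[OF mc \<open>compact C\<close>])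
    then obtain d where d: "d > 0" "\<And>x y. x \<in> C \<Longrightarrow> y \<in> C \<Longrightarrow> dist y x < d \<Longrightarrow> dist (m y) (m x) < \<delta>"
      using \<delta>(1) unfolding uniformly_continuous_on_def by metis
    obtain s where s: "s < b" "\<And>z. s < norm z \<Longrightarrow> norm z < b \<Longrightarrow> \<bar>norm (g z) - 1\<bar> < \<delta>"
      using lim[OF \<delta>(1)] by blast
    show "\<exists>s<b. \<forall>z\<in>ball 0 b. s < norm z \<longrightarrow> \<bar>norm (H z) - 1\<bar> < \<epsilon>"
    proof (intro exI[of _ "max s (max r1 (b - d))"] conjI ballI impI)
      fix w :: complex assume w: "w \<in> ball 0 b" "max s (max r1 (b - d)) < norm w"
      have wC: "w \<in> C" using w by (auto simp: C_def)
      note w0 = Cin(2)[OF wC]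
      define x where "x = of_real b * sgn w"
      have nx: "norm x = b" using w0 r0 by (simp add: x_def norm_mult norm_sgn)
      have "w - x = of_real (norm w - b) * sgn w" using w0 by (simp add: x_def sgn_eq field_simps)
      then have "norm (w - x) = \<bar>norm w - b\<bar> * norm (sgn w)" by (metis norm_mult norm_of_real)
      then have "dist w x < d" using w w0 by (auto simp: dist_norm norm_sgn)
      moreover have "x \<in> C" using nx r1 by (auto simp: C_def)
      ultimately have "dist (m w) (m x) < \<delta>" using d(2) wC by blast
      then have mw: "\<bar>norm (m w) - 1\<bar> < \<delta>" using nm[OF nx] by (smt (verit) dist_norm norm_triangle_ineq3)
      have gw: "\<bar>norm (g w) - 1\<bar> < \<delta>" using s(2)[of w] w by auto
      have "g w = w powi n * gp w * gm (1/w)" using h(5)[of w] w r1 by auto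
      then have "H w = g w * m w"
        using w0 h(4)[OF Cin(1)[OF wC]] by (simp add: H_def m_def power_int_eq_0_iff)
      then have "norm (H w) = norm (g w) * norm (m w)" by (simp add: norm_mult)
      moreover have "\<bar>x * y - 1\<bar> < 3 * \<delta>" if "\<bar>x - 1\<bar> < \<delta>" "\<bar>y - 1\<bar> < \<delta>" for x y :: real
      proof -
        have "x * y - 1 = (x - 1) * (y - 1) + (x - 1) + (y - 1)" by (simp add: algebra_simps)
        moreover have "\<bar>(x - 1) * (y - 1)\<bar> \<le> \<delta> * 1"
          unfolding abs_mult using that \<delta> by (intro mult_mono) auto
        ultimately show ?thesis using that by linarith
      qed
      ultimately show "\<bar>norm (H w) - 1\<bar> < \<epsilon>" using gw mw \<delta>(3) by fastforce
    qed (use s r1 d in auto)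
  qed
  then obtain c where c: "norm c = 1" "\<And>z. z \<in> ball 0 b \<Longrightarrow> H z = c" by blast
  \<comment> \<open>Solving \<open>H = c\<close> for \<open>gp\<close> and inserting it into the
    splitting of \<open>g\<close>.\<close>
  define G where "G w = c * (w / of_real b) powi n * gm (1/w) / gs w" for w
  have ann: "w \<noteq> 0" "1/w \<in> ball 0 (1/r)" "w \<in> ball 0 (b\<^sup>2 / r)" if "w \<in> annulus r (b\<^sup>2 / r)" for w
  proof -
    show w0: "w \<noteq> 0" using that r0 by auto
    show "1/w \<in> ball 0 (1/r)" using that by (intro inverse_in_ball r0(1)) auto
    show "w \<in> ball 0 (b\<^sup>2 / r)" using that by auto
  qed
  have hG: "G holomorphic_on annulus r (b\<^sup>2 / r)" unfolding G_def
  proof (intro holomorphic_intros)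
    show "(\<lambda>w. gm (1 / w)) holomorphic_on annulus r (b\<^sup>2 / r)"
      by (rule holomorphic_on_compose_gen[OF _ h(2), of "\<lambda>w. 1/w", unfolded o_def])
         (use ann in \<open>auto intro!: holomorphic_intros\<close>)
    show "gs holomorphic_on annulus r (b\<^sup>2 / r)" by (rule holomorphic_on_subset[OF gsh]) auto
  qed (use ann gs0 r0 in \<open>auto simp del: mem_Collect_eq\<close>)
  show ?thesis
  proof (rule that[OF hG])
    fix z :: complex assume z: "r < norm z" "norm z < b"
    have z': "z \<in> annulus r (b\<^sup>2 / r)" using z br by auto
    have gz: "gs z \<noteq> 0" using gs0 ann[OF z'] by blast
    have bp: "b powi n \<noteq> 0" using r0 by (simp add: power_int_eq_0_iff)
    have "c = gp z * gs z * of_real (b powi n)" using c(2)[of z] z by (simp add: H_def)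
    then have "G z = gp z * gs z * of_real (b powi n) * (z powi n / of_real (b powi n)) * gm (1/z) / gs z"
      by (simp add: G_def power_int_divide_distrib)
    also have "\<dots> = z powi n * gp z * gm (1/z)" using gz bp r0 by (simp add: field_simps)
    finally show "G z = g z" using h(5)[OF z] by simp
  next
    fix w assume w: "w \<in> annulus r (b\<^sup>2 / r)"
    define w' where "w' = of_real (b\<^sup>2) / cnj w"
    note w0 = ann(1)[OF w]
    have e1: "gm (1 / w') = cnj (gs w)" using w0 r0 by (simp add: gs_def w'_def)
    have e2: "gs w' = cnj (gm (1 / w))" using w0 r0 by (simp add: gs_def w'_def)
    have nz: "gs w \<noteq> 0" "gm (1/w) \<noteq> 0" using gs0 h(4) ann[OF w] by auto
    have pw: "(w' / of_real b) powi n * cnj ((w / of_real b) powi n) = 1"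
    proof -
      have "(w' / of_real b) * cnj (w / of_real b) = 1" using w0 r0 by (simp add: w'_def power2_eq_square)
      then show ?thesis by (metis complex_cnj_power_int power_int_mult_distrib power_int_1_left)
    qed
    have cc: "c * cnj c = 1" using c(1) complex_norm_square[of c] by simp
    have "G w' * cnj (G w) = (c * cnj c) * ((w' / of_real b) powi n * cnj ((w / of_real b) powi n)) *
        (cnj (gs w) * cnj (gm (1/w)) / (cnj (gm (1/w)) * cnj (gs w)))"
      by (simp add: G_def e1 e2)
    also have "\<dots> = 1" unfolding cc pw using nz by simp
    finally show "G (of_real (b\<^sup>2) / cnj w) * cnj (G w) = 1" by (simp add: w'_def)
  qed
qed

subsection \<open>A growth bound for univalent functions\<close>

text \<open>A square root \<open>h\<close> of \<open>1 - f / a\<close>, with \<open>a\<close> an omitted value, omits \<open>0\<close> and \<open>-1\<close>, so Schottky's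
  theorem applies to \<open>-h\<close>.\<close>

lemma univalent_growth_bound:
  assumes t: "0 < t" "t < 1"
  obtains M where "\<And>f z. f holomorphic_on ball 0 1 \<Longrightarrow> inj_on f (ball 0 1) \<Longrightarrow> f 0 = 0 \<Longrightarrow> deriv f 0 = 1 \<Longrightarrow>
     norm z \<le> t \<Longrightarrow> norm (f z) \<le> M"
proof -
  \<comment> \<open>Schottky's theorem wants holomorphy on the closed unit disc, so the argument is
    scaled by \<open>\<rho> < 1\<close>; \<open>t'\<close> is the scaled radius.\<close>
  define \<rho> where "\<rho> = (1 + t) / 2"
  have \<rho>: "t < \<rho>" "\<rho> < 1" "\<rho> > 0" using t by (auto simp: \<rho>_def)
  define t' where "t' = t / \<rho>"
  have t': "0 < t'" "t' < 1" using t \<rho> by (auto simp: t'_def)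
  define E where "E = exp (pi * exp (pi * (2 + 2 * 1 + 12 * t' / (1 - t'))))"
  have "norm (f z) \<le> 2 * (1 + E\<^sup>2)"
    if f: "f holomorphic_on ball 0 1" "inj_on f (ball 0 1)" "f 0 = 0" "deriv f 0 = 1" and z: "norm z \<le> t" for f z
  proof -
    \<comment> \<open>If the image contained the ball of radius 2, the inverse of \<open>f\<close>,
      rescaled to the unit disc, would fix 0 with derivative 2 there, against the Schwarz
      lemma.\<close>
    have "\<exists>a. norm a < 2 \<and> a \<notin> f ` ball 0 1"
    proof (rule ccontr)
      assume "\<not> (\<exists>a. norm a < 2 \<and> a \<notin> f ` ball 0 1)"
      then have sub: "ball 0 2 \<subseteq> f ` ball 0 1" by auto
      obtain g where g: "g holomorphic_on (f ` ball 0 1)" "\<And>z. z \<in> ball 0 1 \<Longrightarrow> deriv f z * deriv g (f z) = 1"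
        "\<And>z. z \<in> ball 0 1 \<Longrightarrow> g (f z) = z"
        using holomorphic_has_inverse[OF f(1) open_ball f(2)] by metis
      have gh: "g holomorphic_on ball 0 2" using g(1) sub by (rule holomorphic_on_subset)
      have h: "(\<lambda>w. g (2 * w)) holomorphic_on ball 0 1"
        by (rule holomorphic_on_compose_gen[OF _ gh, of "\<lambda>w. 2 * w", unfolded o_def])
           (auto intro!: holomorphic_intros simp: norm_mult)
      have lt: "norm (g (2 * w)) < 1" if "norm w < 1" for w
      proof -
        have "2 * w \<in> f ` ball 0 1" using sub that by (auto simp: norm_mult subset_iff)
        then show ?thesis using g(3) by auto
      qed
      have g00: "g (2 * 0) = 0" using g(3)[of 0] f(3) by simp
      have "norm (deriv (\<lambda>w. g (2 * w)) 0) \<le> 1"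
        by (rule Schwarz_Lemma(2)[OF h g00 lt, of 0]) auto
      moreover have "((\<lambda>w. g (2 * w)) has_field_derivative deriv g (2 * 0) * 2) (at 0)"
      proof (rule DERIV_chain2[where f = g and g = "\<lambda>w. 2 * w"])
        show "(g has_field_derivative deriv g (2 * 0)) (at (2 * 0))"
          using gh by (intro holomorphic_derivI[of _ "ball 0 2"]) auto
      qed (auto intro!: derivative_eq_intros)
      then have "deriv (\<lambda>w. g (2 * w)) 0 = deriv g 0 * 2" by (simp add: DERIV_imp_deriv)
      moreover have "deriv g 0 = 1" using g(2)[of 0] f(3,4) by simp
      ultimately show False by simp
    qed
    then obtain a where a: "norm a < 2" "a \<notin> f ` ball 0 1" by blast
    have a0: "a \<noteq> 0" using a f(3) by force
    have "(\<lambda>z. 1 - f z / a) holomorphic_on ball 0 1" using f(1) a0 by (intro holomorphic_intros)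
    moreover have "1 - f z / a \<noteq> 0" if "z \<in> ball 0 1" for z
      using a a0 that by (auto simp: field_simps)
    ultimately obtain h0 where h0: "h0 holomorphic_on ball 0 1" "\<And>z. z \<in> ball 0 1 \<Longrightarrow> 1 - f z / a = h0 z ^ 2"
      using contractible_imp_holomorphic_sqrt[of "\<lambda>z. 1 - f z / a" "ball 0 1"] convex_imp_contractible[OF convex_ball]
      by blast
    have "h0 0 ^ 2 = 1" using h0(2)[of 0] f(3) by simp
    then have hh: "h0 0 = 1 \<or> h0 0 = - 1" by (simp add: power2_eq_1_iff)
    \<comment> \<open>The sign is normalized to \<open>h 0 = -1\<close>. A point with
      \<open>h z = 1\<close> would satisfy \<open>f z = 0 = f 0\<close>, hence be 0, where the value
      is \<open>-1\<close>.\<close>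
    define h where "h z = - h0 z * h0 0" for z
    have h: "h holomorphic_on ball 0 1" "h 0 = - 1" "\<And>z. z \<in> ball 0 1 \<Longrightarrow> 1 - f z / a = h z ^ 2"
      using h0 hh by (auto simp: h_def[abs_def] power_mult_distrib power2_eq_square intro!: holomorphic_intros)
    have om: "h z \<noteq> 0" "h z \<noteq> 1" if z: "z \<in> ball 0 1" for z
    proof -
      show "h z \<noteq> 0" using h(3)[OF z] a a0 z by (auto simp: field_simps)
      show "h z \<noteq> 1"
      proof
        assume h1: "h z = 1"
        then have "f z = f 0" using h(3)[OF z] a0 f(3) by (simp add: field_simps)
        then have "z = 0" using f(2) z by (auto simp: inj_on_def)
        then show False using h1 h(2) by simp
      qed
    qed
    have "norm (h (of_real \<rho> * (z / of_real \<rho>))) \<le> exp (pi * exp (pi * (2 + 2 * 1 + 12 * t' / (1 - t'))))"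
    proof (rule Schottky[where f = "\<lambda>w. h (of_real \<rho> * w)" and t = t' and z = "z / of_real \<rho>" and r = 1])
      have sub: "of_real \<rho> * w \<in> ball 0 1" if "w \<in> cball 0 1" for w :: complex
      proof -
        have "\<rho> * norm w \<le> \<rho> * 1" using that \<rho> by (intro mult_left_mono) auto
        then have "\<rho> * norm w < 1" using \<rho> by linarith
        then show ?thesis using \<rho> by (simp add: norm_mult)
      qed
      show "(\<lambda>w. h (of_real \<rho> * w)) holomorphic_on cball 0 1"
        by (rule holomorphic_on_compose_gen[OF _ h(1), of "\<lambda>w. of_real \<rho> * w", unfolded o_def])
           (use sub in \<open>auto intro!: holomorphic_intros\<close>)
      show "\<not> (h (of_real \<rho> * w) = 0 \<or> h (of_real \<rho> * w) = 1)" if "w \<in> cball 0 1" for w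
        using om[OF sub[OF that]] by simp
      show "norm (z / of_real \<rho>) \<le> t'" using z \<rho> by (simp add: norm_divide t'_def divide_right_mono)
    qed (use t' h(2) in auto)
    then have hz: "norm (h z) \<le> E" using \<rho> by (simp add: E_def)
    have zb: "z \<in> ball 0 1" using z t by auto
    have "f z = a * (1 - h z ^ 2)" using h(3)[OF zb] a0 by (simp add: field_simps)
    then have "norm (f z) = norm a * norm (1 - h z ^ 2)" by (simp add: norm_mult)
    also have "\<dots> \<le> 2 * (1 + E\<^sup>2)"
    proof (rule mult_mono)
      have "norm (1 - h z ^ 2) \<le> norm (1::complex) + norm (h z ^ 2)" by (rule norm_triangle_ineq4)
      also have "\<dots> \<le> 1 + E\<^sup>2" using hz by (simp add: norm_power power_mono)
      finally show "norm (1 - h z ^ 2) \<le> 1 + E\<^sup>2" .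
    qed (use a in auto)
    finally show ?thesis .
  qed
  then show ?thesis by (rule that)
qed

subsection \<open>Removability of the unit circle\<close>

text \<open>Near a point \<open>t\<close> of the circle the coordinate
  \<open>t * exp \<zeta>\<close> turns the circle into the imaginary axis, where pasting across a
  line applies.\<close>

lemma holomorphic_paste_unit_circle:
  assumes V: "open V" and F: "continuous_on V F" "F holomorphic_on V - sphere 0 1"
  shows "F holomorphic_on V"
proof -
  have "F field_differentiable at t" if t: "t \<in> V" for t
  proof (cases "norm t = 1")
    case False
    have "open (V - sphere 0 1)" using V by (simp add: open_Diff)
    then show ?thesis using F(2) t False by (auto intro: holomorphic_on_imp_differentiable_at)
  next
    case True
    then have t0: "t \<noteq> 0" by auto
    define S where "S = {\<zeta>. t * exp \<zeta> \<in> V}"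
    have oS: "open S"
    proof -
      have "open ((\<lambda>\<zeta>. t * exp \<zeta>) -` V)" using V by (intro open_vimage continuous_intros)
      then show ?thesis by (simp add: S_def vimage_def)
    qed
    have S0: "0 \<in> S" using t by (simp add: S_def)
    define G where "G \<zeta> = F (t * exp \<zeta>)" for \<zeta>
    have nm: "norm (t * exp \<zeta>) = exp (Re \<zeta>)" for \<zeta> using True by (simp add: norm_mult)
    have part: "G holomorphic_on S \<inter> {\<zeta>. P \<zeta>}" if "\<And>\<zeta>. P \<zeta> \<Longrightarrow> Re \<zeta> \<noteq> 0" for P
      unfolding G_def
      by (rule holomorphic_on_compose_gen[OF _ F(2), of "\<lambda>\<zeta>. t * exp \<zeta>", unfolded o_def])
         (use that nm in \<open>auto simp: S_def intro!: holomorphic_intros\<close>)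
    have "G holomorphic_on S"
    proof (rule holomorphic_on_paste_across_line[OF oS, of 1 _ 0])
      show "G holomorphic_on S \<inter> {z. inner 1 z < 0}" by (rule part) auto
      show "G holomorphic_on S \<inter> {z. 0 < inner 1 z}" by (rule part) auto
      show "continuous_on S G" unfolding G_def
        by (rule continuous_on_compose2[OF F(1)]) (auto simp: S_def intro!: continuous_intros)
    qed auto
    then have G: "G field_differentiable at 0" using oS S0 by (auto intro: holomorphic_on_imp_differentiable_at)
    have L: "(\<lambda>z. Ln (z / t)) field_differentiable at t"
    proof -
      have "((\<lambda>z. Ln (z / t)) has_field_derivative inverse (t / t) * (1 / t)) (at t)"
        by (rule DERIV_chain2[where f = Ln and g = "\<lambda>z. z / t"])
           (use t0 in \<open>auto intro!: has_field_derivative_Ln derivative_eq_intros\<close>)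
      then show ?thesis unfolding field_differentiable_def by blast
    qed
    have fd: "(G \<circ> (\<lambda>z. Ln (z / t))) field_differentiable at t"
      using L G t0 by (intro field_differentiable_compose) auto
    have eq: "(G \<circ> (\<lambda>z. Ln (z / t))) z = F z" if "dist z t < 1" for z
    proof -
      have "z \<noteq> 0" using True that by auto
      then show ?thesis using t0 by (simp add: G_def)
    qed
    show ?thesis
      by (rule field_differentiable_transform_within[OF zero_less_one UNIV_I eq fd])
  qed
  then show ?thesis unfolding holomorphic_on_def using field_differentiable_at_within by blast
qed

subsection \<open>Analytic extension of a welding homeomorphism\<close>

lemma dist_sgn: "z \<noteq> 0 \<Longrightarrow> dist (sgn z) z = \<bar>norm z - 1\<bar>" for z :: complex
proof -
  assume z: "z \<noteq> 0"
  have "z - sgn z = of_real (norm z - 1) * sgn z" using z by (simp add: sgn_eq field_simps)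
  then have "norm (z - sgn z) = \<bar>norm z - 1\<bar> * norm (sgn z)" by (metis norm_mult norm_of_real)
  then show ?thesis using z by (simp add: dist_norm norm_minus_commute norm_sgn)
qed

lemma islimpt_unit_circle:
  fixes t :: complex
  assumes "norm t = 1" "\<delta> > 0"
  shows "t islimpt (sphere 0 1 \<inter> ball t \<delta>)"
proof -
  have con: "connected (sphere (0::complex) 1)" by (simp add: connected_sphere_eq)
  have "t + t \<noteq> 0" using assms by auto
  then have "t \<noteq> - t" by (metis add.right_inverse)
  moreover have tT: "t \<in> sphere 0 1" "- t \<in> sphere 0 1" using assms by auto
  ultimately have "sphere (0::complex) 1 \<noteq> {x}" for x by (metis singletonD)
  then have lim: "t islimpt sphere 0 1" by (rule connected_imp_perfect[OF con tT(1)])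
  show ?thesis unfolding islimpt_approachable
  proof (intro allI impI)
    fix e :: real assume "e > 0"
    then obtain x where "x \<in> sphere 0 1" "x \<noteq> t" "dist x t < min e \<delta>"
      using lim assms(2) unfolding islimpt_approachable by (metis min_less_iff_conj)
    then show "\<exists>x'\<in>sphere 0 1 \<inter> ball t \<delta>. x' \<noteq> t \<and> dist x' t < e"
      by (intro bexI[of _ x]) (auto simp: dist_commute)
  qed
qed

text \<open>Locally \<open>k\<close> is a branch of the inverse of \<open>A\<close> composed with
  \<open>B\<close>. The branch exists because \<open>A\<close> has nonzero derivative at
  \<open>k t\<close>; it is the right one because \<open>k\<close>, being continuous, stays in the
  ball where \<open>A\<close> is injective.\<close>

lemma local_welding_extension:
  assumes A: "A holomorphic_on UA" "open UA" "sphere 0 1 \<subseteq> UA" "\<And>t. norm t = 1 \<Longrightarrow> deriv A t \<noteq> 0"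
    and B: "B holomorphic_on UB" "open UB" "sphere 0 1 \<subseteq> UB"
    and k: "continuous_on (sphere 0 1) k" "k ` sphere 0 1 = sphere 0 1"
    and AkB: "\<And>t. norm t = 1 \<Longrightarrow> A (k t) = B t"
    and t: "norm t = 1"
  shows "\<exists>\<delta> \<kappa>. \<delta> > 0 \<and> ball t \<delta> \<subseteq> UB \<and> \<kappa> holomorphic_on ball t \<delta> \<and>
     (\<forall>z\<in>ball t \<delta>. \<kappa> z \<in> UA \<and> A (\<kappa> z) = B z) \<and> (\<forall>s\<in>ball t \<delta>. norm s = 1 \<longrightarrow> \<kappa> s = k s)"
proof -
  have kt: "norm (k t) = 1" using k(2) t by auto
  obtain r where r: "r > 0" "ball (k t) r \<subseteq> UA" "open (A ` ball (k t) r)" "inj_on A (ball (k t) r)"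
    using has_complex_derivative_locally_invertible[OF A(1) _ A(2) A(4)[OF kt]] A(3) kt
    by (metis mem_sphere_0 subsetD)
  obtain i where i: "i holomorphic_on A ` ball (k t) r" "\<And>z. z \<in> ball (k t) r \<Longrightarrow> i (A z) = z"
    using holomorphic_has_inverse[OF holomorphic_on_subset[OF A(1) r(2)] open_ball r(4)] by metis
  have Bc: "continuous_on UB B" using B(1) by (rule holomorphic_on_imp_continuous_on)
  have "open (UB \<inter> B -` (A ` ball (k t) r))"
    by (rule continuous_open_preimage[OF Bc B(2) r(3)])
  moreover have "t \<in> UB \<inter> B -` (A ` ball (k t) r)"
    using B(3) t AkB[OF t] r(1) by (auto intro!: image_eqI[of _ _ "k t"])
  ultimately obtain d1 where d1: "d1 > 0" "ball t d1 \<subseteq> UB \<inter> B -` (A ` ball (k t) r)" using openE by blast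
  obtain d2 where d2: "d2 > 0" "\<And>s. norm s = 1 \<Longrightarrow> dist s t < d2 \<Longrightarrow> dist (k s) (k t) < r"
    using k(1) t r(1) unfolding continuous_on_iff by (metis mem_sphere_0)
  show ?thesis
  proof (intro exI[of _ "min d1 d2"] exI[of _ "i \<circ> B"] conjI ballI impI)
    show "i \<circ> B holomorphic_on ball t (min d1 d2)"
    proof (rule holomorphic_on_compose_gen[OF _ i(1)])
      have "ball t (min d1 d2) \<subseteq> ball t d1" by auto
      then have "ball t (min d1 d2) \<subseteq> UB" "B ` ball t (min d1 d2) \<subseteq> A ` ball (k t) r" using d1(2) by blast+
      then show "B holomorphic_on ball t (min d1 d2)" "B ` ball t (min d1 d2) \<subseteq> A ` ball (k t) r"
        using B(1) by (auto intro: holomorphic_on_subset)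
    qed
    fix z assume z: "z \<in> ball t (min d1 d2)"
    then have "B z \<in> A ` ball (k t) r" using d1 by auto
    then obtain w where w: "w \<in> ball (k t) r" "B z = A w" by blast
    then show "(i \<circ> B) z \<in> UA" "A ((i \<circ> B) z) = B z" using i(2)[OF w(1)] r(2) by auto
    assume nz: "norm z = 1"
    have "k z \<in> ball (k t) r" using d2(2)[OF nz] z by (simp add: dist_commute)
    then show "(i \<circ> B) z = k z" using i(2)[of "k z"] AkB[OF nz] by simp
  qed (use d1 d2 in auto)
qed

text \<open>The intersection of the two balls is convex and contains an arc around \<open>s\<close>
  on which the functions coincide, so the identity theorem applies.\<close>

lemma local_welding_extensions_agree:
  assumes "f holomorphic_on ball s \<delta>" "g holomorphic_on ball t \<delta>" "\<delta> > 0" "norm s = 1" "norm t = 1" "dist s t < \<delta>"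
    and "\<And>u. u \<in> ball s \<delta> \<Longrightarrow> u \<in> ball t \<delta> \<Longrightarrow> norm u = 1 \<Longrightarrow> f u = g u"
    and "z \<in> ball s \<delta>" "z \<in> ball t \<delta>"
  shows "f z = g z"
proof -
  let ?I = "ball s \<delta> \<inter> ball t \<delta>"
  have "open ?I" "s \<in> ?I" using assms by (auto simp: dist_commute)
  then obtain e where e: "e > 0" "ball s e \<subseteq> ?I" using openE by blast
  have "f z - g z = 0"
  proof (rule analytic_continuation[of "\<lambda>z. f z - g z" ?I "sphere 0 1 \<inter> ball s e" s z])
    show "(\<lambda>z. f z - g z) holomorphic_on ?I"
      using assms(1,2) by (intro holomorphic_intros) (auto intro: holomorphic_on_subset)
    show "connected ?I" by (intro convex_connected convex_Int convex_ball)
    show "s islimpt sphere 0 1 \<inter> ball s e" by (rule islimpt_unit_circle[OF assms(4) e(1)])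
    show "f u - g u = 0" if "u \<in> sphere 0 1 \<inter> ball s e" for u
    proof -
      have "u \<in> ball s \<delta>" "u \<in> ball t \<delta>" "norm u = 1" using that e(2) by auto
      then show ?thesis using assms(7) by simp
    qed
  qed (use assms e \<open>s \<in> ?I\<close> in auto)
  then show ?thesis by simp
qed

text \<open>Otherwise there are pairs of distinct points with equal image that approach the circle.
  By compactness they converge, by injectivity on the circle to the same point, and \<open>K\<close>
  is injective near that point since its derivative is nonzero.\<close>

lemma injective_near_unit_circle:
  assumes K: "K holomorphic_on U" "open U" "sphere 0 1 \<subseteq> U" "\<And>t. norm t = 1 \<Longrightarrow> deriv K t \<noteq> 0"
    and inj: "inj_on K (sphere 0 1)"
  obtains \<eta> where "\<eta> > 0" "{z. \<bar>norm z - 1\<bar> < \<eta>} \<subseteq> U" "inj_on K {z. \<bar>norm z - 1\<bar> < \<eta>}"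
proof -
  have Kc: "continuous_on U K" using K(1) by (rule holomorphic_on_imp_continuous_on)
  obtain e where e: "0 < e" "\<And>x. x \<in> sphere 0 1 \<Longrightarrow> \<exists>G \<in> {U}. ball x e \<subseteq> G"
    using Heine_Borel_lemma[OF compact_sphere[of "0::complex" 1], of "{U}"] K(2,3) by auto
  have sub: "{z. \<bar>norm z - 1\<bar> < \<eta>} \<subseteq> U" if "\<eta> \<le> min e 1" for \<eta>
  proof
    fix z :: complex assume z: "z \<in> {z. \<bar>norm z - 1\<bar> < \<eta>}"
    then have "z \<noteq> 0" using that by auto
    then have "sgn z \<in> sphere 0 1" "z \<in> ball (sgn z) e" using z that dist_sgn[of z] by (auto simp: norm_sgn)
    then show "z \<in> U" using e(2) by blast
  qed
  have "\<exists>n. inj_on K {z. \<bar>norm z - 1\<bar> < min e 1 / (real n + 1)}"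
  proof (rule ccontr)
    assume "\<not> ?thesis"
    then have "\<forall>n. \<exists>z w. \<bar>norm z - 1\<bar> < min e 1 / (real n + 1) \<and> \<bar>norm w - 1\<bar> < min e 1 / (real n + 1) \<and> K z = K w \<and> z \<noteq> w"
      unfolding inj_on_def by (metis (no_types, lifting) mem_Collect_eq)
    then obtain x y where xy: "\<And>n. \<bar>norm (x n) - 1\<bar> < min e 1 / (real n + 1)"
      "\<And>n. \<bar>norm (y n) - 1\<bar> < min e 1 / (real n + 1)" "\<And>n. K (x n) = K (y n)" "\<And>n. x n \<noteq> y n" by metis
    have le1: "min e 1 / (real n + 1) \<le> 1" for n using e(1) by (simp add: field_simps min_def)
    have "x n \<in> cball 0 2" "y n \<in> cball 0 2" for n
      using less_le_trans[OF xy(1)[of n] le1[of n]] less_le_trans[OF xy(2)[of n] le1[of n]] by auto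
    then have "\<forall>n. (x n, y n) \<in> cball 0 2 \<times> cball 0 2" by auto
    moreover have "seq_compact (cball (0::complex) 2 \<times> cball (0::complex) 2)"
      by (intro compact_imp_seq_compact compact_Times compact_cball)
    ultimately obtain l r where l: "strict_mono (r::nat\<Rightarrow>nat)" "((\<lambda>n. (x n, y n)) \<circ> r) \<longlonglongrightarrow> l"
      using seq_compactE[of "cball (0::complex) 2 \<times> cball (0::complex) 2" "\<lambda>n. (x n, y n)"] by metis
    have lx: "(\<lambda>n. x (r n)) \<longlonglongrightarrow> fst l" and ly: "(\<lambda>n. y (r n)) \<longlonglongrightarrow> snd l"
      using tendsto_fst[OF l(2)] tendsto_snd[OF l(2)] by (simp_all add: o_def)
    have z0: "(\<lambda>n. min e 1 / (real (r n) + 1)) \<longlonglongrightarrow> 0"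
    proof -
      have "(\<lambda>n. min e 1 / (real n + 1)) \<longlonglongrightarrow> 0" by real_asymp
      then show ?thesis using LIMSEQ_subseq_LIMSEQ[OF _ l(1)] by (auto simp: o_def)
    qed
    have on: "norm v = 1" if "(\<lambda>n. u (r n)) \<longlonglongrightarrow> v" "\<And>n. \<bar>norm (u n) - 1\<bar> < min e 1 / (real n + 1)"
      for u :: "nat \<Rightarrow> complex" and v
    proof -
      have "(\<lambda>n. norm (u (r n)) - 1) \<longlonglongrightarrow> 0"
        by (rule Lim_null_comparison[OF _ z0]) (use that(2) in \<open>auto intro!: always_eventually less_imp_le\<close>)
      moreover have "(\<lambda>n. norm (u (r n)) - 1) \<longlonglongrightarrow> norm v - 1" using that(1) by (intro tendsto_intros)
      ultimately show ?thesis using LIMSEQ_unique by fastforce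
    qed
    have n1: "norm (fst l) = 1" "norm (snd l) = 1" using on[OF lx xy(1)] on[OF ly xy(2)] by auto
    have cK: "isCont K v" if "norm v = 1" for v
      using Kc K(2,3) that by (auto simp: continuous_on_eq_continuous_at)
    have "(\<lambda>n. K (x (r n))) \<longlonglongrightarrow> K (fst l)" "(\<lambda>n. K (y (r n))) \<longlonglongrightarrow> K (snd l)"
      using isCont_tendsto_compose[OF cK lx] isCont_tendsto_compose[OF cK ly] n1 by auto
    then have "K (fst l) = K (snd l)" using xy(3) LIMSEQ_unique by auto
    then have same: "snd l = fst l" using inj n1 by (auto simp: inj_on_def)
    obtain d where d: "d > 0" "ball (fst l) d \<subseteq> U" "inj_on K (ball (fst l) d)"
      using has_complex_derivative_locally_injective[OF K(1) _ K(2) K(4)[OF n1(1)]] K(3) n1(1)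
      by (metis mem_sphere_0 subsetD)
    have "eventually (\<lambda>n. x (r n) \<in> ball (fst l) d) sequentially" "eventually (\<lambda>n. y (r n) \<in> ball (fst l) d) sequentially"
      using tendstoD[OF lx d(1)] tendstoD[OF ly d(1)] same by (simp_all add: dist_commute)
    then have "eventually (\<lambda>n. x (r n) \<in> ball (fst l) d \<and> y (r n) \<in> ball (fst l) d) sequentially"
      by (rule eventually_conj)
    then have "\<exists>n. x (r n) \<in> ball (fst l) d \<and> y (r n) \<in> ball (fst l) d"
      by (rule eventually_happens'[OF sequentially_bot])
    then obtain n where "x (r n) \<in> ball (fst l) d" "y (r n) \<in> ball (fst l) d" by blast
    then show False using d(3) xy(3,4) unfolding inj_on_def by blast
  qed
  then obtain n where n: "inj_on K {z. \<bar>norm z - 1\<bar> < min e 1 / (real n + 1)}" by blast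
  show ?thesis
  proof (rule that[OF _ sub n])
    show "0 < min e 1 / (real n + 1)" using e(1) by simp
    have "m / (real n + 1) \<le> m" if "m > 0" for m :: real using that by (simp add: divide_le_eq)
    from this[of "min e 1"] show "min e 1 / (real n + 1) \<le> min e 1" using e(1)
      by (simp only: min_less_iff_conj zero_less_one simp_thms)
  qed
qed

text \<open>A Lebesgue number gives local branches on balls of one common radius around all points
  of the circle; at \<open>z\<close> the branch centred at the nearest circle point
  \<open>sgn z\<close> is taken. The chain rule for \<open>A (K z) = B z\<close> gives
  \<open>K\<close> nonzero derivative, so it is injective near the circle.\<close>

lemma welding_extension:
  assumes A: "A holomorphic_on UA" "open UA" "sphere 0 1 \<subseteq> UA" "\<And>t. norm t = 1 \<Longrightarrow> deriv A t \<noteq> 0"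
    and B: "B holomorphic_on UB" "open UB" "sphere 0 1 \<subseteq> UB" "\<And>t. norm t = 1 \<Longrightarrow> deriv B t \<noteq> 0"
    and k: "continuous_on (sphere 0 1) k" "inj_on k (sphere 0 1)" "k ` sphere 0 1 = sphere 0 1"
    and AkB: "\<And>t. norm t = 1 \<Longrightarrow> A (k t) = B t"
  obtains V K where "open V" "sphere 0 1 \<subseteq> V" "K holomorphic_on V" "inj_on K V" "V \<subseteq> UB" "K ` V \<subseteq> UA"
    "\<And>t. norm t = 1 \<Longrightarrow> K t = k t" "\<And>z. z \<in> V \<Longrightarrow> A (K z) = B z"
proof -
  define good where "good t \<delta> \<kappa> \<longleftrightarrow> \<delta> > 0 \<and> ball t \<delta> \<subseteq> UB \<and> \<kappa> holomorphic_on ball t \<delta> \<and>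
     (\<forall>z\<in>ball t \<delta>. \<kappa> z \<in> UA \<and> A (\<kappa> z) = B z) \<and> (\<forall>s\<in>ball t \<delta>. norm s = 1 \<longrightarrow> \<kappa> s = k s)" for t \<delta> \<kappa>
  have "\<forall>t. norm t = 1 \<longrightarrow> (\<exists>\<delta> \<kappa>. good t \<delta> \<kappa>)"
    unfolding good_def using local_welding_extension[OF A B(1-3) k(1,3) AkB] by blast
  then obtain d where "\<forall>t. norm t = 1 \<longrightarrow> (\<exists>\<kappa>. good t (d t) \<kappa>)" by metis
  then obtain \<kappa>0 where dk: "\<And>t. norm t = 1 \<Longrightarrow> good t (d t) (\<kappa>0 t)" by metis
  have "\<exists>e>0. \<forall>x\<in>sphere 0 1. \<exists>t. norm t = 1 \<and> ball x e \<subseteq> ball t (d t)"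
  proof (rule Heine_Borel_lemma[OF compact_sphere[of "0::complex" 1], of "(\<lambda>t. ball t (d t)) ` sphere 0 1"])
    show "sphere 0 1 \<subseteq> \<Union> ((\<lambda>t. ball t (d t)) ` sphere 0 1)"
    proof
      fix t :: complex assume "t \<in> sphere 0 1"
      then have "t \<in> ball t (d t)" "t \<in> sphere 0 1" using dk[of t] by (auto simp: good_def)
      then show "t \<in> \<Union> ((\<lambda>t. ball t (d t)) ` sphere 0 1)" by blast
    qed
    fix e :: real assume "e > 0" "\<And>x. x \<in> sphere 0 1 \<Longrightarrow> \<exists>G\<in>(\<lambda>t. ball t (d t)) ` sphere 0 1. ball x e \<subseteq> G"
    then show ?thesis by (intro exI[of _ e]) fastforce
  qed auto
  then obtain e where e: "0 < e" "\<And>x. norm x = 1 \<Longrightarrow> \<exists>t. norm t = 1 \<and> ball x e \<subseteq> ball t (d t)"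
    by (metis mem_sphere_0)
  define \<delta> where "\<delta> = min e 1"
  have \<delta>: "\<delta> > 0" "\<delta> \<le> 1" using e(1) by (auto simp: \<delta>_def)
  have ex_good: "\<forall>s. norm s = 1 \<longrightarrow> (\<exists>\<kappa>. good s \<delta> \<kappa>)"
  proof (intro allI impI)
    fix s :: complex assume s: "norm s = 1"
    then obtain t where t: "norm t = 1" "ball s e \<subseteq> ball t (d t)" using e(2)[OF s] by blast
    have "ball s \<delta> \<subseteq> ball t (d t)" using t(2) by (auto simp: \<delta>_def)
    then have "good s \<delta> (\<kappa>0 t)" using dk[OF t(1)] \<delta>(1) unfolding good_def
      by (meson holomorphic_on_subset order_trans subsetD)
    then show "\<exists>\<kappa>. good s \<delta> \<kappa>" by blast
  qed
  then obtain \<kappa> where \<kappa>: "\<And>s. norm s = 1 \<Longrightarrow> good s \<delta> (\<kappa> s)" by metis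
  define K where "K z = \<kappa> (sgn z) z" for z
  \<comment> \<open>With half the radius, any centre within \<open>\<delta> / 2\<close> of
    \<open>z\<close> is within \<open>\<delta>\<close> of \<open>sgn z\<close>, as the agreement of
    two branches demands.\<close>
  define V0 where "V0 = {z::complex. \<bar>norm z - 1\<bar> < \<delta> / 2}"
  have oV0: "open V0" unfolding V0_def by (intro open_Collect_less continuous_intros)
  have Veq: "K z = \<kappa> s z" "z \<in> ball s \<delta>" if z: "z \<in> V0" and s: "norm s = 1" "dist s z < \<delta> / 2" for z s
  proof -
    have z0: "z \<noteq> 0" using z \<delta> by (auto simp: V0_def)
    have n: "norm (sgn z) = 1" using z0 by (simp add: norm_sgn)
    have ds: "dist (sgn z) z < \<delta> / 2" using dist_sgn[OF z0] z by (simp add: V0_def)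
    then have ss: "dist (sgn z) s < \<delta>" using s(2) dist_triangle_half_r[of z "sgn z" \<delta> s] by (simp add: dist_commute)
    note g1 = \<kappa>[OF n, unfolded good_def] and g2 = \<kappa>[OF s(1), unfolded good_def]
    show "K z = \<kappa> s z" unfolding K_def
    proof (rule local_welding_extensions_agree[where f = "\<kappa> (sgn z)" and g = "\<kappa> s", OF _ _ \<delta>(1) n s(1) ss])
      show "\<kappa> (sgn z) holomorphic_on ball (sgn z) \<delta>" "\<kappa> s holomorphic_on ball s \<delta>" using g1 g2 by blast+
      show "\<kappa> (sgn z) u = \<kappa> s u" if "u \<in> ball (sgn z) \<delta>" "u \<in> ball s \<delta>" "norm u = 1" for u
        using g1 g2 that by simp
      show "z \<in> ball (sgn z) \<delta>" "z \<in> ball s \<delta>" using ds s(2) \<delta>(1) by auto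
    qed
    show "z \<in> ball s \<delta>" using s(2) \<delta> by auto
  qed
  have Vs: "norm (sgn z) = 1" "dist (sgn z) z < \<delta> / 2" if "z \<in> V0" for z
  proof -
    have z0: "z \<noteq> 0" using that \<delta> by (auto simp: V0_def)
    show "norm (sgn z) = 1" using z0 by (simp add: norm_sgn)
    show "dist (sgn z) z < \<delta> / 2" using dist_sgn[OF z0] that by (simp add: V0_def)
  qed
  have Kh: "K holomorphic_on V0"
    unfolding holomorphic_on_open[OF oV0] 
  proof
    fix z assume z: "z \<in> V0"
    define s where "s = sgn z"
    have s: "norm s = 1" "dist s z < \<delta> / 2" using Vs[OF z] by (auto simp: s_def)
    have "K holomorphic_on V0 \<inter> ball s (\<delta>/2)"
    proof (rule holomorphic_transform[of "\<kappa> s"])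
      show "\<kappa> s holomorphic_on V0 \<inter> ball s (\<delta>/2)"
        using \<kappa>[OF s(1)] \<delta> unfolding good_def by (auto intro: holomorphic_on_subset)
    qed (use Veq s in auto)
    then show "\<exists>f'. (K has_field_derivative f') (at z)"
      using z s oV0 by (metis IntI field_differentiable_def holomorphic_on_imp_differentiable_at mem_ball open_Int open_ball)
  qed
  have KA: "K z \<in> UA \<and> A (K z) = B z \<and> z \<in> UB" if "z \<in> V0" for z
    using Veq[OF that Vs[OF that]] \<kappa>[OF Vs(1)[OF that]] unfolding good_def by (metis subsetD)
  have TV: "sphere 0 1 \<subseteq> V0" using \<delta> by (auto simp: V0_def)
  have Kk: "K t = k t" if t: "norm t = 1" for t
  proof -
    have "sgn t = t" using t by (simp add: sgn_eq)
    then show ?thesis using \<kappa>[OF t] t \<delta> by (auto simp: K_def good_def)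
  qed
  have dK: "deriv K t \<noteq> 0" if t: "norm t = 1" for t
  proof -
    have tV: "t \<in> V0" using TV t by auto
    have "(K has_field_derivative deriv K t) (at t)" using Kh oV0 tV by (rule holomorphic_derivI)
    moreover have "(A has_field_derivative deriv A (K t)) (at (K t))"
      using A(1,2) KA[OF tV] by (intro holomorphic_derivI) auto
    ultimately have "((\<lambda>z. A (K z)) has_field_derivative deriv A (K t) * deriv K t) (at t)"
      by (intro DERIV_chain2[where f = A and g = K])
    then have "(B has_field_derivative deriv A (K t) * deriv K t) (at t)"
      by (rule has_field_derivative_transform_within_open[OF _ oV0 tV]) (use KA in auto)
    then have "deriv B t = deriv A (K t) * deriv K t" by (rule DERIV_imp_deriv)
    then show ?thesis using B(4)[OF t] by auto
  qed
  have injK: "inj_on K (sphere 0 1)" using k(2) Kk by (auto simp: inj_on_def)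
  obtain \<eta> where \<eta>: "\<eta> > 0" "{z. \<bar>norm z - 1\<bar> < \<eta>} \<subseteq> V0" "inj_on K {z. \<bar>norm z - 1\<bar> < \<eta>}"
    using injective_near_unit_circle[OF Kh oV0 TV dK injK] by blast
  show ?thesis
  proof (rule that[OF _ _ holomorphic_on_subset[OF Kh \<eta>(2)] \<eta>(3) _ _ Kk])
    show "open {z::complex. \<bar>norm z - 1\<bar> < \<eta>}" by (intro open_Collect_less continuous_intros)
  qed (use \<eta> KA in auto)
qed

subsection \<open>Partial weldings\<close>

abbreviation (input) collar :: "real \<Rightarrow> complex set" where
  "collar R \<equiv> {w. 1 \<le> norm w \<and> norm w < R}"

text \<open>Gluing the closed unit disc to the collar \<open>1 \<le> |w| < R\<close> along \<open>k\<close> gives a Riemann surface;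
  a holomorphic function on it is a pair \<open>f\<close>, \<open>g\<close> with matching values on the seam
  (holomorphy across the seam is automatic when \<open>k\<close> is analytic).\<close>

definition glued :: "(complex \<Rightarrow> complex) \<Rightarrow> real \<Rightarrow> (complex \<Rightarrow> complex) \<Rightarrow> (complex \<Rightarrow> complex) \<Rightarrow> bool" where
  "glued k R f g \<longleftrightarrow> continuous_on (cball 0 1) f \<and> f holomorphic_on ball 0 1 \<and>
     continuous_on (collar R) g \<and> g holomorphic_on annulus 1 R \<and> (\<forall>t. norm t = 1 \<longrightarrow> g (k t) = f t)"

text \<open>An injective holomorphic function on the glued surface. The disjointness clause pairs
  the open disc with the collar, so that the seam, which lies in both closed pieces, is counted
  once.\<close>

definition weld :: "(complex \<Rightarrow> complex) \<Rightarrow> real \<Rightarrow> (complex \<Rightarrow> complex) \<Rightarrow> (complex \<Rightarrow> complex) \<Rightarrow> bool" where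
  "weld k R f g \<longleftrightarrow> glued k R f g \<and> inj_on f (cball 0 1) \<and> inj_on g (collar R) \<and>
     (\<forall>z w. norm z < 1 \<longrightarrow> w \<in> collar R \<longrightarrow> f z \<noteq> g w)"

definition weld_image :: "real \<Rightarrow> (complex \<Rightarrow> complex) \<Rightarrow> (complex \<Rightarrow> complex) \<Rightarrow> complex set" where
  "weld_image R f g = f ` ball 0 1 \<union> g ` collar R"

text \<open>A topological model of the surface over \<open>ball 0 R\<close>, with \<open>k\<close>
  extended radially to the collar. It is merely continuous and injective; by invariance of domain
  this is enough to see that the image of a welding is open and simply connected.\<close>

definition weld_map :: "(complex \<Rightarrow> complex) \<Rightarrow> (complex \<Rightarrow> complex) \<Rightarrow> (complex \<Rightarrow> complex) \<Rightarrow> complex \<Rightarrow> complex" where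
  "weld_map k f g z = (if norm z \<le> 1 then f z else g (of_real (norm z) * k (sgn z)))"

lemma glued_subset: "glued k R f g \<Longrightarrow> R' \<le> R \<Longrightarrow> glued k R' f g"
  unfolding glued_def by (auto intro: continuous_on_subset holomorphic_on_subset)

lemma weld_subset: "weld k R f g \<Longrightarrow> R' \<le> R \<Longrightarrow> weld k R' f g"
  unfolding weld_def by (auto intro: glued_subset inj_on_subset)

text \<open>\<open>K\<close> continues \<open>k\<close> holomorphically across the circle; the last
  two assumptions say that it keeps the two sides apart, so \<open>k\<close> preserves
  orientation.\<close>

locale analytic_welding =
  fixes k K :: "complex \<Rightarrow> complex" and V :: "complex set"
  assumes k_cont: "continuous_on (sphere 0 1) k" and k_inj: "inj_on k (sphere 0 1)"
    and k_im: "k ` sphere 0 1 = sphere 0 1"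
    and V_open: "open V" and V_circle: "sphere 0 1 \<subseteq> V" and K_hol: "K holomorphic_on V" and K_inj: "inj_on K V"
    and K_k: "\<And>t. norm t = 1 \<Longrightarrow> K t = k t"
    and K_in: "\<And>z. z \<in> V \<Longrightarrow> norm z < 1 \<Longrightarrow> norm (K z) < 1"
    and K_out: "\<And>z. z \<in> V \<Longrightarrow> norm z > 1 \<Longrightarrow> norm (K z) > 1"
begin

lemma norm_k [simp]: "norm t = 1 \<Longrightarrow> norm (k t) = 1"
  using k_im by auto

lemma norm_k_sgn [simp]: "1 \<le> norm z \<Longrightarrow> norm (k (sgn z)) = 1"
  by (rule norm_k) (auto simp: norm_sgn)

lemma k_surj: "norm u = 1 \<Longrightarrow> \<exists>t. norm t = 1 \<and> k t = u"
  using k_im by (metis imageE mem_sphere_0)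

lemma K_cont: "continuous_on V K"
  using K_hol by (rule holomorphic_on_imp_continuous_on)

definition seam_nbhd :: "real \<Rightarrow> complex set" where
  "seam_nbhd R = {z \<in> V. norm (K z) < R}"

text \<open>The pair \<open>f\<close>, \<open>g\<close> in a chart across the seam: the disc
  coordinate is used on both sides, and the collar is read through \<open>K\<close>.\<close>

definition seam_fun :: "(complex \<Rightarrow> complex) \<Rightarrow> (complex \<Rightarrow> complex) \<Rightarrow> complex \<Rightarrow> complex" where
  "seam_fun f g z = (if norm z \<le> 1 then f z else g (K z))"

lemma seam_nbhd: "R > 1 \<Longrightarrow> open (seam_nbhd R)" "R > 1 \<Longrightarrow> sphere 0 1 \<subseteq> seam_nbhd R" "seam_nbhd R \<subseteq> V"
proof -
  have "open (V \<inter> K -` ball 0 R)" by (rule continuous_open_preimage[OF K_cont V_open open_ball])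
  moreover have "V \<inter> K -` ball 0 R = seam_nbhd R" by (auto simp: seam_nbhd_def)
  ultimately show "open (seam_nbhd R)" by simp
qed (use V_circle K_k in \<open>auto simp: seam_nbhd_def subset_iff\<close>)

text \<open>The two halves match on the circle because \<open>g (k t) = f t\<close>, so the function
  is continuous, and a circle is removable for continuous functions. For \<open>R \<le> 1\<close>
  there is no collar, and the neighbourhood lies inside the open disc.\<close>

lemma seam_holomorphic:
  assumes fg: "glued k R f g"
  shows "seam_fun f g holomorphic_on seam_nbhd R"
proof (cases "R > 1")
  case False
  then show ?thesis
  proof -
    have mem: "seam_fun f g z = f z \<and> norm z < 1" if "z \<in> seam_nbhd R" for z
    proof -
      have "norm (K z) < 1" "z \<in> V" using that False by (auto simp: seam_nbhd_def)
      then have "norm z < 1" 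
      proof -
        assume a: "norm (K z) < 1" "z \<in> V"
        consider "norm z < 1" | "norm z = 1" | "norm z > 1" by linarith
        then show ?thesis by cases (use a K_out[of z] K_k[of z] norm_k[of z] in auto)
      qed
      then show ?thesis by (simp add: seam_fun_def)
    qed
    have fh: "f holomorphic_on ball 0 1" using fg by (simp add: glued_def)
    have "seam_nbhd R \<subseteq> ball 0 1"
    proof
      fix z assume "z \<in> seam_nbhd R"
      from mem[OF this] show "z \<in> ball 0 1" by simp
    qed
    then have "f holomorphic_on seam_nbhd R" by (rule holomorphic_on_subset[OF fh])
    then show ?thesis by (rule holomorphic_transform) (use mem in metis)
  qed
next
  case R: True
  have f: "continuous_on (cball 0 1) f" "f holomorphic_on ball 0 1"
    and g: "continuous_on (collar R) g" "g holomorphic_on annulus 1 R" "\<And>t. norm t = 1 \<Longrightarrow> g (k t) = f t"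
    using fg by (auto simp: glued_def)
  have Kge: "1 \<le> norm (K z)" if "z \<in> V" "1 \<le> norm z" for z
    using K_out[OF that(1)] K_k[of z] norm_k[of z] that(2) by (cases "norm z = 1") auto
  show ?thesis
  proof (rule holomorphic_paste_unit_circle[OF seam_nbhd(1)[OF R]])
    show "continuous_on (seam_nbhd R) (seam_fun f g)" unfolding seam_fun_def
    proof (rule continuous_on_cases_le)
      show "continuous_on {z \<in> seam_nbhd R. norm z \<le> 1} f" using f(1) by (rule continuous_on_subset) auto
      show "continuous_on {z \<in> seam_nbhd R. 1 \<le> norm z} (\<lambda>z. g (K z))"
        by (rule continuous_on_compose2[OF g(1) continuous_on_subset[OF K_cont]])
           (use Kge in \<open>auto simp: seam_nbhd_def\<close>)
      show "f z = g (K z)" if "z \<in> seam_nbhd R" "norm z = 1" for z using g(3) K_k that by simp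
    qed (auto intro: continuous_intros)
    have oin: "open {z \<in> seam_nbhd R. norm z < 1}" "open {z \<in> seam_nbhd R. norm z > 1}"
      using seam_nbhd(1)[OF R] by (auto simp: Collect_conj_eq intro!: open_Int open_Collect_less continuous_intros)
    have h1: "seam_fun f g holomorphic_on {z \<in> seam_nbhd R. norm z < 1}"
      by (rule holomorphic_transform[of f]) (auto simp: seam_fun_def intro: holomorphic_on_subset[OF f(2)])
    have h2: "seam_fun f g holomorphic_on {z \<in> seam_nbhd R. norm z > 1}"
    proof (rule holomorphic_transform[of "\<lambda>z. g (K z)"])
      show "(\<lambda>z. g (K z)) holomorphic_on {z \<in> seam_nbhd R. norm z > 1}"
        by (rule holomorphic_on_compose_gen[OF holomorphic_on_subset[OF K_hol] g(2), unfolded o_def])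
           (use K_out in \<open>auto simp: seam_nbhd_def\<close>)
    qed (auto simp: seam_fun_def)
    have "seam_fun f g holomorphic_on {z \<in> seam_nbhd R. norm z < 1} \<union> {z \<in> seam_nbhd R. norm z > 1}"
      by (rule holomorphic_on_Un[OF h1 h2 oin])
    then show "seam_fun f g holomorphic_on seam_nbhd R - sphere 0 1"
      by (rule holomorphic_on_subset) auto
  qed
qed

lemma seam_inj:
  assumes fg: "weld k R f g"
  shows "inj_on (seam_fun f g) (seam_nbhd R)"
proof (rule inj_onI)
  fix z w assume zw: "z \<in> seam_nbhd R" "w \<in> seam_nbhd R" "seam_fun f g z = seam_fun f g w"
  have f: "inj_on f (cball 0 1)" and g: "inj_on g (collar R)"
    and fg': "\<And>z w. norm z < 1 \<Longrightarrow> w \<in> collar R \<Longrightarrow> f z \<noteq> g w" and gk: "\<And>t. norm t = 1 \<Longrightarrow> g (k t) = f t"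
    using fg by (auto simp: weld_def glued_def)
  have V: "z \<in> V" "w \<in> V" "norm (K z) < R" "norm (K w) < R" using zw by (auto simp: seam_nbhd_def)
  have mixed: False if "norm x \<le> 1" "norm y > 1" "x \<in> V" "y \<in> V" "norm (K x) < R" "norm (K y) < R" "f x = g (K y)" for x y
  proof -
    have Ky: "norm (K y) > 1" using K_out that by blast
    show False
    proof (cases "norm x = 1")
      case True
      then have "g (k x) = g (K y)" using gk that by simp
      then have "k x = K y" using g True Ky that by (auto simp: inj_on_def)
      then show False using Ky True by (metis norm_k less_irrefl)
    qed (use fg'[of x "K y"] that Ky in auto)
  qed
  show "z = w"
  proof (cases "norm z \<le> 1"; cases "norm w \<le> 1")
    assume "norm z \<le> 1" "norm w \<le> 1"
    then show ?thesis using f zw by (auto simp: seam_fun_def inj_on_def)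
  next
    assume "norm z \<le> 1" "\<not> norm w \<le> 1"
    then show ?thesis using mixed[of z w] V zw by (auto simp: seam_fun_def)
  next
    assume "\<not> norm z \<le> 1" "norm w \<le> 1"
    then show ?thesis using mixed[of w z] V zw by (auto simp: seam_fun_def)
  next
    assume n: "\<not> norm z \<le> 1" "\<not> norm w \<le> 1"
    then have "norm (K z) > 1" "norm (K w) > 1" using K_out V by auto
    then have "K z = K w" using g V zw n by (auto simp: seam_fun_def inj_on_def)
    then show ?thesis using K_inj V by (auto simp: inj_on_def)
  qed
qed

lemma weld_map_continuous:
  assumes fg: "glued k R f g"
  shows "continuous_on (ball 0 R) (weld_map k f g)"
  unfolding weld_map_def
proof (rule continuous_on_cases_le)
  have f: "continuous_on (cball 0 1) f" and g: "continuous_on (collar R) g" "\<And>t. norm t = 1 \<Longrightarrow> g (k t) = f t"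
    using fg by (auto simp: glued_def)
  show "continuous_on {z \<in> ball 0 R. norm z \<le> 1} f" using f by (rule continuous_on_subset) auto
  have "continuous_on {z \<in> ball 0 R. 1 \<le> norm z} (\<lambda>z. of_real (norm z) * k (sgn z))"
    by (intro continuous_intros continuous_on_compose2[OF k_cont]) (auto simp: norm_sgn)
  then show "continuous_on {z \<in> ball 0 R. 1 \<le> norm z} (\<lambda>z. g (of_real (norm z) * k (sgn z)))"
    by (rule continuous_on_compose2[OF g(1)]) (auto simp: norm_mult norm_sgn)
  show "f z = g (of_real (norm z) * k (sgn z))" if "z \<in> ball 0 R" "norm z = 1" for z
    using g(2) that by (simp add: sgn_eq)
qed (auto intro: continuous_intros)

lemma collar_param:
  assumes "w \<in> collar R"
  obtains z where "norm z = norm w" "w = of_real (norm z) * k (sgn z)" "z \<noteq> 0"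
proof -
  have w0: "w \<noteq> 0" using assms by auto
  then obtain t where t: "norm t = 1" "k t = sgn w" using k_surj[of "sgn w"] by (auto simp: norm_sgn)
  define z where "z = of_real (norm w) * t"
  have nz: "norm z = norm w" using t by (simp add: z_def norm_mult)
  then have "sgn z = t" using w0 by (simp add: sgn_eq) (simp add: z_def)
  then have "w = of_real (norm z) * k (sgn z)" using t nz w0 by (simp add: sgn_eq)
  then show ?thesis using that nz w0 by force
qed

lemma weld_map_image:
  assumes "R > 1" "glued k R f g"
  shows "weld_map k f g ` ball 0 R = weld_image R f g"
proof -
  have gk: "\<And>t. norm t = 1 \<Longrightarrow> g (k t) = f t" using assms by (auto simp: glued_def)
  show ?thesis
  proof (intro equalityI subsetI)
    fix p assume "p \<in> weld_map k f g ` ball 0 R"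
    then obtain z where z: "norm z < R" "p = weld_map k f g z" by auto
    show "p \<in> weld_image R f g"
    proof (cases "norm z < 1")
      case True then show ?thesis using z by (auto simp: weld_map_def weld_image_def)
    next
      case False
      then have "z \<noteq> 0" by auto
      then have "p = g (of_real (norm z) * k (sgn z))"
        using z gk[of z] False by (cases "norm z = 1") (auto simp: weld_map_def sgn_eq)
      moreover have "norm (of_real (norm z) * k (sgn z)) = norm z" using \<open>z \<noteq> 0\<close> by (simp add: norm_mult norm_sgn)
      ultimately show ?thesis using z False unfolding weld_image_def by (intro UnI2) auto
    qed
  next
    fix p assume "p \<in> weld_image R f g"
    then consider z where "norm z < 1" "p = f z" | w where "w \<in> collar R" "p = g w" by (auto simp: weld_image_def)
    then show "p \<in> weld_map k f g ` ball 0 R"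
    proof cases
      case 1 then show ?thesis using assms(1) by (intro image_eqI[of _ _ z]) (auto simp: weld_map_def)
    next
      case 2
      obtain z where z: "norm z = norm w" "w = of_real (norm z) * k (sgn z)" "z \<noteq> 0"
        by (rule collar_param[OF 2(1)])
      have "p = weld_map k f g z"
      proof (cases "norm z = 1")
        case True
        then have "sgn z = z" by (simp add: sgn_eq)
        then have "w = k z" by (metis True mult_1 of_real_1 z(2))
        then show ?thesis using 2 gk True by (simp add: weld_map_def)
      next
        case False
        then have "\<not> norm z \<le> 1" using 2(1) z(1) by auto
        then have "weld_map k f g z = g (of_real (norm z) * k (sgn z))" by (simp only: weld_map_def if_False)
        then show ?thesis using 2(2) z(2) by metis
      qed
      then show ?thesis using 2(1) z(1) by (intro image_eqI[of _ _ z]) auto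
    qed
  qed
qed

lemma weld_map_inj:
  assumes fg: "weld k R f g"
  shows "inj_on (weld_map k f g) (ball 0 R)"
proof (rule inj_onI)
  fix z w :: complex assume zw: "z \<in> ball 0 R" "w \<in> ball 0 R" "weld_map k f g z = weld_map k f g w"
  have f: "inj_on f (cball 0 1)" and g: "inj_on g (collar R)"
    and fg': "\<And>z w. norm z < 1 \<Longrightarrow> w \<in> collar R \<Longrightarrow> f z \<noteq> g w" and gk: "\<And>t. norm t = 1 \<Longrightarrow> g (k t) = f t"
    using fg by (auto simp: weld_def glued_def)
  define c where "c z = of_real (norm z) * k (sgn z)" for z
  have nc: "norm (c z) = norm z" if "norm z \<ge> 1" for z
    using that by (auto simp: c_def norm_mult norm_sgn)
  have wm: "weld_map k f g z = (if norm z < 1 then f z else g (c z))" for z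
    using gk[of z] by (auto simp: weld_map_def c_def sgn_eq)
  show "z = w"
  proof (cases "norm z < 1"; cases "norm w < 1")
    assume "norm z < 1" "norm w < 1"
    then show ?thesis using f zw by (auto simp: wm inj_on_def)
  next
    assume "norm z < 1" "\<not> norm w < 1"
    then show ?thesis using fg'[of z "c w"] nc[of w] zw by (auto simp: wm)
  next
    assume "\<not> norm z < 1" "norm w < 1"
    then show ?thesis using fg'[of w "c z"] nc[of z] zw by (auto simp: wm)
  next
    assume n: "\<not> norm z < 1" "\<not> norm w < 1"
    then have eq: "c z = c w" using g nc[of z] nc[of w] zw by (auto simp: wm inj_on_def)
    then have nn: "norm z = norm w" using nc[of z] nc[of w] n by simp
    have z0: "z \<noteq> 0" "w \<noteq> 0" using n by auto
    then have "k (sgn z) = k (sgn w)" using eq nn by (simp add: c_def)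
    then have "sgn z = sgn w" using k_inj z0 by (auto simp: inj_on_def norm_sgn)
    then show ?thesis using nn z0 by (metis norm_sgn scaleR_cancel_left sgn_div_norm inverse_eq_iff_eq norm_eq_zero nonzero_inverse_eq_imp_eq inverse_zero_imp_zero)
  qed
qed

lemma weld_image_simply_connected:
  assumes "R > 1" "weld k R f g"
  shows "open (weld_image R f g)" "simply_connected (weld_image R f g)"
proof -
  have c: "continuous_on (ball 0 R) (weld_map k f g)" using assms by (intro weld_map_continuous) (auto simp: weld_def)
  have i: "inj_on (weld_map k f g) (ball 0 R)" by (rule weld_map_inj[OF assms(2)])
  have im: "weld_map k f g ` ball 0 R = weld_image R f g" using assms by (intro weld_map_image) (auto simp: weld_def)
  show "open (weld_image R f g)" using invariance_of_domain_gen[OF open_ball c i] im by simp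
  obtain h where "homeomorphism (ball 0 R) (weld_map k f g ` ball 0 R) (weld_map k f g) h"
    by (rule invariance_of_domain_homeomorphism[OF open_ball c _ i]) auto
  then have "ball (0::complex) R homeomorphic weld_image R f g" unfolding im homeomorphic_def by blast
  moreover have "simply_connected (ball (0::complex) R)" by (simp add: convex_imp_simply_connected)
  ultimately show "simply_connected (weld_image R f g)" using homeomorphic_simply_connected by blast
qed

text \<open>A function on the surface becomes a function on the plane domain occupied by a welding.
  The domain is covered by the open images of the disc, the open collar and the seam neighbourhood;
  on each of them the function is the composition with a univalent inverse.\<close>

lemma transfer_glued:
  assumes R: "R > 1" and fg: "weld k R f g" and fg': "glued k R f' g'"
  obtains \<Psi> where "\<Psi> holomorphic_on weld_image R f g" "\<And>z. norm z \<le> 1 \<Longrightarrow> \<Psi> (f z) = f' z"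
    "\<And>w. w \<in> collar R \<Longrightarrow> \<Psi> (g w) = g' w"
proof -
  have f: "continuous_on (cball 0 1) f" "f holomorphic_on ball 0 1" "inj_on f (cball 0 1)"
    and g: "continuous_on (collar R) g" "g holomorphic_on annulus 1 R" "inj_on g (collar R)"
    and disj: "\<And>z w. norm z < 1 \<Longrightarrow> w \<in> collar R \<Longrightarrow> f z \<noteq> g w" and gk: "\<And>t. norm t = 1 \<Longrightarrow> g (k t) = f t"
    using fg by (auto simp: weld_def glued_def)
  have f': "f' holomorphic_on ball 0 1" and g': "g' holomorphic_on annulus 1 R" and gk': "\<And>t. norm t = 1 \<Longrightarrow> g' (k t) = f' t"
    using fg' by (auto simp: glued_def)
  define \<Psi> where "\<Psi> p = (if p \<in> f ` ball 0 1 then f' (inv_into (ball 0 1) f p) else g' (inv_into (collar R) g p))" for p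
  have fi: "inj_on f (ball 0 1)" using f(3) by (rule inj_on_subset) auto
  have gi: "inj_on g (annulus 1 R)" using g(3) by (rule inj_on_subset) auto
  have P1: "\<Psi> (f z) = f' z" if "norm z < 1" for z
    using that inv_into_f_f[OF fi, of z] by (auto simp: \<Psi>_def)
  have P2: "\<Psi> (g w) = g' w" if w: "w \<in> collar R" for w
  proof -
    have "g w \<notin> f ` ball 0 1" using disj[OF _ w] by force
    then show ?thesis using inv_into_f_f[OF g(3) w] by (simp add: \<Psi>_def)
  qed
  have P3: "\<Psi> (f z) = f' z" if "norm z \<le> 1" for z
  proof (cases "norm z < 1")
    case False
    then have z: "norm z = 1" using that by simp
    have "\<Psi> (g (k z)) = g' (k z)" by (rule P2) (use z R in simp)
    then show ?thesis using gk gk' z by simp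
  qed (rule P1)
  have patch: "open (h ` U) \<and> \<Psi> holomorphic_on h ` U"
    if h: "h holomorphic_on U" "open U" "inj_on h U" "h' holomorphic_on U" "\<And>z. z \<in> U \<Longrightarrow> \<Psi> (h z) = h' z" for h h' U
  proof
    show "open (h ` U)" by (rule open_mapping_thm3[OF h(1-3)])
    obtain i where i: "i holomorphic_on h ` U" "\<And>z. z \<in> U \<Longrightarrow> i (h z) = z"
      using holomorphic_has_inverse[OF h(1-3)] by metis
    have "h' \<circ> i holomorphic_on h ` U"
      by (rule holomorphic_on_compose_gen[OF i(1) h(4)]) (use i in auto)
    then show "\<Psi> holomorphic_on h ` U"
      by (rule holomorphic_transform) (use i h(5) in auto)
  qed
  have sR: "seam_nbhd R \<subseteq> V" "open (seam_nbhd R)" "sphere 0 1 \<subseteq> seam_nbhd R" using seam_nbhd R by auto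
  have hs: "\<Psi> (seam_fun f g z) = seam_fun f' g' z" if "z \<in> seam_nbhd R" for z
    using that P3 P2[of "K z"] K_out[of z] sR(1) by (auto simp: seam_fun_def seam_nbhd_def)
  have glu: "glued k R f g" using fg by (simp add: weld_def)
  note p1 = patch[OF f(2) open_ball fi f' P1[simplified]]
  have p1: "open (f ` ball 0 1) \<and> \<Psi> holomorphic_on f ` ball 0 1"
    by (rule patch[OF f(2) open_ball fi f']) (use P1 in auto)
  have p2: "open (g ` annulus 1 R) \<and> \<Psi> holomorphic_on g ` annulus 1 R"
    by (rule patch[OF g(2) open_annulus gi g']) (use P2 in auto)
  have p3: "open (seam_fun f g ` seam_nbhd R) \<and> \<Psi> holomorphic_on seam_fun f g ` seam_nbhd R"
    by (rule patch[OF seam_holomorphic[OF glu] sR(2) seam_inj[OF fg] seam_holomorphic[OF fg'] hs])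
  have "\<Psi> holomorphic_on (f ` ball 0 1 \<union> g ` annulus 1 R) \<union> seam_fun f g ` seam_nbhd R"
    using p1 p2 p3 by (intro holomorphic_on_Un) auto
  moreover have "weld_image R f g \<subseteq> (f ` ball 0 1 \<union> g ` annulus 1 R) \<union> seam_fun f g ` seam_nbhd R"
  proof
    fix p assume "p \<in> weld_image R f g"
    then consider "p \<in> f ` ball 0 1" | w where "w \<in> collar R" "p = g w" by (auto simp: weld_image_def)
    then show "p \<in> (f ` ball 0 1 \<union> g ` annulus 1 R) \<union> seam_fun f g ` seam_nbhd R"
    proof cases
      case 2
      show ?thesis
      proof (cases "norm w = 1")
        case True
        then obtain t where t: "norm t = 1" "k t = w" using k_surj by blast
        then have "p = seam_fun f g t" using 2 gk by (auto simp: seam_fun_def)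
        then show ?thesis using sR(3) t by auto
      qed (use 2 in auto)
    qed auto
  qed
  ultimately have "\<Psi> holomorphic_on weld_image R f g" by (rule holomorphic_on_subset)
  then show ?thesis using that P3 P2 by blast
qed

text \<open>The surface, slightly shrunk, is a bounded simply connected plane domain, hence a disc.\<close>

lemma weld_disc:
  assumes R: "1 < R" "R < R'" and fg: "weld k R' f g"
  obtains h p where "h holomorphic_on weld_image R f g" "p holomorphic_on ball 0 1" "h (f 0) = 0"
    "\<And>z. z \<in> weld_image R f g \<Longrightarrow> h z \<in> ball 0 1 \<and> p (h z) = z"
    "\<And>z. z \<in> ball 0 1 \<Longrightarrow> p z \<in> weld_image R f g \<and> h (p z) = z"
proof -
  let ?\<Omega> = "weld_image R f g"
  have fgR: "weld k R f g" using weld_subset[OF fg] R by simp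
  have glu: "glued k R' f g" using fg by (simp add: weld_def)
  have "continuous_on (cball 0 R) (weld_map k f g)"
    using weld_map_continuous[OF glu] by (rule continuous_on_subset) (use R in auto)
  then have "bounded (weld_map k f g ` cball 0 R)" by (intro compact_imp_bounded compact_continuous_image) auto
  moreover have "?\<Omega> = weld_map k f g ` ball 0 R"
    using weld_map_image[of R f g] R fgR by (auto simp: weld_def)
  then have "?\<Omega> \<subseteq> weld_map k f g ` cball 0 R" using ball_subset_cball by blast
  ultimately have "bounded ?\<Omega>" by (rule bounded_subset)
  then have "?\<Omega> \<noteq> UNIV" using not_bounded_UNIV by metis
  have f0: "f 0 \<in> ?\<Omega>" by (simp add: weld_image_def)
  obtain h0 p0 where h0: "h0 holomorphic_on ?\<Omega>" "p0 holomorphic_on ball 0 1"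
    "\<And>z. z \<in> ?\<Omega> \<Longrightarrow> h0 z \<in> ball 0 1 \<and> p0 (h0 z) = z" "\<And>z. z \<in> ball 0 1 \<Longrightarrow> p0 z \<in> ?\<Omega> \<and> h0 (p0 z) = z"
  proof -
    have "?\<Omega> = {} \<or> ?\<Omega> = UNIV \<or> (\<exists>f g. f holomorphic_on ?\<Omega> \<and> g holomorphic_on ball 0 1 \<and>
           (\<forall>z \<in> ?\<Omega>. f z \<in> ball 0 1 \<and> g (f z) = z) \<and> (\<forall>z \<in> ball 0 1. g z \<in> ?\<Omega> \<and> f (g z) = z))"
      using Riemann_mapping_theorem[of ?\<Omega>] weld_image_simply_connected[OF R(1) fgR] by blast
    then show ?thesis using that \<open>?\<Omega> \<noteq> UNIV\<close> f0 by (metis empty_iff)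
  qed
  obtain m n where m: "m (h0 (f 0)) = 0" "m holomorphic_on ball 0 1" "m ` ball 0 1 \<subseteq> ball 0 1"
    "n holomorphic_on ball 0 1" "n ` ball 0 1 \<subseteq> ball 0 1"
    "\<And>z. z \<in> ball 0 1 \<Longrightarrow> m (n z) = z" "\<And>z. z \<in> ball 0 1 \<Longrightarrow> n (m z) = z"
    by (rule ball_biholomorphism_exists[of "h0 (f 0)"]) (use h0(3)[OF f0] in blast, rule that)
  show ?thesis
  proof (rule that[of "m \<circ> h0" "p0 \<circ> n"])
    show "m \<circ> h0 holomorphic_on ?\<Omega>" by (rule holomorphic_on_compose_gen[OF h0(1) m(2)]) (use h0(3) in auto)
    show "p0 \<circ> n holomorphic_on ball 0 1" by (rule holomorphic_on_compose_gen[OF m(4) h0(2) m(5)])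
    show "(m \<circ> h0) z \<in> ball 0 1 \<and> (p0 \<circ> n) ((m \<circ> h0) z) = z" if "z \<in> ?\<Omega>" for z
    proof -
      have "h0 z \<in> ball 0 1" using h0(3)[OF that] by blast
      moreover from this have "m (h0 z) \<in> ball 0 1" using m(3) by blast
      ultimately show ?thesis using m(7) h0(3)[OF that] by simp
    qed
    show "(p0 \<circ> n) z \<in> ?\<Omega> \<and> (m \<circ> h0) ((p0 \<circ> n) z) = z" if "z \<in> ball 0 1" for z
    proof -
      have "n z \<in> ball 0 1" using m(5) that by blast
      then show ?thesis using h0(4) m(6)[OF that] by simp
    qed
  qed (use m(1) in simp)
qed

text \<open>Take the identity on the disc and the inverse of \<open>K\<close> on the collar. The
  width is a Lebesgue number \<open>e\<close> for the circle inside the range of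
  \<open>K\<close>.\<close>

lemma weld_exists_initial:
  obtains R f g where "R > 1" "weld k R f g"
proof -
  obtain i where i: "i holomorphic_on K ` V" "\<And>z. z \<in> V \<Longrightarrow> i (K z) = z"
    using holomorphic_has_inverse[OF K_hol V_open K_inj] by metis
  have oKV: "open (K ` V)" by (rule open_mapping_thm3[OF K_hol V_open K_inj])
  have cir: "sphere 0 1 \<subseteq> K ` V"
  proof
    fix u :: complex assume "u \<in> sphere 0 1"
    then obtain t where "norm t = 1" "k t = u" using k_surj by auto
    then show "u \<in> K ` V" using K_k V_circle by force
  qed
  have "\<exists>e>0. \<forall>u\<in>sphere 0 1. ball u e \<subseteq> K ` V"
  proof (rule Heine_Borel_lemma[OF compact_sphere[of "0::complex" 1], of "{K ` V}"])
    fix e :: real assume "e > 0" "\<And>x. x \<in> sphere 0 1 \<Longrightarrow> \<exists>G\<in>{K ` V}. ball x e \<subseteq> G"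
    then show ?thesis by (intro exI[of _ e]) auto
  qed (use cir oKV in auto)
  then obtain e where e: "e > 0" "\<And>u. norm u = 1 \<Longrightarrow> ball u e \<subseteq> K ` V" by auto
  have col: "w \<in> K ` V" if w: "w \<in> collar (1 + e)" for w
  proof -
    have w0: "w \<noteq> 0" using w by auto
    then have "dist (sgn w) w < e" using dist_sgn[OF w0] w by auto
    then show ?thesis using e(2)[of "sgn w"] w0 by (auto simp: norm_sgn)
  qed
  have i_out: "1 \<le> norm (i w)" if w: "w \<in> collar (1 + e)" for w
  proof -
    obtain z where z: "z \<in> V" "w = K z" using col[OF w] by blast
    then show ?thesis using K_in[OF z(1)] i(2)[OF z(1)] w by force
  qed
  show ?thesis
  proof (rule that)
    show "1 + e > 1" using e by simp
    have ih: "i holomorphic_on collar (1 + e)" by (rule holomorphic_on_subset[OF i(1)]) (use col in auto)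
    have ik: "i (k t) = t" if "norm t = 1" for t using i(2)[of t] K_k[OF that] V_circle that by auto
    show "weld k (1 + e) (\<lambda>z. z) i" unfolding weld_def glued_def
    proof (intro conjI allI impI)
      show "continuous_on (collar (1 + e)) i" using ih by (rule holomorphic_on_imp_continuous_on)
      show "i holomorphic_on annulus 1 (1 + e)" using ih by (rule holomorphic_on_subset) auto
      show "inj_on i (collar (1 + e))"
      proof (rule inj_onI)
        fix u w assume uw: "u \<in> collar (1 + e)" "w \<in> collar (1 + e)" "i u = i w"
        obtain x y where "x \<in> V" "u = K x" "y \<in> V" "w = K y" using col[OF uw(1)] col[OF uw(2)] by blast
        then show "u = w" using i(2) uw(3) by simp
      qed
      fix z w :: complex assume "norm z < 1" "w \<in> collar (1 + e)"
      then show "z \<noteq> i w" using i_out[of w] by auto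
    qed (use ik in auto)
  qed
qed

end

subsection \<open>Extending partial weldings\<close>

context analytic_welding
begin

lemma weld_map_collar:
  assumes "glued k R f g" "w \<in> collar R"
  obtains z where "norm z = norm w" "weld_map k f g z = g w"
proof -
  have gk: "\<And>t. norm t = 1 \<Longrightarrow> g (k t) = f t" using assms by (auto simp: glued_def)
  obtain z where z: "norm z = norm w" "w = of_real (norm z) * k (sgn z)" "z \<noteq> 0"
    by (rule collar_param[OF assms(2)])
  have "weld_map k f g z = g w"
  proof (cases "norm z = 1")
    case True
    then have "sgn z = z" by (simp add: sgn_eq)
    then have "w = k z" by (metis True mult_1 of_real_1 z(2))
    then show ?thesis using gk True by (simp add: weld_map_def)
  next
    case False
    then have "\<not> norm z \<le> 1" using assms(2) z(1) by auto
    then have "weld_map k f g z = g (of_real (norm z) * k (sgn z))" by (simp only: weld_map_def if_False)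
    then show ?thesis using z(2) by metis
  qed
  then show ?thesis using that z(1) by blast
qed

lemma f_in_weld_image:
  assumes "R > 1" "glued k R f g" "norm z \<le> 1"
  shows "f z \<in> weld_image R f g"
proof (cases "norm z < 1")
  case False
  then have z: "norm z = 1" using assms by simp
  then have "f z = g (k z)" using assms by (simp add: glued_def)
  moreover have "k z \<in> collar R" using z assms by simp
  ultimately show ?thesis unfolding weld_image_def by blast
qed (auto simp: weld_image_def)

lemma weld_compose:
  assumes R: "R > 1" and fg: "weld k R f g" and T: "T holomorphic_on weld_image R f g" "inj_on T (weld_image R f g)"
    and eq: "\<And>z. norm z \<le> 1 \<Longrightarrow> f' z = T (f z)" "\<And>w. w \<in> collar R \<Longrightarrow> g' w = T (g w)"
  shows "weld k R f' g'"
proof -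
  have f: "continuous_on (cball 0 1) f" "f holomorphic_on ball 0 1" "inj_on f (cball 0 1)"
    and g: "continuous_on (collar R) g" "g holomorphic_on annulus 1 R" "inj_on g (collar R)"
    and disj: "\<And>z w. norm z < 1 \<Longrightarrow> w \<in> collar R \<Longrightarrow> f z \<noteq> g w" and gk: "\<And>t. norm t = 1 \<Longrightarrow> g (k t) = f t"
    and glu: "glued k R f g"
    using fg by (auto simp: weld_def glued_def)
  have Tc: "continuous_on (weld_image R f g) T" using T(1) by (rule holomorphic_on_imp_continuous_on)
  have fi: "f z \<in> weld_image R f g" if "norm z \<le> 1" for z by (rule f_in_weld_image[OF R glu that])
  have gi: "g w \<in> weld_image R f g" if "w \<in> collar R" for w using that by (auto simp: weld_image_def)
  show ?thesis unfolding weld_def glued_def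
  proof (intro conjI allI impI)
    have "continuous_on (cball 0 1) (\<lambda>z. T (f z))"
      by (rule continuous_on_compose2[OF Tc f(1)]) (use fi in auto)
    then show "continuous_on (cball 0 1) f'" by (rule continuous_on_eq) (use eq in auto)
    have "(T \<circ> f) holomorphic_on ball 0 1"
      by (rule holomorphic_on_compose_gen[OF f(2) T(1)]) (use fi in auto)
    then show "f' holomorphic_on ball 0 1" by (rule holomorphic_transform) (use eq in auto)
    have "continuous_on (collar R) (\<lambda>w. T (g w))"
      by (rule continuous_on_compose2[OF Tc g(1)]) (use gi in blast)
    then show "continuous_on (collar R) g'" by (rule continuous_on_eq) (use eq in auto)
    have "(T \<circ> g) holomorphic_on annulus 1 R"
      by (rule holomorphic_on_compose_gen[OF g(2) T(1)]) (use gi in auto)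
    then show "g' holomorphic_on annulus 1 R" by (rule holomorphic_transform) (use eq in auto)
    show "g' (k t) = f' t" if "norm t = 1" for t using that eq R gk by simp
    show "inj_on f' (cball 0 1)"
    proof (rule inj_onI)
      fix x y :: complex assume xy: "x \<in> cball 0 1" "y \<in> cball 0 1" "f' x = f' y"
      then have "T (f x) = T (f y)" using eq by simp
      then have "f x = f y" using T(2) fi xy unfolding inj_on_def by (metis mem_cball_0)
      then show "x = y" using f(3) xy by (auto simp: inj_on_def)
    qed
    show "inj_on g' (collar R)"
    proof (rule inj_onI)
      fix x y assume xy: "x \<in> collar R" "y \<in> collar R" "g' x = g' y"
      then have "T (g x) = T (g y)" using eq by metis
      then have "g x = g y" using T(2) gi xy unfolding inj_on_def by metis
      then show "x = y" using g(3) xy by (auto simp: inj_on_def)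
    qed
    fix z w :: complex assume zw: "norm z < 1" "w \<in> collar R"
    have "T (f z) \<noteq> T (g w)" using T(2) fi[of z] gi[OF zw(2)] disj[OF zw] zw(1) unfolding inj_on_def by (metis less_imp_le)
    then show "f' z \<noteq> g' w" using eq zw by simp
  qed
qed

text \<open>Points going to the outer rim leave every compact part of the surface. The closed disc
  of radius \<open>1 - \<delta>\<close> pulls back through \<open>p\<close> and the inverse
  \<open>j\<close> of \<open>weld_map\<close> to a compact subset of \<open>ball 0 R\<close>, and
  this stays within some radius \<open>s < R\<close>.\<close>

lemma weld_boundary_modulus:
  assumes R: "1 < R" and fg: "weld k R f g"
    and p: "p holomorphic_on ball 0 1"
    "\<And>z. z \<in> weld_image R f g \<Longrightarrow> h z \<in> ball 0 1 \<and> p (h z) = z" "\<And>z. z \<in> ball 0 1 \<Longrightarrow> p z \<in> weld_image R f g"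
    and \<epsilon>: "\<epsilon> > 0"
  shows "\<exists>s<R. \<forall>w. s < norm w \<longrightarrow> norm w < R \<longrightarrow> \<bar>norm (h (g w)) - 1\<bar> < \<epsilon>"
proof -
  have glu: "glued k R f g" using fg by (simp add: weld_def)
  have c: "continuous_on (ball 0 R) (weld_map k f g)" by (rule weld_map_continuous[OF glu])
  have i: "inj_on (weld_map k f g) (ball 0 R)" by (rule weld_map_inj[OF fg])
  have im: "weld_map k f g ` ball 0 R = weld_image R f g" by (rule weld_map_image[OF R glu])
  obtain j where j: "homeomorphism (ball 0 R) (weld_map k f g ` ball 0 R) (weld_map k f g) j"
    by (rule invariance_of_domain_homeomorphism[OF open_ball c _ i]) auto
  define \<delta> where "\<delta> = min \<epsilon> 1 / 2"
  have \<delta>: "0 < \<delta>" "\<delta> < 1" "\<delta> < \<epsilon>" using \<epsilon> by (auto simp: \<delta>_def min_def)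
  define C where "C = p ` cball 0 (1 - \<delta>)"
  have sub: "cball 0 (1 - \<delta>) \<subseteq> ball (0::complex) 1" using \<delta> by auto
  have "compact C" unfolding C_def
    by (intro compact_continuous_image continuous_on_subset[OF holomorphic_on_imp_continuous_on[OF p(1)] sub]) auto
  moreover have CS: "C \<subseteq> weld_image R f g" using p(3) sub by (auto simp: C_def)
  moreover have "continuous_on (weld_image R f g) j" using j im by (simp add: homeomorphism_def)
  ultimately have cj: "compact (j ` C)" by (intro compact_continuous_image) (auto intro: continuous_on_subset)
  have "j ` weld_image R f g = ball 0 R" using j im by (simp add: homeomorphism_def)
  then have jb: "j ` C \<subseteq> ball 0 R" using image_mono[OF CS, of j] by simp
  have "\<exists>s<R. \<forall>z\<in>j ` C. norm z \<le> s"
  proof (cases "C = {}")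
    case True then show ?thesis using R by (intro exI[of _ 0]) auto
  next
    case False
    then obtain z where "z \<in> j ` C" "\<forall>y\<in>j ` C. norm y \<le> norm z"
      using continuous_attains_sup[OF cj, of norm] by (auto intro: continuous_intros)
    then show ?thesis using jb by (intro exI[of _ "norm z"]) auto
  qed
  then obtain s where s: "s < R" "\<And>z. z \<in> j ` C \<Longrightarrow> norm z \<le> s" by blast
  show ?thesis
  proof (intro exI[of _ "max s 1"] conjI allI impI)
    fix w :: complex assume w: "max s 1 < norm w" "norm w < R"
    then have wc: "w \<in> collar R" by auto
    then have gw: "g w \<in> weld_image R f g" by (auto simp: weld_image_def)
    obtain z where z: "norm z = norm w" "weld_map k f g z = g w" by (rule weld_map_collar[OF glu wc])
    have "g w \<notin> C"
    proof
      assume "g w \<in> C"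
      moreover have "j (g w) = z" using j z w by (auto simp: homeomorphism_def simp flip: z(2))
      ultimately have "norm z \<le> s" using s(2) by blast
      then show False using z w by simp
    qed
    moreover have hp: "h (g w) \<in> ball 0 1" "p (h (g w)) = g w" using p(2)[OF gw] by auto
    ultimately have "h (g w) \<notin> cball 0 (1 - \<delta>)" unfolding C_def by (metis image_eqI)
    then show "\<bar>norm (h (g w)) - 1\<bar> < \<epsilon>" using hp(1) \<delta> by auto
  qed (use s R in auto)
qed

text \<open>With the surface mapped onto the unit disc, \<open>g1\<close> is reflected in the outer
  rim. The new part takes values outside the closed disc, so injectivity holds inside by the old
  welding and outside by symmetry; only the rim itself needs a separate argument.\<close>

lemma weld_extend:
  assumes r: "1 < r" "r < R" "R < R'" and fg: "weld k R' f g"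
  shows "\<exists>f2 g2. weld k (R\<^sup>2 / r) f2 g2"
proof -
  have R1: "R > 1" using r by simp
  have R0: "R > 0" "r > 0" using r by auto
  have fgR: "weld k R f g" using weld_subset[OF fg] r by simp
  let ?\<Omega> = "weld_image R f g"
  obtain h p where h: "h holomorphic_on ?\<Omega>" "p holomorphic_on ball 0 1" "h (f 0) = 0"
    "\<And>z. z \<in> ?\<Omega> \<Longrightarrow> h z \<in> ball 0 1 \<and> p (h z) = z" "\<And>z. z \<in> ball 0 1 \<Longrightarrow> p z \<in> ?\<Omega> \<and> h (p z) = z"
    by (rule weld_disc[OF R1 r(3) fg]) blast
  define f1 g1 where "f1 z = h (f z)" and "g1 w = h (g w)" for z w
  have ih: "inj_on h ?\<Omega>" by (metis h(4) inj_onI)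
  have w1: "weld k R f1 g1"
    by (rule weld_compose[OF R1 fgR h(1) ih]) (auto simp: f1_def g1_def)
  have glu1: "glued k R f1 g1" using w1 by (simp add: weld_def)
  have f1: "continuous_on (cball 0 1) f1" "f1 holomorphic_on ball 0 1" "inj_on f1 (cball 0 1)"
    and g1: "continuous_on (collar R) g1" "g1 holomorphic_on annulus 1 R" "inj_on g1 (collar R)"
    and disj: "\<And>z w. norm z < 1 \<Longrightarrow> w \<in> collar R \<Longrightarrow> f1 z \<noteq> g1 w" and gk: "\<And>t. norm t = 1 \<Longrightarrow> g1 (k t) = f1 t"
    using w1 by (auto simp: weld_def glued_def)
  have n1: "norm (f1 z) < 1" if "norm z \<le> 1" for z
  proof -
    have "f z \<in> ?\<Omega>" using f_in_weld_image[OF R1 _ that] fgR by (simp add: weld_def)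
    then show ?thesis using h(4) by (auto simp: f1_def)
  qed
  have n2: "norm (g1 w) < 1" if "w \<in> collar R" for w
  proof -
    have "g w \<in> ?\<Omega>" using that by (auto simp: weld_image_def)
    then show ?thesis using h(4) by (auto simp: g1_def)
  qed
  \<comment> \<open>The reflection requires a zero-free function. The value 0 is taken by
    \<open>f1\<close> at the centre of the disc, and the values of \<open>g1\<close> avoid those of
    \<open>f1\<close> on the open disc.\<close>
  have g10: "g1 w \<noteq> 0" if "w \<in> collar R" for w
    using disj[of 0 w] that h(3) by (simp add: f1_def)
  obtain G where G: "G holomorphic_on annulus r (R\<^sup>2 / r)" "\<And>z. r < norm z \<Longrightarrow> norm z < R \<Longrightarrow> G z = g1 z"
    "\<And>z. z \<in> annulus r (R\<^sup>2 / r) \<Longrightarrow> G (of_real (R\<^sup>2) / cnj z) * cnj (G z) = 1"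
  proof (rule annulus_reflection[OF g1(2) _ _ r(1,2)])
    show "g1 z \<noteq> 0" if "z \<in> annulus 1 R" for z using g10[of z] that by simp
    fix \<epsilon> :: real assume "\<epsilon> > 0"
    then show "\<exists>s<R. \<forall>z. s < norm z \<longrightarrow> norm z < R \<longrightarrow> \<bar>norm (g1 z) - 1\<bar> < \<epsilon>"
      unfolding g1_def using h by (intro weld_boundary_modulus[OF R1 fgR]) auto
  qed (use that in auto)
  define R2 where "R2 = R\<^sup>2 / r"
  have RR: "R < R2" using r R0 by (simp add: R2_def power2_eq_square field_simps)
  define rf where "rf w = of_real (R\<^sup>2) / cnj w" for w
  have nrf: "norm (rf w) = R\<^sup>2 / norm w" for w by (simp add: rf_def norm_divide norm_power)
  have G1: "norm (G w) = 1" if w: "norm w = R" for w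
  proof -
    have "w \<noteq> 0" using w R0 by auto
    have "of_real (R\<^sup>2) = w * cnj w" using w complex_norm_square[of w] by simp
    then have "of_real (R\<^sup>2) / cnj w = w" using \<open>w \<noteq> 0\<close> by (simp add: field_simps)
    then have "G w * cnj (G w) = 1" using G(3)[of w] w RR r by (simp add: R2_def)
    then have "(norm (G w))\<^sup>2 = 1" by (metis complex_norm_square of_real_eq_1_iff)
    then show ?thesis by (simp add: power2_eq_1_iff) (metis norm_ge_zero not_one_le_zero neg_0_le_iff_le)
  qed
  have refl: "r < norm (rf w)" "norm (rf w) < R" "G w = 1 / cnj (g1 (rf w))" "norm (G w) > 1"
    if w: "R < norm w" "norm w < R2" for w
  proof -
    have nw: "norm w > 0" "w \<noteq> 0" using w R0 by auto
    have "r * norm w < R\<^sup>2" using w R0 by (simp add: R2_def field_simps)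
    then show l1: "r < norm (rf w)" using nw by (simp add: nrf field_simps)
    have "R * R < R * norm w" using w R0 by simp
    then show l2: "norm (rf w) < R" using nw by (simp add: nrf power2_eq_square field_simps)
    have c: "rf w \<in> collar R" using l1 l2 r by simp
    have "G (rf w) * cnj (G w) = 1" using G(3)[of w] w r unfolding rf_def R2_def by auto
    then have "g1 (rf w) * cnj (G w) = 1" using G(2)[OF l1 l2] by simp
    then have "cnj (g1 (rf w)) * G w = 1" by (metis complex_cnj_cnj complex_cnj_mult complex_cnj_one)
    then show eq: "G w = 1 / cnj (g1 (rf w))" using g10[OF c] by (simp add: field_simps)
    show "norm (G w) > 1" unfolding eq using n2[OF c] g10[OF c] by (simp add: norm_divide)
  qed
  define g2 where "g2 w = (if norm w < R then g1 w else G w)" for w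
  have g2G: "g2 w = G w" if "w \<in> annulus r R2" for w using G(2) that by (auto simp: g2_def)
  have Gh: "G holomorphic_on annulus r R2" using G(1) by (simp add: R2_def)
  have Gc: "continuous_on (annulus r R2) G" using Gh by (rule holomorphic_on_imp_continuous_on)
  have ge1: "norm (g2 w) \<ge> 1" if "\<not> norm w < R" "norm w < R2" for w
    using that G1[of w] refl(4)[of w] by (cases "norm w = R") (auto simp: g2_def)
  \<comment> \<open>If two distinct rim points had the same image, disjoint balls around them would
    have open images overlapping on both sides of the unit circle; on the inner side this
    contradicts injectivity of \<open>g1\<close>.\<close>
  have circ: "z = w" if zw: "norm z = R" "norm w = R" "G z = G w" for z w
  proof (rule ccontr)
    assume "z \<noteq> w"
    define d where "d = min (dist z w / 2) (min (R - r) (R2 - R))"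
    have d: "d > 0" "d \<le> R - r" "d \<le> R2 - R" using \<open>z \<noteq> w\<close> r RR by (auto simp: d_def)
    have sub: "ball x d \<subseteq> annulus r R2" if "norm x = R" for x :: complex
    proof
      fix y assume "y \<in> ball x d"
      then have "norm (x - y) < d" by (simp add: dist_norm)
      then show "y \<in> annulus r R2" using that d norm_triangle_ineq2[of x y] norm_triangle_ineq3[of x y] by auto
    qed
    have op: "open (G ` ball x d)" if x: "norm x = R" for x
    proof (rule open_mapping_thm[OF holomorphic_on_subset[OF Gh sub[OF x]] open_ball connected_ball open_ball order_refl])
      show "\<not> G constant_on ball x d"
      proof
        assume "G constant_on ball x d"
        then obtain c where c: "\<And>y. y \<in> ball x d \<Longrightarrow> G y = c" unfolding constant_on_def by blast
        define y where "y = of_real (1 - d / (2 * R)) * x"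
        have dR: "0 < d / (2 * R)" "d / (2 * R) < 1" using d R0 r by (auto simp: field_simps)
        have "x - y = of_real (d / (2 * R)) * x" by (simp add: y_def algebra_simps)
        then have "norm (x - y) = d / (2 * R) * R" using x dR d(1) R0 by (simp add: norm_mult abs_of_pos del: of_real_divide)
        then have yb: "y \<in> ball x d" using R0 d by (simp add: dist_norm)
        have "norm y = \<bar>1 - d / (2 * R)\<bar> * R" using x by (simp only: y_def norm_mult norm_of_real)
        then have "norm y < R" using dR R0 by (simp add: abs_of_pos)
        moreover have ya: "y \<in> annulus r R2" using yb sub[OF x] by blast
        ultimately have "norm (G y) < 1" using n2[of y] G(2)[of y] r by simp
        then show False using c[OF yb] c[of x] G1[OF x] d by simp
      qed
    qed
    have "open (G ` ball z d \<inter> G ` ball w d)" using op zw by auto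
    moreover have "G z \<in> G ` ball z d" "G w \<in> G ` ball w d" using d(1) by (auto intro!: imageI)
    then have "G z \<in> G ` ball z d \<inter> G ` ball w d" using zw(3) by simp
    ultimately obtain e where e: "e > 0" "ball (G z) e \<subseteq> G ` ball z d \<inter> G ` ball w d" using openE by blast
    \<comment> \<open>A point of the common open image just inside the unit circle: its preimages
      near \<open>z\<close> and near \<open>w\<close> have modulus below \<open>R\<close>.\<close>
    define \<zeta> where "\<zeta> = of_real (1 - min e 1 / 2) * G z"
    have me: "0 < min e 1 / 2" "min e 1 / 2 < 1" "min e 1 / 2 < e" using e by (auto simp: min_def)
    have "G z - \<zeta> = of_real (min e 1 / 2) * G z" by (simp add: \<zeta>_def algebra_simps)
    then have "norm (G z - \<zeta>) = min e 1 / 2" using G1[OF zw(1)] me by (simp add: norm_mult del: of_real_diff of_real_divide of_real_1)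
    then have \<zeta>b: "\<zeta> \<in> ball (G z) e" using me by (simp add: dist_norm)
    have n\<zeta>: "norm \<zeta> < 1" using G1[OF zw(1)] me by (simp add: \<zeta>_def norm_mult del: of_real_diff of_real_divide of_real_1)
    obtain x y where xy: "x \<in> ball z d" "\<zeta> = G x" "y \<in> ball w d" "\<zeta> = G y" using e(2) \<zeta>b by blast
    have low: "norm u < R \<and> G u = g1 u \<and> u \<in> collar R" if "u \<in> annulus r R2" "G u = \<zeta>" for u
    proof -
      have "norm u < R" using ge1[of u] g2G[OF that(1)] that n\<zeta> by fastforce
      then show ?thesis using G(2)[of u] that r by auto
    qed
    have "x \<in> annulus r R2" "y \<in> annulus r R2" using xy sub zw by blast+
    then have "g1 x = g1 y" "x \<in> collar R" "y \<in> collar R" using low[of x] low[of y] xy by auto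
    then have "x = y" using g1(3) by (auto simp: inj_on_def)
    then have "dist z w < 2 * d" using xy dist_triangle_half_l[of z x "2*d" w] by (auto simp: dist_commute)
    moreover have "d \<le> dist z w / 2" unfolding d_def by (rule min.cobounded1)
    ultimately show False by simp
  qed
  have rfinj: "z = w" if "rf z = rf w" "z \<noteq> 0" "w \<noteq> 0" for z w
    using that R0 by (simp add: rf_def field_simps)
  have "weld k R2 f1 g2" unfolding weld_def glued_def
  proof (intro conjI allI impI)
    have un: "collar R \<union> annulus r R2 = collar R2" using r RR by auto
    have "continuous_on (collar R \<union> annulus r R2) g2"
    proof (rule continuous_on_Un_local_open)
      show "openin (top_of_set (collar R \<union> annulus r R2)) (collar R)"
        unfolding un by (rule openin_open[THEN iffD2], rule exI[of _ "ball 0 R"]) (use RR in auto)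
      show "openin (top_of_set (collar R \<union> annulus r R2)) (annulus r R2)"
        unfolding un by (rule openin_open[THEN iffD2], rule exI[of _ "annulus r R2"]) (use r open_annulus in auto)
      show "continuous_on (collar R) g2" using g1(1) by (rule continuous_on_eq) (auto simp: g2_def)
      show "continuous_on (annulus r R2) g2" using Gc by (rule continuous_on_eq) (use g2G in auto)
    qed
    then show "continuous_on (collar R2) g2" unfolding un .
    have "g2 holomorphic_on annulus 1 R \<union> annulus r R2"
    proof (rule holomorphic_on_Un)
      show "g2 holomorphic_on annulus 1 R" using g1(2) by (rule holomorphic_transform) (auto simp: g2_def)
      show "g2 holomorphic_on annulus r R2" using Gh by (rule holomorphic_transform) (use g2G in auto)
    qed (auto intro: open_annulus)
    moreover have "annulus 1 R2 \<subseteq> annulus 1 R \<union> annulus r R2" using r by auto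
    ultimately show "g2 holomorphic_on annulus 1 R2" by (rule holomorphic_on_subset)
    show "inj_on g2 (collar R2)"
    proof (rule inj_onI)
      fix z w assume zw: "z \<in> collar R2" "w \<in> collar R2" "g2 z = g2 w"
      have lt: "norm (g2 u) < 1 \<longleftrightarrow> norm u < R" if "u \<in> collar R2" for u
        using ge1[of u] n2[of u] that by (cases "norm u < R") (auto simp: g2_def)
      have gt: "norm (g2 u) > 1 \<longleftrightarrow> norm u > R" if "u \<in> collar R2" for u
        using lt[OF that] refl(4)[of u] G1[of u] that by (cases "norm u = R"; cases "norm u > R") (auto simp: g2_def)
      consider "norm z < R" | "norm z = R" | "norm z > R" by linarith
      then show "z = w"
      proof cases
        case 1
        then have "norm w < R" using lt zw by metis
        then show ?thesis using 1 zw g1(3) by (auto simp: g2_def inj_on_def)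
      next
        case 2
        then have "norm w = R" using lt[OF zw(1)] lt[OF zw(2)] gt[OF zw(1)] gt[OF zw(2)] zw(3) by auto
        then show ?thesis using 2 zw circ by (auto simp: g2_def)
      next
        case 3
        then have w: "norm w > R" using gt zw by metis
        then have "G z = G w" using 3 zw by (auto simp: g2_def)
        then have "g1 (rf z) = g1 (rf w)" using refl(3)[of z] refl(3)[of w] 3 w zw by simp
        moreover have "rf z \<in> collar R" "rf w \<in> collar R" using refl(1,2)[of z] refl(1,2)[of w] 3 w zw r by auto
        ultimately have "rf z = rf w" using g1(3) by (auto simp: inj_on_def)
        then show ?thesis using rfinj 3 w R0 by force
      qed
    qed
    show "g2 (k t) = f1 t" if "norm t = 1" for t using gk[OF that] that R1 by (simp add: g2_def)
    fix z w :: complex assume zw: "norm z < 1" "w \<in> collar R2"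
    show "f1 z \<noteq> g2 w"
      using disj[of z w] n1[of z] ge1[of w] zw by (cases "norm w < R") (auto simp: g2_def)
  qed (use f1 in auto)
  then show ?thesis unfolding R2_def by blast
qed

text \<open>Each extension raises the radius to the power \<open>5/4\<close>, so the exponents grow
  geometrically and every radius is reached.\<close>

lemma weld_exists: "\<exists>f g. weld k R f g"
proof -
  obtain R0 f0 g0 where R0: "R0 > 1" "weld k R0 f0 g0" by (rule weld_exists_initial)
  have step: "\<exists>f g. weld k (S powr (5/4)) f g" if S: "S > 1" and w: "\<exists>f g. weld k S f g" for S
  proof -
    obtain f g where fg: "weld k S f g" using w by blast
    \<comment> \<open>The extension is applied with inner radius \<open>S^(1/4)\<close> and rim
      \<open>S^(3/4)\<close>, both strictly below the given radius \<open>S\<close>; reflection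
      reaches \<open>S^(3/2 - 1/4)\<close>.\<close>
    have "1 < S powr (1/4)" using S by (simp add: gr_one_powr)
    moreover have "S powr (1/4) < S powr (3/4)" using S by (intro powr_less_mono) auto
    moreover have "S powr (3/4) < S powr 1" using S by (intro powr_less_mono) auto
    ultimately have "\<exists>f2 g2. weld k ((S powr (3/4))\<^sup>2 / S powr (1/4)) f2 g2"
      using S by (intro weld_extend[OF _ _ _ fg]) auto
    moreover have "(S powr (3/4))\<^sup>2 / S powr (1/4) = S powr (5/4)"
      using S by (simp add: power2_eq_square powr_add[symmetric] powr_diff[symmetric])
    ultimately show ?thesis by simp
  qed
  have all: "\<exists>f g. weld k (R0 powr ((5/4) ^ n)) f g" for n
  proof (induction n)
    case 0
    then show ?case using R0 by (intro exI[of _ f0] exI[of _ g0]) simp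
  next
    case (Suc n)
    have "R0 powr ((5/4) ^ n) > 1" using R0(1) by (simp add: gr_one_powr)
    from step[OF this Suc] show ?case by (simp add: powr_powr mult.commute)
  qed
  obtain n where "ln (max R 1) / ln R0 < (5/4::real) ^ n"
    using real_arch_pow[of "5/4::real" "ln (max R 1) / ln R0"] by auto
  then have n: "(5/4::real) ^ n \<ge> ln (max R 1) / ln R0" by simp
  have "ln (max R 1) \<le> (5/4) ^ n * ln R0" using n R0(1) by (simp add: field_simps)
  then have "exp (ln (max R 1)) \<le> exp ((5/4) ^ n * ln R0)" by (simp only: exp_le_cancel_iff)
  moreover have "exp (ln (max R 1)) = max R 1" by (rule exp_ln) simp
  ultimately have "max R 1 \<le> R0 powr ((5/4) ^ n)" using R0(1) by (simp add: powr_def)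
  then show ?thesis using all[of n] weld_subset by (meson max.cobounded1 order_trans)
qed

end

subsection \<open>The conformal welding of the two discs\<close>

context analytic_welding
begin

lemma weld_inj_transfer:
  assumes R: "R > 1" and fg: "weld k R f g" and fg': "weld k R f' g'"
    and \<Psi>: "\<And>z. norm z \<le> 1 \<Longrightarrow> \<Psi> (f z) = f' z" "\<And>w. w \<in> collar R \<Longrightarrow> \<Psi> (g w) = g' w"
  shows "inj_on \<Psi> (weld_image R f g)"
proof (rule inj_onI)
  fix p q assume pq: "p \<in> weld_image R f g" "q \<in> weld_image R f g" "\<Psi> p = \<Psi> q"
  have rep: "(\<exists>z. norm z < 1 \<and> x = f z) \<or> (\<exists>w\<in>collar R. x = g w)" if "x \<in> weld_image R f g" for x
    using that by (auto simp: weld_image_def)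
  have f': "\<And>x y. norm x < 1 \<Longrightarrow> norm y < 1 \<Longrightarrow> f' x = f' y \<Longrightarrow> x = y"
    using fg' unfolding weld_def inj_on_def by auto
  have g': "\<And>x y. x \<in> collar R \<Longrightarrow> y \<in> collar R \<Longrightarrow> g' x = g' y \<Longrightarrow> x = y"
    using fg' unfolding weld_def inj_on_def by blast
  have d: "\<And>x y. norm x < 1 \<Longrightarrow> y \<in> collar R \<Longrightarrow> f' x \<noteq> g' y"
    using fg' unfolding weld_def by blast
  from rep[OF pq(1)] rep[OF pq(2)] show "p = q"
  proof (elim disjE exE conjE bexE)
    fix x y assume "norm x < 1" "p = f x" "norm y < 1" "q = f y"
    then show ?thesis using pq(3) \<Psi>(1) f'[of x y] by simp
  next
    fix x y assume "norm x < 1" "p = f x" "y \<in> collar R" "q = g y"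
    then show ?thesis using pq(3) \<Psi>(1)[of x] \<Psi>(2)[of y] d[of x y] by simp
  next
    fix x y assume "y \<in> collar R" "p = g y" "norm x < 1" "q = f x"
    then show ?thesis using pq(3) \<Psi>(1)[of x] \<Psi>(2)[of y] d[of x y] by simp
  next
    fix x y assume "x \<in> collar R" "p = g x" "y \<in> collar R" "q = g y"
    then show ?thesis using pq(3) \<Psi>(2)[of x] \<Psi>(2)[of y] g'[of x y] by simp
  qed
qed

lemma weld_normalized:
  assumes "R > 1"
  obtains f g where "weld k R f g" "f 0 = 0" "deriv f 0 = 1"
proof -
  obtain f g where fg: "weld k R f g" using weld_exists by blast
  have fh: "f holomorphic_on ball 0 1" and fi: "inj_on f (cball 0 1)" using fg by (auto simp: weld_def glued_def)
  have "inj_on f (ball 0 1)" using fi by (rule inj_on_subset) auto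
  then have d0: "deriv f 0 \<noteq> 0" using holomorphic_injective_imp_regular[OF fh open_ball] by simp
  define T where "T z = (z - f 0) / deriv f 0" for z
  have w: "weld k R (\<lambda>z. T (f z)) (\<lambda>w. T (g w))"
    by (rule weld_compose[OF assms fg, of T]) (use d0 in \<open>auto simp: T_def[abs_def] inj_on_def intro!: holomorphic_intros\<close>)
  have "(f has_field_derivative deriv f 0) (at 0)" using fh by (intro holomorphic_derivI) auto
  then have "((\<lambda>z. T (f z)) has_field_derivative 1) (at 0)"
    unfolding T_def using d0 by (auto intro!: derivative_eq_intros)
  then have "deriv (\<lambda>z. T (f z)) 0 = 1" by (rule DERIV_imp_deriv)
  then show ?thesis using that[OF w] by (simp add: T_def)
qed

section \<open>The limit of normalized weldings as the radius tends to infinity\<close>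

lemma disjoint_unit_balls:
  fixes z :: complex
  assumes "z \<in> ball (of_nat (3 * m)) 1" "z \<in> ball (of_nat (3 * n)) 1"
  shows "m = n"
proof (rule ccontr)
  assume "m \<noteq> n"
  have "dist (of_nat (3 * m)) (of_nat (3 * n) :: complex) < 2"
    using assms dist_triangle_half_l[of "of_nat (3 * m)" z 2 "of_nat (3 * n)"] by (simp add: dist_commute)
  moreover have "dist (of_nat (3 * m)) (of_nat (3 * n) :: complex) = \<bar>of_int (3 * int m - 3 * int n)\<bar>"
  proof -
    have "of_nat (3 * m) - of_nat (3 * n) = (of_int (3 * int m - 3 * int n) :: complex)" by simp
    then show ?thesis unfolding dist_norm by (metis norm_of_int)
  qed
  moreover have "\<bar>3 * int m - 3 * int n\<bar> \<ge> 3" using \<open>m \<noteq> n\<close> by linarith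
  then have "\<bar>of_int (3 * int m - 3 * int n) :: real\<bar> \<ge> 3" by linarith
  ultimately show False by linarith
qed

text \<open>Montel's theorem is applied once, on a disjoint union of discs that carries all the charts.\<close>

lemma Montel_family:
  fixes \<Phi> :: "nat \<Rightarrow> nat \<Rightarrow> complex \<Rightarrow> complex"
  assumes hol: "\<And>m n. m \<le> n \<Longrightarrow> \<Phi> m n holomorphic_on ball 0 1"
    and bd: "\<And>m t. 0 < t \<Longrightarrow> t < 1 \<Longrightarrow> \<exists>B. \<forall>n\<ge>m. \<forall>z\<in>ball 0 t. norm (\<Phi> m n z) \<le> B"
  obtains r \<phi> where "strict_mono (r::nat \<Rightarrow> nat)" "\<And>m. \<phi> m holomorphic_on ball 0 1"
    "\<And>m z. z \<in> ball 0 1 \<Longrightarrow> (\<lambda>n. \<Phi> m (r n) z) \<longlonglongrightarrow> \<phi> m z"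
    "\<And>m X. compact X \<Longrightarrow> X \<subseteq> ball 0 1 \<Longrightarrow> uniform_limit X (\<lambda>n. \<Phi> m (r n)) (\<phi> m) sequentially"
proof -
  define c where "c m = (of_nat (3 * m) :: complex)" for m
  define S where "S = (\<Union>m. ball (c m) 1)"
  define idx where "idx z = (THE m. z \<in> ball (c m) 1)" for z
  have idx: "idx z = m" if "z \<in> ball (c m) 1" for z m
    unfolding idx_def using that disjoint_unit_balls unfolding c_def by blast
  \<comment> \<open>\<open>\<Phi> m n\<close> is holomorphic only for \<open>m \<le> n\<close>; on
    the discs of larger index the \<open>n\<close>-th function is set to 0, which does not affect
    limits.\<close>
  define \<F> where "\<F> n z = (if idx z \<le> n then \<Phi> (idx z) n (z - c (idx z)) else 0)" for n z
  have Fm: "\<F> n z = (if m \<le> n then \<Phi> m n (z - c m) else 0)" if "z \<in> ball (c m) 1" for n m z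
    using idx[OF that] by (simp add: \<F>_def)
  have Fh: "\<F> n holomorphic_on S" for n unfolding S_def
  proof (rule holomorphic_on_UN_open)
    fix m
    show "\<F> n holomorphic_on ball (c m) 1"
    proof (cases "m \<le> n")
      case True
      have "(\<Phi> m n \<circ> (\<lambda>z. z - c m)) holomorphic_on ball (c m) 1"
        by (rule holomorphic_on_compose_gen[OF _ hol[OF True]]) (auto intro!: holomorphic_intros simp: dist_norm norm_minus_commute)
      then show ?thesis by (rule holomorphic_transform) (use Fm True in auto)
    next
      case False
      show ?thesis by (rule holomorphic_transform[of "\<lambda>_. 0"]) (use Fm False in auto)
    qed
  qed auto
  have bounded: "\<exists>B. \<forall>h\<in>range \<F>. \<forall>z\<in>X. norm (h z) \<le> B" if X: "compact X" "X \<subseteq> S" for X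
  proof -
    \<comment> \<open>Radii increasing to 1; the shrunken discs around all centres form an open
      cover from which a compact set needs only finitely many.\<close>
    define t where "t j = 1 - 1 / (real j + 2)" for j
    have t: "0 < t j" "t j < 1" for j by (auto simp: t_def field_simps)
    have "X \<subseteq> (\<Union>p\<in>UNIV. ball (c (fst p)) (t (snd p)))"
    proof
      fix z assume "z \<in> X"
      then obtain m where m: "dist (c m) z < 1" using X(2) by (auto simp: S_def)
      then obtain j where "inverse (real (Suc j)) < 1 - dist (c m) z" using reals_Archimedean[of "1 - dist (c m) z"] by auto
      moreover have "1 / (real j + 2) \<le> inverse (real (Suc j))" by (simp add: field_simps)
      ultimately have "z \<in> ball (c m) (t j)" by (simp add: t_def)
      then show "z \<in> (\<Union>p\<in>UNIV. ball (c (fst p)) (t (snd p)))" by (intro UN_I[of "(m, j)"]) auto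
    qed
    then obtain P where P: "finite P" "X \<subseteq> (\<Union>p\<in>P. ball (c (fst p)) (t (snd p)))"
      using compactE_image[OF X(1), of UNIV "\<lambda>p. ball (c (fst p)) (t (snd p))"] by (metis open_ball)
    have "\<forall>p. \<exists>B. \<forall>n\<ge>fst p. \<forall>z\<in>ball 0 (t (snd p)). norm (\<Phi> (fst p) n z) \<le> B" using bd t by blast
    then obtain B where B: "\<And>p n z. n \<ge> fst p \<Longrightarrow> z \<in> ball 0 (t (snd p)) \<Longrightarrow> norm (\<Phi> (fst p) n z) \<le> B p" by metis
    have "norm (\<F> n z) \<le> (\<Sum>p\<in>P. \<bar>B p\<bar>)" if z: "z \<in> X" for n z
    proof -
      obtain p where p: "p \<in> P" "z \<in> ball (c (fst p)) (t (snd p))" using P(2) z by blast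
      have z1: "z \<in> ball (c (fst p)) 1" using p(2) t(2)[of "snd p"] by auto
      have "z - c (fst p) \<in> ball 0 (t (snd p))" using p(2) by (simp add: dist_norm norm_minus_commute)
      then have "norm (\<F> n z) \<le> \<bar>B p\<bar>" using Fm[OF z1, of n] B[of p n "z - c (fst p)"] by auto
      also have "\<dots> \<le> (\<Sum>p\<in>P. \<bar>B p\<bar>)" using p(1) P(1) by (intro member_le_sum) auto
      finally show ?thesis .
    qed
    then show ?thesis by blast
  qed
  have oS: "open S" unfolding S_def by auto
  obtain \<G> r where G: "\<G> holomorphic_on S" "strict_mono (r::nat \<Rightarrow> nat)"
    "\<And>x. x \<in> S \<Longrightarrow> ((\<lambda>n. \<F> (r n) x) \<longlongrightarrow> \<G> x) sequentially"
    "\<And>X. compact X \<Longrightarrow> X \<subseteq> S \<Longrightarrow> uniform_limit X (\<F> \<circ> r) \<G> sequentially"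
    by (rule Montel[OF oS, of "range \<F>" \<F>]) (use Fh bounded in auto)
  have sh: "z + c m \<in> ball (c m) 1" "z + c m \<in> S" if "z \<in> ball 0 1" for z m
    using that by (auto simp: S_def dist_norm intro!: exI[of _ m])
  have ev: "\<forall>\<^sub>F n in sequentially. m \<le> r n" for m
    using eventually_ge_at_top[of m] by (rule eventually_mono) (use seq_suble[OF G(2)] order_trans in blast)
  have evF: "\<forall>\<^sub>F n in sequentially. \<forall>z\<in>ball 0 1. \<F> (r n) (z + c m) = \<Phi> m (r n) z" for m
    using ev[of m] by eventually_elim (use Fm[OF sh(1)] in auto)
  show ?thesis
  proof (rule that[OF G(2), of "\<lambda>m z. \<G> (z + c m)"])
    fix m
    have "(\<G> \<circ> (\<lambda>z. z + c m)) holomorphic_on ball 0 1"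
      by (rule holomorphic_on_compose_gen[OF _ G(1)]) (use sh in \<open>auto intro!: holomorphic_intros\<close>)
    then show "(\<lambda>z. \<G> (z + c m)) holomorphic_on ball 0 1" by (simp add: o_def)
    show "(\<lambda>n. \<Phi> m (r n) z) \<longlonglongrightarrow> \<G> (z + c m)" if z: "z \<in> ball 0 1" for z
      by (rule Lim_transform_eventually[OF G(3)[OF sh(2)[OF z]]]) (use evF[of m] z in \<open>auto elim: eventually_mono\<close>)
    fix X assume X: "compact X" "X \<subseteq> ball (0::complex) 1"
    define Y where "Y = (\<lambda>z. z + c m) ` X"
    have "compact Y" unfolding Y_def using X(1) by (intro compact_continuous_image continuous_intros)
    moreover have "Y \<subseteq> S" using sh X by (auto simp: Y_def)
    ultimately have ul: "uniform_limit Y (\<F> \<circ> r) \<G> sequentially" by (rule G(4))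
    show "uniform_limit X (\<lambda>n. \<Phi> m (r n)) (\<lambda>z. \<G> (z + c m)) sequentially"
      unfolding uniform_limit_iff
    proof (intro allI impI)
      fix e :: real assume "e > 0"
      then have "\<forall>\<^sub>F n in sequentially. \<forall>x\<in>Y. dist ((\<F> \<circ> r) n x) (\<G> x) < e" using ul unfolding uniform_limit_iff by blast
      then show "\<forall>\<^sub>F n in sequentially. \<forall>x\<in>X. dist (\<Phi> m (r n) x) (\<G> (x + c m)) < e"
        using evF[of m]
      proof eventually_elim
        case (elim n)
        show ?case
        proof
          fix x assume x: "x \<in> X"
          have "dist (\<F> (r n) (x + c m)) (\<G> (x + c m)) < e" using elim(1) x by (auto simp: Y_def)
          then show "dist (\<Phi> m (r n) x) (\<G> (x + c m)) < e" using elim(2) x X(2) by auto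
        qed
      qed
    qed
  qed
qed

text \<open>On the piece of radius \<open>R m\<close> the \<open>n\<close>-th welding is a univalent
  function \<open>\<Psi> m n\<close> of the \<open>m\<close>-th one; precomposed with the Riemann
  map \<open>p m\<close> it becomes \<open>\<Phi> m n\<close> on the unit disc. A subsequence
  converges for all \<open>m\<close> at once, the limits remain univalent by Hurwitz's theorem, and
  composing them with the \<open>m\<close>-th welding gives the limit welding on each piece.\<close>

lemma weld_entire: "\<exists>f g. \<forall>R. weld k R f g"
proof -
  have "\<forall>n::nat. \<exists>f g. weld k (real n + 3) f g \<and> f 0 = 0 \<and> deriv f 0 = 1"
  proof
    fix n :: nat
    have "1 < real n + 3" by simp
    then show "\<exists>f g. weld k (real n + 3) f g \<and> f 0 = 0 \<and> deriv f 0 = 1" using weld_normalized by metis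
  qed
  then obtain F G where FG: "\<And>n::nat. weld k (real n + 3) (F n) (G n)" "\<And>n. F n 0 = 0" "\<And>n. deriv (F n) 0 = 1"
    by metis
  \<comment> \<open>Strictly less than the radius \<open>real m + 3\<close> of the
    \<open>m\<close>-th welding, so that the piece is relatively compact and
    \<open>weld_disc\<close> applies.\<close>
  define R where "R m = real m + 2" for m
  have R1: "R m > 1" for m by (simp add: R_def)
  have FGR: "weld k (R m) (F n) (G n)" if "m \<le> n" for m n
    by (rule weld_subset[OF FG(1)]) (use that in \<open>simp add: R_def\<close>)
  define \<Omega> where "\<Omega> m = weld_image (R m) (F m) (G m)" for m
  have "\<forall>m. \<exists>h p. h holomorphic_on \<Omega> m \<and> p holomorphic_on ball 0 1 \<and> h 0 = 0 \<and>
     (\<forall>z\<in>\<Omega> m. h z \<in> ball 0 1 \<and> p (h z) = z) \<and> (\<forall>z\<in>ball 0 1. p z \<in> \<Omega> m \<and> h (p z) = z)"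
  proof
    fix m
    have "R m < real m + 3" by (simp add: R_def)
    show "\<exists>h p. h holomorphic_on \<Omega> m \<and> p holomorphic_on ball 0 1 \<and> h 0 = 0 \<and>
     (\<forall>z\<in>\<Omega> m. h z \<in> ball 0 1 \<and> p (h z) = z) \<and> (\<forall>z\<in>ball 0 1. p z \<in> \<Omega> m \<and> h (p z) = z)"
    proof (rule weld_disc[OF R1 \<open>R m < real m + 3\<close> FG(1)])
      fix h p
      assume a: "h holomorphic_on weld_image (R m) (F m) (G m)" "p holomorphic_on ball 0 1" "h (F m 0) = 0"
        "\<And>z. z \<in> weld_image (R m) (F m) (G m) \<Longrightarrow> h z \<in> ball 0 1 \<and> p (h z) = z"
        "\<And>z. z \<in> ball 0 1 \<Longrightarrow> p z \<in> weld_image (R m) (F m) (G m) \<and> h (p z) = z"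
      show ?thesis unfolding \<Omega>_def
        by (rule exI[of _ h], rule exI[of _ p]) (use a FG(2) in simp)
    qed
  qed
  then obtain h p where hp: "\<And>m. h m holomorphic_on \<Omega> m" "\<And>m. p m holomorphic_on ball 0 1" "\<And>m. h m 0 = 0"
    "\<And>m z. z \<in> \<Omega> m \<Longrightarrow> h m z \<in> ball 0 1 \<and> p m (h m z) = z" "\<And>m z. z \<in> ball 0 1 \<Longrightarrow> p m z \<in> \<Omega> m \<and> h m (p m z) = z"
    by metis
  define extends where "extends m n \<Psi> \<longleftrightarrow> \<Psi> holomorphic_on \<Omega> m \<and> (\<forall>z. norm z \<le> 1 \<longrightarrow> \<Psi> (F m z) = F n z) \<and>
      (\<forall>w\<in>collar (R m). \<Psi> (G m w) = G n w)" for m n \<Psi>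
  have "\<forall>m n. \<exists>\<Psi>. m \<le> n \<longrightarrow> extends m n \<Psi>"
  proof (intro allI)
    fix m n
    show "\<exists>\<Psi>. m \<le> n \<longrightarrow> extends m n \<Psi>"
    proof (cases "m \<le> n")
      case True
      have "glued k (R m) (F n) (G n)" using FGR[OF True] by (simp add: weld_def)
      then show ?thesis
      proof (rule transfer_glued[OF R1 FGR[OF order_refl, of m]])
        fix \<Psi>
        assume "\<Psi> holomorphic_on weld_image (R m) (F m) (G m)" "\<And>z. norm z \<le> 1 \<Longrightarrow> \<Psi> (F m z) = F n z"
          "\<And>w. w \<in> collar (R m) \<Longrightarrow> \<Psi> (G m w) = G n w"
        then have "extends m n \<Psi>" unfolding extends_def \<Omega>_def by simp
        then show ?thesis by blast
      qed
    qed simp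
  qed
  then obtain \<Psi> where ext: "\<And>m n. m \<le> n \<Longrightarrow> extends m n (\<Psi> m n)" by metis
  then have \<Psi>: "\<And>m n. m \<le> n \<Longrightarrow> \<Psi> m n holomorphic_on \<Omega> m"
    "\<And>m n z. m \<le> n \<Longrightarrow> norm z \<le> 1 \<Longrightarrow> \<Psi> m n (F m z) = F n z"
    "\<And>m n w. m \<le> n \<Longrightarrow> w \<in> collar (R m) \<Longrightarrow> \<Psi> m n (G m w) = G n w"
    unfolding extends_def by blast+
  define \<Phi> where "\<Phi> m n z = \<Psi> m n (p m z)" for m n z
  have pin: "inj_on (p m) (ball 0 1)" for m by (metis hp(5) inj_onI)
  have hin: "inj_on (h m) (\<Omega> m)" for m by (metis hp(4) inj_onI)
  have \<Omega>0: "0 \<in> \<Omega> m" and F\<Omega>: "norm z \<le> 1 \<Longrightarrow> F m z \<in> \<Omega> m" and G\<Omega>: "w \<in> collar (R m) \<Longrightarrow> G m w \<in> \<Omega> m" for m z w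
  proof -
    have glu: "glued k (R m) (F m) (G m)" using FGR[OF order_refl] by (simp add: weld_def)
    show F: "F m z \<in> \<Omega> m" if "norm z \<le> 1" for z unfolding \<Omega>_def by (rule f_in_weld_image[OF R1 glu that])
    show "0 \<in> \<Omega> m" using F[of 0] FG(2) by simp
    show "w \<in> collar (R m) \<Longrightarrow> G m w \<in> \<Omega> m" by (auto simp: \<Omega>_def weld_image_def)
  qed
  have p0: "p m 0 = 0" for m using hp(4)[OF \<Omega>0] hp(3) by metis
  define c where "c m = deriv (p m) 0" for m
  have c0: "c m \<noteq> 0" for m unfolding c_def
    using holomorphic_injective_imp_regular[OF hp(2) open_ball pin] by simp
  have o\<Omega>: "open (\<Omega> m)" for m unfolding \<Omega>_def using weld_image_simply_connected(1)[OF R1 FGR[OF order_refl]] .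
  have \<Phi>h: "\<Phi> m n holomorphic_on ball 0 1" if "m \<le> n" for m n
    unfolding \<Phi>_def by (rule holomorphic_on_compose_gen[OF hp(2) \<Psi>(1)[OF that], unfolded o_def]) (use hp(5) in auto)
  have \<Psi>i: "inj_on (\<Psi> m n) (\<Omega> m)" if "m \<le> n" for m n
    unfolding \<Omega>_def by (rule weld_inj_transfer[OF R1 FGR[OF order_refl] FGR[OF that]]) (use \<Psi>(2,3)[OF that] in auto)
  have \<Phi>i: "inj_on (\<Phi> m n) (ball 0 1)" if "m \<le> n" for m n
  proof (rule inj_onI)
    fix x y :: complex assume xy: "x \<in> ball 0 1" "y \<in> ball 0 1" "\<Phi> m n x = \<Phi> m n y"
    then have "p m x = p m y" using \<Psi>i[OF that] hp(5) unfolding \<Phi>_def inj_on_def by metis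
    then show "x = y" using pin xy unfolding inj_on_def by metis
  qed
  have \<Phi>0: "\<Phi> m n 0 = 0" if "m \<le> n" for m n
    using \<Psi>(2)[OF that, of 0] FG(2) by (simp add: \<Phi>_def p0)
  have Fd: "(F m has_field_derivative 1) (at 0)" for m
  proof -
    have "F m holomorphic_on ball 0 1" using FG(1) by (auto simp: weld_def glued_def)
    then show ?thesis using holomorphic_derivI[of "F m" "ball 0 1" 0] FG(3) by simp
  qed
  \<comment> \<open>\<open>F m\<close> and \<open>F n\<close> both have derivative 1 at 0, so
    \<open>\<Psi> m n\<close> has derivative 1 there. The derivative of \<open>\<Phi> m n\<close> is
    thus that of \<open>p m\<close>, independent of \<open>n\<close>; this gives the uniform bound
    now and a nonconstant limit later.\<close>
  have \<Phi>d: "(\<Phi> m n has_field_derivative c m) (at 0)" if mn: "m \<le> n" for m n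
  proof -
    have d1: "(\<Psi> m n has_field_derivative deriv (\<Psi> m n) 0) (at 0)"
      by (rule holomorphic_derivI[OF \<Psi>(1)[OF mn] o\<Omega> \<Omega>0])
    have "((\<lambda>z. \<Psi> m n (F m z)) has_field_derivative deriv (\<Psi> m n) 0 * 1) (at 0)"
      by (rule DERIV_chain2[where f = "\<Psi> m n" and g = "F m"]) (use d1 Fd FG(2) in simp_all)
    then have "(F n has_field_derivative deriv (\<Psi> m n) 0 * 1) (at 0)"
      by (rule has_field_derivative_transform_within_open[of _ _ _ "ball 0 1"]) (use \<Psi>(2)[OF mn] in auto)
    then have e: "deriv (\<Psi> m n) 0 = 1" using DERIV_unique[OF Fd] by fastforce
    have d2: "(p m has_field_derivative c m) (at 0)" unfolding c_def
      by (rule holomorphic_derivI[OF hp(2) open_ball]) simp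
    have "((\<lambda>z. \<Psi> m n (p m z)) has_field_derivative 1 * c m) (at 0)"
      by (rule DERIV_chain2[where f = "\<Psi> m n" and g = "p m"]) (use d1 d2 e p0 in simp_all)
    then show ?thesis by (simp add: \<Phi>_def[abs_def])
  qed
  have bd: "\<exists>B. \<forall>n\<ge>m. \<forall>z\<in>ball 0 t. norm (\<Phi> m n z) \<le> B" if t: "0 < t" "t < 1" for m t
  proof -
    obtain M where M: "\<And>f z. f holomorphic_on ball 0 1 \<Longrightarrow> inj_on f (ball 0 1) \<Longrightarrow> f 0 = 0 \<Longrightarrow> deriv f 0 = 1 \<Longrightarrow>
       norm z \<le> t \<Longrightarrow> norm (f z) \<le> M" by (rule univalent_growth_bound[OF t]) blast
    have "norm (\<Phi> m n z) \<le> norm (c m) * M" if "m \<le> n" "z \<in> ball 0 t" for n z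
    proof -
      have "norm (\<Phi> m n z / c m) \<le> M"
      proof (rule M[of "\<lambda>z. \<Phi> m n z / c m"])
        show "(\<lambda>z. \<Phi> m n z / c m) holomorphic_on ball 0 1" using \<Phi>h[OF that(1)] c0 by (intro holomorphic_intros)
        show "inj_on (\<lambda>z. \<Phi> m n z / c m) (ball 0 1)" using \<Phi>i[OF that(1)] c0[of m] by (auto simp: inj_on_def)
        have "((\<lambda>z. \<Phi> m n z / c m) has_field_derivative c m / c m) (at 0)"
          by (rule DERIV_cdivide[OF \<Phi>d[OF that(1)]])
        then show "deriv (\<lambda>z. \<Phi> m n z / c m) 0 = 1" using c0[of m] by (simp add: DERIV_imp_deriv)
      qed (use \<Phi>0[OF that(1)] that(2) in auto)
      then show ?thesis using c0[of m] by (simp add: norm_divide field_simps)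
    qed
    then show ?thesis by blast
  qed
  obtain r \<phi> where r: "strict_mono (r::nat \<Rightarrow> nat)" "\<And>m. \<phi> m holomorphic_on ball 0 1"
    "\<And>m z. z \<in> ball 0 1 \<Longrightarrow> (\<lambda>n. \<Phi> m (r n) z) \<longlonglongrightarrow> \<phi> m z"
    "\<And>m X. compact X \<Longrightarrow> X \<subseteq> ball 0 1 \<Longrightarrow> uniform_limit X (\<lambda>n. \<Phi> m (r n)) (\<phi> m) sequentially"
    by (rule Montel_family[of \<Phi>])
       (rule \<Phi>h, assumption, rule bd, assumption, assumption, rule that, assumption+)
  have rge: "m \<le> r (n + m)" for m n using seq_suble[OF r(1), of "n + m"] by simp
  have \<phi>i: "inj_on (\<phi> m) (ball 0 1)" for m
  proof -
    have ul: "uniform_limit X (\<lambda>n. \<Phi> m (r (n + m))) (\<phi> m) sequentially" if "compact X" "X \<subseteq> ball 0 1" for X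
      using filterlim_compose[OF r(4)[OF that] filterlim_add_const_nat_at_top[of m]] .
    show ?thesis
    proof (rule Hurwitz_injective[OF open_ball connected_ball _ r(2) ul])
      show "\<Phi> m (r (n + m)) holomorphic_on ball 0 1" for n by (rule \<Phi>h[OF rge])
      show "inj_on (\<Phi> m (r (n + m))) (ball 0 1)" for n by (rule \<Phi>i[OF rge])
      \<comment> \<open>Derivatives converge along with the functions, and at 0 they are all equal
        to \<open>c m\<close>, which is nonzero.\<close>
      show "\<not> \<phi> m constant_on ball 0 1"
      proof
        assume "\<phi> m constant_on ball 0 1"
        then obtain d where d: "\<And>z. z \<in> ball 0 1 \<Longrightarrow> \<phi> m z = d" unfolding constant_on_def by blast
        have ul2: "uniform_limit (cball 0 (1/2)) (\<lambda>n. \<Phi> m (r (n + m))) (\<phi> m) sequentially" by (rule ul) auto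
        have evd: "\<forall>\<^sub>F n in sequentially. continuous_on (cball 0 (1/2)) (\<Phi> m (r (n + m))) \<and>
            (\<forall>w\<in>ball 0 (1/2). (\<Phi> m (r (n + m)) has_field_derivative deriv (\<Phi> m (r (n + m))) w) (at w))"
        proof (intro always_eventually allI conjI ballI)
          fix n
          show "continuous_on (cball 0 (1/2)) (\<Phi> m (r (n + m)))"
            by (rule continuous_on_subset[OF holomorphic_on_imp_continuous_on[OF \<Phi>h[OF rge]]]) auto
          fix w :: complex assume "w \<in> ball 0 (1/2)"
          then show "(\<Phi> m (r (n + m)) has_field_derivative deriv (\<Phi> m (r (n + m))) w) (at w)"
            by (intro holomorphic_derivI[OF \<Phi>h[OF rge] open_ball]) auto
        qed
        obtain g' where g': "\<And>w. w \<in> ball 0 (1/2) \<Longrightarrow>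
            (\<phi> m has_field_derivative g' w) (at w) \<and> ((\<lambda>n. deriv (\<Phi> m (r (n + m))) w) \<longlongrightarrow> g' w) sequentially"
          by (rule has_complex_derivative_uniform_limit[OF evd ul2]) auto
        have "deriv (\<Phi> m (r (n + m))) 0 = c m" for n by (rule DERIV_imp_deriv[OF \<Phi>d[OF rge]])
        then have "g' 0 = c m" using g'[of 0] by (simp add: LIMSEQ_const_iff)
        moreover have "(\<phi> m has_field_derivative 0) (at 0)"
          by (rule has_field_derivative_transform_within_open[of "\<lambda>_. d" _ _ "ball 0 1"]) (use d in auto)
        ultimately show False using g'[of 0] c0[of m] DERIV_unique by fastforce
      qed
    qed
  qed
  \<comment> \<open>As limits of the weldings themselves, \<open>f\<close> and \<open>g\<close> do
    not depend on the piece \<open>m\<close> on which they are computed.\<close>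
  define f where "f z = lim (\<lambda>n. F (r n) z)" for z
  define g where "g w = lim (\<lambda>n. G (r n) w)" for w
  have evr: "\<forall>\<^sub>F n in sequentially. m \<le> r n" for m
    using eventually_ge_at_top[of m] by (rule eventually_mono) (use seq_suble[OF r(1)] order_trans in blast)
  have fe: "f z = \<phi> m (h m (F m z))" if z: "norm z \<le> 1" for m z
  proof -
    have "(\<lambda>n. \<Phi> m (r n) (h m (F m z))) \<longlonglongrightarrow> \<phi> m (h m (F m z))"
      using r(3) hp(4)[OF F\<Omega>[OF z]] by blast
    moreover have "\<forall>\<^sub>F n in sequentially. \<Phi> m (r n) (h m (F m z)) = F (r n) z"
      using evr[of m] by eventually_elim (use hp(4)[OF F\<Omega>[OF z]] \<Psi>(2) z in \<open>simp add: \<Phi>_def\<close>)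
    ultimately have "(\<lambda>n. F (r n) z) \<longlonglongrightarrow> \<phi> m (h m (F m z))" by (rule Lim_transform_eventually)
    then show ?thesis unfolding f_def by (rule limI)
  qed
  have ge: "g w = \<phi> m (h m (G m w))" if w: "w \<in> collar (R m)" for m w
  proof -
    have "(\<lambda>n. \<Phi> m (r n) (h m (G m w))) \<longlonglongrightarrow> \<phi> m (h m (G m w))"
      using r(3) hp(4)[OF G\<Omega>[OF w]] by blast
    moreover have "\<forall>\<^sub>F n in sequentially. \<Phi> m (r n) (h m (G m w)) = G (r n) w"
      using evr[of m] by eventually_elim (use hp(4)[OF G\<Omega>[OF w]] \<Psi>(3)[OF _ w] in \<open>simp add: \<Phi>_def\<close>)
    ultimately have "(\<lambda>n. G (r n) w) \<longlonglongrightarrow> \<phi> m (h m (G m w))" by (rule Lim_transform_eventually)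
    then show ?thesis unfolding g_def by (rule limI)
  qed
  have wm: "weld k (R m) f g" for m
  proof (rule weld_compose[OF R1 FGR[OF order_refl]])
    show "(\<phi> m \<circ> h m) holomorphic_on weld_image (R m) (F m) (G m)"
      by (rule holomorphic_on_compose_gen[OF hp(1)[unfolded \<Omega>_def] r(2)]) (use hp(4) in \<open>auto simp: \<Omega>_def\<close>)
    show "inj_on (\<phi> m \<circ> h m) (weld_image (R m) (F m) (G m))"
      by (rule comp_inj_on[OF hin[unfolded \<Omega>_def]]) (rule inj_on_subset[OF \<phi>i], use hp(4) in \<open>auto simp: \<Omega>_def\<close>)
  qed (use fe ge in auto)
  have "weld k S f g" for S
  proof -
    obtain m :: nat where "S \<le> real m" using real_arch_simple by blast
    then show ?thesis by (intro weld_subset[OF wm[of m]]) (simp add: R_def)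
  qed
  then show ?thesis by blast
qed

text \<open>The point at infinity of the glued surface: near it \<open>g\<close> omits an open set, so it has at most
  a pole there, and a finite limit would embed a sphere in the plane.\<close>

lemma weld_at_infinity:
  assumes fg: "\<And>R. weld k R f g"
  obtains Q where "Q holomorphic_on ball 0 1" "Q 0 = 0"
    "\<And>v. v \<in> ball 0 1 \<Longrightarrow> v \<noteq> 0 \<Longrightarrow> g (1 / v) \<noteq> f 0 \<and> Q v = inverse (g (1 / v) - f 0)"
    "f ` ball 0 1 \<union> g ` {w. 1 \<le> norm w} = UNIV"
proof -
  have f: "continuous_on (cball 0 1) f" "f holomorphic_on ball 0 1" "inj_on f (cball 0 1)"
    using fg[of 2] by (auto simp: weld_def glued_def)
  have disj: "f z \<noteq> g w" if "norm z < 1" "1 \<le> norm w" for z w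
    using fg[of "norm w + 1"] that by (auto simp: weld_def)
  have gh: "g holomorphic_on {w. 1 < norm w}"
    unfolding holomorphic_on_def
  proof
    fix w :: complex assume w: "w \<in> {w. 1 < norm w}"
    have "g holomorphic_on annulus 1 (norm w + 1)" using fg[of "norm w + 1"] by (simp add: weld_def glued_def)
    then have "g field_differentiable at w" using w open_annulus by (intro holomorphic_on_imp_differentiable_at) auto
    then show "g field_differentiable at w within {w. 1 < norm w}" by (rule field_differentiable_at_within)
  qed
  define q where "q v = inverse (g (1 / v) - f 0)" for v
  have inv: "1 / v \<in> {w. 1 < norm w}" if "v \<in> ball 0 1 - {0}" for v :: complex
    using that by (auto simp: norm_divide field_simps)
  have q0: "g (1 / v) \<noteq> f 0" if "v \<in> ball 0 1 - {0}" for v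
    using disj[of 0 "1 / v"] inv[OF that] by (metis less_imp_le mem_Collect_eq norm_zero zero_less_one)
  have gi: "(\<lambda>v. g (1 / v)) holomorphic_on ball 0 1 - {0}"
    by (rule holomorphic_on_compose_gen[OF _ gh, of "\<lambda>v. 1 / v", unfolded o_def]) (use inv in \<open>auto intro!: holomorphic_intros\<close>)
  have qh: "q holomorphic_on ball 0 1 - {0}" unfolding q_def
    using gi q0 by (intro holomorphic_intros) auto
  have fi: "inj_on f (ball 0 1)" using f(3) by (rule inj_on_subset) auto
  have "open (f ` ball 0 1)" by (rule open_mapping_thm3[OF f(2) open_ball fi])
  then obtain e where e: "e > 0" "ball (f 0) e \<subseteq> f ` ball 0 1"
    by (metis centre_in_ball image_eqI openE zero_less_one)
  have qb: "norm (q v) \<le> 1 / e" if v: "v \<in> ball 0 1 - {0}" for v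
  proof -
    have "g (1 / v) \<notin> f ` ball 0 1"
    proof
      assume "g (1 / v) \<in> f ` ball 0 1"
      then obtain z where "norm z < 1" "g (1 / v) = f z" by auto
      then show False using disj[of z "1 / v"] inv[OF v] by auto
    qed
    then have "g (1 / v) \<notin> ball (f 0) e" using e(2) by blast
    then have "e \<le> norm (g (1 / v) - f 0)" by (simp add: dist_norm norm_minus_commute)
    then have "inverse (norm (g (1 / v) - f 0)) \<le> inverse e" using e(1) by (intro le_imp_inverse_le)
    then show ?thesis by (simp add: q_def norm_divide inverse_eq_divide)
  qed
  have "\<exists>B. eventually (\<lambda>v. norm (q v) \<le> B) (at 0)"
  proof -
    have "eventually (\<lambda>v. v \<in> ball 0 1 - {0}) (at (0::complex))"
      by (rule eventually_at_in_open) auto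
    then have "eventually (\<lambda>v. norm (q v) \<le> 1 / e) (at 0)" by (rule eventually_mono) (rule qb)
    then show ?thesis by blast
  qed
  then obtain Q where Q: "Q holomorphic_on ball 0 1" "\<And>v. v \<in> ball 0 1 - {0} \<Longrightarrow> Q v = q v"
    using holomorphic_on_extend_bounded[OF qh] by auto
  have Qc: "continuous_on (ball 0 1) Q" using Q(1) by (rule holomorphic_on_imp_continuous_on)
  have Qn: "Q v \<noteq> 0" if "v \<in> ball 0 1 - {0}" for v
    using Q(2)[OF that] q0[OF that] by (simp add: q_def)
  have gQ: "g w = f 0 + inverse (Q (1 / w))" if "norm w > 1" for w
  proof -
    have "1 / w \<in> ball 0 1 - {0}" using that inverse_in_ball[of 1 w] by auto
    from Q(2)[OF this] show ?thesis by (simp add: q_def)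
  qed
  define U where "U = f ` ball 0 1 \<union> g ` {w. 1 \<le> norm w}"
  have wmc: "continuous_on (ball 0 R) (weld_map k f g)" for R
    using fg[of R] by (intro weld_map_continuous) (simp add: weld_def)
  have im: "weld_map k f g ` ball 0 R = weld_image R f g" if "R > 1" for R
    using fg[of R] that by (intro weld_map_image) (auto simp: weld_def)
  have Ueq: "U = (\<Union>n::nat. weld_image (real n + 2) f g)"
  proof (intro equalityI subsetI)
    fix x assume "x \<in> U"
    then consider "x \<in> f ` ball 0 1" | w where "1 \<le> norm w" "x = g w" by (auto simp: U_def)
    then show "x \<in> (\<Union>n::nat. weld_image (real n + 2) f g)"
    proof cases
      case 2
      obtain n :: nat where "norm w \<le> real n" using real_arch_simple by blast
      then have "w \<in> collar (real n + 2)" using 2 by simp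
      then show ?thesis using 2 unfolding weld_image_def by blast
    qed (auto simp: weld_image_def)
  qed (auto simp: U_def weld_image_def)
  have oU: "open U" unfolding Ueq using weld_image_simply_connected(1)[OF _ fg] by auto
  have cpt: "compact (weld_map k f g ` cball 0 R)" for R
    by (intro compact_continuous_image continuous_on_subset[OF wmc[of "R + 1"]]) auto
  have wU: "weld_map k f g ` cball 0 R \<subseteq> U" for R
  proof -
    have "weld_map k f g ` cball 0 R \<subseteq> weld_map k f g ` ball 0 (\<bar>R\<bar> + 2)" by (intro image_mono) auto
    also have "\<dots> = weld_image (\<bar>R\<bar> + 2) f g" by (rule im) simp
    also have "\<dots> \<subseteq> U" by (auto simp: U_def weld_image_def)
    finally show ?thesis .
  qed
  have Ucov: "x \<in> weld_map k f g ` cball 0 R \<or> (\<exists>w. norm w > R \<and> x = g w)"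
    if xU: "x \<in> U" and R1: "R > 1" for x R
  proof -
    consider z where "norm z < 1" "x = f z" | w where "1 \<le> norm w" "x = g w" using xU by (auto simp: U_def)
    then show ?thesis
    proof cases
      case 1
      then show ?thesis using R1 by (intro disjI1 image_eqI[of _ _ z]) (auto simp: weld_map_def)
    next
      case 2
      have "glued k (norm w + 1) f g" using fg by (simp add: weld_def)
      then obtain z where "norm z = norm w" "weld_map k f g z = g w" using weld_map_collar[of "norm w + 1" f g w] 2 by auto
      then have "norm w \<le> R \<Longrightarrow> x \<in> weld_map k f g ` cball 0 R" using 2 by (intro image_eqI[of _ _ z]) auto
      then show ?thesis using 2 by (cases "norm w > R") auto
    qed
  qed
  have Q0: "Q 0 = 0"
  proof (rule ccontr)
    assume "Q 0 \<noteq> 0"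
    then have Qnz: "Q v \<noteq> 0" if "v \<in> ball 0 1" for v using Qn that by (cases "v = 0") auto
    \<comment> \<open>The supposed finite value at infinity. With it the image \<open>U\<close>
      becomes compact, while \<open>U\<close> is open; connectedness of the plane without
      \<open>a\<close> then forces \<open>insert a U\<close> to be the whole plane, which is not
      compact.\<close>
    define a where "a = f 0 + inverse (Q 0)"
    define C where "C = (\<lambda>v. f 0 + inverse (Q v)) ` cball 0 (1/2)"
    have "compact C" unfolding C_def
      by (intro compact_continuous_image continuous_intros continuous_on_subset[OF Qc]) (use Qnz in auto)
    have CU: "C \<subseteq> insert a U"
    proof
      fix x assume "x \<in> C"
      then obtain v where v: "norm v \<le> 1/2" "x = f 0 + inverse (Q v)" by (auto simp: C_def)
      show "x \<in> insert a U"
      proof (cases "v = 0")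
        case False
        then have n: "norm (1 / v) > 1" using v(1) by (auto simp: norm_divide field_simps)
        then have "x = g (1 / v)" using gQ[OF n] v(2) by simp
        then show ?thesis using n by (auto simp: U_def)
      qed (use v in \<open>simp add: a_def\<close>)
    qed
    have "insert a U = weld_map k f g ` cball 0 2 \<union> C"
    proof (intro equalityI subsetI)
      fix x assume "x \<in> insert a U"
      then consider "x = a" | "x \<in> weld_map k f g ` cball 0 2" | w where "norm w > 2" "x = g w"
        using Ucov[of x 2] by auto
      then show "x \<in> weld_map k f g ` cball 0 2 \<union> C"
      proof cases
        case 1 then show ?thesis by (auto simp: C_def a_def intro!: image_eqI[of _ _ 0])
      next
        case 3
        then have "x = f 0 + inverse (Q (1 / w))" using gQ[of w] by simp
        moreover have "1 / w \<in> cball 0 (1/2)" using 3 inverse_in_ball[of 2 w] by auto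
        ultimately show ?thesis by (auto simp: C_def)
      qed auto
    qed (use wU CU in auto)
    then have cc: "compact (insert a U)" using cpt[of 2] \<open>compact C\<close> by (simp add: compact_Un)
    have "connected (- {a})" by (rule connected_punctured_universe) simp
    moreover have "open (- insert a U)" using cc by (simp add: compact_imp_closed open_Compl)
    moreover have "- {a} \<subseteq> U \<union> (- insert a U)" by blast
    ultimately have "U \<inter> (- {a}) = {} \<or> (- insert a U) \<inter> (- {a}) = {}"
      using connectedD[OF _ oU, of "- {a}" "- insert a U"] by blast
    then show False
    proof
      assume "U \<inter> (- {a}) = {}"
      then have "U \<subseteq> {a}" by blast
      moreover have "U \<noteq> {}" by (auto simp: U_def)
      ultimately have "U = {a}" by blast
      then show False using oU not_open_singleton by metis
    next
      assume "(- insert a U) \<inter> (- {a}) = {}"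
      then have "insert a U = UNIV" by blast
      then show False using cc by (metis compact_imp_bounded not_bounded_UNIV)
    qed
  qed
  have big: "\<exists>R>1. \<forall>w. norm w > R \<longrightarrow> norm (g w) > B" for B
  proof -
    define \<delta> where "\<delta> = 1 / (\<bar>B\<bar> + norm (f 0) + 1)"
    have den: "\<bar>B\<bar> + norm (f 0) + 1 > 0" by (metis abs_ge_zero add_nonneg_pos add_nonneg_nonneg norm_ge_zero zero_less_one)
    then have \<delta>: "\<delta> > 0" by (simp add: \<delta>_def)
    have "isCont Q 0" using Qc by (simp add: continuous_on_eq_continuous_at)
    then obtain d where d: "d > 0" "\<And>v. dist v 0 < d \<Longrightarrow> dist (Q v) (Q 0) < \<delta>"
      using \<delta> unfolding continuous_at_eps_delta dist_norm[symmetric] by metis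
    show ?thesis
    proof (intro exI[of _ "max 2 (1 / d)"] conjI allI impI)
      fix w :: complex assume w: "max 2 (1 / d) < norm w"
      have w0: "norm w > 0" "w \<noteq> 0" using w by auto
      have "1 < norm w * d" using w d(1) by (simp add: field_simps)
      then have "norm (1 / w) < d" using w0 by (simp add: norm_divide field_simps)
      then have Qs: "norm (Q (1 / w)) < \<delta>" using d(2)[of "1 / w"] Q0 by simp
      have "1 / w \<in> ball 0 1 - {0}" using w inverse_in_ball[of 1 w] by auto
      then have "norm (Q (1 / w)) > 0" using Qn by simp
      then have "inverse \<delta> < inverse (norm (Q (1 / w)))" using Qs by (intro less_imp_inverse_less)
      then have "\<bar>B\<bar> + norm (f 0) + 1 < norm (inverse (Q (1 / w)))" by (simp add: \<delta>_def norm_inverse)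
      moreover have "g w = f 0 + inverse (Q (1 / w))" using gQ w by simp
      ultimately show "B < norm (g w)" using norm_triangle_ineq4[of "f 0 + inverse (Q (1 / w))" "f 0"] by simp
    qed simp
  qed
  \<comment> \<open>Because \<open>g\<close> tends to infinity, a bounded sequence in
    \<open>U\<close> stays in the compact image of a closed ball under
    \<open>weld_map\<close>.\<close>
  have "closed U"
  proof (rule closed_sequential_limits[THEN iffD2], intro allI impI, elim conjE)
    fix x l assume x: "\<forall>n. x n \<in> U" "x \<longlonglongrightarrow> l"
    obtain B where B: "\<And>n. norm (x n) \<le> B" using convergent_imp_bounded[OF x(2)] by (auto simp: bounded_iff)
    obtain R where R: "R > 1" "\<And>w. norm w > R \<Longrightarrow> norm (g w) > B" using big by blast
    have "x n \<in> weld_map k f g ` cball 0 R" for n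
      using Ucov[of "x n" R] x(1) R B[of n] by fastforce
    then have "l \<in> weld_map k f g ` cball 0 R"
      using closed_sequentially[OF compact_imp_closed[OF cpt]] x(2) by blast
    then show "l \<in> U" using wU by blast
  qed
  then have "U = {} \<or> U = UNIV" using oU clopen by blast
  moreover have "U \<noteq> {}" by (auto simp: U_def)
  ultimately have "U = UNIV" by simp
  show ?thesis
  proof (rule that[OF Q(1) Q0])
    show "g (1 / v) \<noteq> f 0 \<and> Q v = inverse (g (1 / v) - f 0)" if "v \<in> ball 0 1" "v \<noteq> 0" for v
      using Q(2)[of v] q0[of v] that by (simp add: q_def)
    show "f ` ball 0 1 \<union> g ` {w. 1 \<le> norm w} = UNIV" using \<open>U = UNIV\<close> by (simp add: U_def)
  qed
qed

end

subsection \<open>Discs, circles and closures on the sphere\<close>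

lemma openin_unit_disc: "openin riemann_sphere unit_disc"
proof -
  have "unit_disc = Some ` ball (0::complex) 1" by (auto simp: unit_disc_def)
  moreover have "openin riemann_sphere (Some ` ball (0::complex) 1)" by simp
  ultimately show ?thesis by metis
qed

lemma exterior_disc_eq: "exterior_disc = sphere_inversion ` unit_disc"
proof (intro equalityI subsetI)
  fix p assume "p \<in> exterior_disc"
  then have "sphere_inversion p \<in> unit_disc" by (simp add: sphere_inversion_unit_disc_iff)
  then show "p \<in> sphere_inversion ` unit_disc" by (metis image_eqI sphere_inversion_invol)
qed (auto simp: sphere_inversion_exterior_disc_iff)

lemma openin_exterior_disc: "openin riemann_sphere exterior_disc"
  unfolding exterior_disc_eq
  using homeomorphic_map_openness[OF homeomorphic_map_sphere_inversion] openin_unit_disc by auto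

lemma continuous_map_Some_iff:
  fixes u :: "complex \<Rightarrow> complex"
  shows "continuous_map (top_of_set S) riemann_sphere (\<lambda>z. Some (u z)) \<longleftrightarrow> continuous_on S u"
proof
  assume c: "continuous_map (top_of_set S) riemann_sphere (\<lambda>z. Some (u z))"
  show "continuous_on S u" unfolding continuous_openin_preimage_eq
  proof (intro allI impI)
    fix T :: "complex set" assume "open T"
    then have "openin riemann_sphere (Some ` T)" by simp
    from openin_continuous_map_preimage[OF c this]
    have "openin (top_of_set S) {x \<in> S. Some (u x) \<in> Some ` T}" by simp
    moreover have "{x \<in> S. Some (u x) \<in> Some ` T} = S \<inter> u -` T" by auto
    ultimately show "openin (top_of_set S) (S \<inter> u -` T)" by simp
  qed
next
  assume "continuous_on S u"
  then have "continuous_map (top_of_set S) euclidean u" by simp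
  from continuous_map_compose[OF this continuous_map_Some]
  show "continuous_map (top_of_set S) riemann_sphere (\<lambda>z. Some (u z))" by (simp add: o_def)
qed

lemma continuous_map_map_option:
  fixes u :: "complex \<Rightarrow> complex"
  assumes "continuous_on S u"
  shows "continuous_map (sphere_subspace (Some ` S)) riemann_sphere (map_option u)"
proof -
  have "openin (sphere_subspace (Some ` S)) {p \<in> Some ` S. map_option u p \<in> W}" if W: "openin riemann_sphere W" for W
  proof -
    have "open {z. Some z \<in> W}" using W by (simp add: openin_sphere_iff)
    then have "openin (top_of_set S) (S \<inter> u -` {z. Some z \<in> W})"
      using assms unfolding continuous_openin_preimage_eq by blast
    then obtain T where T: "open T" "S \<inter> u -` {z. Some z \<in> W} = S \<inter> T"
      unfolding openin_open by blast
    have "{p \<in> Some ` S. map_option u p \<in> W} = Some ` T \<inter> Some ` S" using T(2) by auto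
    moreover have "openin riemann_sphere (Some ` T)" using T(1) by simp
    ultimately show ?thesis unfolding openin_subtopology by metis
  qed
  then show ?thesis by (simp add: continuous_map_def)
qed

lemma compactin_Some: "compact S \<Longrightarrow> compactin riemann_sphere (Some ` (S :: complex set))"
  by (rule image_compactin[OF _ continuous_map_Some]) simp

lemma closed_unit_disc_eq: "unit_disc \<union> unit_circle = Some ` cball 0 1"
  by (auto simp: unit_disc_def unit_circle_def image_iff)

lemma closure_of_unit_disc: "riemann_sphere closure_of unit_disc = unit_disc \<union> unit_circle"
proof (rule equalityI)
  have "closedin riemann_sphere (Some ` cball (0::complex) 1)"
    by (rule compactin_imp_closedin[OF Hausdorff_sphere compactin_Some]) simp
  then show "riemann_sphere closure_of unit_disc \<subseteq> unit_disc \<union> unit_circle"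
    unfolding closed_unit_disc_eq by (intro closure_of_minimal) (auto simp: unit_disc_def)
  have "Some ` (euclidean closure_of ball (0::complex) 1) \<subseteq> riemann_sphere closure_of (Some ` ball 0 1)"
    by (rule continuous_map_image_closure_subset[OF continuous_map_Some])
  then have "Some ` cball (0::complex) 1 \<subseteq> riemann_sphere closure_of (Some ` ball 0 1)" by simp
  moreover have "unit_disc = Some ` ball (0::complex) 1" by (auto simp: unit_disc_def)
  ultimately show "unit_disc \<union> unit_circle \<subseteq> riemann_sphere closure_of unit_disc"
    unfolding closed_unit_disc_eq by metis
qed

lemma closure_of_exterior_disc: "riemann_sphere closure_of exterior_disc = exterior_disc \<union> unit_circle"
proof -
  have "riemann_sphere closure_of exterior_disc = sphere_inversion ` (riemann_sphere closure_of unit_disc)"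
    unfolding exterior_disc_eq by (rule homeomorphic_map_closure_of[OF homeomorphic_map_sphere_inversion]) simp
  also have "\<dots> = exterior_disc \<union> sphere_inversion ` unit_circle"
    unfolding closure_of_unit_disc image_Un exterior_disc_eq ..
  also have "sphere_inversion ` unit_circle = unit_circle"
  proof (intro equalityI subsetI)
    fix p assume "p \<in> unit_circle"
    then have "sphere_inversion p \<in> unit_circle" by (simp add: sphere_inversion_unit_circle_iff)
    then show "p \<in> sphere_inversion ` unit_circle" by (metis image_eqI sphere_inversion_invol)
  qed (auto simp: sphere_inversion_unit_circle_iff)
  finally show ?thesis .
qed

lemma continuous_image_closure_of:
  assumes c: "continuous_map (sphere_subspace (riemann_sphere closure_of U)) riemann_sphere \<psi>"
  shows "\<psi> ` (riemann_sphere closure_of U) = riemann_sphere closure_of (\<psi> ` U)"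
proof (rule equalityI)
  let ?C = "riemann_sphere closure_of U"
  have UC: "U \<subseteq> ?C" by (rule closure_of_subset) simp
  have "sphere_subspace ?C closure_of U = ?C"
    unfolding closure_of_subtopology using UC by (simp add: inf.absorb2)
  then show "\<psi> ` ?C \<subseteq> riemann_sphere closure_of (\<psi> ` U)"
    using continuous_map_image_closure_subset[OF c, of U] by simp
  have "compactin riemann_sphere ?C" by (intro closedin_compact_space compact_riemann_sphere closedin_closure_of)
  then have "compactin (sphere_subspace ?C) ?C" by (simp add: compactin_subtopology)
  from image_compactin[OF this c] have "closedin riemann_sphere (\<psi> ` ?C)"
    by (rule compactin_imp_closedin[OF Hausdorff_sphere])
  then show "riemann_sphere closure_of (\<psi> ` U) \<subseteq> \<psi> ` ?C" using UC by (intro closure_of_minimal image_mono)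
qed

text \<open>The closure is compact and the sphere Hausdorff, so a continuous injection is already a
  homeomorphism onto the closure of the image.\<close>

lemma conformal_with_boundaryI:
  assumes hol: "sphere_holomorphic_on \<psi> U"
    and c: "continuous_map (sphere_subspace (riemann_sphere closure_of U)) riemann_sphere \<psi>"
    and inj: "inj_on \<psi> (riemann_sphere closure_of U)"
  shows "conformal_with_boundary \<psi> U (\<psi> ` U)"
  unfolding conformal_with_boundary_def conformal_map_onto_def
proof (intro conjI hol refl)
  let ?C = "riemann_sphere closure_of U"
  show "inj_on \<psi> U" using inj by (rule inj_on_subset) (rule closure_of_subset, simp)
  have im: "\<psi> ` ?C = riemann_sphere closure_of (\<psi> ` U)" by (rule continuous_image_closure_of[OF c])
  show "homeomorphic_map (sphere_subspace ?C) (sphere_subspace (riemann_sphere closure_of (\<psi> ` U))) \<psi>"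
  proof (rule continuous_imp_homeomorphic_map)
    show "continuous_map (sphere_subspace ?C) (sphere_subspace (riemann_sphere closure_of (\<psi> ` U))) \<psi>"
      by (rule continuous_map_into_subtopology[OF c]) (use im in auto)
    show "compact_space (sphere_subspace ?C)"
      by (intro compact_space_subtopology closedin_compact_space compact_riemann_sphere closedin_closure_of)
    show "Hausdorff_space (sphere_subspace (riemann_sphere closure_of (\<psi> ` U)))"
      by (rule Hausdorff_space_subtopology[OF Hausdorff_sphere])
  qed (use im inj in auto)
qed

lemma connected_components_of_two:
  assumes "openin riemann_sphere U" "openin riemann_sphere V" "connectedin riemann_sphere U" "U \<noteq> {}" "U \<inter> V = {}"
  shows "U \<in> connected_components_of (sphere_subspace (U \<union> V))"
proof -
  let ?X = "sphere_subspace (U \<union> V)"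
  obtain x where x: "x \<in> U" using assms(4) by blast
  have conU: "connectedin ?X U" using assms(3) by (simp add: connectedin_subtopology)
  have oU: "openin ?X U" "openin ?X V" using assms by (auto simp: openin_open_subtopology openin_Un)
  let ?C = "connected_component_of_set ?X x"
  have "U \<subseteq> ?C" by (rule connected_component_of_maximal[OF conU x])
  moreover have "?C \<subseteq> U"
  proof -
    have con: "connectedin ?X ?C" by (rule connectedin_connected_component_of)
    have xC: "x \<in> ?C" using \<open>U \<subseteq> ?C\<close> x by blast
    have "?C \<subseteq> U \<union> V" using connectedin_subset_topspace[OF con] by simp
    then have "V \<inter> ?C = {}" using con oU xC x assms(5) unfolding connectedin by blast
    then show ?thesis using \<open>?C \<subseteq> U \<union> V\<close> by blast
  qed
  ultimately have "U = ?C" by blast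
  then show ?thesis unfolding connected_components_of_def using x by auto
qed

lemma connectedin_unit_disc: "connectedin riemann_sphere unit_disc"
proof -
  have "connectedin riemann_sphere (Some ` ball (0::complex) 1)"
    by (rule connectedin_continuous_map_image[OF continuous_map_Some]) simp
  moreover have "unit_disc = Some ` ball (0::complex) 1" by (auto simp: unit_disc_def)
  ultimately show ?thesis by simp
qed

lemma connectedin_exterior_disc: "connectedin riemann_sphere exterior_disc"
  unfolding exterior_disc_eq
  by (rule connectedin_continuous_map_image[OF homeomorphic_imp_continuous_map[OF homeomorphic_map_sphere_inversion]
        connectedin_unit_disc])

lemma connectedin_holomorphic_image:
  assumes "sphere_holomorphic_on f U" "connectedin riemann_sphere U"
  shows "connectedin riemann_sphere (f ` U)"
proof -
  have "continuous_map (sphere_subspace U) riemann_sphere f" using assms(1) by (simp add: sphere_holomorphic_on_def)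
  moreover have "connectedin (sphere_subspace U) U" using assms(2) by (simp add: connectedin_subtopology)
  ultimately show ?thesis by (rule connectedin_continuous_map_image)
qed

text \<open>Splitting off the zero, \<open>y = (z - z0) * e\<close> with \<open>e\<close> zero-free,
  the logarithmic derivative is \<open>1 / (z - z0) + deriv e / e\<close>. The first term integrates
  to \<open>2 * pi * i\<close>, the second to 0.\<close>

lemma winding_number_simple_zero:
  assumes y: "y holomorphic_on ball 0 \<rho>" "\<rho> > 1" and z0: "norm z0 < 1" "y z0 = 0" "deriv y z0 \<noteq> 0"
    and nz: "\<And>z. z \<in> ball 0 \<rho> \<Longrightarrow> z \<noteq> z0 \<Longrightarrow> y z \<noteq> 0"
  shows "winding_number (y \<circ> circlepath 0 1) 0 = 1"
proof -
  have im: "path_image (circlepath 0 1) \<subseteq> ball (0::complex) \<rho>" using y(2) by auto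
  have nim: "y u \<noteq> 0" "u \<noteq> z0" if "u \<in> path_image (circlepath 0 1)" for u
  proof -
    have "norm u = 1" using that by simp
    then show "u \<noteq> z0" using z0(1) by auto
    then show "y u \<noteq> 0" using nz[of u] \<open>norm u = 1\<close> y(2) by simp
  qed
  have vp: "valid_path (y \<circ> circlepath 0 1)"
    by (rule valid_path_compose_holomorphic[OF _ y(1) open_ball im]) simp
  define e where "e = (\<lambda>z. if z = z0 then deriv y z0 else (y z - y z0) / (z - z0))"
  have eh: "e holomorphic_on ball 0 \<rho>" unfolding e_def by (rule pole_lemma_open[OF y(1) open_ball])
  have e0: "e z \<noteq> 0" if "z \<in> ball 0 \<rho>" for z using nz[OF that] z0 by (auto simp: e_def)
  have ye: "y z = (z - z0) * e z" for z using z0 by (simp add: e_def)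
  have eq: "deriv y u / y u = 1 / (u - z0) + deriv e u / e u" if u: "u \<in> path_image (circlepath 0 1)" for u
  proof -
    have ub: "u \<in> ball 0 \<rho>" using u im by blast
    have "(e has_field_derivative deriv e u) (at u)" by (rule holomorphic_derivI[OF eh open_ball ub])
    then have "((\<lambda>z. (z - z0) * e z) has_field_derivative e u + (u - z0) * deriv e u) (at u)"
      by (auto intro!: derivative_eq_intros)
    then have "deriv y u = e u + (u - z0) * deriv e u" unfolding ye[symmetric] by (rule DERIV_imp_deriv)
    then show ?thesis using e0[OF ub] nim(2)[OF u] by (simp add: ye field_simps)
  qed
  have "winding_number (y \<circ> circlepath 0 1) 0 = 1 / (2 * pi * \<i>) * contour_integral (y \<circ> circlepath 0 1) (\<lambda>w. 1 / (w - 0))"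
    by (rule winding_number_valid_path[OF vp]) (use nim in \<open>auto simp: path_image_compose\<close>)
  also have "contour_integral (y \<circ> circlepath 0 1) (\<lambda>w. 1 / (w - 0)) = contour_integral (circlepath 0 1) (\<lambda>w. deriv y w * (1 / (y w - 0)))"
    by (rule contour_integral_comp_analyticW[of _ "ball 0 \<rho>"]) (use y im in \<open>auto simp: analytic_on_open\<close>)
  also have "\<dots> = contour_integral (circlepath 0 1) (\<lambda>u. 1 / (u - z0) + deriv e u / e u)"
    by (rule contour_integral_cong) (use eq in auto)
  also have "\<dots> = 2 * of_real pi * \<i> + 0"
  proof (rule contour_integral_unique, rule has_contour_integral_add)
    show "((\<lambda>u. 1 / (u - z0)) has_contour_integral 2 * of_real pi * \<i>) (circlepath 0 1)"
      using Cauchy_integral_circlepath_simple[of "\<lambda>_. 1" 0 1 z0] z0(1) by simp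
    show "((\<lambda>u. deriv e u / e u) has_contour_integral 0) (circlepath 0 1)"
      by (rule Cauchy_theorem_disc_simple[of _ 0 \<rho>]) (use eh e0 im in \<open>auto intro!: holomorphic_intros\<close>)
  qed
  finally show ?thesis by (simp only: add_0_right) simp
qed

lemma circle_nbhd_ball:
  assumes "open W" "cball (0::complex) 1 \<subseteq> W"
  obtains \<rho> where "\<rho> > 1" "ball 0 \<rho> \<subseteq> W"
proof -
  have "\<exists>e>0. \<forall>x\<in>cball 0 1. ball x e \<subseteq> W"
  proof (rule Heine_Borel_lemma[OF compact_cball[of "0::complex" 1], of "{W}"])
    fix e :: real assume "e > 0" "\<And>x. x \<in> cball 0 1 \<Longrightarrow> \<exists>G\<in>{W}. ball x e \<subseteq> G"
    then show ?thesis by (intro exI[of _ e]) auto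
  qed (use assms in auto)
  then obtain e where e: "e > 0" "\<And>x. x \<in> cball 0 1 \<Longrightarrow> ball x e \<subseteq> W" by blast
  have "ball 0 (1 + e) \<subseteq> W"
  proof
    fix z :: complex assume z: "z \<in> ball 0 (1 + e)"
    show "z \<in> W"
    proof (cases "norm z \<le> 1")
      case False
      then have z0: "z \<noteq> 0" by auto
      then have "z \<in> ball (sgn z) e" using z dist_sgn[OF z0] False by simp
      moreover have "sgn z \<in> cball 0 1" using z0 by (simp add: norm_sgn)
      ultimately show ?thesis using e(2) by blast
    qed (use assms(2) in auto)
  qed
  then show ?thesis using that[of "1 + e"] e by simp
qed

text \<open>As a function of \<open>z\<close> in the disc, the quotient has a simple zero at
  \<open>z0\<close>, no other zero by injectivity of \<open>F\<close>, and no pole because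
  \<open>q\<close> is not attained. For \<open>q\<close> at infinity the denominator is 1 by
  definition of \<open>sphere_diff\<close>.\<close>

lemma winding_number_sphere_quot:
  assumes F: "F holomorphic_on W" and W: "open W" "cball (0::complex) 1 \<subseteq> W" and Fi: "inj_on F (cball 0 1)"
    and z0: "norm z0 < 1" and q: "q \<notin> Some ` F ` cball 0 1"
  shows "winding_number (\<lambda>t. sphere_quot (Some (F z0)) q (Some (F (circlepath 0 1 t)))) 0 = 1"
proof -
  define c where "c z = sphere_diff (Some (F z)) q" for z
  define y where "y z = (F z - F z0) / c z" for z
  have ch: "c holomorphic_on W" unfolding c_def[abs_def] sphere_diff_def
    by (cases q) (auto intro!: holomorphic_intros F)
  have Fc: "continuous_on W F" and cc: "continuous_on W c"
    using F ch by (auto intro: holomorphic_on_imp_continuous_on)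
  have c0: "c z \<noteq> 0" if "z \<in> cball 0 1" for z
    using q that by (cases q) (auto simp: c_def sphere_diff_def)
  have o1: "open (W \<inter> c -` (- {0}))" "open (W \<inter> F -` (- {F z0}))"
    by (auto intro!: continuous_open_preimage Fc cc W)
  \<comment> \<open>A neighbourhood of the closed disc without zeros of the denominator and with no
    zero of the numerator but \<open>z0\<close>: outside the open disc this is required, inside it
    follows from injectivity.\<close>
  define W' where "W' = (W \<inter> c -` (- {0})) \<inter> (ball 0 1 \<union> (W \<inter> F -` (- {F z0})))"
  have Fz: "F z \<noteq> F z0" if "z \<in> cball 0 1" "z \<noteq> z0" for z
    using inj_onD[OF Fi, of z z0] that z0 by auto
  have "open W'" unfolding W'_def by (intro open_Int[OF o1(1)] open_Un open_ball o1(2))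
  moreover have "cball 0 1 \<subseteq> W'"
  proof
    fix z :: complex assume z: "z \<in> cball 0 1"
    then have "norm z < 1 \<or> z \<noteq> z0" using z0 by auto
    then show "z \<in> W'" using z c0[OF z] Fz[OF z] W(2) by (auto simp: W'_def)
  qed
  ultimately obtain \<rho> where \<rho>: "\<rho> > 1" "ball 0 \<rho> \<subseteq> W'" by (rule circle_nbhd_ball)
  have \<rho>W: "ball 0 \<rho> \<subseteq> W" using \<rho>(2) by (auto simp: W'_def)
  have z0\<rho>: "z0 \<in> ball 0 \<rho>" using z0 \<rho>(1) by simp
  have "winding_number (y \<circ> circlepath 0 1) 0 = 1"
  proof (rule winding_number_simple_zero[OF _ \<rho>(1) z0])
    have "\<And>z. z \<in> ball 0 \<rho> \<Longrightarrow> c z \<noteq> 0" using \<rho>(2) by (auto simp: W'_def)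
    then show "y holomorphic_on ball 0 \<rho>" unfolding y_def
      by (intro holomorphic_intros holomorphic_on_subset[OF F \<rho>W] holomorphic_on_subset[OF ch \<rho>W])
    show "y z0 = 0" by (simp add: y_def)
    have z0W: "z0 \<in> W" using z0\<rho> \<rho>W by blast
    have c00: "c z0 \<noteq> 0" using c0 z0 by simp
    have "(F has_field_derivative deriv F z0) (at z0)" "(c has_field_derivative deriv c z0) (at z0)"
      using holomorphic_derivI[OF F W(1) z0W] holomorphic_derivI[OF ch W(1) z0W] by auto
    then have "(y has_field_derivative deriv F z0 / c z0) (at z0)" unfolding y_def[abs_def]
      by (auto intro!: derivative_eq_intros simp: c00)
    then have "deriv y z0 = deriv F z0 / c z0" by (rule DERIV_imp_deriv)
    moreover have "deriv F z0 \<noteq> 0"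
    proof (rule holomorphic_injective_imp_regular[of F "ball 0 1"])
      show "F holomorphic_on ball 0 1" using F W(2) by (meson ball_subset_cball holomorphic_on_subset subset_trans)
      show "inj_on F (ball 0 1)" using Fi by (rule inj_on_subset) auto
    qed (use z0 in auto)
    ultimately show "deriv y z0 \<noteq> 0" using c00 by simp
    fix z assume z: "z \<in> ball 0 \<rho>" "z \<noteq> z0"
    then have "c z \<noteq> 0" "norm z < 1 \<or> F z \<noteq> F z0" using \<rho>(2) by (auto simp: W'_def)
    then show "y z \<noteq> 0" using Fz[of z] z by (auto simp: y_def)
  qed
  moreover have "y \<circ> circlepath 0 1 = (\<lambda>t. sphere_quot (Some (F z0)) q (Some (F (circlepath 0 1 t))))"
    by (auto simp: fun_eq_iff y_def c_def sphere_quot_def sphere_diff_def)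
  ultimately show ?thesis by simp
qed

subsection \<open>From welding solutions to lemniscates\<close>

lemma blaschke_product_rational: "blaschke_product B \<Longrightarrow> rational_map B"
  by (simp add: blaschke_product_def)

lemma blaschke_product_finite:
  assumes "blaschke_product B" "norm z \<le> 1"
  shows "B (Some z) \<noteq> None"
proof -
  have "Some z \<notin> exterior_disc" using assms(2) by simp
  then have "B (Some z) \<notin> exterior_disc" using blaschke_product_iff(3)[OF assms(1)] by blast
  then show ?thesis using Some_mem_simps(6) by metis
qed

text \<open>The numerator of the derivative is, up to \<open>c\<close>, the Wronskian of numerator
  and denominator, nonzero on the circle by \<open>bnum_bden_wronskian\<close>.\<close>

lemma blaschke_product_deriv:
  assumes B: "blaschke_product B" and t: "norm t = 1"
  shows "deriv (\<lambda>z. the (B (Some z))) t \<noteq> 0"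
proof -
  obtain c as where h: "norm c = 1" "set as \<subseteq> ball 0 1" "as \<noteq> []" "B = blaschke_fun c as"
    by (rule blaschke_productE[OF B])
  define N D where "N = bnum as" and "D = bden as"
  have D0: "poly D t \<noteq> 0" unfolding D_def by (rule poly_bden_nonzero[OF h(2)]) (use t in simp)
  have N0: "poly N t \<noteq> 0" using norm_bnum_bden(1)[OF h(2) t] D0 by (auto simp: N_def D_def)
  obtain s where s: "s > 0" "t * (poly (pderiv N) t * poly D t - poly N t * poly (pderiv D) t) = poly N t * poly D t * of_real s"
    using bnum_bden_wronskian[OF h(2) t] h(3) unfolding N_def D_def by auto
  have "((\<lambda>z. c * poly N z / poly D z) has_field_derivative
      (c * poly (pderiv N) t * poly D t - c * poly N t * poly (pderiv D) t) / (poly D t * poly D t)) (at t)"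
    by (rule derivative_eq_intros poly_DERIV refl D0)+ simp
  then have d: "((\<lambda>z. the (B (Some z))) has_field_derivative
      (c * poly (pderiv N) t * poly D t - c * poly N t * poly (pderiv D) t) / (poly D t * poly D t)) (at t)"
  proof (rule has_field_derivative_transform_within_open[of _ _ _ "- {z. poly D z = 0}"])
    have "D \<noteq> 0" using D0 by auto
    then show "open (- {z. poly D z = 0})" by (simp add: poly_roots_finite finite_imp_closed open_Compl)
  qed (use D0 in \<open>auto simp: h(4) rat_fun_def N_def D_def\<close>)
  have "poly (pderiv N) t * poly D t - poly N t * poly (pderiv D) t \<noteq> 0" using s N0 D0 by auto
  moreover have "c \<noteq> 0" using h(1) by auto
  ultimately have "(c * poly (pderiv N) t * poly D t - c * poly N t * poly (pderiv D) t) / (poly D t * poly D t) \<noteq> 0"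
    using D0 by (simp add: mult.assoc flip: right_diff_distrib)
  then show ?thesis using DERIV_imp_deriv[OF d] by simp
qed

lemma unit_circle_homeomorphism_lift:
  assumes "homeomorphic_map (sphere_subspace unit_circle) (sphere_subspace unit_circle) k"
    and k0_def: "\<And>t. k0 t = the (k (Some t))"
  shows "continuous_on (sphere 0 1) k0" "inj_on k0 (sphere 0 1)" "k0 ` sphere 0 1 = sphere 0 1"
    "\<And>t. norm t = 1 \<Longrightarrow> k (Some t) = Some (k0 t)" "bij_betw k unit_circle unit_circle"
proof -
  have bij: "bij_betw k unit_circle unit_circle"
    using assms(1) homeomorphic_imp_surjective_map[OF assms(1)] homeomorphic_imp_injective_map[OF assms(1)]
    by (simp add: bij_betw_def)
  then show "bij_betw k unit_circle unit_circle" .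
  show ks: "k (Some t) = Some (k0 t)" if "norm t = 1" for t
  proof -
    have "k (Some t) \<in> unit_circle" using bij that by (auto simp: bij_betw_def)
    then show ?thesis by (cases "k (Some t)") (auto simp: k0_def)
  qed
  have uc: "unit_circle = Some ` sphere 0 1" by (auto simp: unit_circle_def)
  show "k0 ` sphere 0 1 = sphere 0 1"
  proof -
    have "Some ` k0 ` sphere 0 1 = k ` unit_circle" using ks by (auto simp: uc image_image)
    also have "\<dots> = Some ` sphere 0 1" using bij by (simp add: bij_betw_def uc)
    finally show ?thesis by (simp add: inj_image_eq_iff)
  qed
  show "inj_on k0 (sphere 0 1)"
  proof (rule inj_onI)
    fix s t :: complex assume st: "s \<in> sphere 0 1" "t \<in> sphere 0 1" "k0 s = k0 t"
    then have "k (Some s) = k (Some t)" using ks by simp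
    moreover have "Some s \<in> unit_circle" "Some t \<in> unit_circle" using st by auto
    ultimately have "Some s = Some t" using bij unfolding bij_betw_def by (meson inj_onD)
    then show "s = t" by simp
  qed
  have "continuous_map (top_of_set (sphere 0 1)) (sphere_subspace unit_circle) (\<lambda>z::complex. Some z)"
    using continuous_map_Some_iff[of "sphere 0 1" "\<lambda>z. z"]
    by (intro continuous_map_into_subtopology) (auto intro: continuous_intros)
  from continuous_map_compose[OF this homeomorphic_imp_continuous_map[OF assms(1)]]
  have "continuous_map (top_of_set (sphere 0 1)) riemann_sphere (\<lambda>z. k (Some z))"
    by (simp add: o_def continuous_map_in_subtopology)
  then have "continuous_map (top_of_set (sphere 0 1)) riemann_sphere (\<lambda>z. Some (k0 z))"
    by (rule continuous_map_eq) (use ks in auto)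
  then show "continuous_on (sphere 0 1) k0" unfolding continuous_map_Some_iff .
qed

text \<open>Near the point, \<open>r\<close> is \<open>S\<close> composed with the inverse of the
  univalent map \<open>h\<close>. The charts allow \<open>h\<close> to be a coordinate at infinity
  as well.\<close>

lemma sphere_holomorphic_at_local_inverse:
  assumes h: "h holomorphic_on U" "open U" "inj_on h U" and z0: "z0 \<in> U"
    and ab: "a \<in> sphere_charts" "b \<in> sphere_charts"
    and r: "\<And>z. z \<in> U \<Longrightarrow> r (a (Some (h z))) = S (b (Some z))"
    and S: "\<And>p. sphere_holomorphic_at S p"
  shows "sphere_holomorphic_at r (a (Some (h z0)))"
proof -
  obtain i where i: "i holomorphic_on h ` U" "\<And>z. z \<in> U \<Longrightarrow> i (h z) = z"
    using holomorphic_has_inverse[OF h] by metis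
  have o: "open (h ` U)" by (rule open_mapping_thm3[OF h])
  define j where "j p = b (Some (i (the (a p))))" for p
  have "sphere_holomorphic_at j (a (Some (h z0)))"
    by (rule sphere_holomorphic_atI[OF ab refl o _ i(1)]) (use z0 ab in \<open>auto simp: j_def chart_invol\<close>)
  then have "sphere_holomorphic_at (S \<circ> j) (a (Some (h z0)))" by (rule sphere_holomorphic_at_compose) (rule S)
  then show ?thesis
  proof (rule sphere_holomorphic_at_cong)
    show "openin riemann_sphere ((\<lambda>z. a (Some z)) ` h ` U)" by (rule openin_chart_image[OF ab(1) o])
    show "a (Some (h z0)) \<in> (\<lambda>z. a (Some z)) ` h ` U" using z0 by blast
    fix q assume "q \<in> (\<lambda>z. a (Some z)) ` h ` U"
    then obtain z where "z \<in> U" "q = a (Some (h z))" by blast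
    then show "(S \<circ> j) q = r q" using r i(2) ab by (simp add: j_def chart_invol)
  qed
qed

theorem welding_solution_imp_lemniscate:
  assumes k: "homeomorphic_map (sphere_subspace unit_circle) (sphere_subspace unit_circle) k"
    and sol: "welding_solution k A B"
  shows "\<exists>L. jordan_rational_lemniscate L \<and> fingerprint k L"
proof -
  have A: "blaschke_product A" and B: "blaschke_product B" and AkB: "\<And>z. z \<in> unit_circle \<Longrightarrow> A (k z) = B z"
    using sol by (auto simp: welding_solution_def)
  define k0 where "k0 t = the (k (Some t))" for t
  note k0 = unit_circle_homeomorphism_lift[OF k k0_def]
  define A0 B0 where "A0 z = the (A (Some z))" and "B0 z = the (B (Some z))" for z
  have Afin: "A (Some z) \<noteq> None" and Bfin: "B (Some z) \<noteq> None" if "norm z \<le> 1" for z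
    using blaschke_product_finite[OF A that] blaschke_product_finite[OF B that] by auto
  obtain V K where VK: "open V" "sphere 0 1 \<subseteq> V" "K holomorphic_on V" "inj_on K V"
    "V \<subseteq> {z. B (Some z) \<noteq> None}" "K ` V \<subseteq> {z. A (Some z) \<noteq> None}"
    "\<And>t. norm t = 1 \<Longrightarrow> K t = k0 t" "\<And>z. z \<in> V \<Longrightarrow> A0 (K z) = B0 z"
  proof (rule welding_extension[of A0 "{z. A (Some z) \<noteq> None}" B0 "{z. B (Some z) \<noteq> None}" k0])
    show "A0 holomorphic_on {z. A (Some z) \<noteq> None}" "open {z. A (Some z) \<noteq> None}"
      "B0 holomorphic_on {z. B (Some z) \<noteq> None}" "open {z. B (Some z) \<noteq> None}"
      unfolding A0_def B0_def
      using open_finite_values[OF blaschke_product_rational[OF A]] open_finite_values[OF blaschke_product_rational[OF B]] by blast+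
    show "sphere 0 1 \<subseteq> {z. A (Some z) \<noteq> None}" "sphere 0 1 \<subseteq> {z. B (Some z) \<noteq> None}"
      using Afin Bfin by auto
    show "deriv A0 t \<noteq> 0" "deriv B0 t \<noteq> 0" if "norm t = 1" for t
      unfolding A0_def B0_def using blaschke_product_deriv[OF A that] blaschke_product_deriv[OF B that] by auto
    show "A0 (k0 t) = B0 t" if "norm t = 1" for t
    proof -
      have "A (Some (k0 t)) = B (Some t)" using AkB[of "Some t"] that unfolding k0(4)[OF that] by simp
      then show ?thesis by (simp add: A0_def B0_def)
    qed
  qed (use k0(1-3) that in blast)+
  have AKB: "A (Some (K z)) = B (Some z)" if "z \<in> V" for z
  proof -
    have "A (Some (K z)) \<noteq> None" "B (Some z) \<noteq> None" using VK(5,6) that by auto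
    then show ?thesis using VK(8)[OF that] by (auto simp: A0_def B0_def)
  qed
  interpret analytic_welding k0 K V
  proof
    \<comment> \<open>\<open>A\<close> and \<open>B\<close> both preserve and reflect the disc and
      the exterior, so \<open>A (K z) = B z\<close> keeps \<open>z\<close> and \<open>K z\<close> on
      the same side.\<close>
    fix z assume z: "z \<in> V"
    have "Some z \<in> unit_disc \<longleftrightarrow> Some (K z) \<in> unit_disc" "Some z \<in> exterior_disc \<longleftrightarrow> Some (K z) \<in> exterior_disc"
      using blaschke_product_iff[OF A, of "Some (K z)"] blaschke_product_iff[OF B, of "Some z"] AKB[OF z] by auto
    then show "norm z < 1 \<Longrightarrow> norm (K z) < 1" "norm z > 1 \<Longrightarrow> norm (K z) > 1" by auto
  qed (use k0(1-3) VK(1-4,7) in auto)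
  obtain f g where fg: "\<And>R. weld k0 R f g" using weld_entire by blast
  obtain Q where Q: "Q holomorphic_on ball 0 1" "Q 0 = 0"
    "\<And>v. v \<in> ball 0 1 \<Longrightarrow> v \<noteq> 0 \<Longrightarrow> g (1 / v) \<noteq> f 0 \<and> Q v = inverse (g (1 / v) - f 0)"
    "f ` ball 0 1 \<union> g ` {w. 1 \<le> norm w} = UNIV"
    by (rule weld_at_infinity[OF fg]) blast
  have fc: "continuous_on (cball 0 1) f" and fh: "f holomorphic_on ball 0 1" and finj: "inj_on f (cball 0 1)"
    and gk: "\<And>t. norm t = 1 \<Longrightarrow> g (k0 t) = f t"
    using fg[of 2] by (auto simp: weld_def glued_def)
  have fi: "inj_on f (ball 0 1)" using finj by (rule inj_on_subset) auto
  have disj: "f z \<noteq> g w" if "norm z < 1" "1 \<le> norm w" for z w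
    using fg[of "norm w + 1"] that by (auto simp: weld_def)
  have ginj: "w = w'" if "1 \<le> norm w" "1 \<le> norm w'" "g w = g w'" for w w'
    using fg[of "max (norm w) (norm w') + 1"] that by (auto simp: weld_def inj_on_def)
  have disj1: "f z \<noteq> g w" if z: "norm z \<le> 1" and w: "1 < norm w" for z w
  proof (cases "norm z < 1")
    case False
    then have n: "norm z = 1" using z by simp
    show ?thesis
    proof
      assume "f z = g w"
      then have "g (k0 z) = g w" using gk[OF n] by simp
      then have "k0 z = w" using ginj[of "k0 z" w] n w by simp
      then show False using n w norm_k[OF n] by simp
    qed
  qed (use disj w in auto)
  have gtop: "g t \<in> f ` sphere 0 1" if t1: "norm t = 1" for t
  proof -
    obtain s where "norm s = 1" "k0 s = t" using k_surj[OF t1] by blast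
    then show ?thesis using gk by (metis image_eqI mem_sphere_0)
  qed
  have gan: "g holomorphic_on annulus 1 R" and gcn: "continuous_on (collar R) g" for R
    using fg[of R] by (auto simp: weld_def glued_def)
  have cover: "(\<exists>z. norm z \<le> 1 \<and> x = f z) \<or> (\<exists>w. 1 < norm w \<and> x = g w)" for x
  proof -
    have "x \<in> f ` ball 0 1 \<union> g ` {w. 1 \<le> norm w}" using Q(4) by simp
    then consider z where "norm z < 1" "x = f z" | w where "1 \<le> norm w" "x = g w" by auto
    then show ?thesis
    proof cases
      case 2
      show ?thesis
      proof (cases "norm w = 1")
        case True
        then obtain s where "norm s = 1" "g w = f s" using gtop[of w] by auto
        then show ?thesis using 2 by (metis order_refl)
      next
        case False
        then have "1 < norm w" using 2 by simp
        then show ?thesis using 2 by blast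
      qed
    next
      case 1
      then show ?thesis by (metis less_imp_le)
    qed
  qed

  define \<psi> :: "csphere \<Rightarrow> csphere" where "\<psi> = map_option f"
  define \<phi> :: "csphere \<Rightarrow> csphere" where "\<phi> = map_option g"
  define L where "L = \<psi> ` unit_circle"
  define \<Omega>l \<Omega>r where "\<Omega>l = \<psi> ` unit_disc" and "\<Omega>r = \<phi> ` exterior_disc"
  have Leq: "L = Some ` f ` sphere 0 1" by (auto simp: L_def \<psi>_def unit_circle_def image_image)
  have \<Omega>leq: "\<Omega>l = Some ` f ` ball 0 1" by (auto simp: \<Omega>l_def \<psi>_def unit_disc_def image_image)
  have \<Omega>req: "\<Omega>r = insert None (Some ` g ` {w. 1 < norm w})" by (auto simp: \<Omega>r_def \<phi>_def exterior_disc_def image_image)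

  \<comment> \<open>Near infinity the map \<open>g\<close> reads \<open>h\<close> in the charts at infinity of source and target.\<close>
  define U0 where "U0 = {v \<in> ball 0 1. 1 + f 0 * Q v \<noteq> 0}"
  \<comment> \<open>Since \<open>Q v = 1 / (g (1/v) - f 0)\<close>, this is
    \<open>1 / g (1/v)\<close>; \<open>U0\<close> leaves out the zeros of
    \<open>g (1/v)\<close>.\<close>
  define h where "h v = Q v / (1 + f 0 * Q v)" for v
  have Qc: "continuous_on (ball 0 1) Q" using Q(1) by (rule holomorphic_on_imp_continuous_on)
  have U0: "open U0" "0 \<in> U0"
  proof -
    have "open (ball 0 1 \<inter> (\<lambda>v. 1 + f 0 * Q v) -` (- {0}))"
      by (rule continuous_open_preimage) (auto intro!: continuous_intros Qc)
    moreover have "ball 0 1 \<inter> (\<lambda>v. 1 + f 0 * Q v) -` (- {0}) = U0" by (auto simp: U0_def)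
    ultimately show "open U0" by simp
    show "0 \<in> U0" using Q(2) by (simp add: U0_def)
  qed
  have hh: "h holomorphic_on U0" unfolding h_def
    by (intro holomorphic_intros holomorphic_on_subset[OF Q(1)]) (auto simp: U0_def)
  have h0: "h 0 = 0" using Q(2) by (simp add: h_def)
  have hv: "h v \<noteq> 0 \<and> inverse (h v) = g (1 / v)" if "v \<in> U0" "v \<noteq> 0" for v
  proof -
    have v: "v \<in> ball 0 1" "1 + f 0 * Q v \<noteq> 0" using that by (auto simp: U0_def)
    have q: "g (1 / v) - f 0 \<noteq> 0" "Q v = inverse (g (1 / v) - f 0)" using Q(3)[OF v(1) that(2)] by auto
    then have "Q v \<noteq> 0" by simp
    moreover have "inverse (h v) = inverse (Q v) + f 0" using \<open>Q v \<noteq> 0\<close> by (simp add: h_def add_divide_distrib inverse_eq_divide)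
    ultimately show ?thesis using q v by (simp add: h_def)
  qed
  have \<phi>h: "\<phi> (sphere_inversion (Some v)) = sphere_inversion (Some (h v))" if "v \<in> U0" for v
    using hv[OF that] h0 by (cases "v = 0") (auto simp: \<phi>_def inverse_eq_divide)
  have hinj: "inj_on h U0"
  proof (rule inj_onI)
    fix u v assume uv: "u \<in> U0" "v \<in> U0" "h u = h v"
    show "u = v"
    proof (cases "u = 0 \<or> v = 0")
      case True
      then show ?thesis using uv hv[of u] hv[of v] h0 by (cases "u = 0"; cases "v = 0") auto
    next
      case False
      have "inverse (h u) = inverse (h v)" using uv(3) by simp
      then have "g (1 / u) = g (1 / v)" using False uv(1,2) hv[of u] hv[of v] by simp
      moreover have "1 \<le> norm (1 / u)" "1 \<le> norm (1 / v)"
        using uv False by (auto simp: U0_def norm_divide field_simps)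
      ultimately have "1 / u = 1 / v" using ginj by blast
      then show ?thesis using False by simp
    qed
  qed

  have \<psi>hol: "sphere_holomorphic_on \<psi> unit_disc" unfolding sphere_holomorphic_on_iff
  proof (intro conjI ballI openin_unit_disc)
    fix p assume "p \<in> unit_disc"
    then obtain z where "p = Some z" "norm z < 1" by (cases p) auto
    then show "sphere_holomorphic_at \<psi> p"
      by (intro sphere_holomorphic_atI[of id id p z "ball 0 1" f]) (use fh in \<open>auto simp: \<psi>_def\<close>)
  qed
  have \<phi>hol: "sphere_holomorphic_on \<phi> exterior_disc" unfolding sphere_holomorphic_on_iff
  proof (intro conjI ballI openin_exterior_disc)
    fix p assume p: "p \<in> exterior_disc"
    show "sphere_holomorphic_at \<phi> p"
    proof (cases p)
      case None
      then show ?thesis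
        by (intro sphere_holomorphic_atI[of sphere_inversion sphere_inversion p 0 U0 h]) (use U0 hh \<phi>h in auto)
    next
      case (Some w)
      then show ?thesis
        by (intro sphere_holomorphic_atI[of id id p w "annulus 1 (norm w + 1)" g])
           (use gan p open_annulus in \<open>auto simp: \<phi>_def\<close>)
    qed
  qed

  have \<psi>c: "continuous_map (sphere_subspace (unit_disc \<union> unit_circle)) riemann_sphere \<psi>"
    unfolding closed_unit_disc_eq \<psi>_def by (rule continuous_map_map_option[OF fc])
  have gc: "continuous_on {w. 1 \<le> norm w} g"
  proof (clarsimp simp: continuous_on_eq_continuous_within)
    fix w :: complex assume w: "1 \<le> norm w"
    have "at w within {w. 1 \<le> norm w} = at w within collar (norm w + 1)"
      by (rule at_within_nhd[of _ "ball 0 (norm w + 1)"]) auto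
    moreover have "continuous (at w within collar (norm w + 1)) g"
      using gcn[of "norm w + 1"] w by (auto simp: continuous_on_eq_continuous_within)
    ultimately show "continuous (at w within {w. 1 \<le> norm w}) g" by simp
  qed
  have \<phi>c: "continuous_map (sphere_subspace (exterior_disc \<union> unit_circle)) riemann_sphere \<phi>"
  proof -
    have "openin (sphere_subspace (exterior_disc \<union> unit_circle)) {p \<in> exterior_disc \<union> unit_circle. \<phi> p \<in> W}"
      if W: "openin riemann_sphere W" for W
    proof -
      have "continuous_map (sphere_subspace exterior_disc) riemann_sphere \<phi>"
        using \<phi>hol by (simp add: sphere_holomorphic_on_def)
      from openin_continuous_map_preimage[OF this W]
      have o1: "openin riemann_sphere {p \<in> exterior_disc. \<phi> p \<in> W}"
        by (simp add: openin_open_subtopology[OF openin_exterior_disc])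
      have "open {z. Some z \<in> W}" using W by (simp add: openin_sphere_iff)
      then have "openin (top_of_set {w. 1 \<le> norm w}) ({w. 1 \<le> norm w} \<inter> g -` {z. Some z \<in> W})"
        using gc unfolding continuous_openin_preimage_eq by blast
      then obtain T where T: "open T" "{w. 1 \<le> norm w} \<inter> g -` {z. Some z \<in> W} = {w. 1 \<le> norm w} \<inter> T"
        unfolding openin_open by blast
      have o2: "openin riemann_sphere (Some ` T)" using T(1) by simp
      have Tw: "w \<in> T \<longleftrightarrow> Some (g w) \<in> W" if "1 \<le> norm w" for w
        using T(2) that by blast
      have "{p \<in> exterior_disc \<union> unit_circle. \<phi> p \<in> W} = ({p \<in> exterior_disc. \<phi> p \<in> W} \<union> Some ` T) \<inter> (exterior_disc \<union> unit_circle)"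
        (is "?l = ?r")
      proof (rule set_eqI)
        fix p show "p \<in> ?l \<longleftrightarrow> p \<in> ?r"
        proof (cases p)
          case (Some w)
          then show ?thesis using Tw[of w] by (auto simp: \<phi>_def)
        qed auto
      qed
      moreover have "openin riemann_sphere ({p \<in> exterior_disc. \<phi> p \<in> W} \<union> Some ` T)" using o1 o2 by (rule openin_Un)
      ultimately show ?thesis unfolding openin_subtopology by blast
    qed
    then show ?thesis by (simp add: continuous_map_def)
  qed
  have \<psi>i: "inj_on \<psi> (unit_disc \<union> unit_circle)"
    unfolding closed_unit_disc_eq by (use finj in \<open>auto simp: \<psi>_def inj_on_def\<close>)
  have \<phi>i: "inj_on \<phi> (exterior_disc \<union> unit_circle)"
  proof (rule inj_onI)
    fix p q assume pq: "p \<in> exterior_disc \<union> unit_circle" "q \<in> exterior_disc \<union> unit_circle" "\<phi> p = \<phi> q"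
    show "p = q"
    proof (cases p)
      case None
      then show ?thesis using pq(3) by (cases q) (auto simp: \<phi>_def)
    next
      case (Some u)
      then obtain v where v: "q = Some v" "g u = g v" using pq(3) by (cases q) (auto simp: \<phi>_def)
      have "1 \<le> norm u" "1 \<le> norm v" using pq(1,2) Some v(1) by auto
      then show ?thesis using ginj v Some by blast
    qed
  qed
  have \<psi>cb: "conformal_with_boundary \<psi> unit_disc \<Omega>l" unfolding \<Omega>l_def
    by (rule conformal_with_boundaryI[OF \<psi>hol]) (simp_all only: closure_of_unit_disc \<psi>c \<psi>i)
  have \<phi>cb: "conformal_with_boundary \<phi> exterior_disc \<Omega>r" unfolding \<Omega>r_def
    by (rule conformal_with_boundaryI[OF \<phi>hol]) (simp_all only: closure_of_exterior_disc \<phi>c \<phi>i)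
  have jp: "jordan_parametrization \<psi> L" unfolding jordan_parametrization_def L_def
  proof (rule continuous_imp_homeomorphic_map)
    show "continuous_map (sphere_subspace unit_circle) (sphere_subspace (\<psi> ` unit_circle)) \<psi>"
      using continuous_map_from_subtopology_mono[OF \<psi>c, of unit_circle]
      by (intro continuous_map_into_subtopology) auto
    have "compactin riemann_sphere unit_circle" unfolding unit_circle_def
      using compactin_Some[OF compact_sphere[of 0 1]] by (simp add: sphere_def)
    then show "compact_space (sphere_subspace unit_circle)" by (rule compact_space_subtopology)
    show "Hausdorff_space (sphere_subspace (\<psi> ` unit_circle))" by (rule Hausdorff_space_subtopology[OF Hausdorff_sphere])
    show "inj_on \<psi> (topspace (sphere_subspace unit_circle))" using inj_on_subset[OF \<psi>i, of unit_circle] by simp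
  qed simp

  have Lc: "- L = \<Omega>l \<union> \<Omega>r"
  proof (rule set_eqI)
    fix p show "p \<in> - L \<longleftrightarrow> p \<in> \<Omega>l \<union> \<Omega>r"
    proof (cases p)
      case None
      then show ?thesis by (auto simp: Leq \<Omega>req)
    next
      case (Some x)
      consider z where "norm z \<le> 1" "x = f z" | w where "1 < norm w" "x = g w" using cover[of x] by blast
      then show ?thesis
      proof cases
        case 1
        have "f z \<in> f ` sphere 0 1 \<longleftrightarrow> norm z = 1"
          using inj_on_image_mem_iff[OF finj, of z "sphere 0 1"] 1(1) by auto
        moreover have "f z \<in> f ` ball 0 1 \<longleftrightarrow> norm z < 1"
          using inj_on_image_mem_iff[OF finj, of z "ball 0 1"] 1(1) by auto
        moreover have "f z \<notin> g ` {w. 1 < norm w}" using disj1[OF 1(1)] by auto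
        ultimately show ?thesis using 1(1) Some 1(2) by (auto simp: Leq \<Omega>leq \<Omega>req image_iff)
      next
        case 2
        then have "x \<notin> f ` sphere 0 1" using disj1[of _ w] by (metis imageE mem_sphere_0 order_refl)
        then show ?thesis using 2 Some by (auto simp: Leq \<Omega>req)
      qed
    qed
  qed
  have lr: "\<Omega>l \<inter> \<Omega>r = {}" using disj1 by (force simp: \<Omega>leq \<Omega>req)
  have ol: "openin riemann_sphere \<Omega>l" unfolding \<Omega>leq using open_mapping_thm3[OF fh open_ball fi] by simp
  \<comment> \<open>The complement is the image of the closed disc under \<open>f\<close>, which is
    compact.\<close>
  have or': "openin riemann_sphere \<Omega>r"
  proof -
    have "closedin riemann_sphere (Some ` f ` cball 0 1)"
      by (rule compactin_imp_closedin[OF Hausdorff_sphere compactin_Some]) (rule compact_continuous_image[OF fc compact_cball])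
    moreover have "\<Omega>r = UNIV - Some ` f ` cball 0 1"
    proof -
      have "Some ` f ` cball 0 1 = L \<union> \<Omega>l" unfolding Leq \<Omega>leq by (force simp: order_le_less)
      then show ?thesis using Lc lr by blast
    qed
    ultimately show ?thesis by (metis openin_diff openin_topspace topspace_sphere)
  qed
  have conl: "connectedin riemann_sphere \<Omega>l" unfolding \<Omega>l_def
    by (rule connectedin_holomorphic_image[OF \<psi>hol connectedin_unit_disc])
  have conr: "connectedin riemann_sphere \<Omega>r" unfolding \<Omega>r_def
    by (rule connectedin_holomorphic_image[OF \<phi>hol connectedin_exterior_disc])
  have compl: "\<Omega>l \<in> connected_components_of (sphere_subspace (- L))" unfolding Lc
    by (rule connected_components_of_two[OF ol or' conl _ lr]) (auto simp: \<Omega>leq)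
  have compr: "\<Omega>r \<in> connected_components_of (sphere_subspace (- L))" unfolding Lc Un_commute[of \<Omega>l]
    by (rule connected_components_of_two[OF or' ol conr]) (use lr in \<open>auto simp: \<Omega>req\<close>)

  \<comment> \<open>The winding number is computed from a holomorphic function on a neighbourhood of
    the closed disc; the seam chart continues \<open>f\<close> across the circle.\<close>
  define F where "F = seam_fun f g"
  define W where "W = ball 0 1 \<union> seam_nbhd 2"
  have Ff: "F z = f z" if "norm z \<le> 1" for z using that by (simp add: F_def seam_fun_def)
  have W: "open W" "cball 0 1 \<subseteq> W" using seam_nbhd(1,2)[of 2] by (auto simp: W_def subset_iff order_le_less)
  have gl2: "glued k0 2 f g" using fg[of 2] by (simp add: weld_def)
  have FW: "F holomorphic_on W" unfolding W_def
  proof (rule holomorphic_on_Un)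
    show "F holomorphic_on ball 0 1" using fh by (rule holomorphic_transform) (use Ff in auto)
    show "F holomorphic_on seam_nbhd 2" unfolding F_def by (rule seam_holomorphic[OF gl2])
  qed (use seam_nbhd(1)[of 2] in auto)
  have Fi: "inj_on F (cball 0 1)" using finj Ff by (auto simp: inj_on_def)
  have lrc: "left_right_components \<psi> L \<Omega>l \<Omega>r" unfolding left_right_components_def
  proof (intro conjI ballI compl compr)
    fix p q assume p: "p \<in> \<Omega>l" and q: "q \<in> \<Omega>r"
    obtain z0 where z0: "norm z0 < 1" "p = Some (f z0)" using p by (auto simp: \<Omega>leq)
    have "q \<notin> Some ` F ` cball 0 1"
    proof -
      have "Some ` F ` cball 0 1 = L \<union> \<Omega>l" using Ff unfolding Leq \<Omega>leq by (force simp: order_le_less)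
      then show ?thesis using q Lc lr by blast
    qed
    from winding_number_sphere_quot[OF FW W Fi z0(1) this]
    have "winding_number (\<lambda>t. sphere_quot (Some (F z0)) q (Some (F (circlepath 0 1 t)))) 0 = 1" .
    moreover have "\<psi> (Some (circlepath 0 1 t)) = Some (F (circlepath 0 1 t))" for t
      using Ff[of "circlepath 0 1 t"] by (simp add: \<psi>_def circlepath norm_mult)
    ultimately show "winding_number (\<lambda>t. sphere_quot p q (\<psi> (Some (circlepath 0 1 t)))) 0 = 1"
      using Ff[of z0] z0 by simp
  qed
  have weld: "\<phi> (k z) = \<psi> z" if "z \<in> unit_circle" for z
  proof (cases z)
    case (Some t)
    then show ?thesis using that gk[of t] k0(4)[of t] by (simp add: \<phi>_def \<psi>_def)
  qed (use that in auto)

  \<comment> \<open>\<open>B\<close> composed with the inverse of \<open>f\<close> on the closed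
    inner side, \<open>A\<close> composed with the inverse of \<open>g\<close> outside; infinity
    corresponds to infinity under \<open>g\<close>. On the curve both descriptions agree by the
    welding equation.\<close>
  define r :: "csphere \<Rightarrow> csphere" where
    "r p = (case p of None \<Rightarrow> A None | Some x \<Rightarrow>
       if x \<in> f ` cball 0 1 then B (Some (inv_into (cball 0 1) f x)) else A (Some (inv_into {w. 1 < norm w} g x)))" for p
  have rf: "r (Some (f z)) = B (Some z)" if "norm z \<le> 1" for z
    using that finj by (auto simp: r_def inv_into_f_f)
  have rg: "r (Some (g w)) = A (Some w)" if "1 \<le> norm w" for w
  proof (cases "norm w = 1")
    case True
    then obtain s where s: "norm s = 1" "k0 s = w" using k_surj by blast
    then have "r (Some (g w)) = B (Some s)" using gk rf[of s] by auto
    also have "\<dots> = A (Some w)" using AkB[of "Some s"] s k0(4)[OF s(1)] by simp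
    finally show ?thesis .
  next
    case False
    have "inj_on g {w. 1 < norm w}" using ginj by (auto intro: inj_onI)
    then have "inv_into {w. 1 < norm w} g (g w) = w" using that False by (intro inv_into_f_f) auto
    moreover have "g w \<notin> f ` cball 0 1" using disj1[of _ w] that False by force
    ultimately show ?thesis by (simp add: r_def)
  qed
  have Ah: "sphere_holomorphic_at A p" and Bh: "sphere_holomorphic_at B p" for p
    using A B by (auto intro: rational_map_holomorphic_at blaschke_product_rational)
  have rh: "sphere_holomorphic_at r p" for p
  proof (cases p)
    case None
    have "r (sphere_inversion (Some (h v))) = A (sphere_inversion (Some v))" if "v \<in> U0" for v
    proof (cases "v = 0")
      case False
      then have "sphere_inversion (Some (h v)) = Some (g (1 / v))" using hv[OF that False] by simp
      moreover have "1 \<le> norm (1 / v)" using that False by (auto simp: U0_def norm_divide field_simps)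
      ultimately show ?thesis using rg[of "1 / v"] False by (simp add: inverse_eq_divide)
    qed (simp add: h0 r_def)
    from sphere_holomorphic_at_local_inverse[OF hh U0(1) hinj U0(2) sphere_charts_intros(2) sphere_charts_intros(2) this Ah]
    show ?thesis using None h0 by simp
  next
    case (Some x)
    consider z where "norm z < 1" "x = f z" | z where "norm z = 1" "x = f z" | w where "1 < norm w" "x = g w"
      using cover[of x] by force
    then show ?thesis
    proof cases
      case 1
      from sphere_holomorphic_at_local_inverse[OF fh open_ball fi _ sphere_charts_intros(1) sphere_charts_intros(1) _ Bh, of z r]
      show ?thesis using 1 rf Some by simp
    next
      case 2
      have "r (id (Some (seam_fun f g z))) = B (id (Some z))" if "z \<in> seam_nbhd 2" for z
      proof (cases "norm z \<le> 1")
        case False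
        have zV: "z \<in> V" using that seam_nbhd(3) by blast
        then have "1 < norm (K z)" using K_out False by simp
        then show ?thesis using rg[of "K z"] AKB[OF zV] False by (simp add: seam_fun_def)
      qed (simp add: seam_fun_def rf)
      moreover have "z \<in> seam_nbhd 2" using seam_nbhd(2)[of 2] 2(1) by auto
      ultimately have "sphere_holomorphic_at r (id (Some (seam_fun f g z)))"
        by (intro sphere_holomorphic_at_local_inverse[OF seam_holomorphic[OF gl2] seam_nbhd(1) seam_inj[OF fg]
              _ sphere_charts_intros(1) sphere_charts_intros(1) _ Bh]) auto
      then show ?thesis using 2 Some by (simp add: seam_fun_def)
    next
      case 3
      have gi: "inj_on g (annulus 1 (norm w + 1))" using ginj by (auto intro!: inj_onI)
      from sphere_holomorphic_at_local_inverse[OF gan open_annulus gi _ sphere_charts_intros(1) sphere_charts_intros(1) _ Ah, of w r]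
      show ?thesis using 3 rg Some by simp
    qed
  qed
  have "rational_map r"
  proof (rule sphere_holomorphic_imp_rational[OF rh])
    show "r (Some (f 0)) \<noteq> None" using rf[of 0] Bfin[of 0] by simp
  qed
  moreover have "L = r -` unit_circle"
  proof (rule set_eqI)
    fix p
    show "p \<in> L \<longleftrightarrow> p \<in> r -` unit_circle"
    proof (cases p)
      case None
      then show ?thesis using blaschke_product_iff(2)[OF A, of None] by (auto simp: Leq r_def)
    next
      case (Some x)
      consider z where "norm z \<le> 1" "x = f z" | w where "1 < norm w" "x = g w" using cover[of x] by blast
      then show ?thesis
      proof cases
        case 1
        have "f z \<in> f ` sphere 0 1 \<longleftrightarrow> norm z = 1"
          using inj_on_image_mem_iff[OF finj, of z "sphere 0 1"] 1(1) by auto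
        then show ?thesis using rf[OF 1(1)] blaschke_product_iff(2)[OF B, of "Some z"] 1 Some by (auto simp: Leq)
      next
        case 2
        then have "x \<notin> f ` sphere 0 1" using disj1[of _ w] by (metis imageE mem_sphere_0 order_refl)
        then show ?thesis using rg[of w] blaschke_product_iff(2)[OF A, of "Some w"] 2 Some by (auto simp: Leq)
      qed
    qed
  qed
  ultimately have "jordan_rational_lemniscate L"
    using jp by (auto simp: jordan_rational_lemniscate_def jordan_curve_def)
  moreover have "fingerprint k L" unfolding fingerprint_def
    using jp lrc \<psi>cb \<phi>cb weld by blast
  ultimately show ?thesis by blast
qed

subsection \<open>From lemniscates to welding solutions\<close>

lemma rational_map_sphere_inversion: "rational_map sphere_inversion"
  by (rule sphere_holomorphic_imp_rational[of _ None]) (simp_all add: sphere_holomorphic_at_chart)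

text \<open>Transports extension results for the disc to maps of the exterior disc.\<close>

lemma blaschke_product_inversion:
  assumes "blaschke_product A"
  shows "blaschke_product (sphere_inversion \<circ> A \<circ> sphere_inversion)"
proof (rule rational_imp_blaschke_product)
  have A: "rational_map A" using assms by (rule blaschke_product_rational)
  have s: "A (sphere_inversion p) \<in> exterior_disc" if "p \<in> unit_disc" for p
    using that by (simp add: blaschke_product_iff[OF assms] sphere_inversion_exterior_disc_iff)
  have "A (sphere_inversion (Some 0)) \<noteq> Some 0" using s[of "Some 0"] by auto
  then have "sphere_inversion (A (sphere_inversion (Some 0))) \<noteq> None" by simp
  moreover have "rational_map (A \<circ> sphere_inversion)"
    using rational_map_not_None[OF A] by (metis rational_map_compose[OF A rational_map_sphere_inversion] sphere_inversion_invol)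
  ultimately show "rational_map (sphere_inversion \<circ> A \<circ> sphere_inversion)"
    unfolding comp_assoc by (intro rational_map_compose[OF rational_map_sphere_inversion, of _ "Some 0"]) auto
qed (use blaschke_product_iff[OF assms] in
    \<open>auto simp: sphere_inversion_unit_disc_iff sphere_inversion_unit_circle_iff sphere_inversion_exterior_disc_iff\<close>)

lemma holomorphic_extension_blaschke_product:
  assumes hol: "sphere_holomorphic_on f unit_disc"
    and cont: "continuous_map (sphere_subspace (unit_disc \<union> unit_circle)) riemann_sphere f"
    and D: "\<And>p. p \<in> unit_disc \<Longrightarrow> f p \<in> unit_disc" and T: "\<And>p. p \<in> unit_circle \<Longrightarrow> f p \<in> unit_circle"
  obtains B where "blaschke_product B" "\<And>p. p \<in> unit_disc \<union> unit_circle \<Longrightarrow> B p = f p"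
proof -
  define f0 where "f0 z = the (f (Some z))" for z
  have f0: "f (Some z) = Some (f0 z)" if "norm z \<le> 1" for z
  proof -
    have "f (Some z) \<in> unit_disc \<union> unit_circle"
      using D[of "Some z"] T[of "Some z"] that by (auto simp: order_le_less)
    then show ?thesis unfolding f0_def by (cases "f (Some z)") auto
  qed
  have "continuous_map (top_of_set (cball 0 1)) riemann_sphere (\<lambda>z::complex. Some z)"
    using continuous_map_Some_iff[of "cball 0 1" "\<lambda>z. z"] by (simp add: continuous_on_id)
  then have "continuous_map (top_of_set (cball 0 1)) (sphere_subspace (unit_disc \<union> unit_circle)) (\<lambda>z::complex. Some z)"
    by (rule continuous_map_into_subtopology) (auto simp: order_le_less)
  from continuous_map_compose[OF this cont]
  have "continuous_map (top_of_set (cball 0 1)) riemann_sphere (\<lambda>z. Some (f0 z))"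
    by (rule continuous_map_eq) (use f0 in auto)
  then have c: "continuous_on (cball 0 1) f0" unfolding continuous_map_Some_iff .
  have "(\<lambda>z. the (id (f (id (Some z))))) holomorphic_on {z. id (Some z) \<in> unit_disc \<and> id (f (id (Some z))) \<noteq> None}"
    using hol unfolding sphere_holomorphic_on_def by blast
  moreover have "{z. id (Some z) \<in> unit_disc \<and> id (f (id (Some z))) \<noteq> None} = ball 0 1" using f0 by auto
  ultimately have h: "f0 holomorphic_on ball 0 1" by (simp add: f0_def[abs_def])
  obtain B where B: "blaschke_product B" "\<And>z. norm z \<le> 1 \<Longrightarrow> B (Some z) = Some (f0 z)"
  proof (rule unimodular_boundary_blaschke_product[OF c h])
    show "norm (f0 z) = 1" if "norm z = 1" for z using T[of "Some z"] f0[of z] that by simp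
    show "norm (f0 z) < 1" if "norm z < 1" for z using D[of "Some z"] f0[of z] that by simp
  qed blast
  have "B p = f p" if "p \<in> unit_disc \<union> unit_circle" for p
    using that B(2) f0 by (cases p) auto
  then show ?thesis using B(1) that by blast
qed

text \<open>Near a noncritical point of \<open>r\<^sup>-\<^sup>1(T)\<close> the preimage of the disc is connected, so only one
  component of the complement having that point on its boundary is mapped into the disc.\<close>

lemma lemniscate_sides:
  assumes r: "rational_map r" and L: "L = r -` unit_circle" and S: "S \<subseteq> L" "infinite S"
    and U: "U \<in> connected_components_of (sphere_subspace (- L))" "r ` U \<subseteq> unit_disc"
    and V: "V \<in> connected_components_of (sphere_subspace (- L))" "r ` V \<subseteq> unit_disc"
    and cl: "S \<subseteq> riemann_sphere closure_of U" "S \<subseteq> riemann_sphere closure_of V"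
  shows "U = V"
proof -
  obtain P Q where PQ: "coprime P Q" "Q \<noteq> 0" "r = rat_fun P Q" using r by (auto simp: rational_map_def)
  \<comment> \<open>The zeros of \<open>G\<close> contain all finite critical points of
    \<open>r\<close>. It does not vanish identically: a constant \<open>r\<close> would have one
    value both on the circle, at \<open>S\<close>, and in the disc, on \<open>U\<close>.\<close>
  define G where "G = pderiv P * Q - P * pderiv Q"
  have G0: "G \<noteq> 0"
  proof
    assume "G = 0"
    then have eq: "pderiv P * Q = P * pderiv Q" by (simp add: G_def)
    then have "Q dvd P * pderiv Q" by (metis dvd_triv_right)
    then have "Q dvd pderiv Q" using PQ(1) by (metis coprime_commute coprime_dvd_mult_right_iff)
    then have dQ: "degree Q = 0" using not_dvd_pderiv by blast
    then have "pderiv Q = 0" by (simp add: pderiv_eq_0_iff)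
    then have "pderiv P = 0" using eq PQ(2) by simp
    then have dP: "degree P = 0" by (simp add: pderiv_eq_0_iff)
    obtain a where a: "P = [:a:]" using dP by (metis degree_eq_zeroE)
    obtain b where b: "Q = [:b:]" using dQ by (metis degree_eq_zeroE)
    have const: "r p = Some (a / b)" for p
      using PQ(2,3) a b by (cases p) (auto simp: rat_fun_def)
    obtain s where "s \<in> S" using S(2) by (metis ex_in_conv finite.emptyI)
    then have "Some (a / b) \<in> unit_circle" using S(1) L const by auto
    moreover have "U \<noteq> {}" using U(1) by (rule nonempty_connected_components_of)
    then have "Some (a / b) \<in> unit_disc" using U(2) const by auto
    ultimately show False using sphere_disjoint by blast
  qed
  \<comment> \<open>\<open>S\<close> is infinite, so some finite point of it is noncritical.\<close>
  have "finite (insert None (Some ` {z. poly G z = 0}))" using G0 by (simp add: poly_roots_finite)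
  then obtain p where "p \<in> S" "p \<notin> insert None (Some ` {z. poly G z = 0})"
    using S(2) by (meson finite_subset subsetI)
  then obtain \<zeta> where \<zeta>: "Some \<zeta> \<in> S" "poly G \<zeta> \<noteq> 0" by (cases p) auto
  define \<rho> where "\<rho> = (\<lambda>z. the (r (Some z)))"
  define E where "E = {z. r (Some z) \<noteq> None}"
  have E: "open E" "\<rho> holomorphic_on E" unfolding E_def \<rho>_def using open_finite_values[OF r] by auto
  have rc: "r (Some \<zeta>) \<in> unit_circle" using \<zeta>(1) S(1) L by auto
  then have \<zeta>E: "\<zeta> \<in> E" by (cases "r (Some \<zeta>)") (auto simp: E_def)
  have Q\<zeta>: "poly Q \<zeta> \<noteq> 0" using \<zeta>E by (auto simp: E_def PQ(3) rat_fun_def)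
  have "((\<lambda>z. poly P z / poly Q z) has_field_derivative
      (poly (pderiv P) \<zeta> * poly Q \<zeta> - poly P \<zeta> * poly (pderiv Q) \<zeta>) / (poly Q \<zeta> * poly Q \<zeta>)) (at \<zeta>)"
    by (rule derivative_eq_intros poly_DERIV refl Q\<zeta>)+
  then have "(\<rho> has_field_derivative poly G \<zeta> / (poly Q \<zeta> * poly Q \<zeta>)) (at \<zeta>)"
    unfolding G_def poly_diff poly_mult
  proof (rule has_field_derivative_transform_within_open[OF _ E(1) \<zeta>E])
    show "poly P z / poly Q z = \<rho> z" if "z \<in> E" for z
      using that by (auto simp: \<rho>_def E_def PQ(3) rat_fun_def split: if_splits)
  qed
  then have "deriv \<rho> \<zeta> \<noteq> 0" using DERIV_imp_deriv \<zeta>(2) Q\<zeta> by fastforce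
  then obtain d where d: "d > 0" "ball \<zeta> d \<subseteq> E" "inj_on \<rho> (ball \<zeta> d)"
    by (rule has_complex_derivative_locally_injective[OF E(2) \<zeta>E E(1)])
  have \<rho>h: "\<rho> holomorphic_on ball \<zeta> d" using E(2) d(2) by (rule holomorphic_on_subset)
  obtain i where i: "i holomorphic_on \<rho> ` ball \<zeta> d" "\<And>z. z \<in> ball \<zeta> d \<Longrightarrow> i (\<rho> z) = z"
    using holomorphic_has_inverse[OF \<rho>h open_ball d(3)] by metis
  have o: "open (\<rho> ` ball \<zeta> d)" by (rule open_mapping_thm3[OF \<rho>h open_ball d(3)])
  then obtain \<epsilon> where \<epsilon>: "\<epsilon> > 0" "ball (\<rho> \<zeta>) \<epsilon> \<subseteq> \<rho> ` ball \<zeta> d"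
    using d(1) by (metis centre_in_ball imageI open_contains_ball)
  \<comment> \<open>An intersection of two convex sets, so its image under the local inverse is
    connected and lies in a single component.\<close>
  define H where "H = ball (\<rho> \<zeta>) \<epsilon> \<inter> ball 0 1"
  define N where "N = i ` ball (\<rho> \<zeta>) \<epsilon>"
  have ih: "i holomorphic_on ball (\<rho> \<zeta>) \<epsilon>" using i(1) \<epsilon>(2) by (rule holomorphic_on_subset)
  have inv: "\<rho> (i w) = w \<and> i w \<in> ball \<zeta> d" if w: "w \<in> ball (\<rho> \<zeta>) \<epsilon>" for w
  proof -
    obtain z where "z \<in> ball \<zeta> d" "w = \<rho> z" using w \<epsilon>(2) by blast
    then show ?thesis using i(2) by simp
  qed
  have oN: "open N" unfolding N_def
    by (rule open_mapping_thm3[OF ih open_ball]) (metis inj_onI inv)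
  have \<zeta>N: "\<zeta> \<in> N" unfolding N_def using i(2)[of \<zeta>] d(1) \<epsilon>(1) by (metis centre_in_ball imageI)
  have Nr: "r (Some (i w)) = Some w" if "w \<in> ball (\<rho> \<zeta>) \<epsilon>" for w
  proof -
    have "i w \<in> E" "\<rho> (i w) = w" using inv[OF that] d(2) by auto
    then show ?thesis by (auto simp: \<rho>_def E_def)
  qed
  have "connected (i ` H)" unfolding H_def
    by (intro connected_continuous_image continuous_on_subset[OF holomorphic_on_imp_continuous_on[OF ih]]
        convex_connected convex_Int convex_ball) auto
  then have "connectedin riemann_sphere (Some ` i ` H)"
    by (intro connectedin_continuous_map_image[OF continuous_map_Some]) simp
  moreover have "Some ` i ` H \<subseteq> - L"
    using Nr sphere_disjoint by (fastforce simp: L H_def)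
  ultimately have con: "connectedin (sphere_subspace (- L)) (Some ` i ` H)" by (simp add: connectedin_subtopology)
  have meet: "Some ` i ` H \<inter> W \<noteq> {}"
    if W: "r ` W \<subseteq> unit_disc" "S \<subseteq> riemann_sphere closure_of W" for W
  proof -
    have "openin riemann_sphere (Some ` N)" using oN by simp
    moreover have "Some \<zeta> \<in> riemann_sphere closure_of W" using W(2) \<zeta>(1) by blast
    moreover have "Some \<zeta> \<in> Some ` N" using \<zeta>N by blast
    ultimately obtain q where "q \<in> W" "q \<in> Some ` N" unfolding in_closure_of by blast
    then obtain w where w: "w \<in> ball (\<rho> \<zeta>) \<epsilon>" "q = Some (i w)" "q \<in> W" by (auto simp: N_def)
    then have "Some w \<in> unit_disc" using Nr[OF w(1)] W(1) by force
    then have "w \<in> H" using w(1) by (simp add: H_def)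
    then show ?thesis using w by blast
  qed
  have sub: "Some ` i ` H \<subseteq> W" if "W \<in> connected_components_of (sphere_subspace (- L))" "Some ` i ` H \<inter> W \<noteq> {}" for W
    using connected_components_of_maximal[OF that(1) con] that(2) by (auto simp: disjnt_def)
  have "Some ` i ` H \<subseteq> U" by (rule sub[OF U(1) meet[OF U(2) cl(1)]])
  moreover have "Some ` i ` H \<subseteq> V" by (rule sub[OF V(1) meet[OF V(2) cl(2)]])
  moreover have "Some ` i ` H \<noteq> {}" using meet[OF U(2) cl(1)] by blast
  ultimately have "U \<inter> V \<noteq> {}" by blast
  then show ?thesis using connected_components_of_overlap[OF U(1) V(1)] by simp
qed

text \<open>By injectivity up to the boundary, circle points are not mapped into \<open>W\<close>.
  As \<open>W\<close> is closed relative to the complement of \<open>L\<close>, the rest of its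
  closure lies on \<open>L\<close>.\<close>

lemma conformal_boundary_values:
  assumes \<psi>: "conformal_with_boundary \<psi> U W" and W: "W \<in> connected_components_of (sphere_subspace (- L))"
    and cl: "riemann_sphere closure_of U = U \<union> unit_circle" and d: "U \<inter> unit_circle = {}"
  shows "\<psi> ` unit_circle \<subseteq> L" "\<psi> ` unit_circle \<subseteq> riemann_sphere closure_of W" "inj_on \<psi> unit_circle"
    "continuous_map (sphere_subspace (U \<union> unit_circle)) riemann_sphere \<psi>" "sphere_holomorphic_on \<psi> U" "\<psi> ` U = W"
proof -
  have hm: "homeomorphic_map (sphere_subspace (U \<union> unit_circle)) (sphere_subspace (riemann_sphere closure_of W)) \<psi>"
    using \<psi> unfolding conformal_with_boundary_def cl by blast
  show "sphere_holomorphic_on \<psi> U" "\<psi> ` U = W"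
    using \<psi> unfolding conformal_with_boundary_def conformal_map_onto_def by auto
  have im: "\<psi> ` (U \<union> unit_circle) = riemann_sphere closure_of W"
    using homeomorphic_imp_surjective_map[OF hm] by simp
  have inj: "inj_on \<psi> (U \<union> unit_circle)" using homeomorphic_imp_injective_map[OF hm] by simp
  then show "inj_on \<psi> unit_circle" by (rule inj_on_subset) simp
  show cm: "\<psi> ` unit_circle \<subseteq> riemann_sphere closure_of W" using im by blast
  show "continuous_map (sphere_subspace (U \<union> unit_circle)) riemann_sphere \<psi>"
    using homeomorphic_imp_continuous_map[OF hm] by (simp add: continuous_map_in_subtopology)
  have "closedin (sphere_subspace (- L)) W" by (rule closedin_connected_components_of[OF W])
  then obtain C where C: "closedin riemann_sphere C" "W = C \<inter> - L" unfolding closedin_subtopology by blast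
  then have "riemann_sphere closure_of W \<subseteq> C" by (intro closure_of_minimal) auto
  moreover have "\<psi> ` unit_circle \<inter> W = {}"
    using inj d \<open>\<psi> ` U = W\<close> by (auto simp: inj_on_def)
  ultimately show "\<psi> ` unit_circle \<subseteq> L" using cm C(2) by blast
qed

lemma infinite_unit_circle: "infinite unit_circle"
proof
  assume "finite unit_circle"
  moreover have "unit_circle = Some ` sphere (0::complex) 1" by (auto simp: unit_circle_def)
  ultimately have "finite (sphere (0::complex) 1)" by (metis finite_imageD inj_Some inj_on_subset subset_UNIV)
  moreover have "connected (sphere (0::complex) 1)" by (rule connected_sphere) simp
  ultimately have "sphere (0::complex) 1 = {} \<or> (\<exists>a. sphere (0::complex) 1 = {a})"
    by (metis connected_finite_iff_sing)
  moreover have "1 \<in> sphere (0::complex) 1" "-1 \<in> sphere (0::complex) 1" by auto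
  ultimately show False by (metis empty_iff one_neq_neg_one singletonD)
qed

theorem lemniscate_imp_welding_solution:
  assumes k: "homeomorphic_map (sphere_subspace unit_circle) (sphere_subspace unit_circle) k"
    and L: "jordan_rational_lemniscate L" "fingerprint k L"
  shows "\<exists>A B. welding_solution k A B"
proof -
  have bij: "bij_betw k unit_circle unit_circle"
    by (rule unit_circle_homeomorphism_lift(5)[OF k refl])
  obtain g \<Omega>l \<Omega>r \<psi> \<phi> where f: "jordan_parametrization g L" "left_right_components g L \<Omega>l \<Omega>r"
    "conformal_with_boundary \<psi> unit_disc \<Omega>l" "conformal_with_boundary \<phi> exterior_disc \<Omega>r"
    "\<And>z. z \<in> unit_circle \<Longrightarrow> \<phi> (k z) = \<psi> z"
    using L(2) unfolding fingerprint_def by blast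
  have \<Omega>l: "\<Omega>l \<in> connected_components_of (sphere_subspace (- L))"
    and \<Omega>r: "\<Omega>r \<in> connected_components_of (sphere_subspace (- L))"
    and wn: "\<And>p q. p \<in> \<Omega>l \<Longrightarrow> q \<in> \<Omega>r \<Longrightarrow> winding_number (\<lambda>t. sphere_quot p q (g (Some (circlepath 0 1 t)))) 0 = 1"
    using f(2) by (auto simp: left_right_components_def)
  \<comment> \<open>The winding condition separates the two components: at a common point
    \<open>p = q\<close> the quotient is constantly 1, and a constant path has winding number
    0.\<close>
  have ne: "\<Omega>l \<noteq> \<Omega>r"
  proof
    assume eq: "\<Omega>l = \<Omega>r"
    obtain p where p: "p \<in> \<Omega>l" using nonempty_connected_components_of[OF \<Omega>l] by blast
    then have pL: "p \<notin> L" using connected_components_of_subset[OF \<Omega>l] by auto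
    have gL: "g ` unit_circle = L"
      using homeomorphic_imp_surjective_map[OF f(1)[unfolded jordan_parametrization_def]] by simp
    have "sphere_quot p p (g (Some (circlepath 0 1 t))) = 1" for t
    proof -
      have "Some (circlepath 0 1 t) \<in> unit_circle" by (simp add: circlepath norm_mult)
      then have "g (Some (circlepath 0 1 t)) \<noteq> p" using gL pL by blast
      then show ?thesis by (auto simp: sphere_quot_def sphere_diff_def split: option.splits)
    qed
    then have "winding_number (\<lambda>t. 1) 0 = 1" using wn[of p p] p eq by simp
    moreover have "winding_number (linepath 1 1) 0 = 0" by (rule winding_number_trivial) simp
    then have "winding_number (\<lambda>t. 1) 0 = 0" unfolding linepath_refl .
    ultimately show False by simp
  qed
  note \<psi> = conformal_boundary_values[OF f(3) \<Omega>l closure_of_unit_disc]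
  note \<phi> = conformal_boundary_values[OF f(4) \<Omega>r closure_of_exterior_disc]
  have dis: "unit_disc \<inter> unit_circle = {}" "exterior_disc \<inter> unit_circle = {}" using sphere_disjoint by blast+
  note \<psi> = \<psi>[OF dis(1)] and \<phi> = \<phi>[OF dis(2)]
  define S where "S = \<psi> ` unit_circle"
  have S\<phi>: "S = \<phi> ` unit_circle"
  proof -
    have "S = \<phi> ` k ` unit_circle" unfolding S_def image_image using f(5) by simp
    then show ?thesis using bij by (simp add: bij_betw_def)
  qed
  have Sinf: "infinite S" unfolding S_def using infinite_unit_circle \<psi>(3) by (simp add: finite_image_iff)
  have conl: "connectedin riemann_sphere \<Omega>l" "connectedin riemann_sphere \<Omega>r" "\<Omega>l \<subseteq> - L" "\<Omega>r \<subseteq> - L"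
    using connectedin_connected_components_of[OF \<Omega>l] connectedin_connected_components_of[OF \<Omega>r]
      connected_components_of_subset[OF \<Omega>l] connected_components_of_subset[OF \<Omega>r]
    by (auto simp: connectedin_subtopology)
  have side: "r ` W \<subseteq> unit_disc \<or> r ` W \<subseteq> exterior_disc"
    if r: "rational_map r" "L = r -` unit_circle" and W: "connectedin riemann_sphere W" "W \<subseteq> - L" for r W
  proof -
    have "connectedin riemann_sphere (r ` W)"
      by (rule connectedin_continuous_map_image[OF sphere_holomorphic_imp_continuous_map W(1)])
         (rule rational_map_holomorphic_at[OF r(1)])
    moreover have "r ` W \<subseteq> unit_disc \<union> exterior_disc" using W(2) r(2) sphere_trichotomy by fastforce
    ultimately have "unit_disc \<inter> r ` W = {} \<or> exterior_disc \<inter> r ` W = {}"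
      using openin_unit_disc openin_exterior_disc sphere_disjoint(2) unfolding connectedin by blast
    then show ?thesis using \<open>r ` W \<subseteq> unit_disc \<union> exterior_disc\<close> by blast
  qed
  \<comment> \<open>Passing from \<open>r\<close> to \<open>1/r\<close> leaves the lemniscate
    unchanged, so the left side may be assumed to go into the disc.\<close>
  obtain r where r: "rational_map r" "L = r -` unit_circle" "r ` \<Omega>l \<subseteq> unit_disc"
  proof -
    obtain r where r: "rational_map r" "L = r -` unit_circle" using L(1) by (auto simp: jordan_rational_lemniscate_def)
    show ?thesis
    proof (cases "r ` \<Omega>l \<subseteq> unit_disc")
      case True
      then show ?thesis using r that by blast
    next
      case False
      then have e: "r ` \<Omega>l \<subseteq> exterior_disc" using side[OF r conl(1,3)] by blast
      show ?thesis
      proof (rule that[of "sphere_inversion \<circ> r"])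
        show "(sphere_inversion \<circ> r) ` \<Omega>l \<subseteq> unit_disc" using e by (auto simp: sphere_inversion_unit_disc_iff)
        show "L = (sphere_inversion \<circ> r) -` unit_circle" using r(2) by (auto simp: sphere_inversion_unit_circle_iff)
        obtain p where "p \<in> S" using Sinf by (metis ex_in_conv finite.emptyI)
        then have "r p \<in> unit_circle" using \<psi>(1) r(2) by (auto simp: S_def)
        then have "sphere_inversion (r p) \<noteq> None" by auto
        then show "rational_map (sphere_inversion \<circ> r)"
          by (rule rational_map_compose[OF rational_map_sphere_inversion r(1)])
      qed
    qed
  qed
  \<comment> \<open>Both components have \<open>S\<close> on their boundary; if both went into the
    disc they would coincide by \<open>lemniscate_sides\<close>.\<close>
  have rr: "r ` \<Omega>r \<subseteq> exterior_disc"
  proof (rule ccontr)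
    assume "\<not> ?thesis"
    then have "r ` \<Omega>r \<subseteq> unit_disc" using side[OF r(1,2) conl(2,4)] by blast
    moreover have "S \<subseteq> L" "S \<subseteq> riemann_sphere closure_of \<Omega>l" unfolding S_def by (rule \<psi>)+
    moreover have "S \<subseteq> riemann_sphere closure_of \<Omega>r" unfolding S\<phi> by (rule \<phi>)
    ultimately have "\<Omega>l = \<Omega>r"
      using lemniscate_sides[OF r(1,2) _ Sinf \<Omega>l r(3) \<Omega>r] by blast
    then show False using ne by simp
  qed
  have rh: "sphere_holomorphic_at r p" for p by (rule rational_map_holomorphic_at[OF r(1)])
  have rcm: "continuous_map riemann_sphere riemann_sphere r" by (rule sphere_holomorphic_imp_continuous_map[OF rh])
  obtain B where B: "blaschke_product B" "\<And>p. p \<in> unit_disc \<union> unit_circle \<Longrightarrow> B p = (r \<circ> \<psi>) p"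
  proof (rule holomorphic_extension_blaschke_product[of "r \<circ> \<psi>"])
    show "sphere_holomorphic_on (r \<circ> \<psi>) unit_disc"
      using \<psi>(5) unfolding sphere_holomorphic_on_iff by (auto intro: sphere_holomorphic_at_compose rh)
    show "continuous_map (sphere_subspace (unit_disc \<union> unit_circle)) riemann_sphere (r \<circ> \<psi>)"
      by (rule continuous_map_compose[OF \<psi>(4) rcm])
    show "(r \<circ> \<psi>) p \<in> unit_disc" if "p \<in> unit_disc" for p using that \<psi>(6) r(3) by auto
    show "(r \<circ> \<psi>) p \<in> unit_circle" if "p \<in> unit_circle" for p using that \<psi>(1) r(2) by auto
  qed blast
  \<comment> \<open>Conjugation by the inversion turns the map on the exterior disc into a self-map
    of the disc, to which the boundary lemma applies.\<close>
  define a where "a = sphere_inversion \<circ> (r \<circ> (\<phi> \<circ> sphere_inversion))"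
  have sicm: "continuous_map riemann_sphere riemann_sphere sphere_inversion"
    by (rule homeomorphic_imp_continuous_map[OF homeomorphic_map_sphere_inversion])
  obtain A0 where A0: "blaschke_product A0" "\<And>p. p \<in> unit_disc \<union> unit_circle \<Longrightarrow> A0 p = a p"
  proof (rule holomorphic_extension_blaschke_product[of a])
    show "sphere_holomorphic_on a unit_disc" unfolding sphere_holomorphic_on_iff
    proof (intro conjI openin_unit_disc ballI)
      fix p assume "p \<in> unit_disc"
      then have "sphere_inversion p \<in> exterior_disc" by (simp add: sphere_inversion_exterior_disc_iff)
      then have "sphere_holomorphic_at \<phi> (sphere_inversion p)" using \<phi>(5) by (simp add: sphere_holomorphic_on_iff)
      then show "sphere_holomorphic_at a p" unfolding a_def
        by (intro sphere_holomorphic_at_compose rh sphere_holomorphic_at_chart[of sphere_inversion]) auto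
    qed
    have "continuous_map (sphere_subspace (unit_disc \<union> unit_circle)) (sphere_subspace (exterior_disc \<union> unit_circle)) sphere_inversion"
      by (rule continuous_map_into_subtopology[OF continuous_map_from_subtopology[OF sicm]])
         (auto simp: sphere_inversion_exterior_disc_iff sphere_inversion_unit_circle_iff)
    from continuous_map_compose[OF this \<phi>(4)]
    show "continuous_map (sphere_subspace (unit_disc \<union> unit_circle)) riemann_sphere a" unfolding a_def
      by (intro continuous_map_compose[OF _ sicm] continuous_map_compose[OF _ rcm])
    show "a p \<in> unit_disc" if "p \<in> unit_disc" for p
    proof -
      have "\<phi> (sphere_inversion p) \<in> \<Omega>r" using that \<phi>(6) by (auto simp: sphere_inversion_exterior_disc_iff)
      then show ?thesis using rr by (auto simp: a_def sphere_inversion_unit_disc_iff)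
    qed
    show "a p \<in> unit_circle" if "p \<in> unit_circle" for p
    proof -
      have "\<phi> (sphere_inversion p) \<in> L" using that \<phi>(1) by (auto simp: sphere_inversion_unit_circle_iff)
      then show ?thesis using r(2) by (auto simp: a_def sphere_inversion_unit_circle_iff)
    qed
  qed blast
  define A where "A = sphere_inversion \<circ> A0 \<circ> sphere_inversion"
  have A: "blaschke_product A" unfolding A_def by (rule blaschke_product_inversion[OF A0(1)])
  have AkB: "A (k z) = B z" if z: "z \<in> unit_circle" for z
  proof -
    have kz: "k z \<in> unit_circle" using bij z by (auto simp: bij_betw_def)
    then have "A (k z) = r (\<phi> (k z))" by (simp add: A_def A0(2) a_def sphere_inversion_unit_circle_iff)
    also have "\<dots> = B z" using f(5)[OF z] B(2) z by simp
    finally show ?thesis .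
  qed
  have "welding_solution k A B" unfolding welding_solution_def
    using A B(1) AkB blaschke_welding_degree_eq[OF A B(1) bij AkB] by simp
  then show ?thesis by blast
qed

subsection \<open>Lueroth's theorem over the reals\<close>

text \<open>Lueroth's theorem compares several subfields of one field, so a subfield is a set rather
  than a type.\<close>

locale subfield_set =
  fixes M :: "'f::field set"
  assumes one_in: "1 \<in> M"
    and diff_in: "u \<in> M \<Longrightarrow> v \<in> M \<Longrightarrow> u - v \<in> M"
    and mult_in: "u \<in> M \<Longrightarrow> v \<in> M \<Longrightarrow> u * v \<in> M"
    and inverse_in: "u \<in> M \<Longrightarrow> inverse u \<in> M"
begin

lemma zero_in: "0 \<in> M"
  using diff_in[OF one_in one_in] by simp

lemma divide_in: "u \<in> M \<Longrightarrow> v \<in> M \<Longrightarrow> u / v \<in> M"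
  unfolding divide_inverse by (intro mult_in inverse_in)

definition over :: "'f poly \<Rightarrow> bool" where
  "over p \<longleftrightarrow> (\<forall>i. coeff p i \<in> M)"

lemma over_diff: "over p \<Longrightarrow> over q \<Longrightarrow> over (p - q)"
  by (simp add: over_def diff_in)

lemma over_smult: "c \<in> M \<Longrightarrow> over p \<Longrightarrow> over (smult c p)"
  by (simp add: over_def mult_in)

lemma over_monom_mult: "c \<in> M \<Longrightarrow> over p \<Longrightarrow> over (monom c n * p)"
  by (simp add: over_def mult_in zero_in coeff_monom_mult)

text \<open>Long division only uses quotients of leading coefficients, so the remainder keeps its
  coefficients in the subfield.\<close>

lemma over_division:
  assumes p: "over p" "p \<noteq> 0" and q: "over q"
  shows "\<exists>a r. over r \<and> q = a * p + r \<and> (r = 0 \<or> degree r < degree p)"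
  using q
proof (induction "degree q" arbitrary: q rule: less_induct)
  case less
  show ?case
  proof (cases "q = 0 \<or> degree q < degree p")
    case True
    then show ?thesis using less.prems by (intro exI[of _ 0] exI[of _ q]) auto
  next
    case False
    define c where "c = lead_coeff q / lead_coeff p"
    define m where "m = monom c (degree q - degree p)"
    define q' where "q' = q - m * p"
    have c: "c \<in> M" "c \<noteq> 0" using p less.prems False by (auto simp: c_def over_def intro: divide_in)
    have q': "over q'" unfolding q'_def m_def by (intro over_diff less.prems over_monom_mult c p)
    have "m \<noteq> 0" using c(2) by (simp add: m_def)
    then have "degree (m * p) = degree q"
      using p(2) False c(2) by (simp add: degree_mult_eq m_def degree_monom_eq)
    then have dle: "degree q' \<le> degree q" unfolding q'_def by (intro degree_diff_le) auto
    have "coeff (m * p) (degree q) = c * lead_coeff p"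
      using False by (simp add: m_def coeff_monom_mult)
    then have "coeff q' (degree q) = 0" using p(2) by (simp add: q'_def c_def)
    then have "q' = 0 \<or> degree q' < degree q"
      using dle by (metis leading_coeff_0_iff le_neq_implies_less)
    moreover have "\<exists>a r. over r \<and> q' = a * p + r \<and> (r = 0 \<or> degree r < degree p)" if "q' = 0"
      using that zero_in by (intro exI[of _ 0] exI[of _ 0]) (auto simp: over_def)
    ultimately obtain a r where ar: "over r" "q' = a * p + r" "r = 0 \<or> degree r < degree p"
      using less.hyps[OF _ q'] by blast
    then have "q = (a + m) * p + r" by (simp add: q'_def algebra_simps)
    then show ?thesis using ar by blast
  qed
qed

end

section \<open>Substitution in the field of real rational functions\<close>

abbreviation cst :: "real \<Rightarrow> real poly fract" where "cst c \<equiv> to_fract [:c:]"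

lemma cst_0: "cst 0 = 0" by simp

lemma cst_1: "cst 1 = 1"
  by (metis one_pCons to_fract_1)

lemma inj_cst: "inj cst"
  by (rule injI) simp

lemma cst_divide: "b \<noteq> 0 \<Longrightarrow> cst (a / b) = cst a / cst b"
proof -
  assume "b \<noteq> 0"
  then have "cst (a / b) * cst b = cst a" by (simp flip: to_fract_mult)
  then show ?thesis using \<open>b \<noteq> 0\<close> by (simp add: field_simps)
qed

definition subst :: "real poly fract \<Rightarrow> real poly \<Rightarrow> real poly fract" where
  "subst u p = poly (map_poly cst p) u"

lemma subst_pCons [simp]: "subst u (pCons a p) = cst a + u * subst u p"
  by (simp add: subst_def map_poly_pCons)

lemma subst_0 [simp]: "subst u 0 = 0"
  by (simp add: subst_def)

lemma subst_1 [simp]: "subst u 1 = 1"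
  unfolding one_pCons subst_pCons by (simp only: cst_1 subst_0 mult_zero_right add_0_right)

lemma subst_add [simp]: "subst u (p + q) = subst u p + subst u q"
proof -
  have "map_poly cst (p + q) = map_poly cst p + map_poly cst q"
    by (rule poly_eqI) (simp add: coeff_map_poly flip: to_fract_add)
  then show ?thesis by (simp add: subst_def)
qed

lemma subst_smult [simp]: "subst u (smult c p) = cst c * subst u p"
  by (induction p) (simp_all add: algebra_simps flip: to_fract_mult)

lemma subst_mult [simp]: "subst u (p * q) = subst u p * subst u q"
  by (induction p) (simp_all add: algebra_simps)

lemma subst_diff [simp]: "subst u (p - q) = subst u p - subst u q"
  using subst_add[of u "p - q" q] by simp

lemma subst_X: "subst (to_fract [:0, 1:]) p = to_fract p"
proof (induction p)
  case (pCons a p)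
  have "to_fract [:a:] + to_fract [:0, 1:] * to_fract p = to_fract ([:a:] + [:0, 1:] * p)"
    by (simp only: to_fract_add to_fract_mult)
  then show ?case using pCons by simp
qed simp

text \<open>The field R(D) generated by \<open>D\<close> over the reals.\<close>

definition subst_field :: "real poly fract \<Rightarrow> real poly fract set" where
  "subst_field D = {u. \<exists>a b. subst D b \<noteq> 0 \<and> u = subst D a / subst D b}"

lemma subst_fieldI: "subst D b \<noteq> 0 \<Longrightarrow> u = subst D a / subst D b \<Longrightarrow> u \<in> subst_field D"
  unfolding subst_field_def by blast

lemma subst_fieldE:
  assumes "u \<in> subst_field D"
  obtains a b where "subst D b \<noteq> 0" "u = subst D a / subst D b"
  using assms unfolding subst_field_def by blast

lemma subfield_subst: "subfield_set (subst_field D)"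
proof (rule subfield_set.intro)
  show "1 \<in> subst_field D" by (rule subst_fieldI[of D "[:1:]" _ "[:1:]"]) simp_all
next
  fix u v assume "u \<in> subst_field D" "v \<in> subst_field D"
  then obtain a b c d where h: "subst D b \<noteq> 0" "u = subst D a / subst D b" "subst D d \<noteq> 0" "v = subst D c / subst D d"
    by (metis subst_fieldE)
  show "u - v \<in> subst_field D"
    by (rule subst_fieldI[of D "b * d" _ "a * d - c * b"]) (use h in \<open>auto simp: diff_frac_eq\<close>)
  show "u * v \<in> subst_field D"
    by (rule subst_fieldI[of D "b * d" _ "a * c"]) (use h in auto)
next
  fix u assume "u \<in> subst_field D"
  then obtain a b where h: "subst D b \<noteq> 0" "u = subst D a / subst D b" by (rule subst_fieldE)
  show "inverse u \<in> subst_field D"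
  proof (cases "subst D a = 0")
    case True
    then show ?thesis by (intro subst_fieldI[of D b _ 0]) (use h in auto)
  next
    case False
    then show ?thesis by (intro subst_fieldI[of D a _ b]) (use h in auto)
  qed
qed

lemma quot_of_fract_props:
  fixes u :: "real poly fract"
  shows "coprime (fst (quot_of_fract u)) (snd (quot_of_fract u))" "snd (quot_of_fract u) \<noteq> 0"
    "u * to_fract (snd (quot_of_fract u)) = to_fract (fst (quot_of_fract u))"
proof -
  obtain a b where ab: "quot_of_fract u = (a, b)" by fastforce
  have n: "(a, b) \<in> normalized_fracts" using quot_of_fract_in_normalized_fracts[of u] ab by simp
  then show 1: "coprime (fst (quot_of_fract u)) (snd (quot_of_fract u))" "snd (quot_of_fract u) \<noteq> 0"
    by (auto simp: normalized_fracts_def ab)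
  have "u = Fract a b" using quot_to_fract_quot_of_fract[of u] ab by (simp add: quot_to_fract_def)
  then show "u * to_fract (snd (quot_of_fract u)) = to_fract (fst (quot_of_fract u))"
    using 1(2) unfolding ab fst_conv snd_conv by (simp add: Fract_conv_to_fract)
qed

lemma fract_quotE:
  fixes u :: "real poly fract"
  obtains a b where "coprime a b" "b \<noteq> 0" "u * to_fract b = to_fract a"
  by (rule that[OF quot_of_fract_props])

text \<open>For \<open>u = a/b\<close> the polynomial \<open>a(T) - u * b(T)\<close> has the
  indeterminate \<open>x\<close> as a root. It is nontrivial for nonconstant \<open>u\<close>, which
  shows that \<open>x\<close> is algebraic over any field containing such a
  \<open>u\<close>.\<close>

lemma graph_poly_nonzero:
  fixes u :: "real poly fract"
  assumes "\<And>c. u \<noteq> cst c" "b \<noteq> 0"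
  shows "map_poly cst a - smult u (map_poly cst b) \<noteq> 0"
proof
  assume "map_poly cst a - smult u (map_poly cst b) = 0"
  then have "coeff (map_poly cst a - smult u (map_poly cst b)) (degree b) = 0" by (metis coeff_0)
  then have "cst (coeff a (degree b)) = u * cst (lead_coeff b)" by (simp add: coeff_map_poly)
  then have "u = cst (coeff a (degree b)) / cst (lead_coeff b)" using assms(2) by (simp add: field_simps)
  then have "u = cst (coeff a (degree b) / lead_coeff b)" using assms(2) by (simp add: cst_divide)
  then show False using assms(1) by blast
qed

text \<open>A bivariate polynomial is a polynomial in \<open>T\<close> with coefficients in \<open>\<real>[x]\<close>.\<close>

lemma poly_linear_coeffs:
  fixes G :: "real poly poly" and lf :: "real poly \<Rightarrow> real"
  assumes "lf 0 = 0" "\<And>a b. lf (a + b) = lf a + lf b" "\<And>c a. lf (smult c a) = c * lf a"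
  shows "poly (map_poly lf G) t = lf (poly G [:t:])"
  by (induction G) (use assms in \<open>auto simp: map_poly_pCons\<close>)

lemma poly_map_const: "poly (map_poly (\<lambda>c. [:c:]) g) [:t:] = [:poly g (t::real):]"
  by (induction g) (auto simp: map_poly_pCons)

lemma poly_eq_0_cofinite:
  fixes p :: "real poly"
  assumes "finite F" "\<And>t. t \<notin> F \<Longrightarrow> poly p t = 0"
  shows "p = 0"
proof (rule ccontr)
  assume "p \<noteq> 0"
  then have "finite {t. poly p t = 0}" by (rule poly_roots_finite)
  then have "finite (F \<union> {t. poly p t = 0})" using assms(1) by simp
  moreover have "F \<union> {t. poly p t = 0} = UNIV" using assms(2) by auto
  ultimately show False using infinite_UNIV_char_0[where 'a=real] by simp
qed

text \<open>The polynomial \<open>h(x) * g(T) - g(x) * h(T)\<close> has degree at most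
  \<open>max (degree g) (degree h)\<close> in \<open>x\<close>. A factor \<open>P\<close> of that
  degree in \<open>x\<close> leaves a cofactor \<open>Q\<close> in \<open>T\<close> alone.
  Specializing \<open>x\<close>, this cofactor divides \<open>h(a) * g - g(a) * h\<close> for every
  \<open>a\<close>, hence both \<open>g\<close> and \<open>h\<close>, which are coprime; so it is a
  constant.\<close>

lemma antisymmetric_factor:
  fixes g h :: "real poly" and P Q :: "real poly poly"
  assumes gh: "coprime g h" "h \<noteq> 0" "\<And>c. g \<noteq> smult c h"
    and F: "smult h (map_poly (\<lambda>c. [:c:]) g) - smult g (map_poly (\<lambda>c. [:c:]) h) = P * Q"
    and P: "coeff P j \<noteq> 0" "max (degree g) (degree h) \<le> degree (coeff P j)"
  shows "\<exists>\<kappa>. Q = [:[:\<kappa>:]:]"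
proof -
  define F where "F = smult h (map_poly (\<lambda>c. [:c:]) g) - smult g (map_poly (\<lambda>c. [:c:]) h)"
  have FPQ: "F = P * Q" unfolding F_def by (rule assms(4))
  have Ft: "poly F [:t:] = smult (poly g t) h - smult (poly h t) g" for t
    by (simp add: F_def poly_map_const mult.commute)
  \<comment> \<open>The coefficient of \<open>x^N\<close>, as a polynomial in \<open>T\<close>. That
    of \<open>P\<close> is nonzero for suitable \<open>N\<close>, so \<open>P\<close> keeps its
    degree in \<open>x\<close> for all but finitely many specializations of
    \<open>T\<close>.\<close>
  define xc where "xc N = map_poly (\<lambda>c::real poly. coeff c N)" for N
  have xc: "poly (xc N G) t = coeff (poly G [:t:]) N" for N G t
    unfolding xc_def by (rule poly_linear_coeffs) auto
  have cxc: "coeff (xc N G) i = coeff (coeff G i) N" for N G i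
    unfolding xc_def by (simp add: coeff_map_poly)
  define N where "N = degree (coeff P j)"
  have "coeff (xc N P) j \<noteq> 0" unfolding cxc N_def using P(1) by simp
  then have "xc N P \<noteq> 0" by auto
  then have fin: "finite {t. poly (xc N P) t = 0}" by (rule poly_roots_finite)
  have Qt: "coeff (poly Q [:t:]) k = 0" if t: "poly (xc N P) t \<noteq> 0" and k: "k > 0" for t k
  proof (cases "poly Q [:t:] = 0")
    case False
    have cP: "coeff (poly P [:t:]) N \<noteq> 0" using t by (simp add: xc)
    then have dP: "N \<le> degree (poly P [:t:])" "poly P [:t:] \<noteq> 0" by (auto intro: le_degree)
    have "degree (poly F [:t:]) \<le> max (degree g) (degree h)" unfolding Ft
      by (rule order_trans[OF degree_diff_le_max]) (auto simp: degree_smult_le max.coboundedI1 max.coboundedI2)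
    moreover have "poly F [:t:] = poly P [:t:] * poly Q [:t:]" by (simp add: FPQ)
    ultimately have "degree (poly P [:t:]) + degree (poly Q [:t:]) \<le> max (degree g) (degree h)"
      using degree_mult_eq[OF dP(2) False] by simp
    then have "degree (poly Q [:t:]) = 0" using dP(1) P(2) unfolding N_def by linarith
    then show ?thesis using k by (simp add: coeff_eq_0)
  qed simp
  have xQ: "xc k Q = 0" if "k > 0" for k
    by (rule poly_eq_0_cofinite[OF fin]) (use Qt that in \<open>auto simp: xc\<close>)
  define Q0 where "Q0 = xc 0 Q"
  have Qc: "coeff Q i = [:coeff Q0 i:]" for i
  proof (rule poly_eqI)
    fix k
    show "coeff (coeff Q i) k = coeff [:coeff Q0 i:] k"
    proof (cases k)
      case (Suc m)
      then have "coeff (xc k Q) i = 0" using xQ[of k] by simp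
      then show ?thesis using Suc by (simp add: cxc)
    qed (simp add: Q0_def cxc)
  qed
  then have QQ0: "Q = map_poly (\<lambda>c. [:c:]) Q0" by (intro poly_eqI) (simp add: coeff_map_poly)
  have dv: "Q0 dvd smult (poly h a) g - smult (poly g a) h" for a
  proof -
    define e where "e = map_poly (\<lambda>c::real poly. poly c a)"
    have e: "poly (e G) t = poly (poly G [:t:]) a" for G t
      unfolding e_def by (rule poly_linear_coeffs) auto
    have "poly (smult (poly h a) g - smult (poly g a) h) t = poly (e P * Q0) t" for t
    proof -
      have "poly (smult (poly h a) g - smult (poly g a) h) t = poly (poly F [:t:]) a" by (simp add: Ft mult.commute)
      also have "\<dots> = poly (e P) t * poly (poly Q [:t:]) a" by (simp add: FPQ e)
      also have "poly (poly Q [:t:]) a = poly Q0 t" by (simp add: QQ0 poly_map_const)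
      finally show ?thesis by simp
    qed
    then have "smult (poly h a) g - smult (poly g a) h = e P * Q0" by (intro poly_eqI_degree_lead_coeff poly_ext) auto
    then show ?thesis by simp
  qed
  \<comment> \<open>\<open>g\<close> and \<open>h\<close> are not proportional, so two
    specializations are linearly independent and recover \<open>g\<close> and
    \<open>h\<close>.\<close>
  obtain a b where ab: "poly g a * poly h b \<noteq> poly g b * poly h a"
  proof (rule ccontr)
    assume "\<not> thesis"
    then have eq: "poly g a * poly h b = poly g b * poly h a" for a b using that by blast
    obtain b where b: "poly h b \<noteq> 0" using gh(2) poly_eq_0_cofinite[of "{}" h] by auto
    have "g = smult (poly g b / poly h b) h"
      by (rule poly_ext) (use eq[of _ b] b in \<open>simp add: field_simps\<close>)
    then show False using gh(3) by blast
  qed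
  define dt where "dt = poly g b * poly h a - poly g a * poly h b"
  have dt: "dt \<noteq> 0" using ab by (simp add: dt_def)
  have "smult dt h = smult (poly h b) (smult (poly h a) g - smult (poly g a) h) - smult (poly h a) (smult (poly h b) g - smult (poly g b) h)"
    by (rule poly_ext) (simp add: dt_def algebra_simps)
  then have "Q0 dvd smult dt h" using dv[of a] dv[of b] by (metis dvd_diff dvd_smult)
  then have 1: "Q0 dvd h" using dt by (simp add: dvd_smult_iff)
  have "smult dt g = smult (poly g b) (smult (poly h a) g - smult (poly g a) h) - smult (poly g a) (smult (poly h b) g - smult (poly g b) h)"
    by (rule poly_ext) (simp add: dt_def algebra_simps)
  then have "Q0 dvd smult dt g" using dv[of a] dv[of b] by (metis dvd_diff dvd_smult)
  then have "Q0 dvd g" using dt by (simp add: dvd_smult_iff)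
  then have "is_unit Q0" using 1 gh(1) by (meson coprime_common_divisor)
  then obtain \<kappa> where "Q0 = [:\<kappa>:]" by (auto simp: is_unit_poly_iff)
  then have "Q = [:[:\<kappa>:]:]" using QQ0 by (simp add: map_poly_pCons)
  then show ?thesis by blast
qed

text \<open>\<open>p\<close> is the minimal polynomial of \<open>x\<close> over \<open>M\<close>,
  and \<open>D = g/h\<close> is a nonconstant coefficient of it. \<open>p\<close> divides
  \<open>g(T) - D * h(T)\<close>; clearing denominators, its primitive part \<open>P\<close> divides
  \<open>h(x) * g(T) - g(x) * h(T)\<close> by Gauss's lemma. Since \<open>P\<close> has full degree
  in \<open>x\<close>, the cofactor is constant, so \<open>x\<close> has the same degree over R(D)
  as over \<open>M\<close>, and the two fields coincide.\<close>

theorem lueroth: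
  fixes M :: "real poly fract set"
  assumes sub: "subfield_set M" and const: "\<And>c. cst c \<in> M" and u0: "u0 \<in> M" "\<And>c. u0 \<noteq> cst c"
  obtains D where "D \<in> M" "\<And>c. D \<noteq> cst c" "\<And>u. u \<in> M \<Longrightarrow> \<exists>a b. subst D b \<noteq> 0 \<and> u = subst D a / subst D b"
proof -
  interpret subfield_set M by (rule sub)
  let ?X = "to_fract [:0, 1:] :: real poly fract"
  have X: "poly (map_poly cst a) ?X = to_fract a" for a using subst_X[of a] by (simp add: subst_def)
  have over_c: "over (map_poly cst a)" for a using const by (simp add: over_def coeff_map_poly)
  define good where "good q \<longleftrightarrow> over q \<and> q \<noteq> 0 \<and> poly q ?X = 0" for q
  have good_graph: "good (map_poly cst a - smult u (map_poly cst b))"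
    if "u \<in> M" "\<And>c. u \<noteq> cst c" "u * to_fract b = to_fract a" "b \<noteq> 0" for u a b
    unfolding good_def using graph_poly_nonzero[OF that(2,4)] that by (auto intro!: over_diff over_smult over_c simp: X)
  obtain a0 b0 where ab0: "b0 \<noteq> 0" "u0 * to_fract b0 = to_fract a0" by (rule fract_quotE[of u0])
  have "good (map_poly cst a0 - smult u0 (map_poly cst b0))" by (rule good_graph[OF u0 ab0(2,1)])
  \<comment> \<open>Least degree among the nonzero polynomials over \<open>M\<close> that vanish at
    the indeterminate.\<close>
  then obtain p0 where p0: "good p0" "\<And>q. good q \<Longrightarrow> degree p0 \<le> degree q"
    using ex_has_least_nat[of good _ degree] by blast
  define p where "p = smult (inverse (lead_coeff p0)) p0"
  have lp0: "lead_coeff p0 \<noteq> 0" using p0(1) by (simp add: good_def)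
  have p: "over p" "p \<noteq> 0" "poly p ?X = 0" "degree p = degree p0" "lead_coeff p = 1"
    using p0(1) lp0 by (auto simp: p_def good_def over_def intro: mult_in inverse_in)
  have pdvd: "p dvd q" if q: "over q" "poly q ?X = 0" for q
  proof -
    obtain a r where ar: "over r" "q = a * p + r" "r = 0 \<or> degree r < degree p"
      using over_division[OF p(1,2) q(1)] by blast
    have "poly r ?X = 0" using ar(2) q(2) p(3) by simp
    then have "r = 0" using ar(1,3) p0(2)[of r] p(4) by (metis good_def not_le)
    then show ?thesis using ar(2) by simp
  qed
  \<comment> \<open>If all coefficients were constants, a nonzero real polynomial would vanish at
    the indeterminate.\<close>
  obtain i0 where i0: "\<And>c. coeff p i0 \<noteq> cst c"
  proof (rule ccontr)
    assume "\<not> thesis"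
    then have ex: "\<exists>c. coeff p i = cst c" for i using that by blast
    define p' where "p' = map_poly (the_inv cst) p"
    have ti: "the_inv cst (cst c) = c" for c by (rule the_inv_f_f[OF inj_cst])
    have "the_inv cst 0 = 0" using ti[of 0] by simp
    then have "map_poly cst p' = p"
      by (intro poly_eqI) (metis p'_def coeff_map_poly cst_0 ex ti)
    then have "to_fract p' = 0" using p(3) X[of p'] by simp
    then have "p' = 0" by simp
    then show False using p(2) \<open>map_poly cst p' = p\<close> by simp
  qed
  define D where "D = coeff p i0"
  have DM: "D \<in> M" using p(1) by (simp add: D_def over_def)
  have Dc: "\<And>c. D \<noteq> cst c" using i0 by (simp add: D_def)
  obtain g h where gh: "coprime g h" "h \<noteq> 0" "D * to_fract h = to_fract g" by (rule fract_quotE[of D])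
  define q where "q = map_poly cst g - smult D (map_poly cst h)"
  have q: "good q" unfolding q_def by (rule good_graph[OF DM Dc gh(3,2)])
  then have pq: "p dvd q" using pdvd by (simp add: good_def)
  define F where "F = smult h (map_poly (\<lambda>c. [:c:]) g) - smult g (map_poly (\<lambda>c. [:c:]) h)"
  have Fq: "fract_poly F = smult (to_fract h) q"
  proof (rule poly_eqI)
    fix i
    have "coeff (fract_poly F) i = to_fract h * cst (coeff g i) - to_fract g * cst (coeff h i)"
      by (simp add: F_def coeff_map_poly flip: to_fract_mult to_fract_diff)
    also have "\<dots> = coeff (smult (to_fract h) q) i"
      by (simp add: q_def coeff_map_poly algebra_simps flip: gh(3))
    finally show "coeff (fract_poly F) i = coeff (smult (to_fract h) q) i" .
  qed
  obtain c P where cP: "p = smult c (fract_poly P)" "content P = 1" by (rule content_decompose_fract)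
  have c0: "c \<noteq> 0" using cP(1) p(2) by auto
  have "fract_poly P dvd p" unfolding cP(1) by (rule dvd_smult) simp
  then have "fract_poly P dvd fract_poly F" unfolding Fq using pq by (meson dvd_smult dvd_trans)
  then have "P dvd F" by (rule fract_poly_dvdD[OF _ cP(2)])
  then obtain Q where FPQ: "F = P * Q" by (rule dvdE)
  define m where "m = degree p"
  have Pi: "coeff p i = c * to_fract (coeff P i)" for i by (simp add: cP(1) coeff_map_poly)
  have Pm: "c * to_fract (coeff P m) = 1" using p(5) Pi[of m] by (simp add: m_def)
  then have Pm0: "coeff P m \<noteq> 0" by auto
  \<comment> \<open>\<open>D\<close> is the quotient of two coefficients of \<open>P\<close> and
    equals \<open>g/h\<close> in lowest terms, so these coefficients are \<open>g * s\<close> and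
    \<open>h * s\<close>. One of them has degree at least \<open>max (degree g) (degree h)\<close>
    in \<open>x\<close>.\<close>
  have "to_fract (coeff P i0) = D * to_fract (coeff P m)"
    using Pi[of i0] Pm c0 unfolding D_def[symmetric] by (metis mult.commute mult.left_commute mult.right_neutral mult_cancel_left)
  then have "to_fract (coeff P i0) * to_fract h = to_fract g * to_fract (coeff P m)"
    unfolding gh(3)[symmetric] by simp
  then have cross: "coeff P i0 * h = g * coeff P m" by (simp flip: to_fract_mult)
  then have "h dvd g * coeff P m" by (metis dvd_triv_right)
  then have "h dvd coeff P m" using gh(1) by (metis coprime_commute coprime_dvd_mult_right_iff)
  then obtain s where s: "coeff P m = h * s" by (rule dvdE)
  then have s0: "s \<noteq> 0" using Pm0 by auto
  have Pi0: "coeff P i0 = g * s" using cross s gh(2) by (simp add: mult.commute mult.left_commute)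
  have ex: "\<exists>j. coeff P j \<noteq> 0 \<and> max (degree g) (degree h) \<le> degree (coeff P j)"
  proof (cases "degree g \<le> degree h")
    case True
    then show ?thesis using s s0 gh(2) Pm0 by (intro exI[of _ m]) (simp add: degree_mult_eq)
  next
    case False
    then have "g \<noteq> 0" by auto
    then show ?thesis using Pi0 s0 False by (intro exI[of _ i0]) (simp add: degree_mult_eq)
  qed
  have gch: "g \<noteq> smult c h" for c
  proof
    assume "g = smult c h"
    then have "D * to_fract h = cst c * to_fract h" using gh(3) by (simp flip: to_fract_mult)
    then show False using gh(2) Dc by simp
  qed
  obtain \<kappa> where \<kappa>: "Q = [:[:\<kappa>:]:]"
    using antisymmetric_factor[OF gh(1,2) gch FPQ[unfolded F_def]] ex by blast
  have "smult (to_fract h) q = smult (cst \<kappa>) (fract_poly P)"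
    unfolding Fq[symmetric] FPQ \<kappa> by (simp add: map_poly_pCons)
  then have "smult (inverse (to_fract h)) (smult (to_fract h) q) = smult (inverse (to_fract h)) (smult (cst \<kappa>) (smult (inverse c) p))"
    using cP(1) c0 by simp
  then have qp: "q = smult (inverse (to_fract h) * (cst \<kappa> * inverse c)) p" using gh(2) by simp
  define l where "l = inverse (to_fract h) * (cst \<kappa> * inverse c)"
  have qlp: "q = smult l p" using qp by (simp add: l_def)
  have l0: "l \<noteq> 0" using qlp q by (auto simp: good_def)
  have dq: "degree q = degree p" using l0 by (simp add: qlp)
  \<comment> \<open>\<open>q\<close> has coefficients in R(D) and the degree of \<open>p\<close>.
    For \<open>u = a/b\<close> in \<open>M\<close> both \<open>a(T)\<close> and \<open>b(T)\<close>
    are reduced modulo \<open>q\<close> over R(D); the combination \<open>r1 - u * r2\<close> of the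
    remainders is divisible by \<open>p\<close> but of smaller degree, hence 0, and its coefficients
    express \<open>u\<close>.\<close>
  define S where "S = subst_field D"
  interpret S: subfield_set S unfolding S_def by (rule subfield_subst)
  have cS: "cst c \<in> S" for c unfolding S_def
    by (rule subst_fieldI[of D 1 _ "[:c:]"]) simp_all
  have DS: "D \<in> S" unfolding S_def
    by (rule subst_fieldI[of D 1 _ "[:0, 1:]"]) (simp_all add: cst_1)
  have oS: "S.over (map_poly cst a)" for a using cS by (simp add: S.over_def coeff_map_poly)
  have qS: "S.over q" unfolding q_def by (intro S.over_diff S.over_smult oS DS)
  have q0: "q \<noteq> 0" "poly q ?X = 0" using q by (auto simp: good_def)
  have "u \<in> S" if u: "u \<in> M" for u
  proof -
    obtain a b where ab: "b \<noteq> 0" "u * to_fract b = to_fract a" by (rule fract_quotE[of u])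
    obtain a1 r1 where 1: "S.over r1" "map_poly cst a = a1 * q + r1" "r1 = 0 \<or> degree r1 < degree q"
      using S.over_division[OF qS q0(1) oS] by blast
    obtain a2 r2 where 2: "S.over r2" "map_poly cst b = a2 * q + r2" "r2 = 0 \<or> degree r2 < degree q"
      using S.over_division[OF qS q0(1) oS] by blast
    have "over (map_poly cst a - smult u (map_poly cst b))" by (intro over_diff over_smult u over_c)
    moreover have "poly (map_poly cst a - smult u (map_poly cst b)) ?X = 0" using ab by (simp add: X)
    ultimately have "p dvd map_poly cst a - smult u (map_poly cst b)" by (rule pdvd)
    moreover have "map_poly cst a - smult u (map_poly cst b) = (a1 - smult u a2) * q + (r1 - smult u r2)"
      unfolding 1(2) 2(2) by (simp add: algebra_simps smult_add_right)
    moreover have "p dvd (a1 - smult u a2) * q" using pq by simp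
    ultimately have pd: "p dvd r1 - smult u r2" by (metis dvd_add_right_iff)
    have eq: "r1 - smult u r2 = 0"
    proof (rule ccontr)
      assume nz: "r1 - smult u r2 \<noteq> 0"
      then have "degree p \<le> degree (r1 - smult u r2)" using pd by (rule dvd_imp_degree_le[rotated])
      moreover have "degree (r1 - smult u r2) < degree q \<or> r1 - smult u r2 = 0"
      proof (cases "degree q = 0")
        case True
        then show ?thesis using 1(3) 2(3) by auto
      next
        case False
        then have "degree r1 < degree q" "degree (smult u r2) < degree q"
          using 1(3) 2(3) le_less_trans[OF degree_smult_le[of u r2]] by auto
        then show ?thesis by (simp add: degree_diff_less)
      qed
      ultimately show False using dq nz by simp
    qed
    have "r2 \<noteq> 0"
    proof
      assume "r2 = 0"
      then have "poly (map_poly cst b) ?X = 0" using 2(2) q0(2) by simp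
      then show False using X ab(1) by simp
    qed
    then have "coeff r1 (degree r2) = u * lead_coeff r2" "lead_coeff r2 \<noteq> 0" using eq by auto
    then have "u = coeff r1 (degree r2) / lead_coeff r2" by simp
    then show ?thesis using 1(1) 2(1) by (metis S.divide_in S.over_def)
  qed
  then show ?thesis using that[of D] DM Dc unfolding S_def subst_field_def by blast
qed

subsection \<open>Real rational functions on the circle\<close>

text \<open>Takes the upper half-plane to the disc, \<open>i\<close> to 0 and infinity to 1, hence
  the extended real line to the circle.\<close>

definition cayley :: "csphere \<Rightarrow> csphere" where
  "cayley = rat_fun [:- \<i>, 1:] [:\<i>, 1:]"

definition cayley_inv :: "csphere \<Rightarrow> csphere" where
  "cayley_inv = rat_fun [:\<i>, \<i>:] [:1, - 1:]"

definition real_line :: "csphere set" where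
  "real_line = insert None (range (\<lambda>t::real. Some (of_real t)))"

lemma cayley_simps:
  "cayley None = Some 1" "cayley (Some z) = (if z = - \<i> then None else Some ((z - \<i>) / (z + \<i>)))"
  "cayley_inv None = Some (- \<i>)" "cayley_inv (Some w) = (if w = 1 then None else Some (\<i> * (1 + w) / (1 - w)))"
proof -
  show "cayley None = Some 1" "cayley_inv None = Some (- \<i>)" by (simp_all add: cayley_def cayley_inv_def rat_fun_def)
  have "poly [:\<i>, 1:] z = z + \<i>" "poly [:- \<i>, 1:] z = z - \<i>" by simp_all
  then show "cayley (Some z) = (if z = - \<i> then None else Some ((z - \<i>) / (z + \<i>)))"
    unfolding cayley_def rat_fun_def by (simp only: option.case add_eq_0_iff2)
  have "poly [:1, - 1:] w = 1 - w" "poly [:\<i>, \<i>:] w = \<i> * (1 + w)" by (simp_all add: algebra_simps)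
  moreover have "1 - w = 0 \<longleftrightarrow> w = 1" by auto
  ultimately show "cayley_inv (Some w) = (if w = 1 then None else Some (\<i> * (1 + w) / (1 - w)))"
    unfolding cayley_inv_def rat_fun_def by (simp only: option.case)
qed

lemma rational_map_cayley: "rational_map cayley" "rational_map cayley_inv"
proof -
  have "coprime [:- \<i>, 1:] [:\<i>, 1:]"
    by (rule coprime_complex_polyI) (auto simp: add_eq_0_iff complex_eq_iff)
  then show "rational_map cayley" unfolding cayley_def rational_map_def
    by (intro exI[of _ "[:- \<i>, 1:]"] exI[of _ "[:\<i>, 1:]"]) auto
  have "coprime [:\<i>, \<i>:] [:1, - 1:]"
    by (rule coprime_complex_polyI) (auto simp: add_eq_0_iff complex_eq_iff)
  then show "rational_map cayley_inv" unfolding cayley_inv_def rational_map_def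
    by (intro exI[of _ "[:\<i>, \<i>:]"] exI[of _ "[:1, - 1:]"]) auto
qed

lemma cayley_inverse [simp]: "cayley (cayley_inv p) = p" "cayley_inv (cayley p) = p"
proof -
  show "cayley (cayley_inv p) = p"
  proof (cases p)
    case (Some w)
    show ?thesis
    proof (cases "w = 1")
      case False
      then have w: "1 - w \<noteq> 0" by simp
      have 1: "\<i> * (1 + w) / (1 - w) - \<i> = 2 * \<i> * w / (1 - w)" "\<i> * (1 + w) / (1 - w) + \<i> = 2 * \<i> / (1 - w)"
        using w by (simp_all add: field_simps)
      have "2 * \<i> / (1 - w) \<noteq> 0" using w by simp
      then have "\<i> * (1 + w) / (1 - w) \<noteq> - \<i>" unfolding 1(2)[symmetric] by (metis add.left_inverse)
      then show ?thesis using False w Some by (simp add: cayley_simps 1)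
    qed (simp add: Some cayley_simps)
  qed (simp add: cayley_simps)
  show "cayley_inv (cayley p) = p"
  proof (cases p)
    case (Some z)
    show ?thesis
    proof (cases "z = - \<i>")
      case False
      then have z: "z + \<i> \<noteq> 0" by (metis add_eq_0_iff2)
      have 1: "1 + (z - \<i>) / (z + \<i>) = 2 * z / (z + \<i>)" "1 - (z - \<i>) / (z + \<i>) = 2 * \<i> / (z + \<i>)"
        using z by (simp_all add: field_simps)
      have "2 * \<i> / (z + \<i>) \<noteq> 0" using z by simp
      then have "(z - \<i>) / (z + \<i>) \<noteq> 1" unfolding 1(2)[symmetric] by (metis diff_self)
      then show ?thesis using False z Some by (simp add: cayley_simps 1)
    qed (simp add: Some cayley_simps)
  qed (simp add: cayley_simps)
qed

lemma cayley_real_line: "p \<in> real_line \<Longrightarrow> cayley p \<in> unit_circle"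
proof -
  assume "p \<in> real_line"
  then consider "p = None" | t :: real where "p = Some (of_real t)" by (auto simp: real_line_def)
  then show ?thesis
  proof cases
    case 2
    have "complex_of_real t \<noteq> - \<i>" by (simp add: complex_eq_iff)
    moreover have "norm (complex_of_real t - \<i>) = norm (complex_of_real t + \<i>)" by (simp add: cmod_def)
    moreover have "complex_of_real t + \<i> \<noteq> 0" by (simp add: complex_eq_iff)
    ultimately show ?thesis using 2 by (simp add: cayley_simps norm_divide)
  qed (simp add: cayley_simps)
qed

lemma cayley_inv_circle: "p \<in> unit_circle \<Longrightarrow> cayley_inv p \<in> real_line"
proof -
  assume p: "p \<in> unit_circle"
  then obtain w where w: "p = Some w" "norm w = 1" by (cases p) auto
  show ?thesis
  proof (cases "w = 1")
    case False
    have w0: "w \<noteq> 0" using w(2) by auto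
    have cw: "cnj w = 1 / w" using w(2) w0 by (metis complex_norm_square mult.commute nonzero_eq_divide_eq of_real_1 power_one)
    have "cnj (\<i> * (1 + w) / (1 - w)) = \<i> * (1 + w) / (1 - w)"
      using w0 False by (simp add: cw field_simps)
    then have "\<i> * (1 + w) / (1 - w) \<in> \<real>" by (simp add: Reals_cnj_iff)
    then obtain t where "\<i> * (1 + w) / (1 - w) = of_real t" by (rule Reals_cases)
    then show ?thesis using False by (auto simp: w cayley_simps real_line_def)
  qed (simp add: w cayley_simps real_line_def)
qed

section \<open>Real fractions as maps of the sphere\<close>

abbreviation cpoly :: "real poly \<Rightarrow> complex poly" where "cpoly \<equiv> map_poly complex_of_real"

lemma coeff_cpoly: "coeff (cpoly p) i = of_real (coeff p i)"
  by (simp add: coeff_map_poly)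

lemma poly_cpoly: "poly (cpoly p) (of_real t) = of_real (poly p t)"
  by (induction p) (auto simp: map_poly_pCons)

lemma degree_cpoly: "degree (cpoly p) = degree p"
  by (rule degree_map_poly) simp

lemma cpoly_mult: "cpoly (p * q) = cpoly p * cpoly q"
  by (rule poly_eqI) (simp add: coeff_cpoly coeff_mult)

lemma cpoly_add: "cpoly (p + q) = cpoly p + cpoly q"
  by (rule poly_eqI) (simp add: coeff_cpoly)

text \<open>A Bezout relation over the reals remains one over the complex numbers.\<close>

lemma cpoly_coprime:
  assumes "coprime a b" "b \<noteq> 0"
  shows "coprime (cpoly a) (cpoly b)" "cpoly b \<noteq> 0"
proof -
  show b: "cpoly b \<noteq> 0" using assms(2) by (metis coeff_cpoly leading_coeff_0_iff of_real_eq_0_iff coeff_0)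
  obtain r s where "r * a + s * b = 1"
    using bezout_coefficients_fst_snd[of a b] assms(1) by (metis coprime_imp_gcd_eq_1)
  then have "cpoly r * cpoly a + cpoly s * cpoly b = cpoly 1" by (metis cpoly_add cpoly_mult)
  then have eq: "cpoly r * cpoly a + cpoly s * cpoly b = 1" by simp
  show "coprime (cpoly a) (cpoly b)"
  proof (rule coprime_complex_polyI[OF _ b])
    fix z assume "poly (cpoly a) z = 0"
    then show "poly (cpoly b) z \<noteq> 0" using arg_cong[OF eq, of "\<lambda>p. poly p z"] by auto
  qed
qed

definition real_rat :: "real poly fract \<Rightarrow> csphere \<Rightarrow> csphere" where
  "real_rat u = rat_fun (cpoly (fst (quot_of_fract u))) (cpoly (snd (quot_of_fract u)))"

text \<open>At a zero of the reduced denominator the value is 0 by the convention for division;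
  identities between values are therefore stated off finite sets.\<close>

definition fract_eval :: "real poly fract \<Rightarrow> real \<Rightarrow> real" where
  "fract_eval u t = poly (fst (quot_of_fract u)) t / poly (snd (quot_of_fract u)) t"

lemma real_rat_rational: "rational_map (real_rat u)"
  unfolding rational_map_def real_rat_def using cpoly_coprime[OF quot_of_fract_props(1,2)[of u]] by blast

lemma real_rat_real_line: "p \<in> real_line \<Longrightarrow> real_rat u p \<in> real_line"
proof -
  have q: "Some (complex_of_real a / complex_of_real b) \<in> real_line" for a b
    unfolding real_line_def by (metis insertI2 of_real_divide rangeI)
  assume "p \<in> real_line"
  then consider "p = None" | t :: real where "p = Some (of_real t)" by (auto simp: real_line_def)
  then show ?thesis
    by cases (auto simp: real_rat_def rat_fun_def poly_cpoly coeff_cpoly degree_cpoly q intro: real_line_def[THEN equalityD2, THEN subsetD])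
qed

text \<open>The value may be read off any representation, since the reduced denominator divides
  every other one and so is nonzero where that one is.\<close>

lemma fract_eval_quotient:
  assumes "u * to_fract b = to_fract a" "poly b t \<noteq> 0"
  shows "real_rat u (Some (of_real t)) = Some (of_real (poly a t / poly b t))" "fract_eval u t = poly a t / poly b t"
proof -
  define a' b' where "a' = fst (quot_of_fract u)" and "b' = snd (quot_of_fract u)"
  have q: "coprime a' b'" "b' \<noteq> 0" "u * to_fract b' = to_fract a'"
    unfolding a'_def b'_def by (rule quot_of_fract_props)+
  have "to_fract (a * b') = u * to_fract b * to_fract b'" using assms(1) by simp
  also have "\<dots> = to_fract (a' * b)" using q(3) by (simp add: mult.assoc mult.left_commute)
  finally have eq: "a * b' = a' * b" by (simp only: to_fract_eq_iff)
  then have "b' dvd a' * b" by (metis dvd_triv_right)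
  then have "b' dvd b" using q(1) by (metis coprime_commute coprime_dvd_mult_right_iff)
  then have b't: "poly b' t \<noteq> 0" using assms(2) by (auto elim!: dvdE)
  have "poly a t * poly b' t = poly a' t * poly b t" using arg_cong[OF eq, of "\<lambda>p. poly p t"] by simp
  then have e: "poly a' t / poly b' t = poly a t / poly b t" using b't assms(2) by (simp add: field_simps)
  then show "fract_eval u t = poly a t / poly b t" by (simp add: fract_eval_def a'_def b'_def)
  have "real_rat u (Some (of_real t)) = Some (of_real (poly a' t) / of_real (poly b' t))"
    using b't by (simp add: real_rat_def rat_fun_def poly_cpoly a'_def b'_def)
  also have "\<dots> = Some (of_real (poly a' t / poly b' t))" by simp
  finally show "real_rat u (Some (of_real t)) = Some (of_real (poly a t / poly b t))" using e by simp
qed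

text \<open>Arithmetic of values holds off the finitely many zeros of the denominators involved, hence
  along the filter \<open>cofinite\<close>.\<close>

lemma eventually_poly_nonzero: "(p::real poly) \<noteq> 0 \<Longrightarrow> eventually (\<lambda>t. poly p t \<noteq> 0) cofinite"
  by (simp add: eventually_cofinite poly_roots_finite)

lemma fract_eval_real_rat: "eventually (\<lambda>t. real_rat u (Some (of_real t)) = Some (of_real (fract_eval u t))) cofinite"
  using eventually_poly_nonzero[OF quot_of_fract_props(2)[of u]]
  by eventually_elim (use fract_eval_quotient[OF quot_of_fract_props(3)] in \<open>simp add: fract_eval_def\<close>)

lemma fract_eval_diff: "eventually (\<lambda>t. fract_eval (u - v) t = fract_eval u t - fract_eval v t) cofinite"
  and fract_eval_add: "eventually (\<lambda>t. fract_eval (u + v) t = fract_eval u t + fract_eval v t) cofinite"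
  and fract_eval_mult: "eventually (\<lambda>t. fract_eval (u * v) t = fract_eval u t * fract_eval v t) cofinite"
proof -
  define a b c d where ab: "a = fst (quot_of_fract u)" "b = snd (quot_of_fract u)" "c = fst (quot_of_fract v)" "d = snd (quot_of_fract v)"
  have q: "b \<noteq> 0" "u * to_fract b = to_fract a" "d \<noteq> 0" "v * to_fract d = to_fract c"
    unfolding ab by (rule quot_of_fract_props)+
  have ev: "eventually (\<lambda>t. poly b t \<noteq> 0 \<and> poly d t \<noteq> 0) cofinite"
    by (intro eventually_conj eventually_poly_nonzero q)
  have u: "fract_eval u t = poly a t / poly b t" and v: "fract_eval v t = poly c t / poly d t" for t
    by (simp_all add: fract_eval_def ab)
  have s: "(u - v) * to_fract (b * d) = to_fract (a * d - c * b)" "(u + v) * to_fract (b * d) = to_fract (a * d + c * b)"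
    "(u * v) * to_fract (b * d) = to_fract (a * c)"
    unfolding to_fract_mult to_fract_diff to_fract_add q(2)[symmetric] q(4)[symmetric] by (simp_all add: algebra_simps)
  show "eventually (\<lambda>t. fract_eval (u - v) t = fract_eval u t - fract_eval v t) cofinite" using ev
    by eventually_elim (subst fract_eval_quotient(2)[OF s(1)], auto simp: u v diff_frac_eq)
  show "eventually (\<lambda>t. fract_eval (u + v) t = fract_eval u t + fract_eval v t) cofinite" using ev
    by eventually_elim (subst fract_eval_quotient(2)[OF s(2)], auto simp: u v add_frac_eq)
  show "eventually (\<lambda>t. fract_eval (u * v) t = fract_eval u t * fract_eval v t) cofinite" using ev
    by eventually_elim (subst fract_eval_quotient(2)[OF s(3)], auto simp: u v)
qed

lemma fract_eval_nonzero: "u \<noteq> 0 \<Longrightarrow> eventually (\<lambda>t. fract_eval u t \<noteq> 0) cofinite"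
proof -
  assume "u \<noteq> 0"
  then have "fst (quot_of_fract u) \<noteq> 0" using quot_of_fract_props(2,3)[of u] by auto
  then have "eventually (\<lambda>t. poly (fst (quot_of_fract u)) t \<noteq> 0 \<and> poly (snd (quot_of_fract u)) t \<noteq> 0) cofinite"
    by (intro eventually_conj eventually_poly_nonzero quot_of_fract_props)
  then show ?thesis by eventually_elim (simp add: fract_eval_def)
qed

lemma fract_eval_cst: "fract_eval (cst c) t = c"
  using fract_eval_quotient(2)[of "cst c" 1 "[:c:]" t] by simp

lemma fract_eval_0: "fract_eval 0 t = 0"
  using fract_eval_cst[of 0 t] by simp

lemma fract_eval_inverse: "eventually (\<lambda>t. fract_eval (inverse u) t = inverse (fract_eval u t)) cofinite"
proof (cases "u = 0")
  case False
  then have eq: "inverse u * u = cst 1" by (simp add: cst_1)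
  show ?thesis using fract_eval_mult[of "inverse u" u, unfolded eq] fract_eval_nonzero[OF False]
    by eventually_elim (simp add: fract_eval_cst field_simps)
qed (simp add: fract_eval_0)

lemma fract_eval_divide: "eventually (\<lambda>t. fract_eval (u / v) t = fract_eval u t / fract_eval v t) cofinite"
  using fract_eval_mult[of u "inverse v"] fract_eval_inverse[of v]
  by eventually_elim (simp add: divide_inverse)

lemma fract_eval_subst: "eventually (\<lambda>t. fract_eval (subst D p) t = poly p (fract_eval D t)) cofinite"
proof (induction p)
  case (pCons a p)
  show ?case using pCons.IH fract_eval_add[of "cst a" "D * subst D p"] fract_eval_mult[of D "subst D p"]
    by eventually_elim (simp add: fract_eval_cst)
qed (simp add: fract_eval_0)

definition circle_rat :: "real poly fract \<Rightarrow> csphere \<Rightarrow> csphere" where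
  "circle_rat u = cayley \<circ> (real_rat u \<circ> cayley_inv)"

lemma circle_rat_circle: "p \<in> unit_circle \<Longrightarrow> circle_rat u p \<in> unit_circle"
  by (simp add: circle_rat_def cayley_real_line real_rat_real_line cayley_inv_circle)

lemma None_notin_circle: "p \<in> unit_circle \<Longrightarrow> p \<noteq> None"
  using Some_mem_simps(5) by metis

lemma one_in_circle: "Some 1 \<in> unit_circle"
  by simp

lemma rational_map_compose_circle:
  assumes "rational_map f" "rational_map g" "\<And>p. p \<in> unit_circle \<Longrightarrow> f p \<in> unit_circle" "\<And>p. p \<in> unit_circle \<Longrightarrow> g p \<in> unit_circle"
  shows "rational_map (f \<circ> g)"
  using rational_map_compose[OF assms(1,2), of "Some 1"] None_notin_circle[OF assms(3)[OF assms(4)[OF one_in_circle]]] by blast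

lemma circle_rat_rational: "rational_map (circle_rat u)"
proof -
  obtain p where "real_rat u p \<noteq> None" using rational_map_not_None[OF real_rat_rational] by blast
  then have "real_rat u (cayley_inv (cayley p)) \<noteq> None" by simp
  then have "rational_map (real_rat u \<circ> cayley_inv)"
    by (rule rational_map_compose[OF real_rat_rational rational_map_cayley(2)])
  moreover have "cayley ((real_rat u \<circ> cayley_inv) (Some 1)) \<noteq> None"
    using None_notin_circle[OF circle_rat_circle[OF one_in_circle]] by (simp add: circle_rat_def)
  ultimately show ?thesis unfolding circle_rat_def by (rule rational_map_compose[OF rational_map_cayley(1)])
qed

lemma poly_Re_Im:
  "poly p (complex_of_real t) = Complex (poly (map_poly Re p) t) (poly (map_poly Im p) t)"
  by (induction p) (auto simp: map_poly_pCons complex_eq_iff)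

lemma infinite_cofinite_reals: "finite F \<Longrightarrow> infinite (complex_of_real ` (- F))"
proof
  assume "finite F" "finite (complex_of_real ` (- F))"
  then have "finite (- F)" by (metis finite_imageD inj_of_real inj_on_subset subset_UNIV)
  then show False using \<open>finite F\<close> infinite_UNIV_char_0[where 'a=real] by (metis finite_compl)
qed

text \<open>On the line the value \<open>Some 1\<close> becomes infinity; the point \<open>q\<close>
  excludes the constant 1, whose counterpart is the constant infinity and not a rational
  function.\<close>

lemma circle_rat_surj:
  assumes f: "rational_map f" "\<And>p. p \<in> unit_circle \<Longrightarrow> f p \<in> unit_circle" and q: "f q \<noteq> Some 1"
  obtains u where "f = circle_rat u"
proof -
  define g where "g = cayley_inv \<circ> (f \<circ> cayley)"
  have "f (cayley None) \<noteq> None" using None_notin_circle[OF f(2)] by (simp add: cayley_simps)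
  then have "rational_map (f \<circ> cayley)" by (rule rational_map_compose[OF f(1) rational_map_cayley(1)])
  moreover have "cayley_inv ((f \<circ> cayley) (cayley_inv q)) \<noteq> None"
    using q by (cases "f q") (auto simp: cayley_simps)
  ultimately have g: "rational_map g" unfolding g_def by (rule rational_map_compose[OF rational_map_cayley(2)])
  have greal: "g p \<in> real_line" if "p \<in> real_line" for p
    using that by (simp add: g_def cayley_inv_circle f(2) cayley_real_line)
  obtain P Q where PQ: "coprime P Q" "Q \<noteq> 0" "g = rat_fun P Q" using g by (auto simp: rational_map_def)
  define pr pi qr qi where "pr = map_poly Re P" and "pi = map_poly Im P" and "qr = map_poly Re Q" and "qi = map_poly Im Q"
  \<comment> \<open>Extending \<open>P/Q\<close> by the conjugate of \<open>Q\<close> on the real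
    line: \<open>a\<close> is the real part of the new numerator, whose imaginary part vanishes
    because \<open>g\<close> is real there, and \<open>b\<close> is the squared modulus of
    \<open>Q\<close>.\<close>
  define a b where "a = pr * qr + pi * qi" and "b = qr * qr + qi * qi"
  have PQt: "poly P (of_real t) = Complex (poly pr t) (poly pi t)" "poly Q (of_real t) = Complex (poly qr t) (poly qi t)" for t
    by (simp_all add: poly_Re_Im pr_def pi_def qr_def qi_def)
  have bQ: "poly b t = 0 \<longleftrightarrow> poly Q (of_real t) = 0" for t
    by (simp add: b_def PQt complex_eq_iff sum_squares_eq_zero_iff)
  have b0: "b \<noteq> 0"
  proof
    assume "b = 0"
    then have "complex_of_real ` (- {}) \<subseteq> {z. poly Q z = 0}" using bQ by auto
    then show False using infinite_cofinite_reals[of "{}"] poly_roots_finite[OF PQ(2)] finite_subset by blast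
  qed
  define u where "u = to_fract a / to_fract b"
  have ub: "u * to_fract b = to_fract a" using b0 by (simp add: u_def)
  have gu: "g = real_rat u"
  proof (rule rational_map_eqI[OF g real_rat_rational infinite_cofinite_reals])
    show "finite {t. poly b t = 0}" using b0 by (rule poly_roots_finite)
    fix z assume "z \<in> complex_of_real ` (- {t. poly b t = 0})"
    then obtain t where t: "z = of_real t" "poly b t \<noteq> 0" by auto
    then have Q: "poly Q (of_real t) \<noteq> 0" using bQ by simp
    then have gt: "g (Some z) = Some (poly P (of_real t) / poly Q (of_real t))" by (simp add: PQ(3) rat_fun_def t(1))
    have "g (Some z) \<in> real_line" using t(1) by (intro greal) (auto simp: real_line_def)
    then obtain w where w: "poly P (of_real t) / poly Q (of_real t) = complex_of_real w"
      unfolding gt by (auto simp: real_line_def)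
    then have "poly P (of_real t) = of_real w * poly Q (of_real t)" using Q by (simp add: field_simps)
    then have "poly pr t = w * poly qr t" "poly pi t = w * poly qi t" unfolding PQt by (auto simp: complex_eq_iff)
    then have "poly a t = w * poly b t" by (simp add: a_def b_def algebra_simps)
    then have "poly a t / poly b t = w" using t(2) by simp
    then show "g (Some z) = real_rat u (Some z)" using fract_eval_quotient(1)[OF ub t(2)] gt w t(1) by simp
  qed
  have "circle_rat u = f" unfolding circle_rat_def gu[symmetric] by (simp add: fun_eq_iff g_def)
  then show ?thesis using that by blast
qed

subsection \<open>Uniqueness\<close>

lemma real_coordinate:
  assumes "p \<in> unit_circle" "p \<noteq> Some 1"
  shows "cayley_inv p = Some (of_real (Re (the (cayley_inv p))))"
proof -
  have "cayley_inv p \<noteq> None" using assms(2) by (metis cayley_inverse(1) cayley_simps(1))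
  then show ?thesis using cayley_inv_circle[OF assms(1)] by (auto simp: real_line_def)
qed

lemma rational_map_sides:
  assumes f: "rational_map f" and "U = unit_disc \<or> U = exterior_disc" and T: "\<And>p. p \<in> U \<Longrightarrow> f p \<notin> unit_circle"
  shows "f ` U \<subseteq> unit_disc \<or> f ` U \<subseteq> exterior_disc"
proof -
  have "connectedin riemann_sphere U" using assms(2) connectedin_unit_disc connectedin_exterior_disc by blast
  then have "connectedin riemann_sphere (f ` U)"
    by (rule connectedin_continuous_map_image[OF sphere_holomorphic_imp_continuous_map, OF rational_map_holomorphic_at[OF f]])
  moreover have sub: "f ` U \<subseteq> unit_disc \<union> exterior_disc" using T sphere_trichotomy by fastforce
  ultimately have "unit_disc \<inter> f ` U = {} \<or> exterior_disc \<inter> f ` U = {}"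
    using openin_unit_disc openin_exterior_disc sphere_disjoint(2) unfolding connectedin by blast
  then show ?thesis using sub by blast
qed

text \<open>Every arc of the circle is infinite, so the agreement set is dense in the circle and
  both sides are continuous.\<close>

lemma circle_eq_cofinite:
  assumes k: "homeomorphic_map (sphere_subspace unit_circle) (sphere_subspace unit_circle) k"
    and f: "rational_map f" and g: "rational_map g" and fin: "finite {p \<in> unit_circle. f (k p) \<noteq> g p}" and p: "p \<in> unit_circle"
  shows "f (k p) = g p"
proof -
  let ?T = "sphere_subspace unit_circle"
  let ?S = "{p \<in> unit_circle. f (k p) = g p}"
  have fc: "continuous_map riemann_sphere riemann_sphere f" and gc: "continuous_map riemann_sphere riemann_sphere g"
    by (rule sphere_holomorphic_imp_continuous_map, rule rational_map_holomorphic_at, rule f g)+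
  have kc: "continuous_map ?T riemann_sphere k"
    using homeomorphic_imp_continuous_map[OF k] by (simp add: continuous_map_in_subtopology)
  have "p \<in> ?T closure_of ?S" unfolding in_closure_of
  proof (intro conjI allI impI)
    show "p \<in> topspace ?T" using p by simp
    fix W assume W: "p \<in> W \<and> openin ?T W"
    then obtain U where U: "openin riemann_sphere U" "W = U \<inter> unit_circle" unfolding openin_subtopology by blast
    obtain t where t: "p = Some t" "norm t = 1" using p by (cases p) auto
    have "open {z. Some z \<in> U}" using U(1) by (simp add: openin_sphere_iff)
    moreover have "t \<in> {z. Some z \<in> U}" using W U(2) t by simp
    ultimately obtain e where e: "e > 0" "ball t e \<subseteq> {z. Some z \<in> U}" by (rule openE)
    have "t islimpt sphere 0 1"
    proof (rule connected_imp_perfect)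
      show "connected (sphere (0::complex) 1)" by (rule connected_sphere) simp
      show "sphere 0 1 \<noteq> {x}" for x :: complex
      proof
        assume eq: "sphere 0 1 = {x}"
        have "1 \<in> sphere (0::complex) 1" "-1 \<in> sphere (0::complex) 1" by auto
        then show False unfolding eq by auto
      qed
    qed (use t in auto)
    then have "infinite (sphere 0 1 \<inter> ball t e)" using e(1) unfolding islimpt_eq_infinite_ball by blast
    then have "infinite (Some ` (sphere 0 1 \<inter> ball t e))" by (simp add: finite_image_iff)
    moreover have "Some ` (sphere 0 1 \<inter> ball t e) \<subseteq> W" using e(2) U(2) by auto
    ultimately have "infinite W" using finite_subset by blast
    moreover have "W \<subseteq> unit_circle" using U(2) by blast
    ultimately have "\<not> W \<subseteq> {p \<in> unit_circle. f (k p) \<noteq> g p}" using fin finite_subset by blast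
    then show "\<exists>y. y \<in> ?S \<and> y \<in> W" using \<open>W \<subseteq> unit_circle\<close> by blast
  qed
  then have "(f \<circ> k) p = g p"
    by (rule forall_in_closure_of_eq[OF _ Hausdorff_sphere continuous_map_compose[OF kc fc] continuous_map_from_subtopology[OF gc]]) auto
  then show ?thesis by simp
qed

lemma blaschke_degree_one_inverse:
  assumes X: "blaschke_product X" "rat_degree X = 1"
  obtains Y where "blaschke_product Y" "Y \<circ> X = id"
proof -
  obtain c as where h: "norm c = 1" "set as \<subseteq> ball 0 1" "as \<noteq> []" "X = blaschke_fun c as" "rat_degree X = length as"
    by (rule blaschke_productE[OF X(1)])
  then obtain a where a: "as = [a]" using X(2) by (metis One_nat_def length_0_conv length_Suc_conv)
  have na: "norm a < 1" using h(2) a by simp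
  \<comment> \<open>Solving \<open>w = c * (z - a) / (1 - cnj a * z)\<close> for \<open>z\<close>
    gives the Blaschke factor with zero \<open>- (c * a)\<close> and constant
    \<open>cnj c\<close>.\<close>
  define Y where "Y = blaschke_fun (cnj c) [- (c * a)]"
  have Y: "blaschke_product Y" unfolding Y_def
    by (rule blaschke_fun_is_blaschke) (use h(1) na in \<open>auto simp: norm_mult\<close>)
  have cc: "c * cnj c = 1" using h(1) by (metis complex_norm_square of_real_1 power_one)
  have val: "Y (X (Some z)) = Some z" if z: "norm z = 1" for z
  proof -
    have d: "1 - z * cnj a \<noteq> 0" by (rule one_minus_cnj_mult_nonzero[OF na]) (use z in simp)
    have Xz: "X (Some z) = Some (c * (z - a) / (1 - z * cnj a))"
      using d by (simp add: h(4) a rat_fun_def algebra_simps)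
    define w where "w = c * (z - a) / (1 - z * cnj a)"
    have "Some w \<in> unit_circle" using blaschke_product_boundary[OF X(1), of "Some z"] z Xz by (simp add: w_def)
    then have nw: "norm w = 1" by simp
    have d2: "1 - w * cnj (- (c * a)) \<noteq> 0"
      by (rule one_minus_cnj_mult_nonzero) (use h(1) na nw in \<open>auto simp: norm_mult\<close>)
    have Yw: "Y (Some w) = Some (cnj c * (w + c * a) / (1 + w * (cnj c * cnj a)))"
      using d2 by (simp add: Y_def rat_fun_def algebra_simps)
    have wc: "w * cnj c = (z - a) / (1 - z * cnj a)" using cc by (simp add: w_def mult.commute mult.left_commute)
    have "cnj c * (w + c * a) = w * cnj c + c * cnj c * a" by (simp add: algebra_simps)
    also have "\<dots> = (z - a) / (1 - z * cnj a) + a" unfolding wc cc by simp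
    also have "\<dots> = z * (1 - a * cnj a) / (1 - z * cnj a)" using d by (simp add: field_simps)
    finally have n: "cnj c * (w + c * a) = z * (1 - a * cnj a) / (1 - z * cnj a)" .
    have "1 + w * (cnj c * cnj a) = 1 + (w * cnj c) * cnj a" by simp
    also have "\<dots> = (1 - a * cnj a) / (1 - z * cnj a)" unfolding wc using d by (simp add: field_simps)
    finally have m: "1 + w * (cnj c * cnj a) = (1 - a * cnj a) / (1 - z * cnj a)" .
    have "1 - a * cnj a \<noteq> 0" by (rule one_minus_cnj_mult_nonzero[OF na]) (use na in simp)
    then have "Y (Some w) = Some z" unfolding Yw n m using d by simp
    then show ?thesis using Xz by (simp add: w_def)
  qed
  have "Y \<circ> X = id"
  proof (rule rational_map_eqI)
    show "rational_map (Y \<circ> X)"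
      by (rule rational_map_compose_circle)
        (use X Y in \<open>auto simp: blaschke_product_rational blaschke_product_boundary\<close>)
    show "rational_map id"
      by (rule sphere_holomorphic_imp_rational[of _ "Some 0"]) (simp_all add: sphere_holomorphic_at_chart)
    have "unit_circle = Some ` sphere (0::complex) 1" by (auto simp: unit_circle_def)
    then show "infinite (sphere (0::complex) 1)" using infinite_unit_circle by (metis finite_imageI)
  qed (use val in auto)
  then show ?thesis using Y that by blast
qed

lemma blaschke_product_circle_rat:
  assumes "blaschke_product A"
  obtains u where "A = circle_rat u"
proof (rule circle_rat_surj[of A "Some 0"])
  have "A (Some 0) \<in> unit_disc" using blaschke_product_iff(1)[OF assms, of "Some 0"] by simp
  then show "A (Some 0) \<noteq> Some 1" by auto
qed (use assms that in \<open>auto simp: blaschke_product_rational blaschke_product_boundary\<close>)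

lemma blaschke_product_image: "blaschke_product B \<Longrightarrow> B ` unit_disc = unit_disc"
  by (simp add: blaschke_product_def)

text \<open>Moving the circle to the real line, the real rational functions \<open>u\<close> for which \<open>u \<circ> k\<close> is
  rational on the circle form a subfield of \<open>\<real>(x)\<close>. A Lueroth generator \<open>D\<close> of it, with \<open>E = D \<circ> k\<close>,
  yields the common right factors of all solutions.\<close>

lemma common_right_factor:
  assumes k: "homeomorphic_map (sphere_subspace unit_circle) (sphere_subspace unit_circle) k"
    and sol0: "welding_solution k A0 B0"
  obtains D E where "rational_map D" "rational_map E"
    "\<And>p. p \<in> unit_circle \<Longrightarrow> D p \<in> unit_circle" "\<And>p. p \<in> unit_circle \<Longrightarrow> E p \<in> unit_circle"
    "\<And>p. p \<in> unit_circle \<Longrightarrow> D (k p) = E p"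
    "\<And>A B. welding_solution k A B \<Longrightarrow> \<exists>X. rational_map X \<and> (\<forall>p\<in>unit_circle. X p \<in> unit_circle) \<and> A = X \<circ> D \<and> B = X \<circ> E"
proof -
  have bij: "bij_betw k unit_circle unit_circle"
    by (rule unit_circle_homeomorphism_lift(5)[OF k refl])
  define x where "x p = Re (the (cayley_inv p))" for p
  define y where "y p = x (k p)" for p
  \<comment> \<open>A property holds along this filter if it fails at only finitely many points of
    the circle. Poles and points corresponding to infinity are thereby absorbed; both coordinates
    \<open>x\<close> and \<open>y\<close> pull finite sets back to finite sets.\<close>
  define F where "F = inf cofinite (principal unit_circle)"
  have evF: "eventually P F \<longleftrightarrow> finite {p \<in> unit_circle. \<not> P p}" for P
    unfolding F_def eventually_inf_principal eventually_cofinite by (simp add: conj_commute)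
  have kc: "k p \<in> unit_circle" if "p \<in> unit_circle" for p using bij that by (auto simp: bij_betw_def)
  have kfin: "finite {p \<in> unit_circle. k p \<in> S}" if "finite S" for S
  proof -
    have "finite (k -` S \<inter> unit_circle)" using bij that by (intro finite_vimage_IntI) (auto simp: bij_betw_def)
    moreover have "k -` S \<inter> unit_circle = {p \<in> unit_circle. k p \<in> S}" by auto
    ultimately show ?thesis by simp
  qed
  have one: "eventually (\<lambda>p. p \<in> unit_circle \<and> p \<noteq> Some 1 \<and> k p \<in> unit_circle \<and> k p \<noteq> Some 1) F"
  proof -
    have "finite ({Some 1} \<union> {p \<in> unit_circle. k p \<in> {Some 1}})" using kfin[of "{Some 1}"] by simp
    then show ?thesis unfolding evF by (rule rev_finite_subset) (use kc in auto)
  qed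
  have xc: "eventually (\<lambda>p. cayley_inv p = Some (of_real (x p)) \<and> cayley_inv (k p) = Some (of_real (y p))) F"
    using one by eventually_elim (use real_coordinate in \<open>simp add: x_def y_def\<close>)
  have fx: "finite {p \<in> unit_circle. x p \<in> S}" if S: "finite S" for S
  proof (rule finite_subset)
    show "{p \<in> unit_circle. x p \<in> S} \<subseteq> insert (Some 1) ((\<lambda>s. cayley (Some (complex_of_real s))) ` S)"
    proof
      fix p assume p: "p \<in> {p \<in> unit_circle. x p \<in> S}"
      show "p \<in> insert (Some 1) ((\<lambda>s. cayley (Some (complex_of_real s))) ` S)"
      proof (cases "p = Some 1")
        case False
        then have "cayley (cayley_inv p) = cayley (Some (of_real (x p)))"
          using real_coordinate[of p] p by (simp add: x_def)
        then show ?thesis using p by auto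
      qed simp
    qed
  qed (use S in simp)
  have evx: "eventually (\<lambda>p. P (x p)) F" if "eventually P cofinite" for P
    using fx[of "{t. \<not> P t}"] that unfolding evF eventually_cofinite by simp
  have evy: "eventually (\<lambda>p. P (y p)) F" if "eventually P cofinite" for P
  proof -
    have "finite {q \<in> unit_circle. \<not> P (x q)}" using evx[OF that] unfolding evF .
    then have "finite {p \<in> unit_circle. k p \<in> {q \<in> unit_circle. \<not> P (x q)}}" by (rule kfin)
    moreover have "{p \<in> unit_circle. \<not> P (y p)} \<subseteq> {p \<in> unit_circle. k p \<in> {q \<in> unit_circle. \<not> P (x q)}}"
      using kc by (auto simp: y_def)
    ultimately show ?thesis unfolding evF by (rule rev_finite_subset)
  qed
  have cr: "eventually (\<lambda>p. circle_rat u p = cayley (Some (of_real (fract_eval u (x p)))) \<and>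
      circle_rat u (k p) = cayley (Some (of_real (fract_eval u (y p))))) F" for u
    using xc evx[OF fract_eval_real_rat[of u]] evy[OF fract_eval_real_rat[of u]]
    by eventually_elim (simp add: circle_rat_def)
  have cay_inj: "s = t" if "cayley (Some (complex_of_real s)) = cayley (Some (complex_of_real t))" for s t
    using arg_cong[OF that, of cayley_inv] by simp
  \<comment> \<open>In real coordinates: \<open>v\<close> is \<open>u\<close> composed with
    \<open>k\<close>, off finitely many points.\<close>
  define rel where "rel u v \<longleftrightarrow> eventually (\<lambda>p. fract_eval u (y p) = fract_eval v (x p)) F" for u v
  have relI: "rel u v" if uv: "\<And>p. p \<in> unit_circle \<Longrightarrow> circle_rat u (k p) = circle_rat v p" for u v
    unfolding rel_def using cr[of u] cr[of v] one
  proof eventually_elim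
    case (elim p)
    then have "cayley (Some (complex_of_real (fract_eval u (y p)))) = cayley (Some (complex_of_real (fract_eval v (x p))))"
      using uv[of p] by metis
    then show ?case by (rule cay_inj)
  qed
  define M where "M = {u. \<exists>v. rel u v}"
  have "subfield_set M"
  proof (rule subfield_set.intro)
    have "rel (cst 1) (cst 1)" by (simp add: rel_def fract_eval_cst)
    then show "1 \<in> M" unfolding cst_1 M_def by blast
  next
    fix u v assume "u \<in> M" "v \<in> M"
    then obtain u' v' where r: "rel u u'" "rel v v'" by (auto simp: M_def)
    have "rel (u - v) (u' - v')" unfolding rel_def
      using r[unfolded rel_def] evy[OF fract_eval_diff[of u v]] evx[OF fract_eval_diff[of u' v']]
      by eventually_elim simp
    then show "u - v \<in> M" unfolding M_def by blast
    have "rel (u * v) (u' * v')" unfolding rel_def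
      using r[unfolded rel_def] evy[OF fract_eval_mult[of u v]] evx[OF fract_eval_mult[of u' v']]
      by eventually_elim simp
    then show "u * v \<in> M" unfolding M_def by blast
  next
    fix u assume "u \<in> M"
    then obtain u' where r: "rel u u'" by (auto simp: M_def)
    have "rel (inverse u) (inverse u')" unfolding rel_def
      using r[unfolded rel_def] evy[OF fract_eval_inverse[of u]] evx[OF fract_eval_inverse[of u']]
      by eventually_elim simp
    then show "inverse u \<in> M" unfolding M_def by blast
  qed
  moreover have cstM: "cst c \<in> M" for c
  proof -
    have "rel (cst c) (cst c)" by (simp add: rel_def fract_eval_cst)
    then show ?thesis unfolding M_def by blast
  qed
  moreover obtain u0 v0 where uv0: "A0 = circle_rat u0" "B0 = circle_rat v0"
    using sol0 blaschke_product_circle_rat unfolding welding_solution_def by metis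
  have "rel u0 v0" by (rule relI) (use sol0 uv0 in \<open>auto simp: welding_solution_def\<close>)
  then have "u0 \<in> M" by (auto simp: M_def)
  \<comment> \<open>A nonconstant element is needed for Lueroth's theorem. A constant
    \<open>u0\<close> would put all but finitely many circle points into one fibre of
    \<open>A0\<close>, but fibres over the circle are finite.\<close>
  moreover have "u0 \<noteq> cst c" for c
  proof
    assume c: "u0 = cst c"
    have A0: "blaschke_product A0" using sol0 by (simp add: welding_solution_def)
    have "eventually (\<lambda>p. A0 p = cayley (Some (of_real c))) F"
      using cr[of u0] by eventually_elim (simp add: uv0 c fract_eval_cst)
    then have f1: "finite {p \<in> unit_circle. A0 p \<noteq> cayley (Some (of_real c))}" unfolding evF .
    have "cayley (Some (of_real c)) \<in> unit_circle" by (rule cayley_real_line) (simp add: real_line_def)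
    then have "finite {p \<in> unit_circle. A0 p = cayley (Some (of_real c))}" by (rule blaschke_product_card_fibre(2)[OF A0])
    with f1 have "finite ({p \<in> unit_circle. A0 p \<noteq> cayley (Some (of_real c))} \<union> {p \<in> unit_circle. A0 p = cayley (Some (of_real c))})" by simp
    moreover have "{p \<in> unit_circle. A0 p \<noteq> cayley (Some (of_real c))} \<union> {p \<in> unit_circle. A0 p = cayley (Some (of_real c))} = unit_circle" by blast
    ultimately show False using infinite_unit_circle by simp
  qed
  ultimately obtain D where D: "D \<in> M" "\<And>u. u \<in> M \<Longrightarrow> \<exists>a b. subst D b \<noteq> 0 \<and> u = subst D a / subst D b"
    by (rule lueroth) blast
  obtain E where E: "rel D E" using D(1) by (auto simp: M_def)
  \<comment> \<open>An identity between values at almost all points of the circle becomes a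
    factorization of rational maps of the sphere.\<close>
  have factor: "circle_rat w = circle_rat (to_fract a / to_fract b) \<circ> circle_rat G"
    if b: "b \<noteq> 0" and w: "eventually (\<lambda>p. fract_eval w (x p) = poly a (fract_eval G (x p)) / poly b (fract_eval G (x p)) \<and>
      poly b (fract_eval G (x p)) \<noteq> 0) F" for w a b G
  proof -
    define X where "X = to_fract a / to_fract b"
    have Xb: "X * to_fract b = to_fract a" using b by (simp add: X_def)
    have "eventually (\<lambda>p. circle_rat w p = (circle_rat X \<circ> circle_rat G) p) F"
      using w cr[of w] cr[of G]
    proof eventually_elim
      case (elim p)
      then have "circle_rat X (circle_rat G p) = cayley (real_rat X (Some (of_real (fract_eval G (x p)))))"
        by (simp add: circle_rat_def)
      also have "\<dots> = cayley (Some (of_real (fract_eval w (x p))))"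
        using fract_eval_quotient(1)[OF Xb] elim by simp
      finally show ?case using elim by simp
    qed
    then have fin: "finite {p \<in> unit_circle. circle_rat w p \<noteq> (circle_rat X \<circ> circle_rat G) p}" unfolding evF .
    have "circle_rat w = circle_rat X \<circ> circle_rat G"
    proof (rule rational_map_eqI[OF circle_rat_rational])
      show "rational_map (circle_rat X \<circ> circle_rat G)"
        by (rule rational_map_compose_circle) (simp_all add: circle_rat_rational circle_rat_circle)
      let ?S = "{z. Some z \<in> unit_circle \<and> circle_rat w (Some z) = (circle_rat X \<circ> circle_rat G) (Some z)}"
      show "infinite ?S"
      proof
        assume "finite ?S"
        then have "finite (Some ` ?S \<union> {p \<in> unit_circle. circle_rat w p \<noteq> (circle_rat X \<circ> circle_rat G) p})" using fin by simp
        moreover have "unit_circle \<subseteq> Some ` ?S \<union> {p \<in> unit_circle. circle_rat w p \<noteq> (circle_rat X \<circ> circle_rat G) p}"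
        proof
          fix p assume "p \<in> unit_circle"
          then show "p \<in> Some ` ?S \<union> {p \<in> unit_circle. circle_rat w p \<noteq> (circle_rat X \<circ> circle_rat G) p}"
            by (cases p) auto
        qed
        ultimately show False using infinite_unit_circle finite_subset by blast
      qed
      show "circle_rat w (Some z) = (circle_rat X \<circ> circle_rat G) (Some z)" if "z \<in> ?S" for z using that by blast
    qed
    then show ?thesis by (simp add: X_def)
  qed
  have fac2: "\<exists>X. circle_rat u = circle_rat X \<circ> circle_rat D \<and> circle_rat v = circle_rat X \<circ> circle_rat E" if r: "rel u v" for u v
  proof -
    have "u \<in> M" using r by (auto simp: M_def)
    then obtain a b where ab: "subst D b \<noteq> 0" "u = subst D a / subst D b" using D(2) by blast
    have b: "b \<noteq> 0" using ab(1) by auto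
    have ev: "eventually (\<lambda>t. fract_eval u t = poly a (fract_eval D t) / poly b (fract_eval D t) \<and> poly b (fract_eval D t) \<noteq> 0) cofinite"
      using fract_eval_divide[of "subst D a" "subst D b"] fract_eval_subst[of D a] fract_eval_subst[of D b] fract_eval_nonzero[OF ab(1)]
      by eventually_elim (simp add: ab(2))
    have "circle_rat u = circle_rat (to_fract a / to_fract b) \<circ> circle_rat D"
      by (rule factor[OF b evx[OF ev]])
    \<comment> \<open>The quotient formula for \<open>u\<close> in terms of \<open>D\<close> is read
      at \<open>k p\<close>; there \<open>u\<close> and \<open>D\<close> take the values of
      \<open>v\<close> and \<open>E\<close> at \<open>p\<close>, so the same outer map serves both
      factorizations.\<close>
    moreover have "circle_rat v = circle_rat (to_fract a / to_fract b) \<circ> circle_rat E"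
    proof (rule factor[OF b])
      show "eventually (\<lambda>p. fract_eval v (x p) = poly a (fract_eval E (x p)) / poly b (fract_eval E (x p)) \<and>
          poly b (fract_eval E (x p)) \<noteq> 0) F"
        using evy[OF ev] r[unfolded rel_def] E[unfolded rel_def] by eventually_elim simp
    qed
    ultimately show ?thesis by blast
  qed
  show ?thesis
  proof (rule that[of "circle_rat D" "circle_rat E"])
    have "eventually (\<lambda>p. circle_rat D (k p) = circle_rat E p) F"
      using cr[of D] cr[of E] E[unfolded rel_def] by eventually_elim simp
    then have fin: "finite {p \<in> unit_circle. circle_rat D (k p) \<noteq> circle_rat E p}" unfolding evF .
    show "circle_rat D (k p) = circle_rat E p" if "p \<in> unit_circle" for p
      by (rule circle_eq_cofinite[OF k circle_rat_rational circle_rat_rational fin that])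
    fix A B assume sol: "welding_solution k A B"
    obtain u v where uv: "A = circle_rat u" "B = circle_rat v"
      using sol blaschke_product_circle_rat unfolding welding_solution_def by metis
    have "rel u v" by (rule relI) (use sol uv in \<open>auto simp: welding_solution_def\<close>)
    then obtain X where "A = circle_rat X \<circ> circle_rat D" "B = circle_rat X \<circ> circle_rat E" using fac2 uv by blast
    then show "\<exists>X. rational_map X \<and> (\<forall>p\<in>unit_circle. X p \<in> unit_circle) \<and> A = X \<circ> circle_rat D \<and> B = X \<circ> circle_rat E"
      using circle_rat_rational circle_rat_circle by blast
  qed (simp_all add: circle_rat_rational circle_rat_circle)
qed

text \<open>\<open>X0\<close> preserves the circle and \<open>A0 = X0 \<circ> D0\<close> avoids it
  on the disc, so \<open>D0\<close> takes the disc to one side of the circle. An inversion between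
  inner and outer factor corrects the side if necessary.\<close>

lemma blaschke_common_right_factor:
  assumes k: "homeomorphic_map (sphere_subspace unit_circle) (sphere_subspace unit_circle) k"
    and sol0: "welding_solution k A0 B0"
  obtains D E where "welding_solution k D E"
    "\<And>A B. welding_solution k A B \<Longrightarrow> \<exists>X. blaschke_product X \<and> A = X \<circ> D \<and> B = X \<circ> E"
proof -
  have bij: "bij_betw k unit_circle unit_circle"
    by (rule unit_circle_homeomorphism_lift(5)[OF k refl])
  obtain D0 E0 where DE: "rational_map D0" "rational_map E0"
    "\<And>p. p \<in> unit_circle \<Longrightarrow> D0 p \<in> unit_circle" "\<And>p. p \<in> unit_circle \<Longrightarrow> E0 p \<in> unit_circle"
    "\<And>p. p \<in> unit_circle \<Longrightarrow> D0 (k p) = E0 p"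
    "\<And>A B. welding_solution k A B \<Longrightarrow> \<exists>X. rational_map X \<and> (\<forall>p\<in>unit_circle. X p \<in> unit_circle) \<and> A = X \<circ> D0 \<and> B = X \<circ> E0"
    by (rule common_right_factor[OF k sol0]) blast
  have A0: "blaschke_product A0" and B0: "blaschke_product B0" using sol0 by (auto simp: welding_solution_def)
  obtain X0 where X0: "rational_map X0" "\<And>p. p \<in> unit_circle \<Longrightarrow> X0 p \<in> unit_circle" "A0 = X0 \<circ> D0" "B0 = X0 \<circ> E0"
    using DE(6)[OF sol0] by blast
  have "D0 p \<notin> unit_circle" if "p \<in> unit_disc" for p
  proof
    assume "D0 p \<in> unit_circle"
    then have "A0 p \<in> unit_circle" using X0(2,3) by simp
    then show False using blaschke_product_iff(2)[OF A0] that sphere_disjoint by blast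
  qed
  then have D0side: "D0 ` unit_disc \<subseteq> unit_disc \<or> D0 ` unit_disc \<subseteq> exterior_disc"
    using rational_map_sides[OF DE(1), of unit_disc] by blast
  \<comment> \<open>An involution preserving the circle: applied after \<open>D0\<close> and
    \<open>E0\<close> and before the outer factor, it leaves the compositions unchanged.\<close>
  define s where "s = (if D0 ` unit_disc \<subseteq> unit_disc then id else sphere_inversion)"
  have ss: "s (s p) = p" for p by (simp add: s_def)
  have sT: "s p \<in> unit_circle" if "p \<in> unit_circle" for p using that by (simp add: s_def sphere_inversion_unit_circle_iff)
  have srat: "rational_map s"
    using rational_map_sphere_inversion sphere_holomorphic_imp_rational[of id "Some 0"] by (simp add: s_def sphere_holomorphic_at_chart)
  define D E where "D = s \<circ> D0" and "E = s \<circ> E0"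
  have Drat: "rational_map D" "rational_map E" unfolding D_def E_def
    by (rule rational_map_compose_circle; simp add: srat DE sT)+
  have DT: "D p \<in> unit_circle" "E p \<in> unit_circle" if "p \<in> unit_circle" for p
    using that by (simp_all add: D_def E_def sT DE)
  have Dd: "D p \<in> unit_disc" if "p \<in> unit_disc" for p
  proof -
    have "D0 p \<in> unit_disc \<and> D0 ` unit_disc \<subseteq> unit_disc \<or> D0 p \<in> exterior_disc \<and> \<not> D0 ` unit_disc \<subseteq> unit_disc"
      using D0side that by blast
    then show ?thesis by (auto simp: D_def s_def sphere_inversion_unit_disc_iff)
  qed
  have DB: "blaschke_product D" by (rule rational_imp_blaschke_product[OF Drat(1) Dd DT(1)])
  have kDE: "D (k p) = E p" if "p \<in> unit_circle" for p using DE(5)[OF that] by (simp add: D_def E_def)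
  have X: "\<exists>X. blaschke_product X \<and> A = X \<circ> D \<and> B = X \<circ> E" if sol: "welding_solution k A B" for A B
  proof -
    have A: "blaschke_product A" using sol by (simp add: welding_solution_def)
    obtain X1 where X1: "rational_map X1" "\<And>p. p \<in> unit_circle \<Longrightarrow> X1 p \<in> unit_circle" "A = X1 \<circ> D0" "B = X1 \<circ> E0"
      using DE(6)[OF sol] by blast
    define X where "X = X1 \<circ> s"
    have AX: "A = X \<circ> D" "B = X \<circ> E" by (simp_all add: X_def D_def E_def X1 fun_eq_iff ss)
    have "blaschke_product X"
    proof (rule rational_imp_blaschke_product)
      show "rational_map X" unfolding X_def by (rule rational_map_compose_circle; simp add: srat X1 sT)
      show "X p \<in> unit_circle" if "p \<in> unit_circle" for p using that by (simp add: X_def X1 sT)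
      fix p assume "p \<in> unit_disc"
      then obtain q where "q \<in> unit_disc" "p = D q" using blaschke_product_image[OF DB] by (metis imageE)
      then show "X p \<in> unit_disc" using blaschke_product_iff(1)[OF A, of q] by (simp add: AX(1))
    qed
    then show ?thesis using AX by blast
  qed
  obtain X where X': "blaschke_product X" "A0 = X \<circ> D" "B0 = X \<circ> E" using X[OF sol0] by blast
  \<comment> \<open>The side of \<open>E\<close> needs no choice: the outer factor \<open>X\<close>
    is already a Blaschke product, and \<open>X \<circ> E = B0\<close> maps the disc into the
    disc.\<close>
  have EB: "blaschke_product E"
  proof (rule rational_imp_blaschke_product[OF Drat(2) _ DT(2)])
    fix p assume p: "p \<in> unit_disc"
    then have "X (E p) \<in> unit_disc" using blaschke_product_iff(1)[OF B0, of p] by (simp add: X'(3))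
    then show "E p \<in> unit_disc" using blaschke_product_iff(1)[OF X'(1)] by blast
  qed
  have "welding_solution k D E" unfolding welding_solution_def
    using DB EB kDE blaschke_welding_degree_eq[OF DB EB bij kDE] by simp
  then show ?thesis using X that by blast
qed

text \<open>Minimality compares \<open>A = X \<circ> D\<close> with the solution \<open>D\<close>
  itself and forces \<open>X\<close> to have degree one. Then \<open>X\<close> is invertible, and
  any other solution factors through \<open>A\<close> by way of \<open>D\<close>.\<close>

theorem welding_solution_unique:
  assumes k: "homeomorphic_map (sphere_subspace unit_circle) (sphere_subspace unit_circle) k"
    and min: "minimal_welding_solution k A B" and sol': "welding_solution k A' B'"
  shows "\<exists>C. blaschke_product C \<and> A' = C \<circ> A \<and> B' = C \<circ> B"
proof -
  have sol: "welding_solution k A B" using min by (simp add: minimal_welding_solution_def)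
  obtain D E where DE: "welding_solution k D E"
    "\<And>A B. welding_solution k A B \<Longrightarrow> \<exists>X. blaschke_product X \<and> A = X \<circ> D \<and> B = X \<circ> E"
    by (rule blaschke_common_right_factor[OF k sol]) blast
  obtain X X' where X: "blaschke_product X" "A = X \<circ> D" "B = X \<circ> E"
    and X': "blaschke_product X'" "A' = X' \<circ> D" "B' = X' \<circ> E"
    using DE(2)[OF sol] DE(2)[OF sol'] by blast
  have A: "blaschke_product A" and D: "blaschke_product D"
    using sol DE(1) by (auto simp: welding_solution_def)
  have le: "rat_degree A \<le> rat_degree D" using min DE(1) by (auto simp: minimal_welding_solution_def)
  have d1: "rat_degree D \<ge> 1" using D by (simp add: blaschke_product_def)
  \<comment> \<open>Two circle points with a common value under \<open>X\<close> would put two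
    disjoint fibres of \<open>D\<close>, together \<open>2 * rat_degree D\<close> points, into one
    fibre of \<open>A\<close>, which has at most \<open>rat_degree D\<close> points by
    minimality.\<close>
  have inj: "w1 = w2" if w: "w1 \<in> unit_circle" "w2 \<in> unit_circle" "X w1 = X w2" for w1 w2
  proof (rule ccontr)
    assume ne: "w1 \<noteq> w2"
    let ?f = "\<lambda>w. {p \<in> unit_circle. D p = w}"
    have "card (?f w1 \<union> ?f w2) = card (?f w1) + card (?f w2)"
      by (rule card_Un_disjoint) (use ne blaschke_product_card_fibre(2)[OF D] w in auto)
    also have "\<dots> = 2 * rat_degree D" using blaschke_product_card_fibre(1)[OF D] w by simp
    finally have "2 * rat_degree D = card (?f w1 \<union> ?f w2)" by simp
    also have "\<dots> \<le> card {p \<in> unit_circle. A p = X w1}"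
      by (rule card_mono) (use blaschke_product_card_fibre(2)[OF A] blaschke_product_boundary[OF X(1)] w in \<open>auto simp: X(2)\<close>)
    also have "\<dots> = rat_degree A" by (rule blaschke_product_card_fibre(1)[OF A blaschke_product_boundary[OF X(1) w(1)]])
    finally show False using le d1 by simp
  qed
  have "{p \<in> unit_circle. X p = X (Some 1)} = {Some 1}" using inj one_in_circle by auto
  then have "rat_degree X = 1"
    using blaschke_product_card_fibre(1)[OF X(1) blaschke_product_boundary[OF X(1) one_in_circle]] by simp
  then obtain Y where Y: "blaschke_product Y" "Y \<circ> X = id" by (rule blaschke_degree_one_inverse[OF X(1)])
  have YX: "Y (X p) = p" for p using fun_cong[OF Y(2), of p] by simp
  have "blaschke_product (X' \<circ> Y)"
  proof (rule rational_imp_blaschke_product)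
    show "rational_map (X' \<circ> Y)"
      by (rule rational_map_compose_circle; simp add: blaschke_product_rational blaschke_product_boundary X'(1) Y(1))
  qed (simp_all add: blaschke_product_iff[OF X'(1)] blaschke_product_iff[OF Y(1)])
  moreover have "A' = (X' \<circ> Y) \<circ> A" "B' = (X' \<circ> Y) \<circ> B" by (simp_all add: X(2,3) X'(2,3) fun_eq_iff YX)
  ultimately show ?thesis by blast
qed

theorem theorem1p7:
  fixes k :: "csphere \<Rightarrow> csphere"
  assumes "homeomorphic_map (sphere_subspace unit_circle) (sphere_subspace unit_circle) k"
  shows "((\<exists>A B. welding_solution k A B) \<longleftrightarrow>
          (\<exists>L. jordan_rational_lemniscate L \<and> fingerprint k L)) \<and>
         (\<forall>A B. minimal_welding_solution k A B \<longrightarrow>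
            (\<forall>A' B'. welding_solution k A' B' \<longrightarrow>
               (\<exists>C. blaschke_product C \<and> A' = C \<circ> A \<and> B' = C \<circ> B)))"
  using welding_solution_imp_lemniscate[OF assms] lemniscate_imp_welding_solution[OF assms]
    welding_solution_unique[OF assms] by blast

end
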